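(* Let $k\ge 0$ and $n$ be integers. If $n<0$ or $n\geq k$, then there is an $\mathrm{SL}(\mathbb V)$-equivariant holomorphic isomorphism of vector bundles on $X=\mathbb P(\mathbb V)$ $$J^k(L^n)\,=\,L^{n-k}\otimes \mathbb V_k .$$ If $k>n\geq 0$, then there is an $\mathrm{SL}(\mathbb V)$-equivariant holomorphic isomorphism $$J^k(L^n)\,=\,\mathbb V_n\oplus\bigl(L^{-(k+1)}\otimes \mathbb V_{k-n-1}\bigr).$$
   Context: $\mathbb V$ is a complex vector space of dimension two and $X=\mathbb P(\mathbb V)$ is the compact Riemann surface of genus zero parametrizing the complex lines $\xi\subset\mathbb V$. $\mathrm{SL}(\mathbb V)$ is the group of linear automorphisms of $\mathbb V$ acting trivially on $\bigwedge^2\mathbb V$; it acts on $X$ by $\xi\mapsto A(\xi)$. $L\to X$ is the holomorphic line bundle of degree one whose fiber over $\xi$ is $\mathbb V/\xi$, with the $\mathrm{SL}(\mathbb V)$-action given by $\mathbb V/\xi\to\mathbb V/A(\xi)$; $L^n$ is $L^{\otimes n}$ for $n>0$, $(L^{\otimes -n})^*$ for $n<0$, and $\mathcal O_X$ for $n=0$. $\mathbb V_j$ is the trivial holomorphic vector bundle $X\times \mathrm{Sym}^j(\mathbb V)$ with the diagonal $\mathrm{SL}(\mathbb V)$-action, and $\mathbb V_0=\mathcal O_X$. For a holomorphic vector bundle $W$ on a Riemann surface $Y$, let $p_1,p_2:Y\times Y\to Y$ be the projections and $\Delta\subset Y\times Y$ the diagonal divisor; the $k$-th jet bundle is $J^k(W)=p_{1*}\bigl(p_2^*W/(p_2^*W\otimes\mathcal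 O_{Y\times Y}(-(k+1)\Delta))\bigr)$. The diagonal action of $\mathrm{SL}(\mathbb V)$ on $X\times X$ preserves $\Delta$ and, together with the action on $L^n$, induces an action of $\mathrm{SL}(\mathbb V)$ on $J^k(L^n)$. *)

theory Defs
  imports
    "HOL-Analysis.Analysis"
    "HOL-Library.Poly_Mapping"
    "HOL-Library.Multiset"
    "HOL-Algebra.Module"
    "HOL-Algebra.AbelCoset"
begin

section \<open>Multilinear algebra over the complex numbers\<close>

text \<open>
  Fibres of bundles are complex vector spaces with a carrier set, given as records of type
  \<open>(complex, 'a) module\<close>; scalars are the type \<open>complex\<close>, and the fields \<open>mult\<close> and \<open>one\<close>
  of the record play no role.
\<close>

definition vector_module :: "(complex \<Rightarrow> 'v \<Rightarrow> 'v::ab_group_add) \<Rightarrow> (complex, 'v) module" where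
  "vector_module cscale =
     \<lparr>carrier = UNIV, mult = undefined, one = undefined, zero = 0, add = (+), smult = cscale\<rparr>"

definition scalar_module :: "(complex, complex) module" where
  "scalar_module = vector_module (*)"

text \<open>In the quotient by \<open>N\<close>, adding \<open>N\<close> in \<open>smult\<close> only matters for the scalar 0.\<close>

definition quotient_module :: "(complex, 'a) module \<Rightarrow> 'a set \<Rightarrow> (complex, 'a set) module" where
  "quotient_module M N =
     \<lparr>carrier = a_rcosets\<^bsub>M\<^esub> N, mult = undefined, one = undefined, zero = N, add = set_add M,
      smult = (\<lambda>c C. ((\<lambda>x. c \<odot>\<^bsub>M\<^esub> x) ` C) <+>\<^bsub>M\<^esub> N)\<rparr>"

text \<open>The map induced by \<open>f\<close> on cosets, with target the quotient of \<open>M\<close> by \<open>N\<close>.\<close>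

definition quotient_map :: "('a \<Rightarrow> 'b) \<Rightarrow> (complex, 'b) module \<Rightarrow> 'b set \<Rightarrow> 'a set \<Rightarrow> 'b set" where
  "quotient_map f M N C = (f ` C) <+>\<^bsub>M\<^esub> N"

definition dual_module :: "(complex, 'a) module \<Rightarrow> (complex, 'a \<Rightarrow> complex) module" where
  "dual_module M =
     \<lparr>carrier = {\<phi> \<in> extensional (carrier M).
        (\<forall>x\<in>carrier M. \<forall>y\<in>carrier M. \<phi> (x \<oplus>\<^bsub>M\<^esub> y) = \<phi> x + \<phi> y) \<and>
        (\<forall>c. \<forall>x\<in>carrier M. \<phi> (c \<odot>\<^bsub>M\<^esub> x) = c * \<phi> x)},
      mult = undefined, one = undefined,
      zero = (\<lambda>x\<in>carrier M. 0),
      add = (\<lambda>\<phi> \<psi>. \<lambda>x\<in>carrier M. \<phi> x + \<psi> x),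
      smult = (\<lambda>c \<phi>. \<lambda>x\<in>carrier M. c * \<phi> x)\<rparr>"

definition sum_module ::
  "(complex, 'a) module \<Rightarrow> (complex, 'b) module \<Rightarrow> (complex, 'a \<times> 'b) module" where
  "sum_module M N =
     \<lparr>carrier = carrier M \<times> carrier N, mult = undefined, one = undefined,
      zero = (\<zero>\<^bsub>M\<^esub>, \<zero>\<^bsub>N\<^esub>),
      add = (\<lambda>(x, y) (x', y'). (x \<oplus>\<^bsub>M\<^esub> x', y \<oplus>\<^bsub>N\<^esub> y')),
      smult = (\<lambda>c (x, y). (c \<odot>\<^bsub>M\<^esub> x, c \<odot>\<^bsub>N\<^esub> y))\<rparr>"

subsection \<open>Free vector spaces\<close>

definition free_scale :: "complex \<Rightarrow> ('a \<Rightarrow>\<^sub>0 complex) \<Rightarrow> ('a \<Rightarrow>\<^sub>0 complex)" where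
  "free_scale c = Poly_Mapping.map ((*) c)"

definition free_module :: "'a set \<Rightarrow> (complex, 'a \<Rightarrow>\<^sub>0 complex) module" where
  "free_module S =
     \<lparr>carrier = {x. Poly_Mapping.keys x \<subseteq> S}, mult = undefined, one = undefined,
      zero = 0, add = (+), smult = free_scale\<rparr>"

definition free_map :: "('a \<Rightarrow> 'b) \<Rightarrow> ('a \<Rightarrow>\<^sub>0 complex) \<Rightarrow> ('b \<Rightarrow>\<^sub>0 complex)" where
  "free_map f x = (\<Sum>i\<in>Poly_Mapping.keys x. Poly_Mapping.single (f i) (Poly_Mapping.lookup x i))"

abbreviation free_gen :: "'a \<Rightarrow> ('a \<Rightarrow>\<^sub>0 complex)" where
  "free_gen a \<equiv> Poly_Mapping.single a 1"

abbreviation free_span :: "('a \<Rightarrow>\<^sub>0 complex) set \<Rightarrow> ('a \<Rightarrow>\<^sub>0 complex) set" where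
  "free_span \<equiv> Modules.module.span free_scale"

subsection \<open>Tensor, symmetric and exterior powers\<close>

text \<open>
  The \<open>n\<close>-fold powers of \<open>M\<close> are quotients of the free vector space on the \<open>n\<close>-tuples of vectors
  (lists of length \<open>n\<close>) of \<open>M\<close>.  For \<open>n = 0\<close> there are no relations and the result is the line
  spanned by the class of the empty list.
\<close>

definition tuples :: "(complex, 'a) module \<Rightarrow> nat \<Rightarrow> 'a list set" where
  "tuples M n = {xs. set xs \<subseteq> carrier M \<and> length xs = n}"

definition multilinear_relations ::
  "(complex, 'a) module \<Rightarrow> nat \<Rightarrow> ('a list \<Rightarrow>\<^sub>0 complex) set" where
  "multilinear_relations M n =
     {free_gen (xs[i := u \<oplus>\<^bsub>M\<^esub> v]) - (free_gen (xs[i := u]) + free_gen (xs[i := v])) | xs i u v.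
        xs \<in> tuples M n \<and> i < n \<and> u \<in> carrier M \<and> v \<in> carrier M} \<union>
     {free_gen (xs[i := c \<odot>\<^bsub>M\<^esub> u]) - free_scale c (free_gen (xs[i := u])) | xs i c u.
        xs \<in> tuples M n \<and> i < n \<and> u \<in> carrier M}"

definition symmetric_relations ::
  "(complex, 'a) module \<Rightarrow> nat \<Rightarrow> ('a list \<Rightarrow>\<^sub>0 complex) set" where
  "symmetric_relations M n =
     {free_gen xs - free_gen ys | xs ys. xs \<in> tuples M n \<and> ys \<in> tuples M n \<and> mset xs = mset ys}"

definition alternating_relations ::
  "(complex, 'a) module \<Rightarrow> nat \<Rightarrow> ('a list \<Rightarrow>\<^sub>0 complex) set" where
  "alternating_relations M n = {free_gen xs | xs. xs \<in> tuples M n \<and> \<not> distinct xs}"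

definition tensor_power_kernel where
  "tensor_power_kernel M n = free_span (multilinear_relations M n)"

definition tensor_power ::
  "(complex, 'a) module \<Rightarrow> nat \<Rightarrow> (complex, ('a list \<Rightarrow>\<^sub>0 complex) set) module" where
  "tensor_power M n = quotient_module (free_module (tuples M n)) (tensor_power_kernel M n)"

definition tensor_of_list ::
  "(complex, 'a) module \<Rightarrow> nat \<Rightarrow> 'a list \<Rightarrow> ('a list \<Rightarrow>\<^sub>0 complex) set" where
  "tensor_of_list M n xs = tensor_power_kernel M n +>\<^bsub>free_module (tuples M n)\<^esub> free_gen xs"

definition tensor_power_map where
  "tensor_power_map f N n =
     quotient_map (free_map (map f)) (free_module (tuples N n)) (tensor_power_kernel N n)"

definition sym_power_kernel where
  "sym_power_kernel M n = free_span (multilinear_relations M n \<union> symmetric_relations M n)"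

definition sym_power ::
  "(complex, 'a) module \<Rightarrow> nat \<Rightarrow> (complex, ('a list \<Rightarrow>\<^sub>0 complex) set) module" where
  "sym_power M n = quotient_module (free_module (tuples M n)) (sym_power_kernel M n)"

definition sym_power_map where
  "sym_power_map f N n =
     quotient_map (free_map (map f)) (free_module (tuples N n)) (sym_power_kernel N n)"

definition ext_power_kernel where
  "ext_power_kernel M n = free_span (multilinear_relations M n \<union> alternating_relations M n)"

definition ext_power ::
  "(complex, 'a) module \<Rightarrow> nat \<Rightarrow> (complex, ('a list \<Rightarrow>\<^sub>0 complex) set) module" where
  "ext_power M n = quotient_module (free_module (tuples M n)) (ext_power_kernel M n)"

definition ext_power_map where
  "ext_power_map f N n =
     quotient_map (free_map (map f)) (free_module (tuples N n)) (ext_power_kernel N n)"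

subsection \<open>Tensor products\<close>

definition bilinear_relations ::
  "(complex, 'a) module \<Rightarrow> (complex, 'b) module \<Rightarrow> ('a \<times> 'b \<Rightarrow>\<^sub>0 complex) set" where
  "bilinear_relations M N =
     {free_gen (x \<oplus>\<^bsub>M\<^esub> x', y) - (free_gen (x, y) + free_gen (x', y)) | x x' y.
        x \<in> carrier M \<and> x' \<in> carrier M \<and> y \<in> carrier N} \<union>
     {free_gen (x, y \<oplus>\<^bsub>N\<^esub> y') - (free_gen (x, y) + free_gen (x, y')) | x y y'.
        x \<in> carrier M \<and> y \<in> carrier N \<and> y' \<in> carrier N} \<union>
     {free_gen (c \<odot>\<^bsub>M\<^esub> x, y) - free_scale c (free_gen (x, y)) | c x y.
        x \<in> carrier M \<and> y \<in> carrier N} \<union>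
     {free_gen (x, c \<odot>\<^bsub>N\<^esub> y) - free_scale c (free_gen (x, y)) | c x y.
        x \<in> carrier M \<and> y \<in> carrier N}"

definition tensor_kernel where
  "tensor_kernel M N = free_span (bilinear_relations M N)"

definition tensor_module ::
  "(complex, 'a) module \<Rightarrow> (complex, 'b) module \<Rightarrow> (complex, ('a \<times> 'b \<Rightarrow>\<^sub>0 complex) set) module"
where
  "tensor_module M N =
     quotient_module (free_module (carrier M \<times> carrier N)) (tensor_kernel M N)"

definition pure_tensor ::
  "(complex, 'a) module \<Rightarrow> (complex, 'b) module \<Rightarrow> 'a \<Rightarrow> 'b \<Rightarrow> ('a \<times> 'b \<Rightarrow>\<^sub>0 complex) set" where
  "pure_tensor M N x y =
     tensor_kernel M N +>\<^bsub>free_module (carrier M \<times> carrier N)\<^esub> free_gen (x, y)"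

definition tensor_map where
  "tensor_map f g M' N' =
     quotient_map (free_map (map_prod f g)) (free_module (carrier M' \<times> carrier N'))
       (tensor_kernel M' N')"

section \<open>Complex manifolds with an action\<close>

text \<open>
  A complex manifold is described by its topology and its sheaf of holomorphic functions
  (\<open>hol M U\<close>, for \<open>U\<close> open); \<open>move\<close> is the action of group elements on points.  Functions and
  sections on \<open>U\<close> are \<open>undefined\<close> outside \<open>U\<close>, so that equality is equality on \<open>U\<close>.
\<close>

record ('p, 'g) space =
  topo :: "'p topology"
  hol :: "'p set \<Rightarrow> ('p \<Rightarrow> complex) set"
  move :: "'g \<Rightarrow> 'p \<Rightarrow> 'p"

text \<open>
  An atlas of a Riemann surface is a set of pairs of a chart domain and a coordinate on it.
  The definitions below are meant for atlases with injective coordinates, open images and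
  holomorphic transition maps.
\<close>

type_synonym 'p atlas = "('p set \<times> ('p \<Rightarrow> complex)) set"

definition surface :: "'p atlas \<Rightarrow> ('g \<Rightarrow> 'p \<Rightarrow> 'p) \<Rightarrow> ('p, 'g) space" where
  "surface \<A> m =
     \<lparr>topo = topology_generated_by {z -` T \<inter> D | D z T. (D, z) \<in> \<A> \<and> open T},
      hol = (\<lambda>U. {f \<in> extensional U. \<forall>(D, z)\<in>\<A>.
               (\<lambda>t. f (inv_into D z t)) holomorphic_on (z ` (U \<inter> D))}),
      move = m\<rparr>"

definition holomorphic2_on :: "(complex \<times> complex \<Rightarrow> complex) \<Rightarrow> (complex \<times> complex) set \<Rightarrow> bool"
where
  "holomorphic2_on f S \<longleftrightarrow>
     (\<forall>p\<in>S. \<exists>a b. (f has_derivative (\<lambda>(h, k). a * h + b * k)) (at p))"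

text \<open>The product of a Riemann surface with itself, with the diagonal action.\<close>

definition surface_square :: "'p atlas \<Rightarrow> ('g \<Rightarrow> 'p \<Rightarrow> 'p) \<Rightarrow> ('p \<times> 'p, 'g) space" where
  "surface_square \<A> m =
     \<lparr>topo = prod_topology (topo (surface \<A> m)) (topo (surface \<A> m)),
      hol = (\<lambda>U. {f \<in> extensional U. \<forall>(D, z)\<in>\<A>. \<forall>(D', z')\<in>\<A>.
               holomorphic2_on (\<lambda>(t, t'). f (inv_into D z t, inv_into D' z' t'))
                 (map_prod z z' ` (U \<inter> D \<times> D'))}),
      move = (\<lambda>g. map_prod (m g) (m g))\<rparr>"

section \<open>Equivariant holomorphic vector bundles\<close>

text \<open>
  A bundle is given by its fibres, its holomorphic sections over each open set, and the maps
  \<open>act E g p\<close> from the fibre at \<open>p\<close> to the fibre at \<open>move M g p\<close>.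
\<close>

record ('p, 'a, 'g) vbundle =
  fibre :: "'p \<Rightarrow> (complex, 'a) module"
  sects :: "'p set \<Rightarrow> ('p \<Rightarrow> 'a) set"
  act :: "'g \<Rightarrow> 'p \<Rightarrow> 'a \<Rightarrow> 'a"

text \<open>
  The sections over \<open>U\<close> that are locally finite linear combinations, with holomorphic
  coefficients, of the sections \<open>gen N\<close> given over open sets \<open>N\<close>.
\<close>

definition local_span ::
  "('p, 'g) space \<Rightarrow> ('p \<Rightarrow> (complex, 'a) module) \<Rightarrow> ('p set \<Rightarrow> ('p \<Rightarrow> 'a) set) \<Rightarrow>
    'p set \<Rightarrow> ('p \<Rightarrow> 'a) set" where
  "local_span M F gen U =
     {s \<in> extensional U. (\<forall>p\<in>U. s p \<in> carrier (F p)) \<and>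
       (\<forall>p\<in>U. \<exists>N. openin (topo M) N \<and> p \<in> N \<and> N \<subseteq> U \<and>
         (\<exists>(m::nat) f e. (\<forall>i<m. f i \<in> hol M N \<and> e i \<in> gen N) \<and>
           (\<forall>q\<in>N. s q = finsum (F q) (\<lambda>i. f i q \<odot>\<^bsub>F q\<^esub> e i q) {..<m})))}"

definition trivial_bundle ::
  "('p, 'g) space \<Rightarrow> (complex, 'a) module \<Rightarrow> ('g \<Rightarrow> 'a \<Rightarrow> 'a) \<Rightarrow> ('p, 'a, 'g) vbundle" where
  "trivial_bundle M W \<rho> =
     \<lparr>fibre = (\<lambda>p. W),
      sects = local_span M (\<lambda>p. W) (\<lambda>N. {\<lambda>q. w | w. w \<in> carrier W}),
      act = (\<lambda>g p. \<rho> g)\<rparr>"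

definition structure_bundle :: "('p, 'g) space \<Rightarrow> ('p, complex, 'g) vbundle" where
  "structure_bundle M = trivial_bundle M scalar_module (\<lambda>g c. c)"

definition tensor_bundle ::
  "('p, 'g) space \<Rightarrow> ('p, 'a, 'g) vbundle \<Rightarrow> ('p, 'b, 'g) vbundle \<Rightarrow>
    ('p, ('a \<times> 'b \<Rightarrow>\<^sub>0 complex) set, 'g) vbundle" where
  "tensor_bundle M E F =
     \<lparr>fibre = (\<lambda>p. tensor_module (fibre E p) (fibre F p)),
      sects = local_span M (\<lambda>p. tensor_module (fibre E p) (fibre F p))
        (\<lambda>N. {\<lambda>q. pure_tensor (fibre E q) (fibre F q) (s q) (t q) | s t.
                s \<in> sects E N \<and> t \<in> sects F N}),
      act = (\<lambda>g p. tensor_map (act E g p) (act F g p)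
                     (fibre E (move M g p)) (fibre F (move M g p)))\<rparr>"

definition sum_bundle ::
  "('p, 'g) space \<Rightarrow> ('p, 'a, 'g) vbundle \<Rightarrow> ('p, 'b, 'g) vbundle \<Rightarrow> ('p, 'a \<times> 'b, 'g) vbundle" where
  "sum_bundle M E F =
     \<lparr>fibre = (\<lambda>p. sum_module (fibre E p) (fibre F p)),
      sects = (\<lambda>U. {\<lambda>q\<in>U. (s q, t q) | s t. s \<in> sects E U \<and> t \<in> sects F U}),
      act = (\<lambda>g p. map_prod (act E g p) (act F g p))\<rparr>"

definition tensor_power_bundle ::
  "('p, 'g) space \<Rightarrow> ('p, 'a, 'g) vbundle \<Rightarrow> nat \<Rightarrow> ('p, ('a list \<Rightarrow>\<^sub>0 complex) set, 'g) vbundle"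
where
  "tensor_power_bundle M E n =
     \<lparr>fibre = (\<lambda>p. tensor_power (fibre E p) n),
      sects = local_span M (\<lambda>p. tensor_power (fibre E p) n)
        (\<lambda>N. {\<lambda>q. tensor_of_list (fibre E q) n (map (\<lambda>s. s q) ss) | ss.
                length ss = n \<and> set ss \<subseteq> sects E N}),
      act = (\<lambda>g p. tensor_power_map (act E g p) (fibre E (move M g p)) n)\<rparr>"

text \<open>
  The holomorphic sections of the dual bundle are those pairing to holomorphic functions with
  all local holomorphic sections; the action is the contragredient one.
\<close>

definition dual_bundle ::
  "('p, 'g) space \<Rightarrow> ('p, 'a, 'g) vbundle \<Rightarrow> ('p, 'a \<Rightarrow> complex, 'g) vbundle" where
  "dual_bundle M E =
     \<lparr>fibre = (\<lambda>p. dual_module (fibre E p)),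
      sects = (\<lambda>U. {\<phi> \<in> extensional U. (\<forall>p\<in>U. \<phi> p \<in> carrier (dual_module (fibre E p))) \<and>
        (\<forall>N s. openin (topo M) N \<and> N \<subseteq> U \<and> s \<in> sects E N \<longrightarrow> (\<lambda>q\<in>N. \<phi> q (s q)) \<in> hol M N)}),
      act = (\<lambda>g p \<phi>. \<lambda>y\<in>carrier (fibre E (move M g p)).
               \<phi> (inv_into (carrier (fibre E p)) (act E g p) y))\<rparr>"

text \<open>
  Integer powers of a line bundle.  The three cases have fibres of different types, which are
  put into one type by the constructors of \<open>int_power\<close>; \<open>relabel_bundle\<close> transports a bundle
  along an injection of types.
\<close>

datatype 'a int_power =
    Pos_Power "('a list \<Rightarrow>\<^sub>0 complex) set"
  | Zero_Power complex
  | Neg_Power "('a list \<Rightarrow>\<^sub>0 complex) set \<Rightarrow> complex"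

definition relabel_module :: "('a \<Rightarrow> 'b) \<Rightarrow> (complex, 'a) module \<Rightarrow> (complex, 'b) module" where
  "relabel_module \<iota> W =
     \<lparr>carrier = \<iota> ` carrier W, mult = undefined, one = undefined, zero = \<iota> \<zero>\<^bsub>W\<^esub>,
      add = (\<lambda>x y. \<iota> (inv_into UNIV \<iota> x \<oplus>\<^bsub>W\<^esub> inv_into UNIV \<iota> y)),
      smult = (\<lambda>c x. \<iota> (c \<odot>\<^bsub>W\<^esub> inv_into UNIV \<iota> x))\<rparr>"

definition relabel_bundle :: "('a \<Rightarrow> 'b) \<Rightarrow> ('p, 'a, 'g) vbundle \<Rightarrow> ('p, 'b, 'g) vbundle" where
  "relabel_bundle \<iota> E =
     \<lparr>fibre = (\<lambda>p. relabel_module \<iota> (fibre E p)),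
      sects = (\<lambda>U. (\<lambda>s. \<lambda>q\<in>U. \<iota> (s q)) ` sects E U),
      act = (\<lambda>g p x. \<iota> (act E g p (inv_into UNIV \<iota> x)))\<rparr>"

definition line_power ::
  "('p, 'g) space \<Rightarrow> ('p, 'a, 'g) vbundle \<Rightarrow> int \<Rightarrow> ('p, 'a int_power, 'g) vbundle" where
  "line_power M L n =
     (if n > 0 then relabel_bundle Pos_Power (tensor_power_bundle M L (nat n))
      else if n = 0 then relabel_bundle Zero_Power (structure_bundle M)
      else relabel_bundle Neg_Power (dual_bundle M (tensor_power_bundle M L (nat (- n)))))"

section \<open>Equivariant sheaves of modules\<close>

text \<open>
  A sheaf of modules over the holomorphic functions of \<open>M\<close>: its module of sections over each
  open \<open>U\<close>, the restriction of sections to a smaller open set, and the translation by \<open>g\<close> of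
  sections over \<open>U\<close> to sections over the image of \<open>U\<close> under \<open>g\<close>.
\<close>

record ('p, 's, 'g) osheaf =
  sections :: "'p set \<Rightarrow> ('p \<Rightarrow> complex, 's) module"
  restr :: "'p set \<Rightarrow> 's \<Rightarrow> 's"
  translate :: "'g \<Rightarrow> 'p set \<Rightarrow> 's \<Rightarrow> 's"

definition translate_section ::
  "('p, 'g) space \<Rightarrow> ('p, 'a, 'g) vbundle \<Rightarrow> 'g \<Rightarrow> 'p set \<Rightarrow> ('p \<Rightarrow> 'a) \<Rightarrow> ('p \<Rightarrow> 'a)" where
  "translate_section M E g U s =
     (\<lambda>q\<in>move M g ` U. let p = inv_into U (move M g) q in act E g p (s p))"

definition sheaf_of_sections ::
  "('p, 'g) space \<Rightarrow> ('p, 'a, 'g) vbundle \<Rightarrow> ('p, 'p \<Rightarrow> 'a, 'g) osheaf" where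
  "sheaf_of_sections M E =
     \<lparr>sections = (\<lambda>U.
        \<lparr>carrier = sects E U, mult = undefined, one = undefined,
         zero = (\<lambda>p\<in>U. \<zero>\<^bsub>fibre E p\<^esub>),
         add = (\<lambda>s t. \<lambda>p\<in>U. s p \<oplus>\<^bsub>fibre E p\<^esub> t p),
         smult = (\<lambda>f s. \<lambda>p\<in>U. f p \<odot>\<^bsub>fibre E p\<^esub> s p)\<rparr>),
      restr = (\<lambda>V s. restrict s V),
      translate = translate_section M E\<rparr>"

text \<open>
  The quotient of the sheaf of sections of \<open>E\<close> by a subsheaf \<open>G\<close>, constructed by
  sheafification of the presheaf quotient: a section assigns to each point an element of the
  stalk of the quotient and is locally induced by a section of \<open>E\<close>.  An element of the stalk at
  \<open>q\<close> is an equivalence class of pairs of an open neighbourhood \<open>N\<close> of \<open>q\<close> and a section over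
  \<open>N\<close>, two of these being equivalent if their difference lies in \<open>G\<close> near \<open>q\<close>.
\<close>

definition quotient_germ ::
  "('p, 'g) space \<Rightarrow> ('p, 'a, 'g) vbundle \<Rightarrow> ('p set \<Rightarrow> ('p \<Rightarrow> 'a) set) \<Rightarrow> 'p \<Rightarrow>
    'p set \<Rightarrow> ('p \<Rightarrow> 'a) \<Rightarrow> ('p set \<times> ('p \<Rightarrow> 'a)) set" where
  "quotient_germ M E G q N s =
     {(N', s'). openin (topo M) N' \<and> q \<in> N' \<and> s' \<in> sects E N' \<and>
        (\<exists>N''. openin (topo M) N'' \<and> q \<in> N'' \<and> N'' \<subseteq> N \<inter> N' \<and>
          (\<lambda>r\<in>N''. s r \<ominus>\<^bsub>fibre E r\<^esub> s' r) \<in> G N'')}"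

text \<open>
  In the module operations the unions are over all representatives; for a subsheaf \<open>G\<close> of
  modules all members of the union coincide.
\<close>

definition quotient_sheaf ::
  "('p, 'g) space \<Rightarrow> ('p, 'a, 'g) vbundle \<Rightarrow> ('p set \<Rightarrow> ('p \<Rightarrow> 'a) set) \<Rightarrow>
    ('p, 'p \<Rightarrow> ('p set \<times> ('p \<Rightarrow> 'a)) set, 'g) osheaf" where
  "quotient_sheaf M E G =
     \<lparr>sections = (\<lambda>U.
        \<lparr>carrier = {\<sigma> \<in> extensional U. \<forall>q\<in>U. \<exists>N s. openin (topo M) N \<and> q \<in> N \<and> N \<subseteq> U \<and>
            s \<in> sects E N \<and> (\<forall>r\<in>N. \<sigma> r = quotient_germ M E G r N s)},
         mult = undefined, one = undefined,
         zero = (\<lambda>q\<in>U. quotient_germ M E G q U (\<lambda>r\<in>U. \<zero>\<^bsub>fibre E r\<^esub>)),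
         add = (\<lambda>\<sigma> \<tau>. \<lambda>q\<in>U. \<Union>(N, s)\<in>\<sigma> q. \<Union>(N', s')\<in>\<tau> q.
            quotient_germ M E G q (N \<inter> N') (\<lambda>r\<in>N \<inter> N'. s r \<oplus>\<^bsub>fibre E r\<^esub> s' r)),
         smult = (\<lambda>f \<sigma>. \<lambda>q\<in>U. \<Union>(N, s)\<in>\<sigma> q.
            quotient_germ M E G q (N \<inter> U) (\<lambda>r\<in>N \<inter> U. f r \<odot>\<^bsub>fibre E r\<^esub> s r))\<rparr>),
      restr = (\<lambda>V \<sigma>. restrict \<sigma> V),
      translate = (\<lambda>g U \<sigma>. \<lambda>q\<in>move M g ` U. let p = inv_into U (move M g) q in
        (\<lambda>(N, s). (move M g ` N, translate_section M E g N s)) ` \<sigma> p)\<rparr>"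

text \<open>Direct image under the first projection from the product of the space \<open>M\<close> with itself.\<close>

definition direct_image_fst ::
  "('p, 'g) space \<Rightarrow> ('p \<times> 'p, 's, 'g) osheaf \<Rightarrow> ('p, 's, 'g) osheaf" where
  "direct_image_fst M Q =
     \<lparr>sections = (\<lambda>U. let S = sections Q (U \<times> topspace (topo M)) in
        \<lparr>carrier = carrier S, mult = undefined, one = undefined, zero = zero S, add = add S,
         smult = (\<lambda>f \<sigma>. (\<lambda>q\<in>U \<times> topspace (topo M). f (fst q)) \<odot>\<^bsub>S\<^esub> \<sigma>)\<rparr>),
      restr = (\<lambda>V. restr Q (V \<times> topspace (topo M))),
      translate = (\<lambda>g U. translate Q g (U \<times> topspace (topo M)))\<rparr>"

text \<open>
  Equivariant holomorphic isomorphism, for equivariant holomorphic vector bundles given as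
  locally free sheaves; \<open>G\<close> is the set of group elements.
\<close>

definition equivariant_iso ::
  "('p, 'g) space \<Rightarrow> 'g set \<Rightarrow> ('p, 's, 'g) osheaf \<Rightarrow> ('p, 't, 'g) osheaf \<Rightarrow> bool" where
  "equivariant_iso M G A B \<longleftrightarrow>
     (\<exists>\<phi>. \<forall>U. openin (topo M) U \<longrightarrow>
        bij_betw (\<phi> U) (carrier (sections A U)) (carrier (sections B U)) \<and>
        (\<forall>s\<in>carrier (sections A U). \<forall>t\<in>carrier (sections A U).
           \<phi> U (s \<oplus>\<^bsub>sections A U\<^esub> t) = \<phi> U s \<oplus>\<^bsub>sections B U\<^esub> \<phi> U t) \<and>
        (\<forall>f\<in>hol M U. \<forall>s\<in>carrier (sections A U).
           \<phi> U (f \<odot>\<^bsub>sections A U\<^esub> s) = f \<odot>\<^bsub>sections B U\<^esub> \<phi> U s) \<and>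
        (\<forall>V. openin (topo M) V \<and> V \<subseteq> U \<longrightarrow> (\<forall>s\<in>carrier (sections A U).
           \<phi> V (restr A V s) = restr B V (\<phi> U s))) \<and>
        (\<forall>g\<in>G. \<forall>s\<in>carrier (sections A U).
           \<phi> (move M g ` U) (translate A g U s) = translate B g U (\<phi> U s)))"

section \<open>Jet bundles\<close>

definition pullback_snd ::
  "'p atlas \<Rightarrow> ('g \<Rightarrow> 'p \<Rightarrow> 'p) \<Rightarrow> ('p, 'a, 'g) vbundle \<Rightarrow> ('p \<times> 'p, 'a, 'g) vbundle" where
  "pullback_snd \<A> m W =
     \<lparr>fibre = (\<lambda>q. fibre W (snd q)),
      sects = local_span (surface_square \<A> m) (\<lambda>q. fibre W (snd q))
        (\<lambda>N. {\<lambda>q. s (snd q) | s U. openin (topo (surface \<A> m)) U \<and> snd ` N \<subseteq> U \<and> s \<in> sects W U}),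
      act = (\<lambda>g q. act W g (snd q))\<rparr>"

text \<open>
  For a bundle \<open>E\<close> on the product, the subsheaf \<open>E \<otimes> O(- j \<Delta>)\<close> of \<open>E\<close>: here \<open>O(- \<Delta>)\<close> is the
  ideal sheaf of functions vanishing on the diagonal, and \<open>O(- j \<Delta>)\<close> is its \<open>j\<close>-th power.
\<close>

definition diagonal_twist ::
  "'p atlas \<Rightarrow> ('g \<Rightarrow> 'p \<Rightarrow> 'p) \<Rightarrow> ('p \<times> 'p, 'a, 'g) vbundle \<Rightarrow> nat \<Rightarrow>
    ('p \<times> 'p) set \<Rightarrow> ('p \<times> 'p \<Rightarrow> 'a) set" where
  "diagonal_twist \<A> m E j =
     local_span (surface_square \<A> m) (fibre E)
       (\<lambda>N. {\<lambda>q. (\<Prod>i<j. h i q) \<odot>\<^bsub>fibre E q\<^esub> t q | h t.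
              (\<forall>i<j. h i \<in> hol (surface_square \<A> m) N \<and> (\<forall>x. (x, x) \<in> N \<longrightarrow> h i (x, x) = 0)) \<and>
              t \<in> sects E N})"

definition jet_bundle where
  "jet_bundle \<A> m k W =
     direct_image_fst (surface \<A> m)
       (quotient_sheaf (surface_square \<A> m) (pullback_snd \<A> m W)
         (diagonal_twist \<A> m (pullback_snd \<A> m W) (k + 1)))"

section \<open>The projective line\<close>

definition lines :: "(complex \<Rightarrow> 'v \<Rightarrow> 'v::ab_group_add) \<Rightarrow> 'v set set" where
  "lines cscale = {\<xi>. Modules.module.subspace cscale \<xi> \<and> vector_space.dim cscale \<xi> = 1}"

text \<open>
  Each basis \<open>(a, b)\<close> gives the affine chart with domain the lines not containing \<open>b\<close>, where
  the line spanned by \<open>a + t b\<close> has coordinate \<open>t\<close>.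
\<close>

definition proj_atlas :: "(complex \<Rightarrow> 'v \<Rightarrow> 'v::ab_group_add) \<Rightarrow> 'v set atlas" where
  "proj_atlas cscale =
     {({\<xi> \<in> lines cscale. b \<notin> \<xi>}, \<lambda>\<xi>. THE t. a + cscale t b \<in> \<xi>) | a b.
        a \<noteq> b \<and> \<not> Modules.module.dependent cscale {a, b}}"

definition SL :: "(complex \<Rightarrow> 'v \<Rightarrow> 'v::ab_group_add) \<Rightarrow> ('v \<Rightarrow> 'v) set" where
  "SL cscale = {A. Vector_Spaces.linear cscale cscale A \<and> bij A \<and>
     (\<forall>w\<in>carrier (ext_power (vector_module cscale) 2).
        ext_power_map A (vector_module cscale) 2 w = w)}"

definition proj_act :: "('v \<Rightarrow> 'v) \<Rightarrow> 'v set \<Rightarrow> 'v set" where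
  "proj_act A \<xi> = A ` \<xi>"

definition proj :: "(complex \<Rightarrow> 'v \<Rightarrow> 'v::ab_group_add) \<Rightarrow> ('v set, 'v \<Rightarrow> 'v) space" where
  "proj cscale = surface (proj_atlas cscale) proj_act"

text \<open>
  The bundle with fibre \<open>V/\<xi>\<close> at \<open>\<xi>\<close>, with the holomorphic structure of a quotient of the
  trivial bundle with fibre \<open>V\<close>.
\<close>

definition line_bundle ::
  "(complex \<Rightarrow> 'v \<Rightarrow> 'v::ab_group_add) \<Rightarrow> ('v set, 'v set, 'v \<Rightarrow> 'v) vbundle" where
  "line_bundle cscale =
     \<lparr>fibre = (\<lambda>\<xi>. quotient_module (vector_module cscale) \<xi>),
      sects = local_span (proj cscale) (\<lambda>\<xi>. quotient_module (vector_module cscale) \<xi>)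
        (\<lambda>N. {\<lambda>\<xi>. \<xi> +>\<^bsub>vector_module cscale\<^esub> v | v. True}),
      act = (\<lambda>A \<xi>. quotient_map A (vector_module cscale) (proj_act A \<xi>))\<rparr>"

definition line_bundle_power ::
  "(complex \<Rightarrow> 'v \<Rightarrow> 'v::ab_group_add) \<Rightarrow> int \<Rightarrow> ('v set, 'v set int_power, 'v \<Rightarrow> 'v) vbundle" where
  "line_bundle_power cscale n = line_power (proj cscale) (line_bundle cscale) n"

definition sym_bundle ::
  "(complex \<Rightarrow> 'v \<Rightarrow> 'v::ab_group_add) \<Rightarrow> nat \<Rightarrow>
    ('v set, ('v list \<Rightarrow>\<^sub>0 complex) set, 'v \<Rightarrow> 'v) vbundle" where
  "sym_bundle cscale j =
     trivial_bundle (proj cscale) (sym_power (vector_module cscale) j)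
       (\<lambda>A. sym_power_map A (vector_module cscale) j)"

end

theory Submission
  imports Defs "HOL-Complex_Analysis.Complex_Analysis"
begin

text \<open>
  A frame is a pair \<open>(v, u)\<close> of vectors with \<open>\<omega> v u \<noteq> 0\<close>, for a fixed nonzero alternating form \<open>\<omega>\<close> on
  the plane. It determines the line spanned by \<open>v\<close> and the affine coordinate \<open>\<tau>\<close> of the line
  spanned by \<open>v + \<tau> u\<close>. All the bundles in question have coordinates on the fibre at the line of
  \<open>v\<close> that depend on a frame \<open>(v, u)\<close> and satisfy three conditions: a section is holomorphic iff its
  coordinates in the frames \<open>(a + t b, b)\<close> are holomorphic in \<open>t\<close>; the special linear group, acting
  on frames, preserves the coordinates; and if \<open>(v, u)\<close> is replaced by another frame
  \<open>(l v, \<nu> u + \<mu> v)\<close> over the same line, then the \<open>i\<close>-th coordinate becomes the sum over \<open>j \<le> i\<close> of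
  \<open>\<kappa> i j \<nu>^j \<mu>^(i - j) l^(e - i)\<close> times the old \<open>j\<close>-th one. Such bundles are called \<open>homogeneous\<close> below.
  Two of them with the same rank, the same \<open>e\<close> and the same constants \<open>\<kappa>\<close> are equivariantly
  isomorphic, by equating coordinates. So the theorem is a comparison of constants.

  For jets of order \<open>k\<close> of \<open>L^n\<close> the coordinates are the Taylor coefficients in \<open>\<tau>\<close> of order at most
  \<open>k\<close>. The coordinate of \<open>L^n\<close> is homogeneous of degree \<open>n\<close> in \<open>v\<close>, and the new frame replaces \<open>\<tau>\<close> by
  \<open>\<tau> \<nu> / (l + \<tau> \<mu>)\<close>; this gives \<open>e = n\<close> and for \<open>\<kappa> i j\<close> the binomial coefficient of \<open>n - j\<close> over
  \<open>i - j\<close> (\<open>taylor_moebius\<close>, \<open>jet_coeff_law\<close>). For \<open>Sym^d\<close> the coordinates of a product of vectors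
  \<open>x\<close> are the coefficients of the product of the polynomials \<open>\<omega> x v + \<omega> x u T\<close>; here \<open>e = d\<close> and
  \<open>\<kappa> i j\<close> is \<open>d - j\<close> over \<open>i - j\<close> (\<open>homogeneous_sym_bundle\<close>). Tensoring with \<open>L^m\<close> adds \<open>m\<close> to \<open>e\<close>.

  Hence jets of \<open>L^n\<close> and \<open>L^(n - k) \<otimes> Sym^k\<close> have the same \<open>e\<close>, and multiplying the coordinates by
  constants matches the \<open>\<kappa>\<close>. The constants are the binomial coefficients of \<open>n - i\<close> over \<open>k - i\<close>,
  and they are all nonzero exactly if \<open>n < 0\<close> or \<open>n \<ge> k\<close> (\<open>high_degree_homogeneous\<close>). If
  \<open>0 \<le> n < k\<close>, the constants of the jets vanish for \<open>j \<le> n < i\<close>, so the jets split into two blocks.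
  The block of order at most \<open>n\<close> is \<open>Sym^n\<close>. The other one consists of the jets of order
  \<open>k - n - 1\<close> of the derivative of order \<open>n + 1\<close>, which by Bol's lemma is an invariant operator from
  \<open>L^n\<close> to \<open>L^(-n - 2)\<close>; so the case of negative degree applies (\<open>low_degree_homogeneous\<close>).

  There remains the passage from the quotient sheaf to Taylor coefficients. A section of the
  pullback of \<open>L^n\<close> lies in the \<open>(k + 1)\<close>-st power of the ideal of the diagonal iff its Taylor
  coefficients of order at most \<open>k\<close> vanish on the diagonal (\<open>twistD\<close>, \<open>twistI\<close>); this rests on the
  division of a function of two variables, vanishing on the diagonal, by \<open>w - z\<close>
  (\<open>holomorphic2_divide_diagonal\<close>). Conversely, holomorphic coefficients are those of the Taylor
  polynomial that they define, which provides local lifts (\<open>local_lift\<close>), and locally equal jets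
  mean equal germs. So taking Taylor coefficients is the isomorphism (\<open>jet_bundle_iso\<close>).
\<close>

section \<open>Holomorphic functions of two variables\<close>

lemma holomorphic2_onD:
  assumes "holomorphic2_on f S" "p \<in> S"
  obtains a b where "(f has_derivative (\<lambda>(h, k). a * h + b * k)) (at p)"
  using assms unfolding holomorphic2_on_def by blast

lemma holomorphic2_on_subset: "holomorphic2_on f S \<Longrightarrow> T \<subseteq> S \<Longrightarrow> holomorphic2_on f T"
  unfolding holomorphic2_on_def by blast

lemma holomorphic2_on_cong:
  assumes "open S" "\<And>p. p \<in> S \<Longrightarrow> f p = g p"
  shows "holomorphic2_on f S \<longleftrightarrow> holomorphic2_on g S"
proof -
  have "holomorphic2_on g S" if f: "holomorphic2_on f S" and eq: "\<And>p. p \<in> S \<Longrightarrow> f p = g p" for f g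
    unfolding holomorphic2_on_def
  proof
    fix p assume p: "p \<in> S"
    obtain a b where "(f has_derivative (\<lambda>(h, k). a * h + b * k)) (at p)"
      using holomorphic2_onD[OF f p] by blast
    then have "(g has_derivative (\<lambda>(h, k). a * h + b * k)) (at p)"
      by (rule has_derivative_transform_within_open[OF _ assms(1) p]) (simp add: eq)
    then show "\<exists>a b. (g has_derivative (\<lambda>(h, k). a * h + b * k)) (at p)" by blast
  qed
  from this[of f g] this[of g f] assms(2) show ?thesis by auto
qed

lemma holomorphic2_on_local:
  assumes "\<And>p. p \<in> S \<Longrightarrow> \<exists>T. p \<in> T \<and> holomorphic2_on f T"
  shows "holomorphic2_on f S"
  using assms unfolding holomorphic2_on_def by blast

lemma holomorphic2_on_const: "holomorphic2_on (\<lambda>p. c) S"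
  unfolding holomorphic2_on_def
proof
  fix p
  have "((\<lambda>p. c) has_derivative (\<lambda>(h, k). 0 * h + 0 * k)) (at p)"
    by (rule has_derivative_eq_rhs[OF has_derivative_const]) auto
  then show "\<exists>a b. ((\<lambda>p. c) has_derivative (\<lambda>(h, k). a * h + b * k)) (at p)" by blast
qed

lemma holomorphic2_on_add:
  assumes "holomorphic2_on f S" "holomorphic2_on g S"
  shows "holomorphic2_on (\<lambda>p. f p + g p) S"
  unfolding holomorphic2_on_def
proof
  fix p assume p: "p \<in> S"
  obtain a b where 1: "(f has_derivative (\<lambda>(h, k). a * h + b * k)) (at p)"
    using holomorphic2_onD[OF assms(1) p] by blast
  obtain c d where 2: "(g has_derivative (\<lambda>(h, k). c * h + d * k)) (at p)"
    using holomorphic2_onD[OF assms(2) p] by blast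
  have "((\<lambda>p. f p + g p) has_derivative (\<lambda>(h, k). (a + c) * h + (b + d) * k)) (at p)"
    by (rule has_derivative_eq_rhs[OF has_derivative_add[OF 1 2]]) (auto simp: algebra_simps)
  then show "\<exists>a b. ((\<lambda>p. f p + g p) has_derivative (\<lambda>(h, k). a * h + b * k)) (at p)" by blast
qed

lemma holomorphic2_on_mult:
  assumes "holomorphic2_on f S" "holomorphic2_on g S"
  shows "holomorphic2_on (\<lambda>p. f p * g p) S"
  unfolding holomorphic2_on_def
proof
  fix p assume p: "p \<in> S"
  obtain a b where 1: "(f has_derivative (\<lambda>(h, k). a * h + b * k)) (at p)"
    using holomorphic2_onD[OF assms(1) p] by blast
  obtain c d where 2: "(g has_derivative (\<lambda>(h, k). c * h + d * k)) (at p)"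
    using holomorphic2_onD[OF assms(2) p] by blast
  have "((\<lambda>p. f p * g p) has_derivative (\<lambda>(h, k). (f p * c + a * g p) * h + (f p * d + b * g p) * k)) (at p)"
    by (rule has_derivative_eq_rhs[OF has_derivative_mult[OF 1 2]]) (auto simp: algebra_simps)
  then show "\<exists>a b. ((\<lambda>p. f p * g p) has_derivative (\<lambda>(h, k). a * h + b * k)) (at p)" by blast
qed

lemma holomorphic2_on_sum:
  "(\<And>i. i \<in> I \<Longrightarrow> holomorphic2_on (f i) S) \<Longrightarrow> holomorphic2_on (\<lambda>p. \<Sum>i\<in>I. f i p) S"
  by (induction I rule: infinite_finite_induct) (auto intro: holomorphic2_on_const holomorphic2_on_add)

lemma holomorphic2_on_prod:
  "(\<And>i. i \<in> I \<Longrightarrow> holomorphic2_on (f i) S) \<Longrightarrow> holomorphic2_on (\<lambda>p. \<Prod>i\<in>I. f i p) S"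
  by (induction I rule: infinite_finite_induct) (auto intro: holomorphic2_on_const holomorphic2_on_mult)

lemma holomorphic2_on_diff:
  assumes "holomorphic2_on f S" "holomorphic2_on g S"
  shows "holomorphic2_on (\<lambda>p. f p - g p) S"
  using holomorphic2_on_add[OF assms(1) holomorphic2_on_mult[OF holomorphic2_on_const[of "-1"] assms(2)]]
  by simp

lemma holomorphic2_on_compose_left:
  assumes "g holomorphic_on T" "open T" "holomorphic2_on f S" "f ` S \<subseteq> T"
  shows "holomorphic2_on (\<lambda>p. g (f p)) S"
  unfolding holomorphic2_on_def
proof
  fix p assume p: "p \<in> S"
  obtain a b where 1: "(f has_derivative (\<lambda>(h, k). a * h + b * k)) (at p)"
    using holomorphic2_onD[OF assms(3) p] by blast
  obtain d where 2: "(g has_field_derivative d) (at (f p))"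
    using assms p by (metis field_differentiable_def holomorphic_on_imp_differentiable_at image_subset_iff)
  have "((\<lambda>p. g (f p)) has_derivative (\<lambda>(h, k). (d * a) * h + (d * b) * k)) (at p)"
    by (rule has_derivative_eq_rhs[OF has_derivative_compose[OF 1 2[unfolded has_field_derivative_def]]])
       (auto simp: algebra_simps)
  then show "\<exists>a b. ((\<lambda>p. g (f p)) has_derivative (\<lambda>(h, k). a * h + b * k)) (at p)" by blast
qed

lemma holomorphic2_on_fst: "holomorphic2_on fst S"
  unfolding holomorphic2_on_def
proof
  fix p :: "complex \<times> complex"
  have "(fst has_derivative (\<lambda>(h, k). 1 * h + 0 * k)) (at p)"
    by (rule has_derivative_eq_rhs[OF has_derivative_fst[OF has_derivative_ident]]) auto
  then show "\<exists>a b. (fst has_derivative (\<lambda>(h, k). a * h + b * k)) (at p)" by blast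
qed

lemma holomorphic2_on_snd: "holomorphic2_on snd S"
  unfolding holomorphic2_on_def
proof
  fix p :: "complex \<times> complex"
  have "(snd has_derivative (\<lambda>(h, k). 0 * h + 1 * k)) (at p)"
    by (rule has_derivative_eq_rhs[OF has_derivative_snd[OF has_derivative_ident]]) auto
  then show "\<exists>a b. (snd has_derivative (\<lambda>(h, k). a * h + b * k)) (at p)" by blast
qed

lemma holomorphic2_on_compose_fst:
  assumes "g holomorphic_on T" "open T" "fst ` S \<subseteq> T"
  shows "holomorphic2_on (\<lambda>(z, w). g z) S"
  using holomorphic2_on_compose_left[OF assms(1,2) holomorphic2_on_fst assms(3)]
  by (simp add: case_prod_unfold)

lemma holomorphic2_on_compose_snd:
  assumes "g holomorphic_on T" "open T" "snd ` S \<subseteq> T"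
  shows "holomorphic2_on (\<lambda>(z, w). g w) S"
  using holomorphic2_on_compose_left[OF assms(1,2) holomorphic2_on_snd assms(3)]
  by (simp add: case_prod_unfold)

lemma holomorphic2_on_compose_map_prod:
  assumes f: "holomorphic2_on f T" and g: "g holomorphic_on A" "open A" and h: "h holomorphic_on B" "open B"
    and S: "\<And>z w. (z, w) \<in> S \<Longrightarrow> z \<in> A \<and> w \<in> B \<and> (g z, h w) \<in> T"
  shows "holomorphic2_on (\<lambda>(z, w). f (g z, h w)) S"
  unfolding holomorphic2_on_def
proof
  fix p assume p: "p \<in> S"
  obtain z w where pe: "p = (z, w)" by (cases p)
  obtain a b where 1: "(f has_derivative (\<lambda>(h, k). a * h + b * k)) (at (g z, h w))"
    using holomorphic2_onD[OF f] S p pe by blast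
  obtain d where 2: "(g has_field_derivative d) (at z)"
    using g S p pe by (metis field_differentiable_def holomorphic_on_imp_differentiable_at)
  obtain e where 3: "(h has_field_derivative e) (at w)"
    using h S p pe by (metis field_differentiable_def holomorphic_on_imp_differentiable_at)
  have A: "((\<lambda>p. g (fst p)) has_derivative (\<lambda>q. d * fst q)) (at p)"
    using has_derivative_compose[of fst fst p UNIV g "(*) d"] 2[unfolded has_field_derivative_def] pe
    by (simp add: has_derivative_fst[OF has_derivative_ident])
  have B: "((\<lambda>p. h (snd p)) has_derivative (\<lambda>q. e * snd q)) (at p)"
    using has_derivative_compose[of snd snd p UNIV h "(*) e"] 3[unfolded has_field_derivative_def] pe
    by (simp add: has_derivative_snd[OF has_derivative_ident])
  have "((\<lambda>p. f (g (fst p), h (snd p))) has_derivative (\<lambda>(h, k). (a * d) * h + (b * e) * k)) (at p)"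
    by (rule has_derivative_eq_rhs[OF has_derivative_compose[OF has_derivative_Pair[OF A B]]])
       (use 1 pe in \<open>auto simp: algebra_simps\<close>)
  then show "\<exists>a b. ((\<lambda>(z, w). f (g z, h w)) has_derivative (\<lambda>(h, k). a * h + b * k)) (at p)"
    by (auto simp: case_prod_unfold)
qed

text \<open>
  The chain rule; it makes the restrictions of a function of two variables to curves available to
  the theory of one variable.
\<close>

lemma holomorphic2_on_along:
  assumes f: "holomorphic2_on f T" and g: "g holomorphic_on A" and h: "h holomorphic_on A" "open A"
    and S: "\<And>z. z \<in> A \<Longrightarrow> (g z, h z) \<in> T"
  shows "(\<lambda>z. f (g z, h z)) holomorphic_on A"
  unfolding holomorphic_on_open[OF h(2)]
proof
  fix z assume z: "z \<in> A"
  obtain a b where 1: "(f has_derivative (\<lambda>(h, k). a * h + b * k)) (at (g z, h z))"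
    using holomorphic2_onD[OF f] S z by blast
  obtain d where 2: "(g has_field_derivative d) (at z)"
    using g h z by (metis field_differentiable_def holomorphic_on_imp_differentiable_at)
  obtain e where 3: "(h has_field_derivative e) (at z)"
    using h z by (metis field_differentiable_def holomorphic_on_imp_differentiable_at)
  have "((\<lambda>z. f (g z, h z)) has_derivative (\<lambda>k. (a * d + b * e) * k)) (at z)"
    by (rule has_derivative_eq_rhs[OF has_derivative_compose[OF has_derivative_Pair[OF
          2[unfolded has_field_derivative_def] 3[unfolded has_field_derivative_def]] 1]])
       (auto simp: algebra_simps)
  then show "\<exists>f'. ((\<lambda>z. f (g z, h z)) has_field_derivative f') (at z)"
    unfolding has_field_derivative_def by blast
qed

lemma holomorphic2_on_imp_continuous_on: "holomorphic2_on f S \<Longrightarrow> continuous_on S f"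
  by (meson continuous_at_imp_continuous_on has_derivative_continuous holomorphic2_onD)

text \<open>
  The derivative in one variable is the derivative at 0 of a family of functions of one variable,
  depending continuously on the point, so its continuity is Weierstrass' theorem on uniform limits.
\<close>

lemma continuous_on_partial_derivative:
  fixes f :: "complex \<times> complex \<Rightarrow> complex"
  assumes "open S" "continuous_on S f"
    and der: "\<And>z w. (z, w) \<in> S \<Longrightarrow> ((\<lambda>w. f (z, w)) has_field_derivative f' (z, w)) (at w)"
  shows "continuous_on S f'"
proof (intro continuous_at_imp_continuous_on ballI)
  fix p assume p: "p \<in> S"
  obtain z0 w0 where pe: "p = (z0, w0)" by (cases p)
  obtain A B where AB: "open A" "open B" "z0 \<in> A" "w0 \<in> B" "A \<times> B \<subseteq> S"
    using open_prod_elim[OF assms(1) p] pe by (metis mem_Sigma_iff)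
  obtain r where r: "r > 0" "cball w0 r \<subseteq> B" using open_contains_cball AB by blast
  define U where "U = A \<times> ball w0 (r/2)"
  \<comment> \<open>The second variable is translated so that all functions are compared on one disc around 0.\<close>
  define fx where "fx = (\<lambda>q :: (complex \<times> complex) \<times> complex. f (fst (fst q), snd q + snd (fst q)))"
  have U: "open U" "p \<in> U" using AB r pe by (auto simp: U_def open_Times)
  have in_S: "(a, x + b) \<in> S" if "(a, b) \<in> U" "x \<in> cball 0 (r/2)" for a b x
  proof -
    have "dist w0 (x + b) \<le> dist w0 b + norm x"
      by (metis add.commute dist_norm dist_triangle dist_commute add_diff_cancel_left' add_left_mono)
    then have "x + b \<in> cball w0 r" using that by (auto simp: U_def)
    then show ?thesis using that r AB by (auto simp: U_def)
  qed
  have "continuous_on (U \<times> cball 0 (r/2)) fx" unfolding fx_def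
    by (rule continuous_on_compose2[OF assms(2)]) (use in_S in \<open>auto intro!: continuous_intros\<close>)
  note cp = continuous_on_prod_compactE[OF this compact_cball U(2)]
  have ul: "uniform_limit (cball 0 (r/2)) (\<lambda>q x. fx (q, x)) (\<lambda>x. fx (p, x)) (at p)"
  proof (rule uniform_limitI)
    fix e :: real assume e: "e > 0"
    then obtain X0 where X0: "p \<in> X0" "open X0" "\<forall>x\<in>X0 \<inter> U. \<forall>t\<in>cball 0 (r/2). dist (fx (x, t)) (fx (p, t)) \<le> e/2"
      using cp[of "e/2"] by auto
    have "\<forall>\<^sub>F q in at p. q \<in> X0 \<inter> U"
      using X0 U by (intro eventually_at_in_open') auto
    then show "\<forall>\<^sub>F q in at p. \<forall>x\<in>cball 0 (r/2). dist (fx (q, x)) (fx (p, x)) < e"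
      by eventually_elim (use X0 e in force)
  qed
  have der2: "((\<lambda>x. fx (q, x)) has_field_derivative f' (fst q, x + snd q)) (at x)"
    if "q \<in> U" "x \<in> cball 0 (r/2)" for q x
  proof -
    have "((\<lambda>w. f (fst q, w)) has_field_derivative f' (fst q, x + snd q)) (at (x + snd q))"
      using der in_S[of "fst q" "snd q" x] that by simp
    then show ?thesis by (simp add: fx_def DERIV_shift)
  qed
  have "\<forall>\<^sub>F q in at p. q \<in> U" using U by (intro eventually_at_in_open') auto
  then have ev: "\<forall>\<^sub>F q in at p. continuous_on (cball 0 (r/2)) (\<lambda>x. fx (q, x)) \<and>
      (\<forall>x\<in>ball 0 (r/2). ((\<lambda>x. fx (q, x)) has_field_derivative f' (fst q, x + snd q)) (at x))"
    by eventually_elim (auto intro!: der2 continuous_at_imp_continuous_on DERIV_isCont)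
  have r2: "0 < r/2" using r by simp
  obtain g' where "continuous_on (cball 0 (r/2)) (\<lambda>x. fx (p, x))"
    and g': "\<And>x. x \<in> ball 0 (r/2) \<Longrightarrow> ((\<lambda>x. fx (p, x)) has_field_derivative g' x) (at x) \<and>
      ((\<lambda>q. f' (fst q, x + snd q)) \<longlongrightarrow> g' x) (at p)"
    by (rule has_complex_derivative_uniform_limit[OF ev ul trivial_limit_at r2]) blast
  from g'[of 0] der2[of p 0] U r have "g' 0 = f' p"
    by (auto intro: DERIV_unique)
  with g'[of 0] r show "continuous (at p) f'" by (simp add: continuous_within)
qed

text \<open>
  Osgood's lemma: the partial derivative in the second variable is continuous, and one continuous
  partial derivative together with the existence of the other one gives the total derivative.
\<close>

lemma holomorphic2_onI_separately:
  fixes f :: "complex \<times> complex \<Rightarrow> complex"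
  assumes "open S" "continuous_on S f"
    and 1: "\<And>z w. (z, w) \<in> S \<Longrightarrow> (\<lambda>z. f (z, w)) field_differentiable (at z)"
    and 2: "\<And>z w. (z, w) \<in> S \<Longrightarrow> (\<lambda>w. f (z, w)) field_differentiable (at w)"
  shows "holomorphic2_on f S"
  unfolding holomorphic2_on_def
proof
  fix p assume p: "p \<in> S"
  obtain z0 w0 where pe: "p = (z0, w0)" by (cases p)
  define f' where "f' = (\<lambda>(z, w). deriv (\<lambda>w. f (z, w)) w)"
  have der: "((\<lambda>w. f (z, w)) has_field_derivative f' (z, w)) (at w)" if "(z, w) \<in> S" for z w
    using 2[OF that] by (simp add: f'_def DERIV_deriv_iff_field_differentiable)
  have cont: "continuous_on S f'"
    by (rule continuous_on_partial_derivative[OF assms(1,2) der])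
  obtain A B where AB: "open A" "open B" "z0 \<in> A" "w0 \<in> B" "A \<times> B \<subseteq> S"
    using open_prod_elim[OF assms(1) p] pe by (metis mem_Sigma_iff)
  obtain r where r: "r > 0" "ball w0 r \<subseteq> B" using open_contains_ball AB by blast
  obtain d where d: "((\<lambda>z. f (z, w0)) has_field_derivative d) (at z0)"
    using 1 p pe field_differentiable_def by blast
  have sub: "A \<times> ball w0 r \<subseteq> S" using AB r by blast
  have op: "open (A \<times> ball w0 r)" using AB by (auto intro: open_Times)
  have "continuous (at (z0, w0) within A \<times> ball w0 r) (\<lambda>(z, w). blinfun_mult_right (f' (z, w)))"
    unfolding case_prod_unfold prod.collapse
  proof (rule bounded_linear.continuous[OF bounded_linear_blinfun_mult_right])
    have "continuous (at (z0, w0)) f'" using cont p pe assms(1) continuous_on_eq_continuous_at by blast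
    then show "continuous (at (z0, w0) within A \<times> ball w0 r) f'" by (rule continuous_at_imp_continuous_at_within)
  qed
  then have "((\<lambda>(z, w). f (z, w)) has_derivative (\<lambda>(h, k). d * h + blinfun_mult_right (f' (z0, w0)) k))
      (at (z0, w0) within A \<times> ball w0 r)"
  proof (intro has_derivative_partialsI[where fy = "\<lambda>z w. blinfun_mult_right (f' (z, w))"])
    show "((\<lambda>z. f (z, w0)) has_derivative (*) d) (at z0 within A)"
      using d has_derivative_at_withinI unfolding has_field_derivative_def by blast
    show "((\<lambda>w. f (z, w)) has_derivative blinfun_apply (blinfun_mult_right (f' (z, w)))) (at w within ball w0 r)"
      if "z \<in> A" "w \<in> ball w0 r" for z w
      using der[of z w] that sub unfolding has_field_derivative_def blinfun_mult_right.rep_eq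
      by (blast intro: has_derivative_at_withinI)
  qed (use r in auto)
  then have "(f has_derivative (\<lambda>(h, k). d * h + f' (z0, w0) * k)) (at (z0, w0) within A \<times> ball w0 r)"
    unfolding blinfun_mult_right.rep_eq by (simp add: case_prod_unfold)
  moreover have "at (z0, w0) within A \<times> ball w0 r = at p"
    unfolding pe by (rule at_within_open[OF _ op]) (use AB r in auto)
  ultimately have "(f has_derivative (\<lambda>(h, k). d * h + f' (z0, w0) * k)) (at p)" by metis
  then show "\<exists>a b. (f has_derivative (\<lambda>(h, k). a * h + b * k)) (at p)" by blast
qed

lemma has_field_derivative_along:
  assumes "(f has_derivative (\<lambda>(h, k). a * h + b * k)) (at (g z, h z))"
    "(g has_field_derivative d) (at z)" "(h has_field_derivative e) (at z)"
  shows "((\<lambda>z. f (g z, h z)) has_field_derivative (a * d + b * e)) (at z)"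
  unfolding has_field_derivative_def
  by (rule has_derivative_eq_rhs[OF has_derivative_compose[OF has_derivative_Pair[OF
        assms(2)[unfolded has_field_derivative_def] assms(3)[unfolded has_field_derivative_def]] assms(1)]])
     (auto simp: algebra_simps)

text \<open>
  The quotient by the equation of the diagonal extends to the diagonal by the derivative in the
  second variable. It is holomorphic in each variable by Riemann's theorem on removable
  singularities (in the first variable because the two partial derivatives are opposite on the
  diagonal), and it is continuous by the mean value inequality.
\<close>

lemma holomorphic2_divide_diagonal:
  fixes f :: "complex \<times> complex \<Rightarrow> complex"
  assumes "open B" and f: "holomorphic2_on f (B \<times> B)" and 0: "\<And>z. z \<in> B \<Longrightarrow> f (z, z) = 0"
  obtains g where "holomorphic2_on g (B \<times> B)" "\<And>z w. z \<in> B \<Longrightarrow> w \<in> B \<Longrightarrow> f (z, w) = (w - z) * g (z, w)"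
proof -
  define f2 where "f2 = (\<lambda>(z, w). deriv (\<lambda>w. f (z, w)) w)"
  define g where "g = (\<lambda>(z, w). if w = z then f2 (z, z) else f (z, w) / (w - z))"
  have opB: "open (B \<times> B)" using assms(1) by (intro open_Times)
  have fd: "\<exists>a b. (f has_derivative (\<lambda>(h, k). a * h + b * k)) (at (z, w))" if "z \<in> B" "w \<in> B" for z w
    using f that by (auto simp: holomorphic2_on_def)
  have hol2: "(\<lambda>w. f (z, w)) holomorphic_on B" if "z \<in> B" for z
    by (rule holomorphic2_on_along[OF f]) (use that assms in \<open>auto intro!: holomorphic_intros\<close>)
  have hol1: "(\<lambda>z. f (z, w)) holomorphic_on B" if "w \<in> B" for w
    by (rule holomorphic2_on_along[OF f]) (use that assms in \<open>auto intro!: holomorphic_intros\<close>)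
  have d2: "((\<lambda>w. f (z, w)) has_field_derivative f2 (z, w)) (at w)" if "z \<in> B" "w \<in> B" for z w
    using holomorphic_derivI[OF hol2[OF that(1)] assms(1) that(2)] by (simp add: f2_def)
  \<comment> \<open>The function vanishes along the diagonal, so the two partial derivatives add up to 0 there.\<close>
  have opp: "deriv (\<lambda>z. f (z, w)) w = - f2 (w, w)" if w: "w \<in> B" for w
  proof -
    obtain a b where ab: "(f has_derivative (\<lambda>(h, k). a * h + b * k)) (at (w, w))" using fd[OF w w] by blast
    have "((\<lambda>z. f (z, z)) has_field_derivative a + b) (at w)"
      using has_field_derivative_along[of f a b "\<lambda>z. z" w "\<lambda>z. z" 1 1] ab by simp
    then have "((\<lambda>z. 0) has_field_derivative a + b) (at w)"
      by (rule has_field_derivative_transform_within_open[OF _ assms(1) w]) (simp add: 0)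
    then have "a + b = 0" using DERIV_unique DERIV_const by blast
    moreover have "((\<lambda>z. f (w, z)) has_field_derivative b) (at w)"
      using has_field_derivative_along[of f a b "\<lambda>z. w" w "\<lambda>z. z" 0 1] ab by simp
    then have "f2 (w, w) = b" using d2[OF w w] DERIV_unique by blast
    moreover have "((\<lambda>z. f (z, w)) has_field_derivative a) (at w)"
      using has_field_derivative_along[of f a b "\<lambda>z. z" w "\<lambda>z. w" 1 0] ab by simp
    then have "deriv (\<lambda>z. f (z, w)) w = a" by (rule DERIV_imp_deriv)
    ultimately show ?thesis by (simp add: add_eq_0_iff2)
  qed
  have g2: "(\<lambda>w. g (z, w)) holomorphic_on B" if "z \<in> B" for z
    using pole_lemma_open[OF hol2[OF that] assms(1), of z]
    by (simp add: g_def f2_def 0[OF that] cong: if_cong)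
  have g1: "(\<lambda>z. g (z, w)) holomorphic_on B" if "w \<in> B" for w
  proof -
    have "(\<lambda>z. - (if z = w then deriv (\<lambda>z. f (z, w)) w else (f (z, w) - f (w, w)) / (z - w))) holomorphic_on B"
      by (intro holomorphic_intros pole_lemma_open[OF hol1[OF that] assms(1), of w])
    also have "(\<lambda>z. - (if z = w then deriv (\<lambda>z. f (z, w)) w else (f (z, w) - f (w, w)) / (z - w))) = (\<lambda>z. g (z, w))"
      by (auto simp: g_def fun_eq_iff 0[OF that] opp[OF that] minus_divide_right)
    finally show ?thesis .
  qed
  have contf2: "continuous_on (B \<times> B) f2"
    by (rule continuous_on_partial_derivative[OF opB holomorphic2_on_imp_continuous_on[OF f]])
       (use d2 in auto)
  have contg: "isCont g p" if pB: "p \<in> B \<times> B" for p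
  proof -
    obtain z0 w0 where p: "p = (z0, w0)" "z0 \<in> B" "w0 \<in> B" using pB by blast
    show ?thesis
    proof (cases "z0 = w0")
      case False
      have "isCont (\<lambda>p. f p / (snd p - fst p)) p"
        using continuous_on_interior[OF holomorphic2_on_imp_continuous_on[OF f], of p] pB opB p False
        by (intro continuous_intros) (auto simp: interior_open)
      moreover have "\<forall>\<^sub>F q in nhds p. q \<in> {q. fst q \<noteq> snd q}"
        by (rule eventually_nhds_in_open) (use p False in \<open>auto intro!: open_Collect_neq continuous_intros\<close>)
      then have "\<forall>\<^sub>F q in nhds p. f q / (snd q - fst q) = g q"
        by eventually_elim (auto simp: g_def)
      ultimately show ?thesis using isCont_cong by fast
    next
      case True
      define c where "c = f2 (z0, z0)"
      show ?thesis unfolding isCont_def tendsto_iff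
      proof (intro allI impI)
        fix e :: real assume e: "e > 0"
        have "isCont f2 (z0, z0)" using contf2 opB p by (simp add: continuous_on_eq_continuous_at)
        then obtain d where d: "d > 0" "\<And>q. dist q (z0, z0) < d \<Longrightarrow> dist (f2 q) c < e/2"
          using e unfolding continuous_at_eps_delta c_def by (metis half_gt_zero)
        obtain r0 where r0: "r0 > 0" "ball z0 r0 \<subseteq> B" using open_contains_ball assms(1) p by blast
        define r where "r = min r0 (d/2)"
        have r: "r > 0" "ball z0 r \<subseteq> B" using r0 d by (auto simp: r_def)
        have near: "dist (f2 (z, w)) c < e/2" if "z \<in> ball z0 r" "w \<in> ball z0 r" for z w
        proof (rule d(2))
          have "dist (z, w) (z0, z0) \<le> dist z z0 + dist w z0"
            by (simp add: dist_Pair_Pair sqrt_sum_squares_le_sum)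
          also have "\<dots> < d" using that by (auto simp: r_def dist_commute)
          finally show "dist (z, w) (z0, z0) < d" .
        qed
        have "dist (g (z, w)) c \<le> e/2" if zw: "z \<in> ball z0 r" "w \<in> ball z0 r" for z w
        proof (cases "w = z")
          case True then show ?thesis using near[OF zw(1) zw(1)] by (simp add: g_def)
        next
          case False
          have "norm ((f (z, w) - c * w) - (f (z, z) - c * z)) \<le> e/2 * norm (w - z)"
          proof (rule field_differentiable_bound[where S = "ball z0 r" and f' = "\<lambda>w. f2 (z, w) - c"])
            show "((\<lambda>w. f (z, w) - c * w) has_field_derivative f2 (z, x) - c) (at x within ball z0 r)"
              if "x \<in> ball z0 r" for x
            proof -
              have "((\<lambda>w. f (z, w)) has_field_derivative f2 (z, x)) (at x within ball z0 r)"
                using d2[of z x] zw that r by (blast intro: has_field_derivative_at_within)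
              then show ?thesis by (auto intro!: derivative_eq_intros)
            qed
            show "norm (f2 (z, x) - c) \<le> e/2" if "x \<in> ball z0 r" for x
              using near[OF zw(1) that] by (simp add: dist_norm)
          qed (use zw in auto)
          then have "norm (f (z, w) - c * (w - z)) \<le> e/2 * norm (w - z)"
            using 0[of z] zw r by (auto simp: algebra_simps)
          moreover have "g (z, w) - c = (f (z, w) - c * (w - z)) / (w - z)"
            using False by (simp add: g_def field_simps)
          ultimately show ?thesis using False by (simp add: dist_norm norm_divide divide_le_eq)
        qed
        moreover have "\<forall>\<^sub>F q in at p. q \<in> ball z0 r \<times> ball z0 r"
          using r p True by (intro eventually_at_in_open') (auto intro: open_Times)
        moreover have "g p = c" using p True by (simp add: g_def c_def)
        ultimately show "\<forall>\<^sub>F q in at p. dist (g q) (g p) < e"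
          using e by (auto elim!: eventually_mono) (smt (verit) field_sum_of_halves)
      qed
    qed
  qed
  have "holomorphic2_on g (B \<times> B)"
  proof (rule holomorphic2_onI_separately[OF opB])
    show "continuous_on (B \<times> B) g" using contg continuous_at_imp_continuous_on by blast
  qed (use holomorphic_on_imp_differentiable_at[OF g1 assms(1)]
         holomorphic_on_imp_differentiable_at[OF g2 assms(1)] in auto)
  moreover have "f (z, w) = (w - z) * g (z, w)" if "z \<in> B" "w \<in> B" for z w
    using 0 that by (auto simp: g_def)
  ultimately show ?thesis using that by blast
qed

section \<open>Taylor coefficients at the origin\<close>

definition taylor :: "(complex \<Rightarrow> complex) \<Rightarrow> nat \<Rightarrow> complex" where
  "taylor f i = fps_nth (fps_expansion f 0) i"

lemma taylor_eq: "f has_fps_expansion F \<Longrightarrow> taylor f i = fps_nth F i"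
  by (simp add: taylor_def fps_expansion_eqI)

lemma taylor_cong: "eventually (\<lambda>x. f x = g x) (nhds 0) \<Longrightarrow> taylor f i = taylor g i"
  unfolding taylor_def by (metis fps_expansion_cong)

lemma holomorphic_has_fps_expansion_taylor:
  assumes "f holomorphic_on A" "open A" "0 \<in> A"
  shows "f has_fps_expansion Abs_fps (taylor f)"
proof -
  have "Abs_fps (taylor f) = fps_expansion f 0" by (simp add: taylor_def fps_eq_iff)
  then show ?thesis using has_fps_expansion_fps_expansion assms by metis
qed

lemma taylor_add:
  assumes "f holomorphic_on A" "g holomorphic_on A" "open A" "0 \<in> A"
  shows "taylor (\<lambda>x. f x + g x) i = taylor f i + taylor g i"
  using taylor_eq[OF has_fps_expansion_add[OF holomorphic_has_fps_expansion_taylor[OF assms(1,3,4)]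
        holomorphic_has_fps_expansion_taylor[OF assms(2-4)]]] by simp

lemma taylor_cmult:
  assumes "f holomorphic_on A" "open A" "0 \<in> A"
  shows "taylor (\<lambda>x. c * f x) i = c * taylor f i"
  using taylor_eq[OF has_fps_expansion_cmult_left[OF holomorphic_has_fps_expansion_taylor[OF assms]]] by simp

lemma taylor_0: "taylor (\<lambda>x. 0) i = 0"
  using taylor_eq[OF has_fps_expansion_0] by simp

lemma taylor_power_mult_eq_0:
  assumes "r holomorphic_on A" "open A" "0 \<in> A" "i < m"
  shows "taylor (\<lambda>x. x ^ m * r x) i = 0"
  using taylor_eq[OF has_fps_expansion_mult[OF has_fps_expansion_fps_X_power
        holomorphic_has_fps_expansion_taylor[OF assms(1-3)]]] assms(4)
  by (simp add: fps_X_power_mult_nth)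

text \<open>Each of the factors is divisible by \<open>x\<close>.\<close>

lemma taylor_prod_eq_0:
  assumes "\<And>i. i < m \<Longrightarrow> h i holomorphic_on A" "\<And>i. i < m \<Longrightarrow> h i 0 = 0" "r holomorphic_on A"
    "open A" "0 \<in> A" "l < m"
  shows "taylor (\<lambda>x. (\<Prod>i<m. h i x) * r x) l = 0"
proof -
  define g where "g = (\<lambda>i z. if z = 0 then deriv (h i) 0 else (h i z - h i 0) / (z - 0))"
  have g: "g i holomorphic_on A" if "i < m" for i
    unfolding g_def by (rule pole_lemma_open) (use assms that in auto)
  have "h i x = x * g i x" if "i < m" for i x
    using assms(2)[OF that] by (simp add: g_def)
  then have "(\<lambda>x. (\<Prod>i<m. h i x) * r x) = (\<lambda>x. x ^ m * ((\<Prod>i<m. g i x) * r x))"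
    by (simp add: fun_eq_iff prod.distrib)
  moreover have hol: "(\<lambda>x. (\<Prod>i<m. g i x) * r x) holomorphic_on A"
    by (intro holomorphic_intros) (use g assms in auto)
  ultimately show ?thesis using taylor_power_mult_eq_0[OF hol assms(4-6)] by simp
qed

lemma taylor_remainder:
  assumes "r holomorphic_on A" "open A" "0 \<in> A" "\<And>x. x \<in> A \<Longrightarrow> f x = (\<Sum>i<m. c i * x ^ i) + x ^ m * r x"
    "i < m"
  shows "taylor f i = c i"
proof -
  have "taylor f i = taylor (\<lambda>x. (\<Sum>i<m. c i * x ^ i) + x ^ m * r x) i"
    by (rule taylor_cong) (use assms eventually_nhds_in_open[of A 0] in \<open>auto elim!: eventually_mono\<close>)
  also have "\<dots> = fps_nth ((\<Sum>i<m. fps_const (c i) * fps_X ^ i) + fps_X ^ m * Abs_fps (taylor r)) i"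
    by (intro taylor_eq has_fps_expansion_add[OF has_fps_expansion_sum[OF has_fps_expansion_cmult_left]
        has_fps_expansion_mult] has_fps_expansion_fps_X_power holomorphic_has_fps_expansion_taylor[OF assms(1-3)])
  also have "\<dots> = (\<Sum>j<m. fps_nth (fps_const (c j) * fps_X ^ j) i) + fps_nth (fps_X ^ m * Abs_fps (taylor r)) i"
    unfolding fps_add_nth fps_sum_nth ..
  also have "fps_nth (fps_X ^ m * Abs_fps (taylor r)) i = 0"
    unfolding fps_X_power_mult_nth using assms(5) by simp
  also have "(\<Sum>j<m. fps_nth (fps_const (c j) * fps_X ^ j) i) = (\<Sum>j<m. if i = j then c j else 0)"
    unfolding fps_mult_left_const_nth fps_X_power_nth by (rule sum.cong) auto
  finally show ?thesis using assms(5) by simp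
qed

text \<open>
  Removing the value at 0 from the remainder leaves a function divisible by \<open>x\<close>; the quotient is
  the next remainder.
\<close>

lemma taylor_expansion:
  assumes g: "g holomorphic_on A" "open A" "0 \<in> A"
  shows "\<exists>q. q holomorphic_on A \<and> (\<forall>x\<in>A. g x = (\<Sum>j<m. taylor g j * x ^ j) + x ^ m * q x)"
proof (induction m)
  case (Suc m)
  then obtain q where q: "q holomorphic_on A" "\<And>x. x \<in> A \<Longrightarrow> g x = (\<Sum>j<m. taylor g j * x ^ j) + x ^ m * q x"
    by blast
  define q' where "q' = (\<lambda>z. if z = 0 then deriv q 0 else (q z - q 0) / (z - 0))"
  have q': "q' holomorphic_on A" unfolding q'_def by (rule pole_lemma_open) (use q g in auto)
  have q'q: "q x = q 0 + x * q' x" for x by (simp add: q'_def)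
  have 1: "g x = (\<Sum>j<Suc m. ((taylor g)(m := q 0)) j * x ^ j) + x ^ Suc m * q' x" if "x \<in> A" for x
  proof -
    have "(\<Sum>j<m. ((taylor g)(m := q 0)) j * x ^ j) = (\<Sum>j<m. taylor g j * x ^ j)"
      by (rule sum.cong) auto
    then show ?thesis using q(2)[OF that] q'q[of x] by (simp add: algebra_simps)
  qed
  from taylor_remainder[OF q' g(2,3) this, of m] have "taylor g m = q 0" by simp
  then have "(taylor g)(m := q 0) = taylor g" by auto
  with 1 q' show ?case by metis
qed (use g in auto)

text \<open>
  Repeated division by \<open>w - z\<close> of the remainder minus its restriction to the diagonal.
\<close>

lemma holomorphic2_taylor_expansion:
  assumes "open B" "holomorphic2_on f (B \<times> B)"
  shows "\<exists>c F. (\<forall>i<m. c i holomorphic_on B) \<and> holomorphic2_on F (B \<times> B) \<and>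
    (\<forall>z\<in>B. \<forall>w\<in>B. f (z, w) = (\<Sum>i<m. c i z * (w - z) ^ i) + (w - z) ^ m * F (z, w))"
proof (induction m)
  case 0
  show ?case using assms by (intro exI[of _ f] exI) auto
next
  case (Suc m)
  then obtain c F where cF: "\<And>i. i < m \<Longrightarrow> c i holomorphic_on B" "holomorphic2_on F (B \<times> B)"
    "\<And>z w. z \<in> B \<Longrightarrow> w \<in> B \<Longrightarrow> f (z, w) = (\<Sum>i<m. c i z * (w - z) ^ i) + (w - z) ^ m * F (z, w)"
    by blast
  define d where "d = (\<lambda>z. F (z, z))"
  have d: "d holomorphic_on B" unfolding d_def
    by (rule holomorphic2_on_along[OF cF(2)]) (use assms(1) in \<open>auto intro!: holomorphic_intros\<close>)
  have "holomorphic2_on (\<lambda>p. F p - (case p of (z, w) \<Rightarrow> d z)) (B \<times> B)"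
    by (intro holomorphic2_on_diff cF holomorphic2_on_compose_fst[OF d assms(1)]) auto
  then obtain G where G: "holomorphic2_on G (B \<times> B)"
    "\<And>z w. z \<in> B \<Longrightarrow> w \<in> B \<Longrightarrow> F (z, w) - d z = (w - z) * G (z, w)"
    using holomorphic2_divide_diagonal[OF assms(1), of "\<lambda>p. F p - (case p of (z, w) \<Rightarrow> d z)"]
    by (auto simp: d_def)
  have "f (z, w) = (\<Sum>i<Suc m. (c(m := d)) i z * (w - z) ^ i) + (w - z) ^ Suc m * G (z, w)"
    if "z \<in> B" "w \<in> B" for z w
  proof -
    have "(\<Sum>i<m. (c(m := d)) i z * (w - z) ^ i) = (\<Sum>i<m. c i z * (w - z) ^ i)"
      by (rule sum.cong) auto
    moreover have F: "F (z, w) = d z + (w - z) * G (z, w)" using G(2)[OF that] by (simp add: algebra_simps)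
    ultimately show ?thesis unfolding cF(3)[OF that] F by (simp add: algebra_simps)
  qed
  moreover have "\<forall>i<Suc m. (c(m := d)) i holomorphic_on B" using cF(1) d by (auto simp: less_Suc_eq)
  ultimately show ?case using G(1) by blast
qed

text \<open>
  For fixed \<open>z\<close> the expansion in powers of \<open>w - z\<close> obtained by division is the Taylor expansion;
  so the Taylor coefficients depend holomorphically on \<open>z\<close>.
\<close>

lemma holomorphic2_taylor:
  assumes "open B" "holomorphic2_on f (B \<times> B)"
  obtains F where "\<And>i. i < m \<Longrightarrow> (\<lambda>z. taylor (\<lambda>x. f (z, z + x)) i) holomorphic_on B"
    "holomorphic2_on F (B \<times> B)"
    "\<And>z w. z \<in> B \<Longrightarrow> w \<in> B \<Longrightarrow>
      f (z, w) = (\<Sum>i<m. taylor (\<lambda>x. f (z, z + x)) i * (w - z) ^ i) + (w - z) ^ m * F (z, w)"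
proof -
  obtain c F where cF: "\<And>i. i < m \<Longrightarrow> c i holomorphic_on B" "holomorphic2_on F (B \<times> B)"
    "\<And>z w. z \<in> B \<Longrightarrow> w \<in> B \<Longrightarrow> f (z, w) = (\<Sum>i<m. c i z * (w - z) ^ i) + (w - z) ^ m * F (z, w)"
    using holomorphic2_taylor_expansion[OF assms, of m] by blast
  have c: "taylor (\<lambda>x. f (z, z + x)) i = c i z" if "z \<in> B" "i < m" for z i
  proof (rule taylor_remainder)
    have "(\<lambda>x. z + x) -` B = (+) (- z) ` B"
      by (auto simp: image_iff) (metis add.commute add_diff_cancel_left' add_uminus_conv_diff)
    then show op: "open ((\<lambda>x. z + x) -` B)" using assms(1) open_translation by metis
    show "(\<lambda>x. F (z, z + x)) holomorphic_on (\<lambda>x. z + x) -` B"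
      by (rule holomorphic2_on_along[OF cF(2)]) (use op that in \<open>auto intro!: holomorphic_intros\<close>)
    show "f (z, z + x) = (\<Sum>i<m. c i z * x ^ i) + x ^ m * F (z, z + x)" if "x \<in> (\<lambda>x. z + x) -` B" for x
      using cF(3)[OF \<open>z \<in> B\<close>, of "z + x"] that by simp
  qed (use that in auto)
  show ?thesis
  proof (rule that[OF _ cF(2)])
    show "(\<lambda>z. taylor (\<lambda>x. f (z, z + x)) i) holomorphic_on B" if "i < m" for i
      by (rule holomorphic_transform[OF cF(1)[OF that]]) (simp add: c that)
    show "f (z, w) = (\<Sum>i<m. taylor (\<lambda>x. f (z, z + x)) i * (w - z) ^ i) + (w - z) ^ m * F (z, w)"
      if "z \<in> B" "w \<in> B" for z w
      using cF(3)[OF that] c[OF that(1)] by simp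
  qed
qed

text \<open>
  The binomial series for the function divided by its value \<open>l powi m\<close> at 0.
\<close>

lemma has_fps_expansion_affine_power_int:
  fixes l \<mu> :: complex
  assumes "l \<noteq> 0"
  shows "(\<lambda>x. (l + x * \<mu>) powi m) has_fps_expansion
    Abs_fps (\<lambda>i. (of_int m gchoose i) * \<mu> ^ i * l powi (m - int i))"
proof -
  define F where "F = fps_const (l powi m) * fps_compose (fps_binomial (of_int m)) (fps_const (\<mu> / l) * fps_X)"
  have 1: "(\<lambda>x. l powi m * ((\<lambda>x. (1 + x) powr (of_int m)) \<circ> (\<lambda>x. \<mu> / l * x)) x) has_fps_expansion F"
    unfolding F_def
    by (intro has_fps_expansion_cmult_left has_fps_expansion_compose has_fps_expansion_binomial_complex
        has_fps_expansion_fps_X) auto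
  have "\<forall>\<^sub>F x in nhds 0. x \<in> {x. l + x * \<mu> \<noteq> 0}"
    by (rule eventually_nhds_in_open) (use assms in \<open>auto intro!: open_Collect_neq continuous_intros\<close>)
  then have 2: "\<forall>\<^sub>F x in nhds 0. l powi m * ((\<lambda>x. (1 + x) powr (of_int m)) \<circ> (\<lambda>x. \<mu> / l * x)) x = (l + x * \<mu>) powi m"
  proof eventually_elim
    case (elim x)
    have "l + x * \<mu> = l * (1 + \<mu> / l * x)" using assms by (simp add: field_simps)
    then show ?case using elim assms by (simp add: power_int_mult_distrib complex_powr_of_int)
  qed
  have 3: "F = Abs_fps (\<lambda>i. (of_int m gchoose i) * \<mu> ^ i * l powi (m - int i))"
    using assms by (simp add: F_def fps_compose_linear fps_eq_iff power_int_diff power_divide)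
  show ?thesis by (rule has_fps_expansion_cong[OF 2 3, THEN iffD1, OF 1])
qed

text \<open>
  The substitution turns \<open>x^j\<close> into \<open>\<nu>^j x^j (l + x \<mu>)^(-j)\<close>. So the \<open>j\<close>-th Taylor coefficient of
  \<open>g\<close> is multiplied by that of order \<open>i - j\<close> of the power \<open>(l + x \<mu>)^(n - j)\<close>, given by the binomial
  series.
\<close>

lemma taylor_moebius:
  fixes l \<mu> \<nu> :: complex
  assumes "l \<noteq> 0" and g: "g holomorphic_on A" "open A" "0 \<in> A"
    and f: "\<forall>\<^sub>F x in nhds 0. f x = (l + x * \<mu>) powi n * g (x * \<nu> / (l + x * \<mu>))"
  shows "taylor f i =
    (\<Sum>j\<le>i. ((of_int n - of_nat j) gchoose (i - j)) * \<nu> ^ j * \<mu> ^ (i - j) * l powi (n - int i) * taylor g j)"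
proof -
  \<comment> \<open>The binomial series of the powers of the denominator.\<close>
  define P where "P = (\<lambda>m. Abs_fps (\<lambda>i. (of_int m gchoose i) * \<mu> ^ i * l powi (m - int i)))"
  have P: "(\<lambda>x. (l + x * \<mu>) powi m) has_fps_expansion P m" for m
    unfolding P_def by (rule has_fps_expansion_affine_power_int[OF assms(1)])
  obtain q where q: "q holomorphic_on A"
    "\<And>x. x \<in> A \<Longrightarrow> g x = (\<Sum>j\<le>i. taylor g j * x ^ j) + x ^ Suc i * q x"
    using taylor_expansion[OF g, of "Suc i"] by (auto simp: lessThan_Suc_atMost)
  define h where "h = (\<lambda>x. x * \<nu> / (l + x * \<mu>))"
  have "h holomorphic_on {x. l + x * \<mu> \<noteq> 0}" unfolding h_def by (intro holomorphic_intros) auto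
  moreover have op: "open {x. l + x * \<mu> \<noteq> 0}" by (auto intro!: open_Collect_neq continuous_intros)
  ultimately have opA': "open (h -` A \<inter> {x. l + x * \<mu> \<noteq> 0})"
    using continuous_open_preimage[of "{x. l + x * \<mu> \<noteq> 0}" h A] g(2) holomorphic_on_imp_continuous_on
    by (metis Int_commute)
  define A' where "A' = h -` A \<inter> {x. l + x * \<mu> \<noteq> 0}"
  have A': "open A'" "0 \<in> A'" using opA' g(3) assms(1) by (auto simp: A'_def h_def)
  define s where "s = (\<lambda>x. (l + x * \<mu>) powi n * (\<nu> / (l + x * \<mu>)) ^ Suc i * q (h x))"
  have "(\<lambda>x. q (h x)) holomorphic_on A'"
    by (rule holomorphic_on_compose_gen[OF _ q(1), unfolded o_def])
       (auto simp: A'_def h_def intro!: holomorphic_intros)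
  then have s: "s holomorphic_on A'" unfolding s_def
    by (intro holomorphic_intros) (auto simp: A'_def)
  have "\<forall>\<^sub>F x in nhds 0. f x = (\<Sum>j\<le>i. taylor g j * \<nu> ^ j * (x ^ j * (l + x * \<mu>) powi (n - int j))) + x ^ Suc i * s x"
    using f eventually_nhds_in_open[OF A']
  proof eventually_elim
    case (elim x)
    let ?B = "l + x * \<mu>"
    have B: "?B \<noteq> 0" "h x \<in> A" using elim by (auto simp: A'_def)
    have "f x = ?B powi n * ((\<Sum>j\<le>i. taylor g j * h x ^ j) + h x ^ Suc i * q (h x))"
      using elim q(2)[OF B(2)] by (simp add: h_def)
    also have "\<dots> = (\<Sum>j\<le>i. taylor g j * (h x ^ j * ?B powi n)) + ?B powi n * (h x ^ Suc i * q (h x))"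
      by (simp add: distrib_left sum_distrib_left mult_ac)
    also have "(\<Sum>j\<le>i. taylor g j * (h x ^ j * ?B powi n)) =
        (\<Sum>j\<le>i. taylor g j * \<nu> ^ j * (x ^ j * ?B powi (n - int j)))"
      using B by (intro sum.cong) (auto simp: h_def power_divide power_mult_distrib power_int_diff field_simps)
    also have "?B powi n * (h x ^ Suc i * q (h x)) = x ^ Suc i * s x"
      by (simp add: s_def h_def power_divide power_mult_distrib field_simps)
    finally show ?case .
  qed
  then have "taylor f i = taylor (\<lambda>x. (\<Sum>j\<le>i. taylor g j * \<nu> ^ j * (x ^ j * (l + x * \<mu>) powi (n - int j))) + x ^ Suc i * s x) i"
    by (rule taylor_cong)
  also have "\<dots> = fps_nth ((\<Sum>j\<le>i. fps_const (taylor g j * \<nu> ^ j) * (fps_X ^ j * P (n - int j))) + fps_X ^ Suc i * Abs_fps (taylor s)) i"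
    by (intro taylor_eq has_fps_expansion_add[OF has_fps_expansion_sum[OF has_fps_expansion_cmult_left]]
        has_fps_expansion_mult has_fps_expansion_fps_X_power P holomorphic_has_fps_expansion_taylor[OF s A'])
  also have "\<dots> = (\<Sum>j\<le>i. taylor g j * \<nu> ^ j * (((of_int n - of_nat j) gchoose (i - j)) * \<mu> ^ (i - j) * l powi (n - int i)))"
    unfolding fps_add_nth fps_sum_nth fps_X_power_mult_nth P_def
    by (auto simp: fps_X_power_mult_nth of_nat_diff intro!: sum.cong)
  finally show ?thesis by (simp add: mult_ac)
qed

section \<open>Coordinates on vector spaces with a carrier\<close>

definition seqs :: "nat \<Rightarrow> (nat \<Rightarrow> complex) set" where
  "seqs r = {f. \<forall>i\<ge>r. f i = 0}"

definition unit_seq :: "nat \<Rightarrow> nat \<Rightarrow> complex" where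
  "unit_seq j = (\<lambda>i. if i = j then 1 else 0)"

definition scalar_seq :: "complex \<Rightarrow> nat \<Rightarrow> complex" where
  "scalar_seq z = (\<lambda>i. if i = 0 then z else 0)"

lemma unit_seq_in_seqs: "j < r \<Longrightarrow> unit_seq j \<in> seqs r"
  by (auto simp: unit_seq_def seqs_def)

lemma scalar_seq_in_seqs: "scalar_seq z \<in> seqs 1"
  by (auto simp: scalar_seq_def seqs_def)

lemma seqs_1_eq: "seqs 1 = range scalar_seq"
proof -
  have "f = scalar_seq (f 0)" if "f \<in> seqs 1" for f
    using that by (auto simp: seqs_def scalar_seq_def fun_eq_iff)
  then show ?thesis using scalar_seq_in_seqs by blast
qed

lemma scalar_seq_eq_iff: "scalar_seq a = scalar_seq b \<longleftrightarrow> a = b"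
  by (auto simp: scalar_seq_def fun_eq_iff)

text \<open>
  A linear isomorphism onto the sequences supported below \<open>r\<close>. Sequences of a fixed type serve as
  coordinates in all dimensions, and the algebraic operations are constrained on the carrier only.
\<close>

definition coords :: "(complex, 'a) module \<Rightarrow> nat \<Rightarrow> ('a \<Rightarrow> nat \<Rightarrow> complex) \<Rightarrow> bool" where
  "coords M r C \<longleftrightarrow>
     \<zero>\<^bsub>M\<^esub> \<in> carrier M \<and> C \<zero>\<^bsub>M\<^esub> = (\<lambda>i. 0) \<and>
     (\<forall>x\<in>carrier M. \<forall>y\<in>carrier M. x \<oplus>\<^bsub>M\<^esub> y \<in> carrier M \<and> C (x \<oplus>\<^bsub>M\<^esub> y) = (\<lambda>i. C x i + C y i)) \<and>
     (\<forall>c. \<forall>x\<in>carrier M. c \<odot>\<^bsub>M\<^esub> x \<in> carrier M \<and> C (c \<odot>\<^bsub>M\<^esub> x) = (\<lambda>i. c * C x i)) \<and>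
     bij_betw C (carrier M) (seqs r)"

definition from_coords :: "(complex, 'a) module \<Rightarrow> ('a \<Rightarrow> nat \<Rightarrow> complex) \<Rightarrow> (nat \<Rightarrow> complex) \<Rightarrow> 'a" where
  "from_coords M C = inv_into (carrier M) C"

context
  fixes M :: "(complex, 'a) module" and r C
  assumes coords: "coords M r C"
begin

lemma coords_zero: "\<zero>\<^bsub>M\<^esub> \<in> carrier M" "C \<zero>\<^bsub>M\<^esub> = (\<lambda>i. 0)"
  and coords_add: "x \<in> carrier M \<Longrightarrow> y \<in> carrier M \<Longrightarrow> x \<oplus>\<^bsub>M\<^esub> y \<in> carrier M"
    "x \<in> carrier M \<Longrightarrow> y \<in> carrier M \<Longrightarrow> C (x \<oplus>\<^bsub>M\<^esub> y) = (\<lambda>i. C x i + C y i)"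
  and coords_smult: "x \<in> carrier M \<Longrightarrow> c \<odot>\<^bsub>M\<^esub> x \<in> carrier M"
    "x \<in> carrier M \<Longrightarrow> C (c \<odot>\<^bsub>M\<^esub> x) = (\<lambda>i. c * C x i)"
  and coords_bij: "bij_betw C (carrier M) (seqs r)"
  using coords unfolding coords_def by auto

lemma coords_seqs: "x \<in> carrier M \<Longrightarrow> C x \<in> seqs r"
  using coords_bij by (auto simp: bij_betw_def)

lemma coords_ge: "x \<in> carrier M \<Longrightarrow> i \<ge> r \<Longrightarrow> C x i = 0"
  using coords_seqs by (auto simp: seqs_def)

lemma coords_eqI: "x \<in> carrier M \<Longrightarrow> y \<in> carrier M \<Longrightarrow> (\<And>i. i < r \<Longrightarrow> C x i = C y i) \<Longrightarrow> x = y"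
  using coords_bij coords_ge unfolding bij_betw_def inj_on_def by (metis (no_types, lifting) ext not_le)

lemma from_coords:
  assumes "f \<in> seqs r"
  shows "from_coords M C f \<in> carrier M" "C (from_coords M C f) = f"
  using coords_bij assms unfolding from_coords_def
  by (auto simp: bij_betw_def inv_into_into f_inv_into_f)

lemma coords_abelian_group: "abelian_group M"
proof (rule abelian_groupI)
  fix x assume x: "x \<in> carrier M"
  show "\<exists>y\<in>carrier M. y \<oplus>\<^bsub>M\<^esub> x = \<zero>\<^bsub>M\<^esub>"
    using x by (intro bexI[of _ "(-1) \<odot>\<^bsub>M\<^esub> x"] coords_eqI) (auto simp: coords_add coords_smult coords_zero)
qed (auto intro!: coords_eqI simp: coords_add coords_zero)

lemma coords_finsum:
  assumes "finite A" "\<And>a. a \<in> A \<Longrightarrow> f a \<in> carrier M"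
  shows "finsum M f A \<in> carrier M \<and> C (finsum M f A) = (\<lambda>i. \<Sum>a\<in>A. C (f a) i)"
proof -
  interpret abelian_group M by (rule coords_abelian_group)
  show ?thesis using assms
    by (induction A rule: finite_induct) (auto simp: coords_zero coords_add finsum_insert Pi_iff)
qed

lemma coords_minus:
  assumes "x \<in> carrier M" "y \<in> carrier M"
  shows "x \<ominus>\<^bsub>M\<^esub> y \<in> carrier M" "C (x \<ominus>\<^bsub>M\<^esub> y) = (\<lambda>i. C x i - C y i)"
proof -
  interpret abelian_group M by (rule coords_abelian_group)
  have "\<ominus>\<^bsub>M\<^esub> y = (-1) \<odot>\<^bsub>M\<^esub> y"
    by (rule minus_equality) (use assms in \<open>auto intro!: coords_eqI simp: coords_add coords_smult coords_zero\<close>)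
  then show "x \<ominus>\<^bsub>M\<^esub> y \<in> carrier M" "C (x \<ominus>\<^bsub>M\<^esub> y) = (\<lambda>i. C x i - C y i)"
    using assms by (auto simp: a_minus_def coords_add coords_smult)
qed

end

lemma coordsI:
  assumes "\<zero>\<^bsub>M\<^esub> \<in> carrier M" "C \<zero>\<^bsub>M\<^esub> = (\<lambda>i. 0)"
    and "\<And>x y. x \<in> carrier M \<Longrightarrow> y \<in> carrier M \<Longrightarrow> x \<oplus>\<^bsub>M\<^esub> y \<in> carrier M"
    and "\<And>x y i. x \<in> carrier M \<Longrightarrow> y \<in> carrier M \<Longrightarrow> C (x \<oplus>\<^bsub>M\<^esub> y) i = C x i + C y i"
    and "\<And>x c. x \<in> carrier M \<Longrightarrow> c \<odot>\<^bsub>M\<^esub> x \<in> carrier M"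
    and "\<And>x c i. x \<in> carrier M \<Longrightarrow> C (c \<odot>\<^bsub>M\<^esub> x) i = c * C x i"
    and "\<And>x i. x \<in> carrier M \<Longrightarrow> i \<ge> r \<Longrightarrow> C x i = 0"
    and "\<And>x y. x \<in> carrier M \<Longrightarrow> y \<in> carrier M \<Longrightarrow> C x = C y \<Longrightarrow> x = y"
    and "\<And>f. f \<in> seqs r \<Longrightarrow> \<exists>x\<in>carrier M. C x = f"
  shows "coords M r C"
proof -
  have "C x \<in> seqs r" if "x \<in> carrier M" for x using assms(7)[OF that] by (auto simp: seqs_def)
  then have "bij_betw C (carrier M) (seqs r)"
    using assms(8,9) unfolding bij_betw_def inj_on_def by blast
  then show ?thesis unfolding coords_def using assms(1-6) by (auto simp: fun_eq_iff)
qed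

subsection \<open>Quotients\<close>

text \<open>
  A function on a quotient given by its value on representatives. The choice of the
  representative is harmless for the functions considered in the locale below, which vanish on the subspace.
\<close>

definition rep_coord :: "('b \<Rightarrow> nat \<Rightarrow> complex) \<Rightarrow> 'b set \<Rightarrow> nat \<Rightarrow> complex" where
  "rep_coord e W = e (SOME x. x \<in> W)"

text \<open>
  A linear system of functions with values in the sequences supported below \<open>r\<close>, surjective onto
  them and with common kernel \<open>N\<close>, induces coordinates on the quotient by \<open>N\<close>.
\<close>

locale quotient_coords = vector_space scale
  for scale :: "complex \<Rightarrow> 'b \<Rightarrow> 'b::ab_group_add" +
  fixes S N :: "'b set" and r :: nat and e :: "'b \<Rightarrow> nat \<Rightarrow> complex"
  assumes S: "subspace S" and N: "subspace N" "N \<subseteq> S"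
    and e_add: "\<And>x y i. x \<in> S \<Longrightarrow> y \<in> S \<Longrightarrow> e (x + y) i = e x i + e y i"
    and e_scale: "\<And>c x i. x \<in> S \<Longrightarrow> e (scale c x) i = c * e x i"
    and kernel: "\<And>x. x \<in> S \<Longrightarrow> x \<in> N \<longleftrightarrow> (\<forall>i. e x i = 0)"
    and e_ge: "\<And>x i. x \<in> S \<Longrightarrow> i \<ge> r \<Longrightarrow> e x i = 0"
    and e_surj: "\<And>f. f \<in> seqs r \<Longrightarrow> \<exists>x\<in>S. e x = f"
begin

abbreviation total :: "(complex, 'b) module" where
  "total \<equiv> \<lparr>carrier = S, mult = undefined, one = undefined, zero = 0, add = (+), smult = scale\<rparr>"

definition coset :: "'b \<Rightarrow> 'b set" where
  "coset x = (\<lambda>h. h + x) ` N"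

lemma e_minus: "x \<in> S \<Longrightarrow> e (- x) i = - e x i"
  using e_scale[of x "-1" i] by (simp add: scale_minus_left)

lemma a_r_coset_eq: "N +>\<^bsub>total\<^esub> x = coset x"
  by (auto simp: a_r_coset_def r_coset_def coset_def)

lemma set_add_eq: "A <+>\<^bsub>total\<^esub> B = {a + b | a b. a \<in> A \<and> b \<in> B}"
  by (auto simp: set_add_def set_mult_def)

text \<open>
  Two vectors are congruent iff all the functions agree on them; this turns identities of cosets
  into identities of coordinates.
\<close>

lemma in_coset_iff:
  assumes "x \<in> S"
  shows "y \<in> coset x \<longleftrightarrow> y \<in> S \<and> e y = e x"
proof
  assume "y \<in> coset x"
  then obtain h where h: "h \<in> N" "y = h + x" by (auto simp: coset_def)
  then have "h \<in> S" "\<forall>i. e h i = 0" using N kernel by auto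
  then show "y \<in> S \<and> e y = e x" using assms h S by (auto simp: fun_eq_iff e_add subspace_add)
next
  assume y: "y \<in> S \<and> e y = e x"
  then have "y - x \<in> S" using assms S by (auto simp: subspace_diff)
  moreover have "e (y - x) i = 0" for i
    using y assms S e_add[of y "- x" i] e_minus[of x i] subspace_neg[OF S, of x] by simp
  ultimately have "y - x \<in> N" using kernel by blast
  then show "y \<in> coset x" unfolding coset_def by (intro image_eqI[of _ _ "y - x"]) auto
qed

lemma coset_eqI: "x \<in> S \<Longrightarrow> (\<And>y. y \<in> W \<longleftrightarrow> y \<in> S \<and> e y = e x) \<Longrightarrow> W = coset x"
  using in_coset_iff by blast

lemma rep_coord_coset: "x \<in> S \<Longrightarrow> rep_coord e (coset x) = e x"
  unfolding rep_coord_def using someI[of "\<lambda>y. y \<in> coset x" x] in_coset_iff by auto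

lemma carrier_quotient: "carrier (quotient_module total N) = coset ` S"
  by (auto simp: quotient_module_def A_RCOSETS_def' a_r_coset_eq)

lemma coset_add: "x \<in> S \<Longrightarrow> y \<in> S \<Longrightarrow> coset x \<oplus>\<^bsub>quotient_module total N\<^esub> coset y = coset (x + y)"
proof (rule coset_eqI)
  fix z assume xy: "x \<in> S" "y \<in> S"
  have "coset x \<oplus>\<^bsub>quotient_module total N\<^esub> coset y = {a + b | a b. a \<in> coset x \<and> b \<in> coset y}"
    by (simp add: quotient_module_def set_add_eq)
  moreover have "\<exists>a b. z = a + b \<and> a \<in> coset x \<and> b \<in> coset y" if "z \<in> S" "e z = e (x + y)"
  proof (intro exI conjI)
    show "z = x + (z - x)" by simp
    have "e (z - x) = e y"
      using that xy e_add[of z "- x"] e_minus[of x] subspace_neg[OF S, of x] by (auto simp: e_add)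
    then show "x \<in> coset x" "z - x \<in> coset y" using that xy S by (auto simp: in_coset_iff subspace_diff)
  qed
  ultimately show "z \<in> coset x \<oplus>\<^bsub>quotient_module total N\<^esub> coset y \<longleftrightarrow> z \<in> S \<and> e z = e (x + y)"
    using xy S by (auto simp: in_coset_iff subspace_add e_add fun_eq_iff)
qed (auto simp: S subspace_add)

lemma coset_smult: "x \<in> S \<Longrightarrow> c \<odot>\<^bsub>quotient_module total N\<^esub> coset x = coset (scale c x)"
proof (rule coset_eqI)
  fix z assume x: "x \<in> S"
  have "c \<odot>\<^bsub>quotient_module total N\<^esub> coset x = {scale c a + b | a b. a \<in> coset x \<and> b \<in> N}"
    by (auto simp: quotient_module_def set_add_eq)
  moreover have "\<exists>a b. z = scale c a + b \<and> a \<in> coset x \<and> b \<in> N" if "z \<in> S" "e z = e (scale c x)"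
  proof (intro exI conjI)
    show "z = scale c x + (z - scale c x)" by simp
    show "x \<in> coset x" using x by (simp add: in_coset_iff)
    have "scale c x \<in> S" using x S by (simp add: subspace_scale)
    then have "z \<in> coset (scale c x)" using that by (simp add: in_coset_iff)
    then show "z - scale c x \<in> N" by (auto simp: coset_def)
  qed
  ultimately show "z \<in> c \<odot>\<^bsub>quotient_module total N\<^esub> coset x \<longleftrightarrow> z \<in> S \<and> e z = e (scale c x)"
    using x S N kernel by (auto simp: in_coset_iff subspace_add subspace_scale e_add e_scale fun_eq_iff) (* CHK *)
qed (auto simp: S subspace_scale)

lemma coords_quotient: "coords (quotient_module total N) r (rep_coord e)"
proof (rule coordsI)
  have z: "\<zero>\<^bsub>quotient_module total N\<^esub> = coset 0" by (simp add: quotient_module_def coset_def)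
  have 0: "0 \<in> S" using S by (simp add: subspace_0)
  show "\<zero>\<^bsub>quotient_module total N\<^esub> \<in> carrier (quotient_module total N)"
    using 0 by (auto simp: z carrier_quotient)
  have "e 0 i = 0" for i using e_scale[OF 0, of 0 i] by simp
  then show "rep_coord e \<zero>\<^bsub>quotient_module total N\<^esub> = (\<lambda>i. 0)" using 0 by (auto simp: z rep_coord_coset)
  show "\<exists>x\<in>carrier (quotient_module total N). rep_coord e x = f" if "f \<in> seqs r" for f
    using e_surj[OF that] by (auto simp: carrier_quotient rep_coord_coset)
  show "x = y" if "x \<in> carrier (quotient_module total N)" "y \<in> carrier (quotient_module total N)"
    "rep_coord e x = rep_coord e y" for x y
    using that in_coset_iff by (auto simp: carrier_quotient rep_coord_coset)
qed (use S in \<open>auto simp: carrier_quotient coset_add coset_smult rep_coord_coset subspace_add subspace_scale e_add e_scale e_ge\<close>)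

end

subsection \<open>Quotients of free vector spaces\<close>

lemma lookup_free_scale: "Poly_Mapping.lookup (free_scale c x) i = c * Poly_Mapping.lookup x i"
  by (simp add: free_scale_def Poly_Mapping.map.rep_eq when_def)

interpretation free: vector_space free_scale
  by standard (auto intro!: poly_mapping_eqI simp: lookup_free_scale lookup_add algebra_simps)

text \<open>The linear extension of a function given on the generators.\<close>

definition free_eval :: "('s \<Rightarrow> complex) \<Rightarrow> ('s \<Rightarrow>\<^sub>0 complex) \<Rightarrow> complex" where
  "free_eval h x = (\<Sum>s\<in>Poly_Mapping.keys x. Poly_Mapping.lookup x s * h s)"

lemma free_eval_superset:
  assumes "finite A" "Poly_Mapping.keys x \<subseteq> A"
  shows "free_eval h x = (\<Sum>s\<in>A. Poly_Mapping.lookup x s * h s)"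
  unfolding free_eval_def by (rule sum.mono_neutral_left) (use assms in \<open>auto simp: in_keys_iff\<close>)

lemma free_eval_add: "free_eval h (x + y) = free_eval h x + free_eval h y"
proof -
  let ?A = "Poly_Mapping.keys x \<union> Poly_Mapping.keys y"
  have "free_eval h (x + y) = (\<Sum>s\<in>?A. Poly_Mapping.lookup (x + y) s * h s)"
    by (rule free_eval_superset[OF _ Poly_Mapping.keys_add]) simp
  also have "\<dots> = (\<Sum>s\<in>?A. Poly_Mapping.lookup x s * h s) + (\<Sum>s\<in>?A. Poly_Mapping.lookup y s * h s)"
    by (simp add: lookup_add algebra_simps sum.distrib)
  also have "\<dots> = free_eval h x + free_eval h y"
    by (simp add: free_eval_superset[of ?A])
  finally show ?thesis .
qed

lemma free_eval_scale: "free_eval h (free_scale c x) = c * free_eval h x"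
proof -
  have "Poly_Mapping.keys (free_scale c x) \<subseteq> Poly_Mapping.keys x"
    by (auto simp: in_keys_iff lookup_free_scale)
  then have "free_eval h (free_scale c x) = (\<Sum>s\<in>Poly_Mapping.keys x. c * Poly_Mapping.lookup x s * h s)"
    by (simp add: free_eval_superset[of "Poly_Mapping.keys x"] lookup_free_scale)
  then show ?thesis by (simp add: free_eval_def sum_distrib_left mult.assoc)
qed

lemma free_eval_diff: "free_eval h (x - y) = free_eval h x - free_eval h y"
  using free_eval_add[of h "x - y" y] by simp

lemma free_eval_0: "free_eval h 0 = 0"
  by (simp add: free_eval_def)

lemma free_eval_single: "free_eval h (Poly_Mapping.single s c) = c * h s"
  by (simp add: free_eval_def)

lemma free_eval_sum: "free_eval h (\<Sum>i\<in>I. f i) = (\<Sum>i\<in>I. free_eval h (f i))"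
  by (induction I rule: infinite_finite_induct) (auto simp: free_eval_0 free_eval_add)

lemma free_scale_gen: "free_scale c (free_gen s) = Poly_Mapping.single s c"
  by (rule poly_mapping_eqI) (simp add: lookup_free_scale lookup_single when_def)

lemma free_expansion: "x = (\<Sum>s\<in>Poly_Mapping.keys x. free_scale (Poly_Mapping.lookup x s) (free_gen s))"
  unfolding free_scale_gen
  by (rule poly_mapping_eqI) (simp add: lookup_sum lookup_single when_def in_keys_iff)

lemma subspace_free_carrier: "free.subspace (carrier (free_module S))"
proof -
  have "Poly_Mapping.keys (free_scale c x) \<subseteq> Poly_Mapping.keys x" for c and x :: "'a \<Rightarrow>\<^sub>0 complex"
    by (auto simp: in_keys_iff lookup_free_scale)
  moreover have "Poly_Mapping.keys (x + y) \<subseteq> Poly_Mapping.keys x \<union> Poly_Mapping.keys y" for x y :: "'a \<Rightarrow>\<^sub>0 complex"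
    by (rule Poly_Mapping.keys_add)
  ultimately show ?thesis unfolding free.subspace_def free_module_def
    by (simp, meson Un_least order_trans)
qed

lemma gen_in_free_carrier: "s \<in> S \<Longrightarrow> Poly_Mapping.single s c \<in> carrier (free_module S)"
  by (auto simp: free_module_def)

lemma free_module_eq_total:
  "free_module S = \<lparr>carrier = carrier (free_module S), mult = undefined, one = undefined, zero = 0,
     add = (+), smult = free_scale\<rparr>"
  by (simp add: free_module_def)

definition free_coord :: "(nat \<Rightarrow> 's \<Rightarrow> complex) \<Rightarrow> ('s \<Rightarrow>\<^sub>0 complex) set \<Rightarrow> nat \<Rightarrow> complex" where
  "free_coord h = rep_coord (\<lambda>x i. free_eval (h i) x)"

definition free_coords :: "'s set \<Rightarrow> ('s \<Rightarrow>\<^sub>0 complex) set \<Rightarrow> nat \<Rightarrow> (nat \<Rightarrow> 's \<Rightarrow> complex) \<Rightarrow> bool" where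
  "free_coords S R r h \<longleftrightarrow>
     quotient_coords free_scale (carrier (free_module S)) (free_span R) r (\<lambda>x i. free_eval (h i) x)"

text \<open>
  An element of the free space is a relation plus a combination of the \<open>b j\<close>, and by duality the
  coefficients of the latter are the values of the functions. So an element on which all functions
  vanish is a relation.
\<close>

lemma free_coordsI:
  assumes R: "R \<subseteq> carrier (free_module S)" "\<And>x i. x \<in> R \<Longrightarrow> free_eval (h i) x = 0"
    and ge: "\<And>s i. s \<in> S \<Longrightarrow> i \<ge> r \<Longrightarrow> h i s = 0"
    and b: "\<And>j. j < r \<Longrightarrow> b j \<in> carrier (free_module S)"
      "\<And>i j. j < r \<Longrightarrow> free_eval (h i) (b j) = unit_seq j i"
    and gen: "\<And>s. s \<in> S \<Longrightarrow> free_gen s \<in> free_span (R \<union> b ` {..<r})"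
  shows "free_coords S R r h"
  unfolding free_coords_def
proof
  show "free.subspace (carrier (free_module S))" by (rule subspace_free_carrier)
  show "free.subspace (free_span R)" by (rule free.subspace_span)
  show sub: "free_span R \<subseteq> carrier (free_module S)"
    by (rule free.span_minimal[OF R(1) subspace_free_carrier])
  have van: "free_eval (h i) x = 0" if "x \<in> free_span R" for x i
    by (rule free.span_induct[OF that]) (auto simp: free.subspace_def R free_eval_add free_eval_scale free_eval_0)
  fix x assume x: "x \<in> carrier (free_module S)"
  show "x \<in> free_span R \<longleftrightarrow> (\<forall>i. free_eval (h i) x = 0)"
  proof (intro iffI allI van)
    assume 0: "\<forall>i. free_eval (h i) x = 0"
    have "x \<in> free_span (R \<union> b ` {..<r})"
      by (subst free_expansion) (use x gen in \<open>auto intro!: free.span_sum free.span_scale simp: free_module_def\<close>)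
    then obtain y z where yz: "x = y + z" "y \<in> free_span R" "z \<in> free_span (b ` {..<r})"
      unfolding free.span_Un by auto
    have "\<exists>c. z = (\<Sum>j<r. free_scale (c j) (b j))"
      using yz(3)
    proof (induction rule: free.span_induct_alt)
      case base
      show ?case by (intro exI[of _ "\<lambda>_. 0"]) simp
    next
      case (step c x y)
      then obtain j d where j: "j < r" "x = b j" and d: "y = (\<Sum>j<r. free_scale (d j) (b j))" by auto
      have "free_scale c x + y = (\<Sum>i<r. free_scale (if i = j then c else 0) (b i)) + y"
        using j by (simp add: if_distrib[of "\<lambda>c. free_scale c _"] cong: if_cong)
      also have "\<dots> = (\<Sum>i<r. free_scale ((if i = j then c else 0) + d i) (b i))"
        by (simp only: d sum.distrib[symmetric] free.scale_left_distrib)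
      finally show ?case by (intro exI[of _ "\<lambda>i. (if i = j then c else 0) + d i"])
    qed
    then obtain c where c: "z = (\<Sum>j<r. free_scale (c j) (b j))" by blast
    have "c i = 0" if "i < r" for i
    proof -
      have "0 = free_eval (h i) z" using 0 yz van by (simp add: free_eval_add)
      also have "\<dots> = (\<Sum>j<r. c j * unit_seq j i)"
        unfolding c free_eval_sum free_eval_scale by (rule sum.cong) (auto simp: b)
      also have "\<dots> = c i" using that by (simp add: unit_seq_def if_distrib[of "\<lambda>x. _ * x"] cong: if_cong)
      finally show ?thesis by simp
    qed
    then have "z = 0" using c by simp
    then show "x \<in> free_span R" using yz by simp
  qed
  show "free_eval (h i) x = 0" if "i \<ge> r" for i
    unfolding free_eval_def by (rule sum.neutral) (use x ge that in \<open>auto simp: free_module_def\<close>)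
next
  fix f assume f: "f \<in> seqs r"
  show "\<exists>x\<in>carrier (free_module S). (\<lambda>i. free_eval (h i) x) = f"
  proof
    show "(\<Sum>j<r. free_scale (f j) (b j)) \<in> carrier (free_module S)"
      by (intro free.subspace_sum[OF subspace_free_carrier] free.subspace_scale[OF subspace_free_carrier]) (auto simp: b)
    have "free_eval (h i) (\<Sum>j<r. free_scale (f j) (b j)) = (\<Sum>j<r. f j * unit_seq j i)" for i
      unfolding free_eval_sum free_eval_scale by (rule sum.cong) (auto simp: b)
    also have "(\<Sum>j<r. f j * unit_seq j i) = f i" for i
      using f by (auto simp: unit_seq_def seqs_def if_distrib[of "\<lambda>x. _ * x"] cong: if_cong)
    finally show "(\<lambda>i. free_eval (h i) (\<Sum>j<r. free_scale (f j) (b j))) = f" by blast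
  qed
qed (auto simp: free_eval_add free_eval_scale)

context
  fixes S :: "'s set" and R r h
  assumes fc: "free_coords S R r h"
begin

interpretation quotient_coords free_scale "carrier (free_module S)" "free_span R" r "\<lambda>x i. free_eval (h i) x"
  using fc by (simp add: free_coords_def)

lemma free_coords_coords: "coords (quotient_module (free_module S) (free_span R)) r (free_coord h)"
  using coords_quotient unfolding free_module_eq_total[symmetric] free_coord_def .

lemma free_coords_carrier: "carrier (quotient_module (free_module S) (free_span R)) =
    (\<lambda>x. free_span R +>\<^bsub>free_module S\<^esub> x) ` carrier (free_module S)"
  using carrier_quotient unfolding a_r_coset_eq[symmetric] free_module_eq_total[symmetric] .

lemma free_coord_coset: "x \<in> carrier (free_module S) \<Longrightarrow>
    free_coord h (free_span R +>\<^bsub>free_module S\<^esub> x) = (\<lambda>i. free_eval (h i) x)"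
  using rep_coord_coset unfolding free_coord_def a_r_coset_eq[symmetric] free_module_eq_total[symmetric] .

lemma free_coords_kernel: "x \<in> carrier (free_module S) \<Longrightarrow> x \<in> free_span R \<longleftrightarrow> (\<forall>i. free_eval (h i) x = 0)"
  by (rule kernel)

lemma free_coords_sub: "free_span R \<subseteq> carrier (free_module S)"
  by (rule N)

end

lemma free_set_add: "A <+>\<^bsub>free_module S\<^esub> B = {a + b | a b. a \<in> A \<and> b \<in> B}"
  by (auto simp: set_add_def set_mult_def free_module_def)

lemma free_coset: "K +>\<^bsub>free_module S\<^esub> x = (\<lambda>h. h + x) ` K"
  by (auto simp: a_r_coset_def r_coset_def free_module_def)

lemma free_map_in_carrier:
  assumes "x \<in> carrier (free_module S)" "\<And>s. s \<in> S \<Longrightarrow> f s \<in> T"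
  shows "free_map f x \<in> carrier (free_module T)"
  unfolding free_map_def
  by (rule free.subspace_sum[OF subspace_free_carrier])
     (use assms in \<open>auto intro!: gen_in_free_carrier simp: free_module_def\<close>)

lemma free_eval_map: "free_eval h (free_map f x) = free_eval (h \<circ> f) x"
  unfolding free_map_def free_eval_sum free_eval_single by (simp add: free_eval_def)

lemma free_map_add: "free_map f (x + y) = free_map f x + free_map f y"
proof -
  have "free_map f z = (\<Sum>s\<in>A. Poly_Mapping.single (f s) (Poly_Mapping.lookup z s))"
    if "finite A" "Poly_Mapping.keys z \<subseteq> A" for A z
    unfolding free_map_def by (rule sum.mono_neutral_left) (use that in \<open>auto simp: in_keys_iff\<close>)
  from this[of "Poly_Mapping.keys x \<union> Poly_Mapping.keys y"] show ?thesis
    using Poly_Mapping.keys_add[of x y] by (simp add: lookup_add single_add sum.distrib)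
qed

text \<open>
  A map of generators compatible with the coordinates maps relations to relations, because
  the relations are what the coordinates annihilate.
\<close>

lemma free_coord_quotient_map:
  assumes 1: "free_coords S R r h" and 2: "free_coords S' R' r h'"
    and f: "\<And>s. s \<in> S \<Longrightarrow> f s \<in> S'" "\<And>s i. s \<in> S \<Longrightarrow> h' i (f s) = h i s"
    and w: "w \<in> carrier (quotient_module (free_module S) (free_span R))"
  shows "quotient_map (free_map f) (free_module S') (free_span R') w
      \<in> carrier (quotient_module (free_module S') (free_span R'))" (is "?w \<in> _")
    and "free_coord h' (quotient_map (free_map f) (free_module S') (free_span R') w) = free_coord h w"
proof -
  obtain x where x: "x \<in> carrier (free_module S)" "w = free_span R +>\<^bsub>free_module S\<^esub> x"
    using w unfolding free_coords_carrier[OF 1] by blast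
  have fx: "free_map f y \<in> carrier (free_module S')" if "y \<in> carrier (free_module S)" for y
    using free_map_in_carrier that f(1) by blast
  have ev: "free_eval (h' i) (free_map f y) = free_eval (h i) y" if "y \<in> carrier (free_module S)" for y i
    unfolding free_eval_map unfolding free_eval_def
    by (rule sum.cong) (use that f in \<open>auto simp: free_module_def\<close>)
  have ker: "free_map f y \<in> free_span R'" if "y \<in> free_span R" for y
    using that free_coords_kernel[OF 1, of y] free_coords_kernel[OF 2, of "free_map f y"] free_coords_sub[OF 1] fx ev
    by (metis subsetD)
  have "?w = free_span R' +>\<^bsub>free_module S'\<^esub> free_map f x"
  proof (rule Set.set_eqI)
    fix z
    show "z \<in> ?w \<longleftrightarrow> z \<in> free_span R' +>\<^bsub>free_module S'\<^esub> free_map f x"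
      unfolding quotient_map_def free_set_add free_coset x
    proof safe
      fix a b assume "a \<in> free_span R" "b \<in> free_span R'"
      then show "free_map f (a + x) + b \<in> (\<lambda>h. h + free_map f x) ` free_span R'"
        using ker by (intro image_eqI[of _ _ "free_map f a + b"]) (auto simp: free_map_add free.span_add)
    next
      fix b assume "b \<in> free_span R'"
      then show "\<exists>c d. b + free_map f x = c + d \<and> c \<in> free_map f ` (\<lambda>h. h + x) ` free_span R \<and> d \<in> free_span R'"
        by (intro exI[of _ "free_map f x"] exI[of _ b]) (auto intro!: image_eqI[of _ _ "0"] simp: image_image free.span_zero)
    qed
  qed
  then show "?w \<in> carrier (quotient_module (free_module S') (free_span R'))" "free_coord h' ?w = free_coord h w"
    using fx[OF x(1)] free_coord_coset[OF 2] free_coord_coset[OF 1] x ev free_coords_carrier[OF 2] by auto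
qed

subsection \<open>Tensor powers and tensor products with a line\<close>

lemma free_span_diff_mem:
  assumes "a - x \<in> R" "R \<subseteq> Q" "free.subspace Q" "x \<in> Q"
  shows "a \<in> Q"
  using free.subspace_add[OF assms(3), of "a - x" x] assms by auto

lemma tuples_update: "xs \<in> tuples M n \<Longrightarrow> u \<in> carrier M \<Longrightarrow> xs[i := u] \<in> tuples M n"
  unfolding tuples_def using set_update_subset_insert by fastforce

text \<open>
  Modulo the multilinear relations the entries of a tuple can be expanded, one after the other, in
  terms of the spanning vectors \<open>B\<close>. Two of them suffice below, so combinations of two terms are used.
\<close>

lemma multilinear_span:
  assumes closed: "\<And>x y. x \<in> carrier M \<Longrightarrow> y \<in> carrier M \<Longrightarrow> x \<oplus>\<^bsub>M\<^esub> y \<in> carrier M"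
      "\<And>c x. x \<in> carrier M \<Longrightarrow> c \<odot>\<^bsub>M\<^esub> x \<in> carrier M"
    and B: "B \<subseteq> carrier M"
      "\<And>x. x \<in> carrier M \<Longrightarrow> \<exists>v\<in>B. \<exists>u\<in>B. \<exists>\<alpha> \<beta>. x = \<alpha> \<odot>\<^bsub>M\<^esub> v \<oplus>\<^bsub>M\<^esub> \<beta> \<odot>\<^bsub>M\<^esub> u"
    and Q: "free.subspace Q" "multilinear_relations M n \<subseteq> Q"
      "\<And>xs. xs \<in> tuples M n \<Longrightarrow> set xs \<subseteq> B \<Longrightarrow> free_gen xs \<in> Q"
    and xs: "xs \<in> tuples M n"
  shows "free_gen xs \<in> Q"
proof -
  have "free_gen xs \<in> Q" if "m \<le> n" "xs \<in> tuples M n" "\<And>i. m \<le> i \<Longrightarrow> i < n \<Longrightarrow> xs ! i \<in> B" for m xs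
    using that
  proof (induction m arbitrary: xs)
    case 0
    then have "set xs \<subseteq> B" by (auto simp: set_conv_nth tuples_def)
    with 0 Q(3) show ?case by blast
  next
    case (Suc m)
    have m: "m < n" "m < length xs" using Suc.prems by (auto simp: tuples_def)
    have "xs ! m \<in> carrier M" using Suc.prems m by (auto simp: tuples_def)
    then obtain v u \<alpha> \<beta> where vu: "v \<in> B" "u \<in> B" "xs ! m = \<alpha> \<odot>\<^bsub>M\<^esub> v \<oplus>\<^bsub>M\<^esub> \<beta> \<odot>\<^bsub>M\<^esub> u"
      using B(2) by blast
    have scaled: "free_gen (xs[m := \<gamma> \<odot>\<^bsub>M\<^esub> b]) \<in> Q" if b: "b \<in> B" for b \<gamma>
    proof (rule free_span_diff_mem[OF _ Q(2,1)])
      have "free_gen (xs[m := b]) \<in> Q"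
      proof (rule Suc.IH)
        show "xs[m := b] \<in> tuples M n" using Suc.prems b B(1) by (auto intro!: tuples_update)
        show "xs[m := b] ! i \<in> B" if "m \<le> i" "i < n" for i
          using that b m Suc.prems(3)[of i] by (cases "i = m") auto
      qed (use m in auto)
      then show "free_scale \<gamma> (free_gen (xs[m := b])) \<in> Q" by (rule free.subspace_scale[OF Q(1)])
      show "free_gen (xs[m := \<gamma> \<odot>\<^bsub>M\<^esub> b]) - free_scale \<gamma> (free_gen (xs[m := b])) \<in> multilinear_relations M n"
        using Suc.prems m b B(1) unfolding multilinear_relations_def by blast
    qed
    have "free_gen (xs[m := \<alpha> \<odot>\<^bsub>M\<^esub> v \<oplus>\<^bsub>M\<^esub> \<beta> \<odot>\<^bsub>M\<^esub> u]) \<in> Q"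
    proof (rule free_span_diff_mem[OF _ Q(2,1) free.subspace_add[OF Q(1) scaled[OF vu(1)] scaled[OF vu(2)]]])
      show "free_gen (xs[m := \<alpha> \<odot>\<^bsub>M\<^esub> v \<oplus>\<^bsub>M\<^esub> \<beta> \<odot>\<^bsub>M\<^esub> u])
          - (free_gen (xs[m := \<alpha> \<odot>\<^bsub>M\<^esub> v]) + free_gen (xs[m := \<beta> \<odot>\<^bsub>M\<^esub> u])) \<in> multilinear_relations M n"
        using Suc.prems m vu B(1) closed unfolding multilinear_relations_def by blast
    qed
    then show ?case unfolding vu(3)[symmetric] by simp
  qed
  from this[OF order_refl xs] show ?thesis by simp
qed

lemma multilinear_relations_sub:
  assumes "\<And>x y. x \<in> carrier M \<Longrightarrow> y \<in> carrier M \<Longrightarrow> x \<oplus>\<^bsub>M\<^esub> y \<in> carrier M"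
      "\<And>c x. x \<in> carrier M \<Longrightarrow> c \<odot>\<^bsub>M\<^esub> x \<in> carrier M"
  shows "multilinear_relations M n \<subseteq> carrier (free_module (tuples M n))"
  unfolding multilinear_relations_def
  by (auto intro!: free.subspace_diff[OF subspace_free_carrier] free.subspace_add[OF subspace_free_carrier]
      free.subspace_scale[OF subspace_free_carrier] gen_in_free_carrier tuples_update assms)

lemma multilinear_relations_eval:
  assumes add: "\<And>xs i u v. xs \<in> tuples M n \<Longrightarrow> i < n \<Longrightarrow> u \<in> carrier M \<Longrightarrow> v \<in> carrier M \<Longrightarrow>
      h (xs[i := u \<oplus>\<^bsub>M\<^esub> v]) = h (xs[i := u]) + h (xs[i := v])"
    and scale: "\<And>xs i u c. xs \<in> tuples M n \<Longrightarrow> i < n \<Longrightarrow> u \<in> carrier M \<Longrightarrow>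
      h (xs[i := c \<odot>\<^bsub>M\<^esub> u]) = c * h (xs[i := u])"
    and x: "x \<in> multilinear_relations M n"
  shows "free_eval h x = 0"
  using x unfolding multilinear_relations_def
  by (auto simp: free_eval_diff free_eval_add free_eval_scale free_eval_single add scale)

lemma prod_list_update:
  fixes f :: "'a \<Rightarrow> 'b::comm_monoid_mult"
  assumes "i < length xs"
  shows "prod_list (map f (xs[i := y])) = prod_list (map f (take i xs)) * prod_list (map f (drop (Suc i) xs)) * f y"
  using assms by (simp add: upd_conv_take_nth_drop mult_ac)

definition tensor_power_coord :: "('a \<Rightarrow> nat \<Rightarrow> complex) \<Rightarrow> ('a list \<Rightarrow>\<^sub>0 complex) set \<Rightarrow> nat \<Rightarrow> complex" where
  "tensor_power_coord C = free_coord (\<lambda>i xs. scalar_seq (\<Prod>x\<leftarrow>xs. C x 0) i)"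

text \<open>
  A tensor power of a line is a line, with the product of the coordinates as coordinate; the dual
  basis is the power of the basis vector.
\<close>

lemma tensor_power_free_coords:
  assumes C: "coords M 1 C"
  shows "free_coords (tuples M n) (multilinear_relations M n) 1 (\<lambda>i xs. scalar_seq (\<Prod>x\<leftarrow>xs. C x 0) i)"
proof (rule free_coordsI[where b = "\<lambda>j. free_gen (replicate n (from_coords M C (unit_seq 0)))"])
  let ?e = "from_coords M C (unit_seq 0)"
  have e: "?e \<in> carrier M" "C ?e 0 = 1"
    using from_coords[OF C unit_seq_in_seqs[of 0]] by (auto simp: unit_seq_def)
  have rep: "replicate n ?e \<in> tuples M n" using e by (auto simp: tuples_def)
  show "multilinear_relations M n \<subseteq> carrier (free_module (tuples M n))"
    by (rule multilinear_relations_sub) (auto simp: coords_add[OF C] coords_smult[OF C])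
  show "free_eval (\<lambda>xs. scalar_seq (\<Prod>x\<leftarrow>xs. C x 0) i) x = 0" if "x \<in> multilinear_relations M n" for x i
    by (rule multilinear_relations_eval[OF _ _ that])
       (auto simp: tuples_def scalar_seq_def prod_list_update coords_add[OF C] coords_smult[OF C] algebra_simps)
  show "free_gen (replicate n ?e) \<in> carrier (free_module (tuples M n))"
    by (rule gen_in_free_carrier[OF rep])
  show "free_eval (\<lambda>xs. scalar_seq (\<Prod>x\<leftarrow>xs. C x 0) i) (free_gen (replicate n ?e)) = unit_seq j i"
    if "j < 1" for i j using that e by (simp add: free_eval_single scalar_seq_def unit_seq_def)
  show "free_gen xs \<in> free_span (multilinear_relations M n \<union> (\<lambda>j. free_gen (replicate n ?e)) ` {..<1::nat})"
    (is "_ \<in> ?Q") if "xs \<in> tuples M n" for xs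
  proof (rule multilinear_span[OF _ _ _ _ _ _ _ that, where B = "{?e}"])
    fix x assume x: "x \<in> carrier M"
    have "x = C x 0 \<odot>\<^bsub>M\<^esub> ?e \<oplus>\<^bsub>M\<^esub> 0 \<odot>\<^bsub>M\<^esub> ?e"
      by (rule coords_eqI[OF C]) (use x e in \<open>auto simp: coords_add[OF C] coords_smult[OF C]\<close>)
    then show "\<exists>v\<in>{?e}. \<exists>u\<in>{?e}. \<exists>\<alpha> \<beta>. x = \<alpha> \<odot>\<^bsub>M\<^esub> v \<oplus>\<^bsub>M\<^esub> \<beta> \<odot>\<^bsub>M\<^esub> u" by blast
  next
    fix ys assume "ys \<in> tuples M n" "set ys \<subseteq> {?e}"
    then have "ys = replicate n ?e" by (auto simp: tuples_def intro!: replicate_eqI)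
    then show "free_gen ys \<in> ?Q" by (intro free.span_base UnI2 image_eqI[of _ _ "0::nat"]) auto
  next
    show "multilinear_relations M n \<subseteq> ?Q" using free.span_superset by blast
  qed (auto simp: e coords_add[OF C] coords_smult[OF C])
qed (auto simp: scalar_seq_def)

lemma tensor_power_coords:
  assumes C: "coords M 1 C"
  shows "coords (tensor_power M n) 1 (tensor_power_coord C)"
  using free_coords_coords[OF tensor_power_free_coords[OF C]]
  by (simp add: tensor_power_def tensor_power_kernel_def tensor_power_coord_def)

lemma tensor_of_list_coord:
  assumes C: "coords M 1 C" and xs: "set xs \<subseteq> carrier M" "length xs = n"
  shows "tensor_of_list M n xs \<in> carrier (tensor_power M n)"
    "tensor_power_coord C (tensor_of_list M n xs) = scalar_seq (\<Prod>x\<leftarrow>xs. C x 0)"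
proof -
  have "free_gen xs \<in> carrier (free_module (tuples M n))"
    using xs by (intro gen_in_free_carrier) (auto simp: tuples_def)
  from free_coords_carrier[OF tensor_power_free_coords[OF C], of n]
    free_coord_coset[OF tensor_power_free_coords[OF C] this] this
  show "tensor_of_list M n xs \<in> carrier (tensor_power M n)"
    "tensor_power_coord C (tensor_of_list M n xs) = scalar_seq (\<Prod>x\<leftarrow>xs. C x 0)"
    by (auto simp: tensor_of_list_def tensor_power_coord_def tensor_power_kernel_def tensor_power_def
        free_eval_single)
qed

lemma tensor_power_map_coord:
  assumes C: "coords M 1 C" and C': "coords M' 1 C'"
    and f: "\<And>x. x \<in> carrier M \<Longrightarrow> f x \<in> carrier M'" "\<And>x. x \<in> carrier M \<Longrightarrow> C' (f x) = C x"
    and w: "w \<in> carrier (tensor_power M n)"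
  shows "tensor_power_map f M' n w \<in> carrier (tensor_power M' n)"
    "tensor_power_coord C' (tensor_power_map f M' n w) = tensor_power_coord C w"
proof -
  have 1: "map f xs \<in> tuples M' n" if "xs \<in> tuples M n" for xs using that f by (auto simp: tuples_def)
  have 2: "scalar_seq (\<Prod>x\<leftarrow>map f xs. C' x 0) i = scalar_seq (\<Prod>x\<leftarrow>xs. C x 0) i" if "xs \<in> tuples M n" for xs i
  proof -
    have "map (\<lambda>x. C' x 0) (map f xs) = map (\<lambda>x. C x 0) xs" using that f by (auto simp: tuples_def subset_iff)
    then show ?thesis by metis
  qed
  note fc = free_coord_quotient_map[OF tensor_power_free_coords[OF C] tensor_power_free_coords[OF C'],
      of n "map f" n, OF 1 2]
  from w fc[of w] show "tensor_power_map f M' n w \<in> carrier (tensor_power M' n)"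
    "tensor_power_coord C' (tensor_power_map f M' n w) = tensor_power_coord C w"
    by (simp_all add: tensor_power_map_def tensor_power_coord_def tensor_power_kernel_def tensor_power_def)
qed

definition tensor_coord ::
  "('a \<Rightarrow> nat \<Rightarrow> complex) \<Rightarrow> ('b \<Rightarrow> nat \<Rightarrow> complex) \<Rightarrow> ('a \<times> 'b \<Rightarrow>\<^sub>0 complex) set \<Rightarrow> nat \<Rightarrow> complex" where
  "tensor_coord A C = free_coord (\<lambda>i (x, y). A x 0 * C y i)"

text \<open>
  The basis dual to the products of the coordinates consists of the tensors of basis vectors; a
  pure tensor is reduced to them by removing the coordinates of its second factor from the top.
\<close>

lemma tensor_free_coords:
  assumes A: "coords M 1 A" and C: "coords N r C"
  shows "free_coords (carrier M \<times> carrier N) (bilinear_relations M N) r (\<lambda>i (x, y). A x 0 * C y i)"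
proof (rule free_coordsI[where b = "\<lambda>j. free_gen (from_coords M A (unit_seq 0), from_coords N C (unit_seq j))"])
  let ?e = "from_coords M A (unit_seq 0)" and ?w = "\<lambda>j. from_coords N C (unit_seq j)"
  let ?R = "bilinear_relations M N"
  have e: "?e \<in> carrier M" "A ?e 0 = 1"
    using from_coords[OF A unit_seq_in_seqs[of 0]] by (auto simp: unit_seq_def)
  have w: "?w j \<in> carrier N" "C (?w j) = unit_seq j" if "j < r" for j
    using from_coords[OF C unit_seq_in_seqs[OF that]] by auto
  show "?R \<subseteq> carrier (free_module (carrier M \<times> carrier N))"
    unfolding bilinear_relations_def
    by (auto intro!: free.subspace_diff[OF subspace_free_carrier] free.subspace_add[OF subspace_free_carrier]
      free.subspace_scale[OF subspace_free_carrier] gen_in_free_carrier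
      simp: coords_add[OF A] coords_smult[OF A] coords_add[OF C] coords_smult[OF C])
  show "free_eval (case_prod (\<lambda>x y. A x 0 * C y i)) z = 0" if "z \<in> ?R" for z i
    using that unfolding bilinear_relations_def
    by (auto simp: free_eval_diff free_eval_add free_eval_scale free_eval_single distrib_left distrib_right mult_ac
        coords_add[OF A] coords_smult[OF A] coords_add[OF C] coords_smult[OF C])
  show "free_gen (?e, ?w j) \<in> carrier (free_module (carrier M \<times> carrier N))" if "j < r" for j
    using e w[OF that] by (intro gen_in_free_carrier) auto
  show "free_eval (case_prod (\<lambda>x y. A x 0 * C y i)) (free_gen (?e, ?w j)) = unit_seq j i" if "j < r" for i j
    using e w[OF that] by (simp add: free_eval_single)
  show "free_gen s \<in> free_span (?R \<union> (\<lambda>j. free_gen (?e, ?w j)) ` {..<r})" (is "_ \<in> ?Q")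
    if s0: "s \<in> carrier M \<times> carrier N" for s
  proof -
    have Q: "free.subspace ?Q" "?R \<subseteq> ?Q" by (auto intro: free.span_base)
    have *: "free_gen (?e, y) \<in> ?Q" if "m \<le> r" "y \<in> carrier N" "\<And>i. i \<ge> m \<Longrightarrow> C y i = 0" for m y
      using that
    proof (induction m arbitrary: y)
      case 0
      have "y = 0 \<odot>\<^bsub>N\<^esub> y"
        by (rule coords_eqI[OF C]) (use 0 in \<open>auto simp: coords_smult[OF C]\<close>)
      moreover have "free_gen (?e, 0 \<odot>\<^bsub>N\<^esub> y) - free_scale 0 (free_gen (?e, y)) \<in> ?R"
        unfolding bilinear_relations_def using e 0 by blast
      ultimately show ?case using Q(2) by auto
    next
      case (Suc m)
      define y' where "y' = from_coords N C ((C y)(m := 0))"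
      have "(C y)(m := 0) \<in> seqs r" using coords_ge[OF C Suc.prems(2)] by (auto simp: seqs_def)
      then have y': "y' \<in> carrier N" "C y' = (C y)(m := 0)" unfolding y'_def by (rule from_coords[OF C])+
      have m: "m < r" using Suc.prems by simp
      let ?c = "C y m"
      have y: "y = y' \<oplus>\<^bsub>N\<^esub> ?c \<odot>\<^bsub>N\<^esub> ?w m"
        by (rule coords_eqI[OF C])
           (use Suc.prems y' w[OF m] in \<open>auto simp: coords_add[OF C] coords_smult[OF C] unit_seq_def\<close>)
      have 0: "free_gen (?e, ?w m) \<in> ?Q" using m by (auto intro: free.span_base)
      have 1: "free_gen (?e, ?c \<odot>\<^bsub>N\<^esub> ?w m) \<in> ?Q"
        by (rule free_span_diff_mem[OF _ Q(2,1) free.subspace_scale[OF Q(1) 0]])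
           (use e w[OF m] in \<open>unfold bilinear_relations_def, blast\<close>)
      have 2: "free_gen (?e, y') \<in> ?Q"
      proof (rule Suc.IH)
        show "C y' i = 0" if "m \<le> i" for i
          using that y' Suc.prems(3)[of i] by (cases "i = m") auto
      qed (use y' m in auto)
      have "free_gen (?e, y' \<oplus>\<^bsub>N\<^esub> ?c \<odot>\<^bsub>N\<^esub> ?w m) \<in> ?Q"
        by (rule free_span_diff_mem[OF _ Q(2,1) free.subspace_add[OF Q(1) 2 1]])
           (use e w[OF m] y' coords_smult[OF C] in \<open>unfold bilinear_relations_def, blast\<close>)
      then show ?case using y by simp
    qed
    obtain x y where s: "s = (x, y)" "x \<in> carrier M" "y \<in> carrier N" using s0 by blast
    have x: "x = A x 0 \<odot>\<^bsub>M\<^esub> ?e"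
      by (rule coords_eqI[OF A]) (use s e in \<open>auto simp: coords_smult[OF A]\<close>)
    have 0: "free_gen (?e, y) \<in> ?Q" by (rule *[OF order_refl s(3)]) (use coords_ge[OF C s(3)] in auto)
    have "free_gen (A x 0 \<odot>\<^bsub>M\<^esub> ?e, y) \<in> ?Q"
      by (rule free_span_diff_mem[OF _ Q(2,1) free.subspace_scale[OF Q(1) 0]])
         (use e s in \<open>unfold bilinear_relations_def, blast\<close>)
    then show ?thesis using x s by simp
  qed
qed (auto simp: coords_ge[OF C])

lemma tensor_coords:
  assumes A: "coords M 1 A" and C: "coords N r C"
  shows "coords (tensor_module M N) r (tensor_coord A C)"
  using free_coords_coords[OF tensor_free_coords[OF A C]]
  by (simp add: tensor_module_def tensor_kernel_def tensor_coord_def)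

lemma pure_tensor_coord:
  assumes A: "coords M 1 A" and C: "coords N r C" and xy: "x \<in> carrier M" "y \<in> carrier N"
  shows "pure_tensor M N x y \<in> carrier (tensor_module M N)"
    "tensor_coord A C (pure_tensor M N x y) = (\<lambda>i. A x 0 * C y i)"
proof -
  have "free_gen (x, y) \<in> carrier (free_module (carrier M \<times> carrier N))"
    using xy by (intro gen_in_free_carrier) auto
  from free_coords_carrier[OF tensor_free_coords[OF A C]]
    free_coord_coset[OF tensor_free_coords[OF A C] this] this
  show "pure_tensor M N x y \<in> carrier (tensor_module M N)"
    "tensor_coord A C (pure_tensor M N x y) = (\<lambda>i. A x 0 * C y i)"
    by (auto simp: pure_tensor_def tensor_coord_def tensor_kernel_def tensor_module_def free_eval_single)
qed

lemma tensor_map_coord: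
  assumes A: "coords M 1 A" "coords M' 1 A'" and C: "coords N r C" "coords N' r C'"
    and f: "\<And>x. x \<in> carrier M \<Longrightarrow> f x \<in> carrier M'" "\<And>x. x \<in> carrier M \<Longrightarrow> A' (f x) = A x"
    and g: "\<And>y. y \<in> carrier N \<Longrightarrow> g y \<in> carrier N'" "\<And>y. y \<in> carrier N \<Longrightarrow> C' (g y) = C y"
    and w: "w \<in> carrier (tensor_module M N)"
  shows "tensor_map f g M' N' w \<in> carrier (tensor_module M' N')"
    "tensor_coord A' C' (tensor_map f g M' N' w) = tensor_coord A C w"
proof -
  note fc = free_coord_quotient_map[OF tensor_free_coords[OF A(1) C(1)] tensor_free_coords[OF A(2) C(2)],
      of "map_prod f g" w]
  have 1: "map_prod f g s \<in> carrier M' \<times> carrier N'" if "s \<in> carrier M \<times> carrier N" for s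
    using that f g by auto
  have 2: "(case map_prod f g s of (x, y) \<Rightarrow> A' x 0 * C' y i) = (case s of (x, y) \<Rightarrow> A x 0 * C y i)"
    if "s \<in> carrier M \<times> carrier N" for s i
    using that f g by auto
  from fc[OF 1 2] w show "tensor_map f g M' N' w \<in> carrier (tensor_module M' N')"
    "tensor_coord A' C' (tensor_map f g M' N' w) = tensor_coord A C w"
    by (simp_all add: tensor_map_def tensor_coord_def tensor_kernel_def tensor_module_def)
qed

subsection \<open>Scalars, duals, sums and relabelled spaces\<close>

lemma scalar_module_coords: "coords scalar_module 1 scalar_seq"
proof (rule coordsI)
  show "\<exists>x\<in>carrier scalar_module. scalar_seq x = f" if "f \<in> seqs 1" for f
    using that unfolding seqs_1_eq by (auto simp: scalar_module_def vector_module_def)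
qed (auto simp: scalar_module_def vector_module_def scalar_seq_eq_iff, auto simp: scalar_seq_def)

definition dual_coord :: "(complex, 'a) module \<Rightarrow> ('a \<Rightarrow> nat \<Rightarrow> complex) \<Rightarrow> ('a \<Rightarrow> complex) \<Rightarrow> nat \<Rightarrow> complex" where
  "dual_coord M C \<phi> = scalar_seq (\<phi> (from_coords M C (unit_seq 0)))"

lemma dual_pairing:
  assumes C: "coords M 1 C" and "\<phi> \<in> carrier (dual_module M)" "x \<in> carrier M"
  shows "\<phi> x = C x 0 * dual_coord M C \<phi> 0"
proof -
  let ?e = "from_coords M C (unit_seq 0)"
  have e: "?e \<in> carrier M" "C ?e 0 = 1"
    using from_coords[OF C unit_seq_in_seqs[of 0]] by (auto simp: unit_seq_def)
  have "x = C x 0 \<odot>\<^bsub>M\<^esub> ?e" by (rule coords_eqI[OF C]) (use assms e in \<open>auto simp: coords_smult[OF C]\<close>)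
  then have "\<phi> x = \<phi> (C x 0 \<odot>\<^bsub>M\<^esub> ?e)" by simp
  also have "\<dots> = C x 0 * \<phi> ?e" using assms(2) e(1) by (simp add: dual_module_def)
  finally show ?thesis by (simp add: dual_coord_def scalar_seq_def)
qed

lemma dual_coords:
  assumes C: "coords M 1 C"
  shows "coords (dual_module M) 1 (dual_coord M C)"
proof (rule coordsI)
  let ?e = "from_coords M C (unit_seq 0)"
  have e: "?e \<in> carrier M" "C ?e 0 = 1"
    using from_coords[OF C unit_seq_in_seqs[of 0]] by (auto simp: unit_seq_def)
  show "\<zero>\<^bsub>dual_module M\<^esub> \<in> carrier (dual_module M)" "dual_coord M C \<zero>\<^bsub>dual_module M\<^esub> = (\<lambda>i. 0)"
    using e by (auto simp: dual_module_def dual_coord_def scalar_seq_def coords_add[OF C] coords_smult[OF C])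
  fix \<phi> \<psi> assume \<phi>: "\<phi> \<in> carrier (dual_module M)" and \<psi>: "\<psi> \<in> carrier (dual_module M)"
  show "\<phi> \<oplus>\<^bsub>dual_module M\<^esub> \<psi> \<in> carrier (dual_module M)"
    using \<phi> \<psi> by (auto simp: dual_module_def coords_add[OF C] coords_smult[OF C] algebra_simps)
  show "dual_coord M C (\<phi> \<oplus>\<^bsub>dual_module M\<^esub> \<psi>) i = dual_coord M C \<phi> i + dual_coord M C \<psi> i" for i
    using e by (auto simp: dual_module_def dual_coord_def scalar_seq_def)
  show "\<phi> = \<psi>" if eq: "dual_coord M C \<phi> = dual_coord M C \<psi>"
  proof (rule extensionalityI[of _ "carrier M"])
    show "\<phi> x = \<psi> x" if "x \<in> carrier M" for x
      using dual_pairing[OF C \<phi> that] dual_pairing[OF C \<psi> that] eq by simp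
  qed (use \<phi> \<psi> in \<open>auto simp: dual_module_def\<close>)
  fix c
  show "c \<odot>\<^bsub>dual_module M\<^esub> \<phi> \<in> carrier (dual_module M)"
    using \<phi> by (auto simp: dual_module_def coords_add[OF C] coords_smult[OF C] algebra_simps)
  show "dual_coord M C (c \<odot>\<^bsub>dual_module M\<^esub> \<phi>) i = c * dual_coord M C \<phi> i" for i
    using e by (auto simp: dual_module_def dual_coord_def scalar_seq_def)
next
  fix f assume "f \<in> seqs 1"
  then obtain z where z: "f = scalar_seq z" unfolding seqs_1_eq by blast
  let ?e = "from_coords M C (unit_seq 0)"
  have e: "?e \<in> carrier M" "C ?e 0 = 1"
    using from_coords[OF C unit_seq_in_seqs[of 0]] by (auto simp: unit_seq_def)
  have "(\<lambda>x\<in>carrier M. z * C x 0) \<in> carrier (dual_module M)"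
    by (auto simp: dual_module_def coords_add[OF C] coords_smult[OF C] algebra_simps)
  moreover have "dual_coord M C (\<lambda>x\<in>carrier M. z * C x 0) = f"
    using e by (simp add: dual_coord_def z)
  ultimately show "\<exists>x\<in>carrier (dual_module M). dual_coord M C x = f" by blast
qed (auto simp: dual_coord_def scalar_seq_def)

lemma relabel_coords:
  assumes "inj \<iota>" and C: "coords M r C"
  shows "coords (relabel_module \<iota> M) r (\<lambda>x. C (inv_into UNIV \<iota> x))"
proof (rule coordsI)
  show "\<exists>x\<in>carrier (relabel_module \<iota> M). C (inv_into UNIV \<iota> x) = f" if "f \<in> seqs r" for f
    using from_coords[OF C that] assms(1) by (auto simp: relabel_module_def)
  show "x = y" if "x \<in> carrier (relabel_module \<iota> M)" "y \<in> carrier (relabel_module \<iota> M)" "C (inv_into UNIV \<iota> x) = C (inv_into UNIV \<iota> y)" for x y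
    using that assms(1) by (auto simp: relabel_module_def intro: arg_cong[OF coords_eqI[OF C]])
qed (use assms(1) in \<open>auto simp: relabel_module_def coords_add[OF C] coords_smult[OF C] coords_zero[OF C] coords_ge[OF C]\<close>)

text \<open>
  The factor \<open>w\<close> will be a power of the form, inserted in order to match transformation laws.
\<close>

lemma sum_coords:
  assumes A: "coords M r A" and C: "coords N s C" and w: "w \<noteq> 0"
  shows "coords (sum_module M N) (r + s) (\<lambda>(x, y) i. if i < r then A x i else w * C y (i - r))"
    (is "coords _ _ ?B")
proof (rule coordsI)
  show "\<exists>p\<in>carrier (sum_module M N). ?B p = f" if f: "f \<in> seqs (r + s)" for f
  proof -
    have 1: "(\<lambda>i. if i < r then f i else 0) \<in> seqs r" by (auto simp: seqs_def)
    have 2: "(\<lambda>i. f (i + r) / w) \<in> seqs s" using f by (auto simp: seqs_def)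
    show ?thesis
      by (intro bexI[of _ "(from_coords M A (\<lambda>i. if i < r then f i else 0), from_coords N C (\<lambda>i. f (i + r) / w))"])
         (use from_coords[OF A 1] from_coords[OF C 2] w in \<open>auto simp: sum_module_def\<close>)
  qed
  show "p = q" if pq: "p \<in> carrier (sum_module M N)" "q \<in> carrier (sum_module M N)" "?B p = ?B q" for p q
  proof -
    obtain x y x' y' where e: "p = (x, y)" "q = (x', y')" by (cases p, cases q)
    have "x = x'"
    proof (rule coords_eqI[OF A])
      show "A x i = A x' i" if "i < r" for i using fun_cong[OF pq(3), of i] that e by simp
    qed (use pq e in \<open>auto simp: sum_module_def\<close>)
    moreover have "C y i = C y' i" for i
      using fun_cong[OF pq(3), of "i + r"] w e by simp
    then have "y = y'"
      by (intro coords_eqI[OF C]) (use pq e in \<open>auto simp: sum_module_def\<close>)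
    ultimately show ?thesis using e by simp
  qed
qed (auto simp: sum_module_def coords_add[OF A] coords_smult[OF A] coords_zero[OF A] coords_ge[OF A]
      coords_add[OF C] coords_smult[OF C] coords_zero[OF C] coords_ge[OF C] algebra_simps)

lemma rescale_coords:
  assumes C: "coords M r C" and q: "\<And>i. i < r \<Longrightarrow> q i \<noteq> 0"
  shows "coords M r (\<lambda>x i. C x i / q i)"
proof (rule coordsI)
  show "\<exists>x\<in>carrier M. (\<lambda>i. C x i / q i) = f" if f: "f \<in> seqs r" for f
  proof -
    have 1: "(\<lambda>i. q i * f i) \<in> seqs r" using f by (auto simp: seqs_def)
    have "q i * f i / q i = f i" for i using q[of i] f by (cases "i < r") (auto simp: seqs_def)
    then show ?thesis using from_coords[OF C 1] by (intro bexI[of _ "from_coords M C (\<lambda>i. q i * f i)"]) auto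
  qed
  show "x = y" if "x \<in> carrier M" "y \<in> carrier M" "(\<lambda>i. C x i / q i) = (\<lambda>i. C y i / q i)" for x y
    by (rule coords_eqI[OF C that(1,2)]) (use q fun_cong[OF that(3)] in fastforce)
qed (auto simp: coords_add[OF C] coords_smult[OF C] coords_zero[OF C] coords_ge[OF C] add_divide_distrib)

section \<open>The projective line in coordinates\<close>

text \<open>
  A plane with a nonzero alternating form, which is unique up to a factor. Cramer's rule expresses,
  without a choice of basis, that the dimension is at most two.
\<close>

locale plane = vector_space cscale
  for cscale :: "complex \<Rightarrow> 'v \<Rightarrow> 'v::ab_group_add" +
  fixes \<omega> :: "'v \<Rightarrow> 'v \<Rightarrow> complex"
  assumes \<omega>_add: "\<omega> v (x + y) = \<omega> v x + \<omega> v y"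
    and \<omega>_scale: "\<omega> v (cscale c x) = c * \<omega> v x"
    and \<omega>_swap: "\<omega> v u = - \<omega> u v"
    and cramer: "cscale (\<omega> v u) x = cscale (\<omega> x u) v + cscale (\<omega> v x) u"
    and \<omega>_nontrivial: "\<exists>v u. \<omega> v u \<noteq> 0"
begin

lemma \<omega>_add_left: "\<omega> (x + y) v = \<omega> x v + \<omega> y v"
  using \<omega>_swap[of "x + y" v] \<omega>_swap[of x v] \<omega>_swap[of y v] \<omega>_add[of v x y] by simp

lemma \<omega>_scale_left: "\<omega> (cscale c x) v = c * \<omega> x v"
  using \<omega>_swap[of "cscale c x" v] \<omega>_swap[of x v] \<omega>_scale[of v c x] by simp

lemma \<omega>_self: "\<omega> v v = 0"
  using \<omega>_swap[of v v] by simp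

lemma \<omega>_zero: "\<omega> v 0 = 0" "\<omega> 0 v = 0"
  using \<omega>_scale[of v 0 0] \<omega>_scale_left[of 0 0 v] by auto

lemmas \<omega>_simps = \<omega>_add \<omega>_scale \<omega>_add_left \<omega>_scale_left \<omega>_self \<omega>_zero

lemma frame_nz: "\<omega> v u \<noteq> 0 \<Longrightarrow> v \<noteq> 0" "\<omega> v u \<noteq> 0 \<Longrightarrow> u \<noteq> 0"
  using \<omega>_zero by auto

lemma ex_frame:
  assumes "v \<noteq> 0"
  shows "\<exists>u. \<omega> v u \<noteq> 0"
proof (rule ccontr)
  assume "\<not> ?thesis"
  then have 0: "\<omega> v u = 0" for u by blast
  obtain a b where ab: "\<omega> a b \<noteq> 0" using \<omega>_nontrivial by blast
  have "cscale (\<omega> a b) v = 0" using cramer[of a b v] 0 \<omega>_swap[of a v] by simp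
  then show False using ab assms by simp
qed

lemma frame_expansion:
  assumes "\<omega> v u \<noteq> 0"
  shows "x = cscale (\<omega> x u / \<omega> v u) v + cscale (\<omega> v x / \<omega> v u) u"
proof -
  have "cscale (inverse (\<omega> v u)) (cscale (\<omega> v u) x) =
      cscale (inverse (\<omega> v u)) (cscale (\<omega> x u) v + cscale (\<omega> v x) u)"
    by (simp only: cramer[of v u x])
  then show ?thesis using assms by (simp add: scale_right_distrib divide_inverse mult.commute)
qed

definition ln :: "'v \<Rightarrow> 'v set" where
  "ln v = range (\<lambda>c. cscale c v)"

lemma ln_span: "ln v = span {v}"
  by (simp add: ln_def span_singleton)

lemma in_ln_iff:
  assumes "v \<noteq> 0"
  shows "x \<in> ln v \<longleftrightarrow> \<omega> v x = 0"
proof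
  assume "\<omega> v x = 0"
  moreover obtain u where u: "\<omega> v u \<noteq> 0" using ex_frame[OF assms] by blast
  ultimately have "cscale (inverse (\<omega> v u)) (cscale (\<omega> v u) x) = cscale (inverse (\<omega> v u)) (cscale (\<omega> x u) v)"
    using cramer[of v u x] by simp
  then have "x = cscale (inverse (\<omega> v u) * \<omega> x u) v" using u by simp
  then show "x \<in> ln v" unfolding ln_def by blast
qed (auto simp: ln_def \<omega>_simps)

lemma ln_self: "v \<in> ln v"
  unfolding ln_span by (simp add: span_base)

lemma ln_scale: "c \<noteq> 0 \<Longrightarrow> ln (cscale c v) = ln v"
  unfolding ln_def by (auto simp: image_iff) (metis nonzero_eq_divide_eq scale_scale)

lemma ln_eq_iff:
  assumes "v \<noteq> 0" "w \<noteq> 0"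
  shows "ln v = ln w \<longleftrightarrow> \<omega> v w = 0"
proof
  assume "\<omega> v w = 0"
  then obtain c where "w = cscale c v" using in_ln_iff[OF assms(1)] unfolding ln_def by blast
  then show "ln v = ln w" using assms by (metis ln_scale scale_zero_left)
qed (use in_ln_iff[OF assms(1)] ln_self in metis)

lemma lines_eq: "lines cscale = ln ` {v. v \<noteq> 0}"
proof (intro equalityI subsetI)
  fix \<xi> assume "\<xi> \<in> lines cscale"
  then have \<xi>: "subspace \<xi>" "dim \<xi> = 1" by (auto simp: lines_def)
  obtain B where B: "B \<subseteq> \<xi>" "independent B" "\<xi> \<subseteq> span B" "card B = dim \<xi>"
    using basis_exists by blast
  then obtain v where v: "B = {v}" using \<xi> card_1_singletonE by metis
  then have "\<xi> = ln v" using B \<xi> by (simp add: ln_span span_minimal subset_antisym)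
  then show "\<xi> \<in> ln ` {v. v \<noteq> 0}" using B v dependent_single by auto
next
  fix \<xi> assume "\<xi> \<in> ln ` {v. v \<noteq> 0}"
  then obtain v where v: "v \<noteq> 0" "\<xi> = ln v" by blast
  have "dim (span {v}) = 1"
    using dim_span_eq_card_independent[of "{v}"] v dependent_single by simp
  then show "\<xi> \<in> lines cscale" using v by (simp add: lines_def ln_span subspace_span)
qed

lemma ln_in_lines: "v \<noteq> 0 \<Longrightarrow> ln v \<in> lines cscale"
  by (auto simp: lines_eq)

subsection \<open>Affine charts\<close>

definition pt :: "'v \<Rightarrow> 'v \<Rightarrow> complex \<Rightarrow> 'v set" where
  "pt a b t = ln (a + cscale t b)"

definition dom :: "'v \<Rightarrow> 'v set set" where
  "dom b = {\<xi> \<in> lines cscale. b \<notin> \<xi>}"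

definition chart :: "'v \<Rightarrow> 'v \<Rightarrow> 'v set \<Rightarrow> complex" where
  "chart a b = (\<lambda>\<xi>. THE t. a + cscale t b \<in> \<xi>)"

definition affine_coord :: "'v \<Rightarrow> 'v \<Rightarrow> 'v \<Rightarrow> complex" where
  "affine_coord a b x = \<omega> a x / \<omega> x b"

lemma \<omega>_pt: "\<omega> (a + cscale t b) b = \<omega> a b"
  by (simp add: \<omega>_simps)

lemma pt_nz: "\<omega> a b \<noteq> 0 \<Longrightarrow> a + cscale t b \<noteq> 0"
  using \<omega>_pt[of a t b] \<omega>_zero by metis

lemma pt_0: "pt a b 0 = ln a"
  by (simp add: pt_def)

lemma ln_in_dom: "v \<noteq> 0 \<Longrightarrow> ln v \<in> dom b \<longleftrightarrow> \<omega> v b \<noteq> 0"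
  by (auto simp: dom_def in_ln_iff ln_in_lines)

lemma pt_in_lines: "\<omega> a b \<noteq> 0 \<Longrightarrow> pt a b t \<in> lines cscale"
  by (simp add: pt_def ln_in_lines pt_nz)

lemma pt_in_dom: "\<omega> a b \<noteq> 0 \<Longrightarrow> pt a b t \<in> dom b"
  by (simp add: pt_def ln_in_dom pt_nz \<omega>_pt)

lemma rescale_to_chart:
  assumes "\<omega> a b \<noteq> 0" "\<omega> x b \<noteq> 0"
  shows "x = cscale (\<omega> x b / \<omega> a b) (a + cscale (affine_coord a b x) b)"
proof -
  have "x = cscale (inverse (\<omega> a b)) (cscale (\<omega> a b) x)" using assms by simp
  also have "\<dots> = cscale (inverse (\<omega> a b)) (cscale (\<omega> x b) a + cscale (\<omega> a x) b)"
    by (simp only: cramer[of a b x])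
  finally show ?thesis using assms by (simp add: scale_right_distrib affine_coord_def field_simps)
qed

lemma ln_eq_pt:
  assumes "\<omega> a b \<noteq> 0" "\<omega> x b \<noteq> 0"
  shows "ln x = pt a b (affine_coord a b x)"
  unfolding pt_def using rescale_to_chart[OF assms] ln_scale assms
  by (metis divide_eq_0_iff)

lemma chart_pt:
  assumes "\<omega> a b \<noteq> 0"
  shows "chart a b (pt a b t) = t"
  unfolding chart_def
proof (rule the_equality)
  show "a + cscale t b \<in> pt a b t" by (simp add: pt_def ln_self)
  fix s assume "a + cscale s b \<in> pt a b t"
  then have "\<omega> (a + cscale t b) (a + cscale s b) = 0"
    using in_ln_iff pt_nz[OF assms] by (simp add: pt_def)
  then have "(s - t) * \<omega> a b = 0" using \<omega>_swap[of b a] by (simp add: \<omega>_simps algebra_simps)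
  then show "s = t" using assms by simp
qed

lemma pt_chart:
  assumes "\<omega> a b \<noteq> 0" "\<xi> \<in> dom b"
  shows "pt a b (chart a b \<xi>) = \<xi>"
proof -
  obtain x where x: "x \<noteq> 0" "\<xi> = ln x" using assms(2) by (auto simp: dom_def lines_eq)
  then have "\<xi> = pt a b (affine_coord a b x)" using assms ln_eq_pt ln_in_dom by metis
  then show ?thesis using chart_pt assms(1) by metis
qed

lemma pt_eq_iff: "\<omega> a b \<noteq> 0 \<Longrightarrow> pt a b s = pt a b t \<longleftrightarrow> s = t"
  using chart_pt by metis

lemma independent_pair_iff: "a \<noteq> b \<and> \<not> dependent {a, b} \<longleftrightarrow> \<omega> a b \<noteq> 0"
proof
  assume *: "a \<noteq> b \<and> \<not> dependent {a, b}"
  then have "b \<noteq> 0" using dependent_zero by blast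
  moreover have "a \<notin> ln b" using * independent_insert[of a "{b}"] by (auto simp: ln_span)
  ultimately show "\<omega> a b \<noteq> 0" using in_ln_iff[of b a] \<omega>_swap[of a b] by auto
next
  assume *: "\<omega> a b \<noteq> 0"
  then have "b \<noteq> 0" "a \<noteq> b" using \<omega>_zero \<omega>_self by auto
  moreover have "a \<notin> ln b" using * in_ln_iff[of b a] \<omega>_swap[of a b] \<open>b \<noteq> 0\<close> by auto
  ultimately show "a \<noteq> b \<and> \<not> dependent {a, b}"
    using independent_insert[of a "{b}"] dependent_single by (auto simp: ln_span)
qed

lemma proj_atlas_eq: "proj_atlas cscale = {(dom b, chart a b) | a b. \<omega> a b \<noteq> 0}"
  unfolding proj_atlas_def dom_def chart_def independent_pair_iff by simp

lemma chart_image: "\<omega> a b \<noteq> 0 \<Longrightarrow> chart a b ` (U \<inter> dom b) = {t. pt a b t \<in> U}"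
proof (intro equalityI subsetI)
  assume ab: "\<omega> a b \<noteq> 0"
  show "t \<in> {t. pt a b t \<in> U}" if "t \<in> chart a b ` (U \<inter> dom b)" for t
    using that pt_chart[OF ab] by auto
  show "t \<in> chart a b ` (U \<inter> dom b)" if "t \<in> {t. pt a b t \<in> U}" for t
    using that pt_in_dom[OF ab] chart_pt[OF ab] by (intro image_eqI[of _ _ "pt a b t"]) auto
qed

lemma inv_chart: "\<omega> a b \<noteq> 0 \<Longrightarrow> inv_into (dom b) (chart a b) t = pt a b t"
  by (metis chart_pt inj_on_inverseI inv_into_f_f pt_chart pt_in_dom)

lemma pt_transition:
  assumes "\<omega> a b \<noteq> 0" "\<omega> c d \<noteq> 0" "pt c d s \<in> dom b"
  shows "\<omega> (c + cscale s d) b \<noteq> 0" "pt c d s = pt a b (affine_coord a b (c + cscale s d))"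
proof -
  show 1: "\<omega> (c + cscale s d) b \<noteq> 0" using assms pt_nz ln_in_dom by (simp add: pt_def)
  show "pt c d s = pt a b (affine_coord a b (c + cscale s d))"
    unfolding pt_def[of c d] by (rule ln_eq_pt[OF assms(1) 1])
qed

lemma open_transition_dom: "open {s. \<omega> (c + cscale s d) b \<noteq> 0}"
  unfolding \<omega>_simps by (intro open_Collect_neq continuous_intros)

lemma holomorphic_transition:
  "(\<lambda>s. affine_coord a b (c + cscale s d)) holomorphic_on {s. \<omega> (c + cscale s d) b \<noteq> 0}"
  unfolding affine_coord_def \<omega>_simps by (intro holomorphic_intros) auto

subsection \<open>Topology and holomorphic functions\<close>

abbreviation X :: "('v set, 'v \<Rightarrow> 'v) space" where "X \<equiv> proj cscale"
abbreviation X2 :: "('v set \<times> 'v set, 'v \<Rightarrow> 'v) space" where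
  "X2 \<equiv> surface_square (proj_atlas cscale) proj_act"

lemma pt_preimage:
  assumes "\<omega> a b \<noteq> 0" "\<omega> c d \<noteq> 0" "open T"
  shows "open {s. pt c d s \<in> chart a b -` T \<inter> dom b}"
proof -
  have "{s. pt c d s \<in> chart a b -` T \<inter> dom b} =
      {s. \<omega> (c + cscale s d) b \<noteq> 0} \<inter> (\<lambda>s. affine_coord a b (c + cscale s d)) -` T"
    using pt_transition[OF assms(1,2)] chart_pt[OF assms(1)] assms(2) ln_in_dom pt_nz
    by (auto simp: pt_def)
  moreover have "open \<dots>"
    by (rule continuous_open_preimage[OF holomorphic_on_imp_continuous_on[OF holomorphic_transition]
          open_transition_dom assms(3)])
  ultimately show ?thesis by simp
qed

text \<open>
  The sets open in a chart generate the topology, and the image of such a set in any other chart is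
  open because the transition functions are continuous on open domains.
\<close>

lemma openin_X: "openin (topo X) U \<longleftrightarrow>
    U \<subseteq> lines cscale \<and> (\<forall>a b. \<omega> a b \<noteq> 0 \<longrightarrow> open {t. pt a b t \<in> U})"
proof
  let ?S = "{z -` T \<inter> D | D z T. (D, z) \<in> proj_atlas cscale \<and> open T}"
  have topo: "topo X = topology_generated_by ?S" by (simp add: proj_def surface_def)
  assume "openin (topo X) U"
  then have "generate_topology_on ?S U" by (simp add: topo openin_topology_generated_by_iff)
  then show "U \<subseteq> lines cscale \<and> (\<forall>a b. \<omega> a b \<noteq> 0 \<longrightarrow> open {t. pt a b t \<in> U})"
  proof (induction rule: generate_topology_on.induct)
    case (Int A B)
    then show ?case by (auto simp: Collect_conj_eq intro!: open_Int)
  next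
    case (UN K)
    have "{t. pt a b t \<in> \<Union>K} = (\<Union>A\<in>K. {t. pt a b t \<in> A})" for a b by auto
    with UN show ?case by auto
  next
    case (Basis A)
    then obtain a b T where A: "\<omega> a b \<noteq> 0" "open T" "A = chart a b -` T \<inter> dom b"
      by (auto simp: proj_atlas_eq)
    then show ?case using pt_preimage[OF A(1) _ A(2)] by (auto simp: dom_def)
  qed auto
next
  assume U: "U \<subseteq> lines cscale \<and> (\<forall>a b. \<omega> a b \<noteq> 0 \<longrightarrow> open {t. pt a b t \<in> U})"
  let ?K = "{chart a b -` {t. pt a b t \<in> U} \<inter> dom b | a b. \<omega> a b \<noteq> 0}"
  have "U = \<Union>?K"
  proof (intro equalityI subsetI)
    fix \<xi> assume \<xi>: "\<xi> \<in> U"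
    then obtain v where v: "v \<noteq> 0" "\<xi> = ln v" using U by (auto simp: lines_eq)
    obtain u where u: "\<omega> v u \<noteq> 0" using ex_frame[OF v(1)] by blast
    have "\<xi> \<in> chart v u -` {t. pt v u t \<in> U} \<inter> dom u"
      using \<xi> v pt_chart[OF u, of \<xi>] ln_in_dom[OF v(1), of u] u by simp
    then show "\<xi> \<in> \<Union>?K" using u by blast
  qed (auto simp: pt_chart)
  moreover have "openin (topo X) A" if A: "A \<in> ?K" for A
  proof -
    obtain a b where ab: "\<omega> a b \<noteq> 0" "A = chart a b -` {t. pt a b t \<in> U} \<inter> dom b" using A by blast
    moreover have "open {t. pt a b t \<in> U}" using U ab by blast
    ultimately have "A \<in> {z -` T \<inter> D | D z T. (D, z) \<in> proj_atlas cscale \<and> open T}"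
      unfolding proj_atlas_eq by blast
    then have "openin (topology_generated_by {z -` T \<inter> D | D z T. (D, z) \<in> proj_atlas cscale \<and> open T}) A"
      by (rule topology_generated_by_Basis)
    then show ?thesis by (simp only: proj_def surface_def space.simps)
  qed
  then have "openin (topo X) (\<Union>?K)" by blast
  ultimately show "openin (topo X) U" by argo
qed

lemma openin_X_sub: "openin (topo X) U \<Longrightarrow> U \<subseteq> lines cscale"
  by (simp add: openin_X)

lemma openin_X_open: "openin (topo X) U \<Longrightarrow> \<omega> a b \<noteq> 0 \<Longrightarrow> open {t. pt a b t \<in> U}"
  by (simp add: openin_X)

lemma openin_dom: "b \<noteq> 0 \<Longrightarrow> openin (topo X) (dom b)"
proof -
  assume "b \<noteq> 0"
  have "{t. pt c d t \<in> dom b} = {s. \<omega> (c + cscale s d) b \<noteq> 0}" if "\<omega> c d \<noteq> 0" for c d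
    using ln_in_dom pt_nz[OF that] by (auto simp: pt_def)
  then show ?thesis unfolding openin_X using open_transition_dom by (auto simp: dom_def)
qed

lemma openin_chart_image:
  assumes "\<omega> a b \<noteq> 0" "open T"
  shows "openin (topo X) (pt a b ` T)"
proof -
  have "pt a b ` T = chart a b -` T \<inter> dom b"
    using assms chart_pt pt_chart pt_in_dom by (auto simp: image_iff) metis
  then show ?thesis unfolding openin_X using pt_preimage[OF assms(1) _ assms(2)] by (auto simp: dom_def)
qed

lemma topspace_X: "topspace (topo X) = lines cscale"
proof -
  have "openin (topo X) (lines cscale)" unfolding openin_X by (auto simp: pt_in_lines)
  moreover have "openin (topo X) (topspace (topo X))" by simp
  ultimately show ?thesis using openin_X_sub openin_subset by blast
qed

lemma hol_X: "hol X U = {f \<in> extensional U. \<forall>a b. \<omega> a b \<noteq> 0 \<longrightarrow>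
    (\<lambda>t. f (pt a b t)) holomorphic_on {t. pt a b t \<in> U}}"
proof -
  have "hol X U = {f \<in> extensional U. \<forall>a b. \<omega> a b \<noteq> 0 \<longrightarrow>
      (\<lambda>t. f (inv_into (dom b) (chart a b) t)) holomorphic_on (chart a b ` (U \<inter> dom b))}"
    unfolding proj_def surface_def proj_atlas_eq by (simp, blast)
  then show ?thesis by (simp add: chart_image inv_chart cong: conj_cong imp_cong)
qed

text \<open>The transition functions to the other charts are holomorphic.\<close>

lemma hol_X_chart:
  assumes "\<omega> a b \<noteq> 0" "U \<subseteq> dom b" "openin (topo X) U"
  shows "f \<in> hol X U \<longleftrightarrow> f \<in> extensional U \<and> (\<lambda>t. f (pt a b t)) holomorphic_on {t. pt a b t \<in> U}"
proof
  assume f: "f \<in> extensional U \<and> (\<lambda>t. f (pt a b t)) holomorphic_on {t. pt a b t \<in> U}"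
  show "f \<in> hol X U" unfolding hol_X
  proof (safe)
    fix c d assume cd: "\<omega> c d \<noteq> 0"
    let ?T = "\<lambda>s. affine_coord a b (c + cscale s d)"
    have tr: "\<omega> (c + cscale s d) b \<noteq> 0" "pt c d s = pt a b (?T s)" if "pt c d s \<in> U" for s
      using pt_transition[OF assms(1) cd] that assms(2) by blast+
    have "(\<lambda>t. f (pt a b t)) \<circ> ?T holomorphic_on {s. pt c d s \<in> U}"
      by (rule holomorphic_on_compose_gen[OF holomorphic_on_subset[OF holomorphic_transition]])
         (use f tr in auto)
    then show "(\<lambda>t. f (pt c d t)) holomorphic_on {t. pt c d t \<in> U}"
      by (rule holomorphic_transform) (use tr in auto)
  qed (use f in auto)
qed (use assms in \<open>auto simp: hol_X\<close>)

lemma topo_X2: "topo X2 = prod_topology (topo X) (topo X)"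
  by (simp add: surface_square_def proj_def)

lemma openin_X2_Times: "openin (topo X) U \<Longrightarrow> openin (topo X) V \<Longrightarrow> openin (topo X2) (U \<times> V)"
  by (simp add: topo_X2 openin_prod_Times_iff)

lemma openin_X2_sub: "openin (topo X2) U \<Longrightarrow> U \<subseteq> lines cscale \<times> lines cscale"
  using openin_subset[of "topo X2"] by (simp add: topo_X2 topspace_X)

lemma openin_X2_open:
  assumes "openin (topo X2) U" "\<omega> a b \<noteq> 0" "\<omega> c d \<noteq> 0"
  shows "open {(s, t). (pt a b s, pt c d t) \<in> U}"
proof (subst open_subopen, intro ballI)
  fix p assume "p \<in> {(s, t). (pt a b s, pt c d t) \<in> U}"
  then obtain s t where p: "p = (s, t)" "(pt a b s, pt c d t) \<in> U" by blast
  obtain A B where AB: "openin (topo X) A" "openin (topo X) B" "(pt a b s, pt c d t) \<in> A \<times> B" "A \<times> B \<subseteq> U"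
    using assms(1)[unfolded topo_X2 openin_prod_topology_alt, rule_format, OF p(2)] by blast
  let ?T = "{s. pt a b s \<in> A} \<times> {t. pt c d t \<in> B}"
  have "open ?T" using AB openin_X_open assms by (intro open_Times) auto
  moreover have "p \<in> ?T" "?T \<subseteq> {(s, t). (pt a b s, pt c d t) \<in> U}" using AB p by auto
  ultimately show "\<exists>T. open T \<and> p \<in> T \<and> T \<subseteq> {(s, t). (pt a b s, pt c d t) \<in> U}" by blast
qed

lemma hol_X2: "hol X2 U = {f \<in> extensional U. \<forall>a b c d. \<omega> a b \<noteq> 0 \<longrightarrow> \<omega> c d \<noteq> 0 \<longrightarrow>
    holomorphic2_on (\<lambda>(s, t). f (pt a b s, pt c d t)) {(s, t). (pt a b s, pt c d t) \<in> U}}"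
proof -
  have im: "map_prod (chart a b) (chart c d) ` (U \<inter> dom b \<times> dom d) = {(s, t). (pt a b s, pt c d t) \<in> U}"
    if "\<omega> a b \<noteq> 0" "\<omega> c d \<noteq> 0" for a b c d
  proof (intro equalityI subsetI)
    fix p assume "p \<in> {(s, t). (pt a b s, pt c d t) \<in> U}"
    then show "p \<in> map_prod (chart a b) (chart c d) ` (U \<inter> dom b \<times> dom d)"
      using that pt_in_dom chart_pt
      by (intro image_eqI[of _ _ "(pt a b (fst p), pt c d (snd p))"]) auto
  qed (use that pt_chart in auto)
  have "hol X2 U = {f \<in> extensional U. \<forall>a b. \<omega> a b \<noteq> 0 \<longrightarrow> (\<forall>c d. \<omega> c d \<noteq> 0 \<longrightarrow>
      holomorphic2_on (\<lambda>(t, t'). f (inv_into (dom b) (chart a b) t, inv_into (dom d) (chart c d) t'))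
        (map_prod (chart a b) (chart c d) ` (U \<inter> dom b \<times> dom d)))}"
    unfolding surface_square_def proj_atlas_eq by (simp, blast)
  then show ?thesis by (simp add: im inv_chart cong: conj_cong imp_cong)
qed

text \<open>As in one variable, the other charts are reached by holomorphic transition functions.\<close>

lemma hol_X2_chart:
  assumes "\<omega> a b \<noteq> 0" "\<omega> c d \<noteq> 0" "U \<subseteq> dom b \<times> dom d" "openin (topo X2) U"
  shows "f \<in> hol X2 U \<longleftrightarrow> f \<in> extensional U \<and>
    holomorphic2_on (\<lambda>(s, t). f (pt a b s, pt c d t)) {(s, t). (pt a b s, pt c d t) \<in> U}"
proof
  assume f: "f \<in> extensional U \<and> holomorphic2_on (\<lambda>(s, t). f (pt a b s, pt c d t)) {(s, t). (pt a b s, pt c d t) \<in> U}"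
  show "f \<in> hol X2 U" unfolding hol_X2
  proof (safe)
    fix a' b' c' d' assume fr: "\<omega> a' b' \<noteq> 0" "\<omega> c' d' \<noteq> 0"
    let ?S = "\<lambda>s. affine_coord a b (a' + cscale s b')" and ?T = "\<lambda>s. affine_coord c d (c' + cscale s d')"
    let ?U = "{(s, t). (pt a' b' s, pt c' d' t) \<in> U}"
    have tr: "\<omega> (a' + cscale s b') b \<noteq> 0" "pt a' b' s = pt a b (?S s)"
        "\<omega> (c' + cscale t d') d \<noteq> 0" "pt c' d' t = pt c d (?T t)" if "(s, t) \<in> ?U" for s t
      using pt_transition[OF assms(1) fr(1)] pt_transition[OF assms(2) fr(2)] that assms(3) by auto
    have 1: "holomorphic2_on (\<lambda>(s, t). (\<lambda>(s, t). f (pt a b s, pt c d t)) (?S s, ?T t)) ?U"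
    proof (rule holomorphic2_on_compose_map_prod[OF conjunct2[OF f] holomorphic_transition open_transition_dom
            holomorphic_transition open_transition_dom])
      fix s t assume st: "(s, t) \<in> ?U"
      show "s \<in> {s. \<omega> (a' + cscale s b') b \<noteq> 0} \<and> t \<in> {s. \<omega> (c' + cscale s d') d \<noteq> 0} \<and>
          (?S s, ?T t) \<in> {(s, t). (pt a b s, pt c d t) \<in> U}"
        using tr(1,3)[OF st] st[unfolded mem_Collect_eq prod.case tr(2,4)[OF st]] by blast
    qed
    have 2: "(case p of (s, t) \<Rightarrow> (\<lambda>(s, t). f (pt a b s, pt c d t)) (?S s, ?T t)) =
        (case p of (s, t) \<Rightarrow> f (pt a' b' s, pt c' d' t))" if "p \<in> ?U" for p
    proof -
      obtain s t where p: "p = (s, t)" by fastforce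
      have st: "(s, t) \<in> ?U" using that unfolding p .
      show ?thesis unfolding p prod.case using tr(2,4)[OF st] by metis
    qed
    show "holomorphic2_on (\<lambda>(s, t). f (pt a' b' s, pt c' d' t)) ?U"
      by (rule iffD1[OF holomorphic2_on_cong[OF openin_X2_open[OF assms(4) fr] 2] 1])
  qed (use f in auto)
qed (use assms in \<open>auto simp: hol_X2\<close>)

end

section \<open>Sections in terms of coordinates\<close>

text \<open>
  The properties of the structure sheaf used for coordinates of sections, stated for an arbitrary
  space in order to cover the line and its square.
\<close>

definition function_algebra :: "('p, 'g) space \<Rightarrow> bool" where
  "function_algebra M \<longleftrightarrow> (\<forall>N. openin (topo M) N \<longrightarrow>
     (\<forall>c. (\<lambda>q\<in>N. c) \<in> hol M N) \<and>
     (\<forall>f\<in>hol M N. \<forall>g\<in>hol M N. (\<lambda>q\<in>N. f q + g q) \<in> hol M N \<and> (\<lambda>q\<in>N. f q * g q) \<in> hol M N) \<and>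
     (\<forall>f\<in>hol M N. \<forall>N'. openin (topo M) N' \<and> N' \<subseteq> N \<longrightarrow> restrict f N' \<in> hol M N'))"

lemma function_algebra_sum:
  assumes "function_algebra M" "openin (topo M) N" "finite I" "\<And>i. i \<in> I \<Longrightarrow> (\<lambda>q\<in>N. f i q) \<in> hol M N"
  shows "(\<lambda>q\<in>N. \<Sum>i\<in>I. f i q) \<in> hol M N"
  using assms(3,4)
proof (induction I rule: finite_induct)
  case empty
  then show ?case unfolding sum.empty using assms(1,2) unfolding function_algebra_def by blast
next
  case (insert x I)
  have 1: "(\<lambda>q\<in>N. (\<lambda>q\<in>N. f x q) q + (\<lambda>q\<in>N. \<Sum>i\<in>I. f i q) q) \<in> hol M N"
    using assms(1,2) insert.IH insert.prems unfolding function_algebra_def by blast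
  have 2: "(\<lambda>q\<in>N. (\<lambda>q\<in>N. f x q) q + (\<lambda>q\<in>N. \<Sum>i\<in>I. f i q) q) = (\<lambda>q\<in>N. \<Sum>i\<in>insert x I. f i q)"
    using insert.hyps by (auto simp: restrict_def fun_eq_iff)
  show ?case using 1 unfolding 2 .
qed

text \<open>
  The coordinates of a combination of generators are combinations of the coordinates of the
  generators, hence holomorphic. Conversely a section is the combination of the generators dual to
  the coordinates with its own coordinates as coefficients.
\<close>

lemma local_span_coords:
  assumes alg: "function_algebra M" and U: "openin (topo M) U" "p \<in> U" and N0: "openin (topo M) N0" "p \<in> N0"
    and K: "\<And>q. q \<in> N0 \<Longrightarrow> coords (F q) r (K q)"
    and s: "\<And>q. q \<in> U \<Longrightarrow> s q \<in> carrier (F q)"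
    and gen: "\<And>N e q. openin (topo M) N \<Longrightarrow> e \<in> gen N \<Longrightarrow> q \<in> N \<Longrightarrow> e q \<in> carrier (F q)"
      "\<And>N e i. openin (topo M) N \<Longrightarrow> e \<in> gen N \<Longrightarrow> i < r \<Longrightarrow> (\<lambda>q\<in>N \<inter> N0. K q (e q) i) \<in> hol M (N \<inter> N0)"
    and dual: "\<And>N j. openin (topo M) N \<Longrightarrow> N \<subseteq> N0 \<Longrightarrow> j < r \<Longrightarrow> \<exists>e\<in>gen N. \<forall>q\<in>N. K q (e q) = unit_seq j"
  shows "(\<exists>N. openin (topo M) N \<and> p \<in> N \<and> N \<subseteq> U \<and>
         (\<exists>(m::nat) f e. (\<forall>i<m. f i \<in> hol M N \<and> e i \<in> gen N) \<and>
           (\<forall>q\<in>N. s q = finsum (F q) (\<lambda>i. f i q \<odot>\<^bsub>F q\<^esub> e i q) {..<m}))) \<longleftrightarrow>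
     (\<exists>N. openin (topo M) N \<and> p \<in> N \<and> N \<subseteq> U \<inter> N0 \<and> (\<forall>i<r. (\<lambda>q\<in>N. K q (s q) i) \<in> hol M N))"
    (is "?L \<longleftrightarrow> ?R")
proof
  assume ?L
  then obtain N and m :: nat and f e where N: "openin (topo M) N" "p \<in> N" "N \<subseteq> U"
    and fe: "\<And>i. i < m \<Longrightarrow> f i \<in> hol M N" "\<And>i. i < m \<Longrightarrow> e i \<in> gen N"
    and sum: "\<And>q. q \<in> N \<Longrightarrow> s q = finsum (F q) (\<lambda>i. f i q \<odot>\<^bsub>F q\<^esub> e i q) {..<m}"
    by blast
  let ?N = "N \<inter> N0"
  have op: "openin (topo M) ?N" using N N0 by blast
  have "(\<lambda>q\<in>?N. K q (s q) l) \<in> hol M ?N" if l: "l < r" for l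
  proof -
    have "(\<lambda>q\<in>?N. f i q * K q (e i q) l) \<in> hol M ?N" if i: "i < m" for i
    proof -
      have 1: "restrict (f i) ?N \<in> hol M ?N" using alg N op fe(1)[OF i] unfolding function_algebra_def by blast
      have 2: "(\<lambda>q\<in>?N. K q (e i q) l) \<in> hol M ?N" by (rule gen(2)[OF N(1) fe(2)[OF i] l])
      have 3: "(\<lambda>q\<in>?N. restrict (f i) ?N q * (\<lambda>q\<in>?N. K q (e i q) l) q) \<in> hol M ?N"
        using alg op 1 2 unfolding function_algebra_def by blast
      have 4: "(\<lambda>q\<in>?N. restrict (f i) ?N q * (\<lambda>q\<in>?N. K q (e i q) l) q) = (\<lambda>q\<in>?N. f i q * K q (e i q) l)"
        by (auto simp: restrict_def fun_eq_iff)
      show ?thesis using 3 unfolding 4 .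
    qed
    then have "(\<lambda>q\<in>?N. \<Sum>i<m. f i q * K q (e i q) l) \<in> hol M ?N"
      by (intro function_algebra_sum[OF alg op]) auto
    moreover have "(\<lambda>q\<in>?N. \<Sum>i<m. f i q * K q (e i q) l) = (\<lambda>q\<in>?N. K q (s q) l)"
    proof (rule restrict_ext)
      fix q assume q: "q \<in> ?N"
      have Kq: "coords (F q) r (K q)" using K q by blast
      have eq: "e i q \<in> carrier (F q)" if "i < m" for i using gen(1)[OF N(1) fe(2)[OF that]] q by blast
      have "K q (s q) = (\<lambda>l. \<Sum>i<m. K q (f i q \<odot>\<^bsub>F q\<^esub> e i q) l)"
        using coords_finsum[OF Kq, of "{..<m}" "\<lambda>i. f i q \<odot>\<^bsub>F q\<^esub> e i q"] sum[of q] q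
        by (simp add: coords_smult(1)[OF Kq] eq)
      then show "(\<Sum>i<m. f i q * K q (e i q) l) = K q (s q) l"
        by (simp add: coords_smult(2)[OF Kq] eq)
    qed
    ultimately show ?thesis by simp
  qed
  then show ?R using op N N0 by (intro exI[of _ ?N]) auto
next
  assume ?R
  then obtain N where N: "openin (topo M) N" "p \<in> N" "N \<subseteq> U \<inter> N0"
    and h: "\<And>i. i < r \<Longrightarrow> (\<lambda>q\<in>N. K q (s q) i) \<in> hol M N" by blast
  have "\<forall>j. \<exists>e. j < r \<longrightarrow> e \<in> gen N \<and> (\<forall>q\<in>N. K q (e q) = unit_seq j)"
    using dual[OF N(1)] N(3) by blast
  then obtain e where e: "\<And>j. j < r \<Longrightarrow> e j \<in> gen N" "\<And>j q. j < r \<Longrightarrow> q \<in> N \<Longrightarrow> K q (e j q) = unit_seq j"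
    by metis
  have "s q = finsum (F q) (\<lambda>i. (\<lambda>q\<in>N. K q (s q) i) q \<odot>\<^bsub>F q\<^esub> e i q) {..<r}" if q: "q \<in> N" for q
  proof -
    have Kq: "coords (F q) r (K q)" using K q N by blast
    have eq: "e i q \<in> carrier (F q)" if "i < r" for i using gen(1)[OF N(1) e(1)[OF that] q] .
    have *: "finsum (F q) (\<lambda>i. (\<lambda>q\<in>N. K q (s q) i) q \<odot>\<^bsub>F q\<^esub> e i q) {..<r} \<in> carrier (F q) \<and>
      K q (finsum (F q) (\<lambda>i. (\<lambda>q\<in>N. K q (s q) i) q \<odot>\<^bsub>F q\<^esub> e i q) {..<r}) =
      (\<lambda>l. \<Sum>i<r. K q ((\<lambda>q\<in>N. K q (s q) i) q \<odot>\<^bsub>F q\<^esub> e i q) l)"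
      by (rule coords_finsum[OF Kq]) (use eq coords_smult(1)[OF Kq] in auto)
    show ?thesis
    proof (rule coords_eqI[OF Kq])
      fix l assume l: "l < r"
      have "(\<Sum>i<r. K q ((\<lambda>q\<in>N. K q (s q) i) q \<odot>\<^bsub>F q\<^esub> e i q) l) = (\<Sum>i<r. if i = l then K q (s q) i else 0)"
        by (rule sum.cong) (use q eq e(2) in \<open>auto simp: coords_smult(2)[OF Kq] unit_seq_def\<close>)
      then show "K q (s q) l = K q (finsum (F q) (\<lambda>i. (\<lambda>q\<in>N. K q (s q) i) q \<odot>\<^bsub>F q\<^esub> e i q) {..<r}) l"
        using * l by simp
    qed (use * s q N in auto)
  qed
  then show ?L using N h e(1)
    by (intro exI[of _ N] conjI exI[of _ r] exI[of _ "\<lambda>i. \<lambda>q\<in>N. K q (s q) i"] exI[of _ e]) auto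
qed

context plane
begin

lemma restrict_in_hol_X:
  assumes "\<And>a b. \<omega> a b \<noteq> 0 \<Longrightarrow> (\<lambda>t. f (pt a b t)) holomorphic_on {t. pt a b t \<in> N}"
  shows "restrict f N \<in> hol X N"
  unfolding hol_X
proof (intro CollectI conjI allI impI)
  fix a b assume "\<omega> a b \<noteq> 0"
  from assms[OF this] show "(\<lambda>t. restrict f N (pt a b t)) holomorphic_on {t. pt a b t \<in> N}"
    by (rule holomorphic_transform) simp
qed simp

lemma restrict_in_hol_X2:
  assumes N: "openin (topo X2) N"
    and "\<And>a b c d. \<omega> a b \<noteq> 0 \<Longrightarrow> \<omega> c d \<noteq> 0 \<Longrightarrow>
      holomorphic2_on (\<lambda>(s, t). f (pt a b s, pt c d t)) {(s, t). (pt a b s, pt c d t) \<in> N}"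
  shows "restrict f N \<in> hol X2 N"
  unfolding hol_X2
proof (intro CollectI conjI allI impI)
  fix a b c d assume fr: "\<omega> a b \<noteq> 0" "\<omega> c d \<noteq> 0"
  show "holomorphic2_on (\<lambda>(s, t). restrict f N (pt a b s, pt c d t)) {(s, t). (pt a b s, pt c d t) \<in> N}"
    by (rule iffD1[OF holomorphic2_on_cong[OF openin_X2_open[OF N fr]] assms(2)[OF fr]]) auto
qed simp

lemma hol_XD: "f \<in> hol X N \<Longrightarrow> \<omega> a b \<noteq> 0 \<Longrightarrow> (\<lambda>t. f (pt a b t)) holomorphic_on {t. pt a b t \<in> N}"
  by (simp add: hol_X)

lemma hol_X2D: "f \<in> hol X2 N \<Longrightarrow> \<omega> a b \<noteq> 0 \<Longrightarrow> \<omega> c d \<noteq> 0 \<Longrightarrow>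
    holomorphic2_on (\<lambda>(s, t). f (pt a b s, pt c d t)) {(s, t). (pt a b s, pt c d t) \<in> N}"
  by (simp add: hol_X2)

lemma function_algebra_X: "function_algebra X"
  unfolding function_algebra_def
proof (intro allI impI conjI ballI)
  fix N assume N: "openin (topo X) N"
  show "(\<lambda>q\<in>N. c) \<in> hol X N" for c by (rule restrict_in_hol_X) auto
  fix f assume f: "f \<in> hol X N"
  show "(\<lambda>q\<in>N. f q + g q) \<in> hol X N" "(\<lambda>q\<in>N. f q * g q) \<in> hol X N" if "g \<in> hol X N" for g
    using hol_XD[OF f] hol_XD[OF that] by (auto intro!: restrict_in_hol_X holomorphic_intros)
  fix N' assume N': "openin (topo X) N' \<and> N' \<subseteq> N"
  show "restrict f N' \<in> hol X N'"
    by (rule restrict_in_hol_X, rule holomorphic_on_subset[OF hol_XD[OF f]]) (use N' in auto)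
qed

lemma function_algebra_X2: "function_algebra X2"
  unfolding function_algebra_def
proof (intro allI impI conjI ballI)
  fix N assume N: "openin (topo X2) N"
  show "(\<lambda>q\<in>N. c) \<in> hol X2 N" for c
    by (rule restrict_in_hol_X2[OF N]) (use holomorphic2_on_const[of c] in \<open>auto simp: case_prod_unfold\<close>)
  fix f assume f: "f \<in> hol X2 N"
  show "(\<lambda>q\<in>N. f q + g q) \<in> hol X2 N" if "g \<in> hol X2 N" for g
    by (rule restrict_in_hol_X2[OF N])
       (use holomorphic2_on_add[OF hol_X2D[OF f] hol_X2D[OF that]] in \<open>auto simp: case_prod_unfold\<close>)
  show "(\<lambda>q\<in>N. f q * g q) \<in> hol X2 N" if "g \<in> hol X2 N" for g
    by (rule restrict_in_hol_X2[OF N])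
       (use holomorphic2_on_mult[OF hol_X2D[OF f] hol_X2D[OF that]] in \<open>auto simp: case_prod_unfold\<close>)
  fix N' assume N': "openin (topo X2) N' \<and> N' \<subseteq> N"
  show "restrict f N' \<in> hol X2 N'"
    by (rule restrict_in_hol_X2[OF conjunct1[OF N']], rule holomorphic2_on_subset[OF hol_X2D[OF f]])
       (use N' in auto)
qed

subsection \<open>Homogeneous bundles\<close>

text \<open>
  The frame \<open>(c + s d, d)\<close> of one chart and the frame \<open>(a + t b, b)\<close> of another one at the same
  point differ by a change of the form \<open>(l v, \<nu> u + \<mu> v)\<close> with coefficients holomorphic in \<open>s\<close>.
\<close>

lemma frame_change:
  assumes ab: "\<omega> a b \<noteq> 0" and cd: "\<omega> c d \<noteq> 0" and x: "\<omega> (c + cscale s d) b \<noteq> 0"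
  defines "t \<equiv> affine_coord a b (c + cscale s d)"
  shows "c + cscale s d = cscale (\<omega> (c + cscale s d) b / \<omega> a b) (a + cscale t b)"
    "d = cscale ((\<omega> a d + t * \<omega> b d) / \<omega> a b) b + cscale (\<omega> d b / \<omega> a b) (a + cscale t b)"
    "(\<omega> a d + t * \<omega> b d) / \<omega> a b \<noteq> 0"
proof -
  let ?y = "a + cscale t b"
  show 1: "c + cscale s d = cscale (\<omega> (c + cscale s d) b / \<omega> a b) ?y"
    unfolding t_def by (rule rescale_to_chart[OF ab x])
  have "cscale (\<omega> a b) d = cscale (\<omega> d b) ?y + cscale (\<omega> a d + t * \<omega> b d) b"
    using cramer[of ?y b d] \<omega>_pt by (simp add: \<omega>_simps)
  then have "cscale (inverse (\<omega> a b)) (cscale (\<omega> a b) d) =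
      cscale (inverse (\<omega> a b)) (cscale (\<omega> d b) ?y + cscale (\<omega> a d + t * \<omega> b d) b)" by simp
  then show "d = cscale ((\<omega> a d + t * \<omega> b d) / \<omega> a b) b + cscale (\<omega> d b / \<omega> a b) ?y"
    unfolding scale_right_distrib[of "inverse (\<omega> a b)"] scale_scale using ab by (simp add: divide_inverse mult.commute add.commute)
  have "\<omega> (c + cscale s d) d = \<omega> (c + cscale s d) b / \<omega> a b * \<omega> ?y d"
    by (subst 1) (simp only: \<omega>_scale_left)
  then show "(\<omega> a d + t * \<omega> b d) / \<omega> a b \<noteq> 0"
    using cd ab by (auto simp: \<omega>_pt \<omega>_simps)
qed

text \<open>
  For coordinates \<open>C v u\<close> on the fibre at the line of \<open>v\<close>: at the point with affine coordinate \<open>t\<close>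
  the frame \<open>(a + t b, b)\<close> is used.
\<close>

definition holomorphic_sections ::
  "('v set \<Rightarrow> (complex, 'a) module) \<Rightarrow> nat \<Rightarrow> ('v \<Rightarrow> 'v \<Rightarrow> 'a \<Rightarrow> nat \<Rightarrow> complex) \<Rightarrow> 'v set set \<Rightarrow> ('v set \<Rightarrow> 'a) set"
where
  "holomorphic_sections F r C U = {s \<in> extensional U. (\<forall>p\<in>U. s p \<in> carrier (F p)) \<and>
     (\<forall>a b. \<omega> a b \<noteq> 0 \<longrightarrow> (\<forall>i<r. (\<lambda>t. C (a + cscale t b) b (s (pt a b t)) i) holomorphic_on {t. pt a b t \<in> U}))}"

text \<open>
  An equivariant bundle of rank \<open>r\<close> with coordinates on the fibre at the line of \<open>v\<close> for each frame
  \<open>(v, u)\<close>. The third condition says that the group only moves the frame. The fourth one amounts to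
  the representation of the stabilizer of a line that determines the bundle: \<open>e\<close> is the degree in
  \<open>v\<close> of the coordinate of index 0, and \<open>\<kappa>\<close> gives the action of the unipotent part.
\<close>

definition homogeneous ::
  "('v set, 'a, 'v \<Rightarrow> 'v) vbundle \<Rightarrow> nat \<Rightarrow> int \<Rightarrow> (nat \<Rightarrow> nat \<Rightarrow> complex) \<Rightarrow> ('v \<Rightarrow> 'v \<Rightarrow> 'a \<Rightarrow> nat \<Rightarrow> complex) \<Rightarrow> bool"
where
  "homogeneous E r e \<kappa> C \<longleftrightarrow>
     (\<forall>v u. \<omega> v u \<noteq> 0 \<longrightarrow> coords (fibre E (ln v)) r (C v u)) \<and>
     (\<forall>U. openin (topo X) U \<longrightarrow> sects E U = holomorphic_sections (fibre E) r C U) \<and>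
     (\<forall>g\<in>SL cscale. \<forall>v u. \<omega> v u \<noteq> 0 \<longrightarrow> (\<forall>x\<in>carrier (fibre E (ln v)).
        act E g (ln v) x \<in> carrier (fibre E (ln (g v))) \<and> C (g v) (g u) (act E g (ln v) x) = C v u x)) \<and>
     (\<forall>v u l \<mu> \<nu> i. \<omega> v u \<noteq> 0 \<longrightarrow> l \<noteq> 0 \<longrightarrow> \<nu> \<noteq> 0 \<longrightarrow> i < r \<longrightarrow> (\<forall>x\<in>carrier (fibre E (ln v)).
        C (cscale l v) (cscale \<nu> u + cscale \<mu> v) x i =
        (\<Sum>j\<le>i. \<kappa> i j * \<nu> ^ j * \<mu> ^ (i - j) * l powi (e - int i) * C v u x j)))"

lemma homogeneousI:
  assumes "\<And>v u. \<omega> v u \<noteq> 0 \<Longrightarrow> coords (fibre E (ln v)) r (C v u)"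
    and "\<And>U. openin (topo X) U \<Longrightarrow> sects E U = holomorphic_sections (fibre E) r C U"
    and "\<And>g v u x. g \<in> SL cscale \<Longrightarrow> \<omega> v u \<noteq> 0 \<Longrightarrow> x \<in> carrier (fibre E (ln v)) \<Longrightarrow>
        act E g (ln v) x \<in> carrier (fibre E (ln (g v)))"
    and "\<And>g v u x. g \<in> SL cscale \<Longrightarrow> \<omega> v u \<noteq> 0 \<Longrightarrow> x \<in> carrier (fibre E (ln v)) \<Longrightarrow>
        C (g v) (g u) (act E g (ln v) x) = C v u x"
    and "\<And>v u l \<mu> \<nu> x i. \<omega> v u \<noteq> 0 \<Longrightarrow> l \<noteq> 0 \<Longrightarrow> \<nu> \<noteq> 0 \<Longrightarrow> i < r \<Longrightarrow> x \<in> carrier (fibre E (ln v)) \<Longrightarrow>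
        C (cscale l v) (cscale \<nu> u + cscale \<mu> v) x i =
        (\<Sum>j\<le>i. \<kappa> i j * \<nu> ^ j * \<mu> ^ (i - j) * l powi (e - int i) * C v u x j)"
  shows "homogeneous E r e \<kappa> C"
  unfolding homogeneous_def by (intro conjI allI impI ballI) (rule assms; assumption)+

lemma holomorphic_sectionsI:
  assumes "s \<in> extensional U" "\<And>p. p \<in> U \<Longrightarrow> s p \<in> carrier (F p)"
    "\<And>a b i. \<omega> a b \<noteq> 0 \<Longrightarrow> i < r \<Longrightarrow> (\<lambda>t. C (a + cscale t b) b (s (pt a b t)) i) holomorphic_on {t. pt a b t \<in> U}"
  shows "s \<in> holomorphic_sections F r C U"
  using assms by (auto simp: holomorphic_sections_def)

lemma holomorphic_sectionsD:
  assumes "s \<in> holomorphic_sections F r C U"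
  shows "s \<in> extensional U" "p \<in> U \<Longrightarrow> s p \<in> carrier (F p)"
    "\<omega> a b \<noteq> 0 \<Longrightarrow> i < r \<Longrightarrow> (\<lambda>t. C (a + cscale t b) b (s (pt a b t)) i) holomorphic_on {t. pt a b t \<in> U}"
  using assms by (auto simp: holomorphic_sections_def)

text \<open>
  It suffices to treat each chart separately, where \<open>local_span_coords\<close> applies to the coordinates
  in the frames of the chart.
\<close>

lemma local_span_eq_holomorphic_sections:
  assumes U: "openin (topo X) U"
    and C: "\<And>v u. \<omega> v u \<noteq> 0 \<Longrightarrow> coords (F (ln v)) r (C v u)"
    and gen: "\<And>N e q. openin (topo X) N \<Longrightarrow> e \<in> gen N \<Longrightarrow> q \<in> N \<Longrightarrow> e q \<in> carrier (F q)"
      "\<And>N e a b i. openin (topo X) N \<Longrightarrow> e \<in> gen N \<Longrightarrow> \<omega> a b \<noteq> 0 \<Longrightarrow> i < r \<Longrightarrow>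
        (\<lambda>t. C (a + cscale t b) b (e (pt a b t)) i) holomorphic_on {t. pt a b t \<in> N}"
    and dual: "\<And>N a b j. openin (topo X) N \<Longrightarrow> \<omega> a b \<noteq> 0 \<Longrightarrow> N \<subseteq> dom b \<Longrightarrow> j < r \<Longrightarrow>
      \<exists>e\<in>gen N. \<forall>t. pt a b t \<in> N \<longrightarrow> C (a + cscale t b) b (e (pt a b t)) = unit_seq j"
  shows "local_span X F gen U = holomorphic_sections F r C U"
proof -
  define K where "K = (\<lambda>a b q. C (a + cscale (chart a b q) b) b)"
  have K: "coords (F q) r (K a b q)" if "\<omega> a b \<noteq> 0" "q \<in> dom b" for a b q
    using C[of "a + cscale (chart a b q) b" b] pt_chart[OF that] that(1) \<omega>_pt by (simp add: K_def pt_def)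
  have K_pt: "K a b (pt a b t) = C (a + cscale t b) b" if "\<omega> a b \<noteq> 0" for a b t
    using chart_pt[OF that] by (simp add: K_def)
  have opdom: "openin (topo X) (dom b)" if "\<omega> a b \<noteq> 0" for a b using openin_dom frame_nz that by blast
  have hol_iff: "(\<lambda>q\<in>N. K a b q (s q) i) \<in> hol X N \<longleftrightarrow>
      (\<lambda>t. C (a + cscale t b) b (s (pt a b t)) i) holomorphic_on {t. pt a b t \<in> N}"
    if "\<omega> a b \<noteq> 0" "openin (topo X) N" "N \<subseteq> dom b" for N a b s i
  proof -
    have "(\<lambda>t. (\<lambda>q\<in>N. K a b q (s q) i) (pt a b t)) holomorphic_on {t. pt a b t \<in> N} \<longleftrightarrow>
      (\<lambda>t. C (a + cscale t b) b (s (pt a b t)) i) holomorphic_on {t. pt a b t \<in> N}"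
      by (rule holomorphic_cong) (auto simp: K_pt[OF that(1)])
    then show ?thesis by (simp add: hol_X_chart[OF that(1,3,2)])
  qed
  have key: "(\<exists>N. openin (topo X) N \<and> p \<in> N \<and> N \<subseteq> U \<and>
         (\<exists>(m::nat) f e. (\<forall>i<m. f i \<in> hol X N \<and> e i \<in> gen N) \<and>
           (\<forall>q\<in>N. s q = finsum (F q) (\<lambda>i. f i q \<odot>\<^bsub>F q\<^esub> e i q) {..<m}))) \<longleftrightarrow>
     (\<exists>N. openin (topo X) N \<and> p \<in> N \<and> N \<subseteq> U \<inter> dom b \<and>
        (\<forall>i<r. (\<lambda>t. C (a + cscale t b) b (s (pt a b t)) i) holomorphic_on {t. pt a b t \<in> N}))"
    if p: "p \<in> U" and ab: "\<omega> a b \<noteq> 0" "p \<in> dom b" and s: "\<And>q. q \<in> U \<Longrightarrow> s q \<in> carrier (F q)" for p a b s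
  proof -
    have "(\<exists>N. openin (topo X) N \<and> p \<in> N \<and> N \<subseteq> U \<and>
         (\<exists>(m::nat) f e. (\<forall>i<m. f i \<in> hol X N \<and> e i \<in> gen N) \<and>
           (\<forall>q\<in>N. s q = finsum (F q) (\<lambda>i. f i q \<odot>\<^bsub>F q\<^esub> e i q) {..<m}))) \<longleftrightarrow>
      (\<exists>N. openin (topo X) N \<and> p \<in> N \<and> N \<subseteq> U \<inter> dom b \<and> (\<forall>i<r. (\<lambda>q\<in>N. K a b q (s q) i) \<in> hol X N))"
    proof (rule local_span_coords[OF function_algebra_X U p opdom[OF ab(1)] ab(2)])
      show "coords (F q) r (K a b q)" if "q \<in> dom b" for q by (rule K[OF ab(1) that])
      show "s q \<in> carrier (F q)" if "q \<in> U" for q by (rule s[OF that])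
      show "e q \<in> carrier (F q)" if "openin (topo X) N" "e \<in> gen N" "q \<in> N" for N e q by (rule gen(1)[OF that])
    next
      fix N e i assume N: "openin (topo X) N" "e \<in> gen N" "i < r"
      have "(\<lambda>t. C (a + cscale t b) b (e (pt a b t)) i) holomorphic_on {t. pt a b t \<in> N \<inter> dom b}"
        by (rule holomorphic_on_subset[OF gen(2)[OF N(1,2) ab(1) N(3)]]) auto
      then show "(\<lambda>q\<in>N \<inter> dom b. K a b q (e q) i) \<in> hol X (N \<inter> dom b)"
        using hol_iff[OF ab(1), of "N \<inter> dom b"] N opdom[OF ab(1)] by auto
    next
      fix N j assume N: "openin (topo X) N" "N \<subseteq> dom b" "j < r"
      obtain e where e: "e \<in> gen N" "\<And>t. pt a b t \<in> N \<Longrightarrow> C (a + cscale t b) b (e (pt a b t)) = unit_seq j"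
        using dual[OF N(1) ab(1) N(2,3)] by blast
      have "K a b q (e q) = unit_seq j" if "q \<in> N" for q
        using e(2)[of "chart a b q"] pt_chart[OF ab(1), of q] that N(2) by (auto simp: K_def)
      then show "\<exists>e\<in>gen N. \<forall>q\<in>N. K a b q (e q) = unit_seq j" using e(1) by blast
    qed
    moreover have "(openin (topo X) N \<and> p \<in> N \<and> N \<subseteq> U \<inter> dom b \<and> (\<forall>i<r. (\<lambda>q\<in>N. K a b q (s q) i) \<in> hol X N)) \<longleftrightarrow>
      (openin (topo X) N \<and> p \<in> N \<and> N \<subseteq> U \<inter> dom b \<and>
        (\<forall>i<r. (\<lambda>t. C (a + cscale t b) b (s (pt a b t)) i) holomorphic_on {t. pt a b t \<in> N}))" for N
    proof (intro conj_cong refl all_cong)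
      fix i assume "openin (topo X) N" "N \<subseteq> U \<inter> dom b"
      then show "(\<lambda>q\<in>N. K a b q (s q) i) \<in> hol X N \<longleftrightarrow>
        (\<lambda>t. C (a + cscale t b) b (s (pt a b t)) i) holomorphic_on {t. pt a b t \<in> N}"
        by (intro hol_iff ab) auto
    qed
    ultimately show ?thesis by presburger
  qed
  show ?thesis
  proof (intro equalityI subsetI)
    fix s assume s: "s \<in> local_span X F gen U"
    show "s \<in> holomorphic_sections F r C U"
    proof (rule holomorphic_sectionsI)
      fix a b i assume ab: "\<omega> a b \<noteq> 0" and i: "i < r"
      show "(\<lambda>t. C (a + cscale t b) b (s (pt a b t)) i) holomorphic_on {t. pt a b t \<in> U}"
      proof (subst holomorphic_on_open[OF openin_X_open[OF U ab]], intro ballI)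
        fix t assume "t \<in> {t. pt a b t \<in> U}"
        then have t: "pt a b t \<in> U" by simp
        have "\<exists>N. openin (topo X) N \<and> pt a b t \<in> N \<and> N \<subseteq> U \<inter> dom b \<and>
          (\<forall>i<r. (\<lambda>t. C (a + cscale t b) b (s (pt a b t)) i) holomorphic_on {t. pt a b t \<in> N})"
          by (rule iffD1[OF key[OF t ab pt_in_dom[OF ab]]]) (use s t in \<open>auto simp: local_span_def\<close>)
        then obtain N where N: "openin (topo X) N" "pt a b t \<in> N"
          "(\<lambda>t. C (a + cscale t b) b (s (pt a b t)) i) holomorphic_on {t. pt a b t \<in> N}" using i by blast
        then show "\<exists>f'. ((\<lambda>t. C (a + cscale t b) b (s (pt a b t)) i) has_field_derivative f') (at t)"
          using holomorphic_on_open[OF openin_X_open[OF N(1) ab]] by blast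
      qed
    qed (use s in \<open>auto simp: local_span_def\<close>)
  next
    fix s assume s: "s \<in> holomorphic_sections F r C U"
    note sD = holomorphic_sectionsD[OF s]
    show "s \<in> local_span X F gen U" unfolding local_span_def
    proof (intro CollectI conjI ballI sD)
      fix p assume p: "p \<in> U"
      then obtain a where a: "a \<noteq> 0" "p = ln a" using openin_X_sub[OF U] by (auto simp: lines_eq)
      obtain b where ab: "\<omega> a b \<noteq> 0" using ex_frame[OF a(1)] by blast
      have pd: "p \<in> dom b" using a ab ln_in_dom by simp
      show "\<exists>N. openin (topo X) N \<and> p \<in> N \<and> N \<subseteq> U \<and>
         (\<exists>(m::nat) f e. (\<forall>i<m. f i \<in> hol X N \<and> e i \<in> gen N) \<and>
           (\<forall>q\<in>N. s q = finsum (F q) (\<lambda>i. f i q \<odot>\<^bsub>F q\<^esub> e i q) {..<m}))"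
      proof (rule iffD2[OF key[OF p ab pd]], rule sD, assumption)
        show "\<exists>N. openin (topo X) N \<and> p \<in> N \<and> N \<subseteq> U \<inter> dom b \<and>
          (\<forall>i<r. (\<lambda>t. C (a + cscale t b) b (s (pt a b t)) i) holomorphic_on {t. pt a b t \<in> N})"
        proof (intro exI[of _ "U \<inter> dom b"] conjI allI impI)
          fix i assume "i < r"
          show "(\<lambda>t. C (a + cscale t b) b (s (pt a b t)) i) holomorphic_on {t. pt a b t \<in> U \<inter> dom b}"
            by (rule holomorphic_on_subset[OF sD(3)[OF ab \<open>i < r\<close>]]) auto
        qed (use U opdom[OF ab] p pd in auto)
      qed
    qed
  qed
qed

context
  fixes E :: "('v set, 'a, 'v \<Rightarrow> 'v) vbundle" and r e \<kappa> C
  assumes hom: "homogeneous E r e \<kappa> C"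
begin

lemma hom_coords: "\<omega> v u \<noteq> 0 \<Longrightarrow> coords (fibre E (ln v)) r (C v u)"
  by (rule hom[unfolded homogeneous_def, THEN conjunct1, rule_format])

lemma hom_sects: "openin (topo X) U \<Longrightarrow> sects E U = holomorphic_sections (fibre E) r C U"
  by (rule hom[unfolded homogeneous_def, THEN conjunct2, THEN conjunct1, rule_format])

lemma hom_act:
  assumes "g \<in> SL cscale" "\<omega> v u \<noteq> 0" "x \<in> carrier (fibre E (ln v))"
  shows "act E g (ln v) x \<in> carrier (fibre E (ln (g v)))" "C (g v) (g u) (act E g (ln v) x) = C v u x"
  using hom[unfolded homogeneous_def, THEN conjunct2, THEN conjunct2, THEN conjunct1, rule_format, OF assms]
  by blast+

lemma hom_law:
  assumes "\<omega> v u \<noteq> 0" "l \<noteq> 0" "\<nu> \<noteq> 0" "i < r" "x \<in> carrier (fibre E (ln v))"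
  shows "C (cscale l v) (cscale \<nu> u + cscale \<mu> v) x i =
        (\<Sum>j\<le>i. \<kappa> i j * \<nu> ^ j * \<mu> ^ (i - j) * l powi (e - int i) * C v u x j)"
  by (rule hom[unfolded homogeneous_def, THEN conjunct2, THEN conjunct2, THEN conjunct2, rule_format, OF assms])

lemma hom_coords_pt: "\<omega> a b \<noteq> 0 \<Longrightarrow> coords (fibre E (pt a b t)) r (C (a + cscale t b) b)"
  unfolding pt_def by (rule hom_coords) (simp add: \<omega>_pt)

text \<open>
  The transformation law has holomorphic coefficients along the frames of two charts, so it makes it
  enough to test holomorphy in one chart.
\<close>

lemma hom_section_one_chart:
  assumes ab: "\<omega> a b \<noteq> 0" and U: "openin (topo X) U" "U \<subseteq> dom b"
    and s: "s \<in> extensional U" "\<And>p. p \<in> U \<Longrightarrow> s p \<in> carrier (fibre E p)"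
    and hol: "\<And>i. i < r \<Longrightarrow> (\<lambda>t. C (a + cscale t b) b (s (pt a b t)) i) holomorphic_on {t. pt a b t \<in> U}"
  shows "s \<in> sects E U"
  unfolding hom_sects[OF U(1)]
proof (rule holomorphic_sectionsI[OF s])
  fix c d i assume cd: "\<omega> c d \<noteq> 0" and i: "i < r"
  define T where "T = (\<lambda>z. affine_coord a b (c + cscale z d))"
  define L where "L = (\<lambda>z. \<omega> (c + cscale z d) b / \<omega> a b)"
  define V where "V = (\<lambda>z. (\<omega> a d + T z * \<omega> b d) / \<omega> a b)"
  let ?S = "{z. pt c d z \<in> U}"
  have tr: "\<omega> (c + cscale z d) b \<noteq> 0" "pt c d z = pt a b (T z)" if "z \<in> ?S" for z
    using pt_transition[OF ab cd] that U(2) unfolding T_def by blast+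
  have T: "T holomorphic_on ?S" unfolding T_def
    by (rule holomorphic_on_subset[OF holomorphic_transition]) (use tr in blast)
  have L: "L holomorphic_on ?S" unfolding L_def \<omega>_simps by (intro holomorphic_intros) (use ab in auto)
  have V: "V holomorphic_on ?S" unfolding V_def by (intro holomorphic_intros T) (use ab in auto)
  have Lnz: "L z \<noteq> 0" if "z \<in> ?S" for z using tr(1)[OF that] ab by (simp add: L_def)
  have comp: "(\<lambda>z. C (a + cscale (T z) b) b (s (pt a b (T z))) j) holomorphic_on ?S" if "j < r" for j
    by (rule holomorphic_on_compose_gen[OF T hol[OF that], unfolded o_def]) (use tr(2) in force)
  have "(\<lambda>z. \<Sum>j\<le>i. \<kappa> i j * V z ^ j * (\<omega> d b / \<omega> a b) ^ (i - j) * L z powi (e - int i) *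
      C (a + cscale (T z) b) b (s (pt a b (T z))) j) holomorphic_on ?S"
    by (intro holomorphic_intros V L comp) (use Lnz i in auto)
  then show "(\<lambda>t. C (c + cscale t d) d (s (pt c d t)) i) holomorphic_on ?S"
  proof (rule holomorphic_transform)
    fix z assume z: "z \<in> ?S"
    let ?y = "a + cscale (T z) b"
    have fc: "c + cscale z d = cscale (L z) ?y" "d = cscale (V z) b + cscale (\<omega> d b / \<omega> a b) ?y" "V z \<noteq> 0"
      unfolding L_def V_def T_def by (rule frame_change[OF ab cd tr(1)[OF z]])+
    have x: "s (pt c d z) \<in> carrier (fibre E (ln ?y))"
      using s(2) z tr(2)[OF z] by (simp add: pt_def[of a b, symmetric])
    have "C (cscale (L z) ?y) (cscale (V z) b + cscale (\<omega> d b / \<omega> a b) ?y) (s (pt c d z)) i =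
       (\<Sum>j\<le>i. \<kappa> i j * V z ^ j * (\<omega> d b / \<omega> a b) ^ (i - j) * L z powi (e - int i) * C ?y b (s (pt c d z)) j)"
      by (rule hom_law[OF _ Lnz[OF z] fc(3) i x]) (simp add: \<omega>_pt ab)
    then show "(\<Sum>j\<le>i. \<kappa> i j * V z ^ j * (\<omega> d b / \<omega> a b) ^ (i - j) * L z powi (e - int i) *
      C ?y b (s (pt a b (T z))) j) = C (c + cscale z d) d (s (pt c d z)) i"
      unfolding fc(1)[symmetric] fc(2)[symmetric] using tr(2)[OF z] by simp
  qed
qed

lemma hom_section_of_coords:
  assumes ab: "\<omega> a b \<noteq> 0" and U: "openin (topo X) U" "U \<subseteq> dom b"
    and f: "\<And>t. f t \<in> seqs r" "\<And>i. i < r \<Longrightarrow> (\<lambda>t. f t i) holomorphic_on {t. pt a b t \<in> U}"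
  obtains s where "s \<in> sects E U" "\<And>t. pt a b t \<in> U \<Longrightarrow> C (a + cscale t b) b (s (pt a b t)) = f t"
proof -
  define s where "s = (\<lambda>q\<in>U. from_coords (fibre E q) (C (a + cscale (chart a b q) b) b) (f (chart a b q)))"
  have s: "s (pt a b t) \<in> carrier (fibre E (pt a b t)) \<and> C (a + cscale t b) b (s (pt a b t)) = f t"
    if "pt a b t \<in> U" for t
    using from_coords[OF hom_coords_pt[OF ab] f(1)] that by (simp add: s_def chart_pt[OF ab])
  have "s \<in> sects E U"
  proof (rule hom_section_one_chart[OF ab U])
    show "s p \<in> carrier (fibre E p)" if "p \<in> U" for p
      using s[of "chart a b p"] pt_chart[OF ab, of p] that U(2) by auto
    show "(\<lambda>t. C (a + cscale t b) b (s (pt a b t)) i) holomorphic_on {t. pt a b t \<in> U}" if "i < r" for i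
      by (rule holomorphic_transform[OF f(2)[OF that]]) (use s in auto)
  qed (simp add: s_def)
  then show ?thesis using that s by blast
qed

end

end

text \<open>
  A linear relation between two coordinate systems needs to be checked on generators only.
\<close>

lemma free_coord_linear:
  assumes h: "free_coords S R r h" and h': "free_coords S R r' h'"
    and w: "w \<in> carrier (quotient_module (free_module S) (free_span R))"
    and eq: "\<And>s. s \<in> S \<Longrightarrow> h' i s = (\<Sum>j\<in>J. c j * h j s)"
  shows "free_coord h' w i = (\<Sum>j\<in>J. c j * free_coord h w j)"
proof -
  obtain x where x: "x \<in> carrier (free_module S)" "w = free_span R +>\<^bsub>free_module S\<^esub> x"
    using w unfolding free_coords_carrier[OF h] by blast
  have "free_eval (h' i) x = (\<Sum>s\<in>Poly_Mapping.keys x. \<Sum>j\<in>J. c j * (Poly_Mapping.lookup x s * h j s))"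
    unfolding free_eval_def
    by (rule sum.cong) (use x eq in \<open>auto simp: free_module_def sum_distrib_left mult_ac\<close>)
  also have "\<dots> = (\<Sum>j\<in>J. c j * free_eval (h j) x)"
    unfolding free_eval_def by (subst sum.swap) (simp add: sum_distrib_left)
  finally show ?thesis
    unfolding x(2) free_coord_coset[OF h x(1)] free_coord_coset[OF h' x(1)] .
qed

context plane
begin

section \<open>The line bundles and the trivial bundles\<close>

subsection \<open>The special linear group\<close>

lemma SL_linear:
  assumes "g \<in> SL cscale"
  shows "g (x + y) = g x + g y" "g (cscale c x) = cscale c (g x)" "bij g"
proof -
  interpret Vector_Spaces.linear cscale cscale g using assms by (simp add: SL_def)
  show "g (x + y) = g x + g y" "g (cscale c x) = cscale c (g x)" by (rule add, rule scale)
  show "bij g" using assms by (simp add: SL_def)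
qed

text \<open>
  The form is a linear function on the exterior square, on which the group acts trivially. It is
  evaluated on two representatives of one vector of the exterior square.
\<close>

lemma SL_\<omega>:
  assumes g: "g \<in> SL cscale"
  shows "\<omega> (g u) (g v) = \<omega> u v"
proof -
  let ?V = "vector_module cscale" and ?S = "tuples (vector_module cscale) 2"
  let ?R = "multilinear_relations ?V 2 \<union> alternating_relations ?V 2"
  define h where "h = (\<lambda>xs. \<omega> (xs ! 0) (xs ! 1))"
  have len: "xs = [xs ! 0, xs ! 1]" if "xs \<in> ?S" for xs :: "'v list"
    using that by (auto simp: tuples_def vector_module_def length_Suc_conv numeral_2_eq_2)
  have "free_eval h x = 0" if "x \<in> multilinear_relations ?V 2" for x
  proof (rule multilinear_relations_eval[OF _ _ that])
    fix xs u v c and i :: nat assume xs: "xs \<in> ?S" "i < 2"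
    have i: "i = 0 \<or> i = 1" using xs by auto
    show "h (xs[i := u \<oplus>\<^bsub>?V\<^esub> v]) = h (xs[i := u]) + h (xs[i := v])"
      by (subst (1 2 3) len[OF xs(1)]) (use i in \<open>auto simp: h_def vector_module_def \<omega>_simps\<close>)
    show "h (xs[i := c \<odot>\<^bsub>?V\<^esub> u]) = c * h (xs[i := u])"
      by (subst (1 2) len[OF xs(1)]) (use i in \<open>auto simp: h_def vector_module_def \<omega>_simps\<close>)
  qed
  moreover have "free_eval h x = 0" if x: "x \<in> alternating_relations ?V 2" for x
  proof -
    obtain xs where xs: "x = free_gen xs" "xs \<in> ?S" "\<not> distinct xs"
      using x unfolding alternating_relations_def by blast
    then have "xs ! 0 = xs ! 1" using len[OF xs(2)] by (metis distinct_length_2_or_more distinct_singleton)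
    then show ?thesis using xs by (simp add: free_eval_single h_def \<omega>_self)
  qed
  ultimately have R0: "free_eval h x = 0" if "x \<in> ?R" for x using that by blast
  have van: "free_eval h x = 0" if "x \<in> free_span ?R" for x
    by (rule free.span_induct[OF that]) (auto simp: free.subspace_def R0 free_eval_add free_eval_scale free_eval_0)
  define w where "w = (\<lambda>k. k + free_gen [u, v]) ` free_span ?R"
  have "free_gen [u, v] \<in> carrier (free_module ?S)"
    by (rule gen_in_free_carrier) (auto simp: tuples_def vector_module_def)
  then have "w \<in> carrier (ext_power ?V 2)"
    unfolding ext_power_def quotient_module_def ext_power_kernel_def A_RCOSETS_def' w_def free_coset
    by auto
  then have fix_w: "ext_power_map g ?V 2 w = w" using g by (simp add: SL_def)
  have "free_gen [u, v] \<in> w" unfolding w_def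
    by (intro image_eqI[of _ _ 0]) (auto simp: free.span_zero)
  then have "free_map (map g) (free_gen [u, v]) + 0 \<in> ext_power_map g ?V 2 w"
    unfolding ext_power_map_def quotient_map_def free_set_add ext_power_kernel_def
    using free.span_zero by blast
  then have "free_gen [g u, g v] \<in> w" using fix_w by (simp add: free_map_def)
  then obtain k where "k \<in> free_span ?R" "free_gen [g u, g v] = k + free_gen [u, v]" unfolding w_def by blast
  then have "free_eval h (free_gen [g u, g v]) = free_eval h (free_gen [u, v])"
    using van by (simp add: free_eval_add)
  then show ?thesis by (simp add: free_eval_single h_def)
qed

lemma move_X: "move X g = proj_act g" and move_X2: "move X2 g = map_prod (proj_act g) (proj_act g)"
  by (simp_all add: proj_def surface_def surface_square_def)

lemma proj_act_ln: "g \<in> SL cscale \<Longrightarrow> proj_act g (ln v) = ln (g v)"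
  by (simp add: proj_act_def ln_def image_image SL_linear)

lemma SL_frame: "g \<in> SL cscale \<Longrightarrow> \<omega> v u \<noteq> 0 \<Longrightarrow> \<omega> (g v) (g u) \<noteq> 0"
  by (simp add: SL_\<omega>)

lemma frame_law: "\<omega> v u \<noteq> 0 \<Longrightarrow> l \<noteq> 0 \<Longrightarrow> \<nu> \<noteq> 0 \<Longrightarrow> \<omega> (cscale l v) (cscale \<nu> u + cscale \<mu> v) \<noteq> 0"
  by (simp add: \<omega>_simps)

lemma line_law:
  assumes "\<omega> v u \<noteq> 0" "l \<noteq> 0" "\<nu> \<noteq> 0" "homogeneous E 1 e (\<lambda>_ _. 1) C" "x \<in> carrier (fibre E (ln v))"
  shows "C (cscale l v) (cscale \<nu> u + cscale \<mu> v) x 0 = l powi e * C v u x 0"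
  using hom_law[OF assms(4,1,2,3) _ assms(5), of 0 \<mu>] by simp

lemma SL_surj: "g \<in> SL cscale \<Longrightarrow> \<exists>x. g x = y"
  using SL_linear(3) by (metis bij_pointE)

lemma inj_proj_act: "g \<in> SL cscale \<Longrightarrow> proj_act g \<xi> = proj_act g \<eta> \<longleftrightarrow> \<xi> = \<eta>"
  unfolding proj_act_def using SL_linear(3) by (simp add: bij_is_inj inj_image_eq_iff)

lemma SL_pt: "g \<in> SL cscale \<Longrightarrow> proj_act g (pt a b t) = pt (g a) (g b) t"
  unfolding pt_def by (simp add: proj_act_ln SL_linear)

lemma openin_translate:
  assumes g: "g \<in> SL cscale" and U: "openin (topo X) U"
  shows "openin (topo X) (proj_act g ` U)"
  unfolding openin_X
proof (intro conjI allI impI)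
  show "proj_act g ` U \<subseteq> lines cscale"
  proof
    fix \<eta> assume "\<eta> \<in> proj_act g ` U"
    then obtain \<xi> where \<xi>: "\<xi> \<in> U" "\<eta> = proj_act g \<xi>" by blast
    then obtain v where v: "v \<noteq> 0" "\<xi> = ln v" using openin_X_sub[OF U] by (auto simp: lines_eq)
    obtain u where u: "\<omega> v u \<noteq> 0" using ex_frame[OF v(1)] by blast
    show "\<eta> \<in> lines cscale"
      using ln_in_lines[OF frame_nz(1)[OF SL_frame[OF g u]]] by (simp add: \<xi>(2) v(2) proj_act_ln[OF g])
  qed
  fix a b assume ab: "\<omega> a b \<noteq> 0"
  obtain a' b' where g': "g a' = a" "g b' = b" using SL_surj[OF g] by metis
  have "\<omega> a' b' \<noteq> 0" using ab SL_\<omega>[OF g, of a' b'] g' by simp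
  from openin_X_open[OF U this] have "open {t. pt a' b' t \<in> U}" .
  moreover have "pt a b t \<in> proj_act g ` U \<longleftrightarrow> pt a' b' t \<in> U" for t
    using SL_pt[OF g, of a' b' t] inj_proj_act[OF g] g' by (auto simp: image_iff)
  ultimately show "open {t. pt a b t \<in> proj_act g ` U}" by simp
qed

lemma translate_section_X:
  assumes "g \<in> SL cscale" "ln v \<in> U"
  shows "translate_section X E g U s (ln (g v)) = act E g (ln v) (s (ln v))"
proof -
  have "inj_on (move X g) U" by (rule inj_onI) (simp add: move_X inj_proj_act[OF assms(1)])
  then have "inv_into U (move X g) (ln (g v)) = ln v"
    using inv_into_f_f[of "move X g" U "ln v"] assms by (simp add: move_X proj_act_ln)
  moreover have "ln (g v) \<in> move X g ` U"
    using assms by (simp add: move_X proj_act_ln[symmetric])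
  ultimately show ?thesis by (simp add: translate_section_def Let_def)
qed

lemma inv_into_move_X2:
  assumes "g \<in> SL cscale" "q \<in> N"
  shows "inv_into N (move X2 g) (move X2 g q) = q"
proof (rule inv_into_f_f[OF _ assms(2)])
  show "inj_on (move X2 g) N"
    by (rule inj_onI) (auto simp: move_X2 inj_proj_act[OF assms(1)])
qed

subsection \<open>The line bundle of degree one\<close>

definition line_coord :: "'v \<Rightarrow> 'v \<Rightarrow> 'v set \<Rightarrow> nat \<Rightarrow> complex" where
  "line_coord v u = rep_coord (\<lambda>x. scalar_seq (\<omega> v x))"

lemma vector_coset: "\<xi> +>\<^bsub>vector_module cscale\<^esub> x = (\<lambda>h. h + x) ` \<xi>"
  by (auto simp: a_r_coset_def r_coset_def vector_module_def)

text \<open>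
  The fibre of \<open>L\<close> at the line of \<open>v\<close> is the quotient of the plane by the kernel of \<open>\<omega> v\<close>, so \<open>\<omega> v\<close>
  is a coordinate, of degree one in \<open>v\<close>.
\<close>

lemma line_fibre:
  assumes v: "\<omega> v u \<noteq> 0"
  shows "coords (fibre (line_bundle cscale) (ln v)) 1 (line_coord v u)"
    "carrier (fibre (line_bundle cscale) (ln v)) = range (\<lambda>x. ln v +>\<^bsub>vector_module cscale\<^esub> x)"
    "line_coord v u (ln v +>\<^bsub>vector_module cscale\<^esub> x) = scalar_seq (\<omega> v x)"
proof -
  interpret quotient_coords cscale UNIV "ln v" 1 "\<lambda>x. scalar_seq (\<omega> v x)"
  proof
    show "subspace (ln v)" by (simp add: ln_span subspace_span)
    show "x \<in> ln v \<longleftrightarrow> (\<forall>i. scalar_seq (\<omega> v x) i = 0)" for x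
      using in_ln_iff[of v x] frame_nz(1)[OF v] by (auto simp: scalar_seq_def)
    show "\<exists>x\<in>UNIV. scalar_seq (\<omega> v x) = f" if f: "f \<in> seqs 1" for f
    proof -
      obtain z where "f = scalar_seq z" using f unfolding seqs_1_eq by blast
      then show ?thesis by (intro bexI[of _ "cscale (z / \<omega> v u) u"]) (auto simp: \<omega>_simps v)
    qed
  qed (auto simp: scalar_seq_def \<omega>_simps)
  have tot: "vector_module cscale = total" by (simp add: vector_module_def)
  show "coords (fibre (line_bundle cscale) (ln v)) 1 (line_coord v u)"
    using coords_quotient by (simp add: line_bundle_def tot line_coord_def)
  show "carrier (fibre (line_bundle cscale) (ln v)) = range (\<lambda>x. ln v +>\<^bsub>vector_module cscale\<^esub> x)"
    using carrier_quotient unfolding a_r_coset_eq[symmetric] by (simp add: line_bundle_def tot)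
  show "line_coord v u (ln v +>\<^bsub>vector_module cscale\<^esub> x) = scalar_seq (\<omega> v x)"
    using rep_coord_coset unfolding a_r_coset_eq[symmetric] by (simp add: line_coord_def tot)
qed

lemma homogeneous_line_bundle: "homogeneous (line_bundle cscale) 1 1 (\<lambda>_ _. 1) line_coord"
proof (rule homogeneousI)
  let ?V = "vector_module cscale"
  fix v u assume vu: "\<omega> v u \<noteq> 0"
  show "coords (fibre (line_bundle cscale) (ln v)) 1 (line_coord v u)" by (rule line_fibre(1)[OF vu])
  fix g x assume g: "g \<in> SL cscale" and x: "x \<in> carrier (fibre (line_bundle cscale) (ln v))"
  obtain y where y: "x = ln v +>\<^bsub>?V\<^esub> y" using x unfolding line_fibre(2)[OF vu] by blast
  have "act (line_bundle cscale) g (ln v) x = {g (h + y) + k | h k. h \<in> ln v \<and> k \<in> ln (g v)}"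
    unfolding y vector_coset line_bundle_def quotient_map_def proj_act_ln[OF g]
    by (auto simp: set_add_def set_mult_def vector_module_def proj_act_ln[OF g])
  also have "\<dots> = (\<lambda>h. h + g y) ` ln (g v)"
  proof (intro equalityI subsetI)
    fix z assume "z \<in> {g (h + y) + k | h k. h \<in> ln v \<and> k \<in> ln (g v)}"
    then obtain h k where z: "z = (g h + k) + g y" "h \<in> ln v" "k \<in> ln (g v)"
      using SL_linear[OF g] by (auto simp: algebra_simps)
    have "g h \<in> ln (g v)" using z(2) proj_act_ln[OF g, of v] by (auto simp: proj_act_def)
    then have "g h + k \<in> ln (g v)" using z(3) by (simp add: ln_span span_add)
    then show "z \<in> (\<lambda>h. h + g y) ` ln (g v)" using z(1) by blast
  next
    fix z assume "z \<in> (\<lambda>h. h + g y) ` ln (g v)"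
    then obtain k where k: "k \<in> ln (g v)" "z = k + g y" by blast
    have "0 \<in> ln v" by (simp add: ln_span span_zero)
    moreover have "z = g (0 + y) + k" using k by (simp add: add.commute)
    ultimately show "z \<in> {g (h + y) + k | h k. h \<in> ln v \<and> k \<in> ln (g v)}" using k by blast
  qed
  finally have ax: "act (line_bundle cscale) g (ln v) x = ln (g v) +>\<^bsub>?V\<^esub> g y" by (simp add: vector_coset)
  show "act (line_bundle cscale) g (ln v) x \<in> carrier (fibre (line_bundle cscale) (ln (g v)))"
    unfolding ax line_fibre(2)[OF SL_frame[OF g vu]] by blast
  show "line_coord (g v) (g u) (act (line_bundle cscale) g (ln v) x) = line_coord v u x"
    unfolding ax unfolding y line_fibre(3)[OF vu] line_fibre(3)[OF SL_frame[OF g vu]] SL_\<omega>[OF g] ..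
next
  fix v u x and l \<mu> \<nu> :: complex and i :: nat
  assume a: "\<omega> v u \<noteq> 0" "l \<noteq> 0" "\<nu> \<noteq> 0" "i < 1" "x \<in> carrier (fibre (line_bundle cscale) (ln v))"
  obtain y where y: "x = ln v +>\<^bsub>vector_module cscale\<^esub> y" using a(5) unfolding line_fibre(2)[OF a(1)] by blast
  have "line_coord (cscale l v) (cscale \<nu> u + cscale \<mu> v) x = scalar_seq (\<omega> (cscale l v) y)"
    unfolding y using line_fibre(3)[OF frame_law[OF a(1-3)]] ln_scale[OF a(2)] by metis
  then show "line_coord (cscale l v) (cscale \<nu> u + cscale \<mu> v) x i =
      (\<Sum>j\<le>i. 1 * \<nu> ^ j * \<mu> ^ (i - j) * l powi (1 - int i) * line_coord v u x j)"
    unfolding y line_fibre(3)[OF a(1)] using a(4) by (simp add: scalar_seq_def \<omega>_simps)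
next
  fix U assume U: "openin (topo X) U"
  have line: "coords (fibre (line_bundle cscale) (ln v)) 1 (line_coord v u)" if "\<omega> v u \<noteq> 0" for v u
    by (rule line_fibre(1)[OF that])
  have val: "line_coord (a + cscale t b) b (pt a b t +>\<^bsub>vector_module cscale\<^esub> x) =
      scalar_seq (\<omega> (a + cscale t b) x)" if "\<omega> a b \<noteq> 0" for a b t x
    unfolding pt_def by (rule line_fibre(3)[of _ b]) (simp add: \<omega>_pt that)
  have sects: "sects (line_bundle cscale) U = local_span X (fibre (line_bundle cscale))
     (\<lambda>N. {\<lambda>\<xi>. \<xi> +>\<^bsub>vector_module cscale\<^esub> v | v. True}) U"
    by (simp add: line_bundle_def)
  show "sects (line_bundle cscale) U = holomorphic_sections (fibre (line_bundle cscale)) 1 line_coord U"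
    unfolding sects
  proof (rule local_span_eq_holomorphic_sections[OF U])
    show "coords (fibre (line_bundle cscale) (ln v)) 1 (line_coord v u)" if "\<omega> v u \<noteq> 0" for v u
      by (rule line[OF that])
  next
    fix N e q assume N: "openin (topo X) N" "e \<in> {\<lambda>\<xi>. \<xi> +>\<^bsub>vector_module cscale\<^esub> v | v. True}" "q \<in> N"
    then obtain w where w: "w \<noteq> 0" "q = ln w" using openin_X_sub[OF N(1)] by (auto simp: lines_eq)
    obtain u where "\<omega> w u \<noteq> 0" using ex_frame[OF w(1)] by blast
    then show "e q \<in> carrier (fibre (line_bundle cscale) q)" using N(2) line_fibre(2) w(2) by blast
  next
    fix N e a b and i :: nat
    assume e: "e \<in> {\<lambda>\<xi>. \<xi> +>\<^bsub>vector_module cscale\<^esub> v | v. True}" and ab: "\<omega> a b \<noteq> 0" and i: "i < 1"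
    obtain x where x: "e = (\<lambda>\<xi>. \<xi> +>\<^bsub>vector_module cscale\<^esub> x)" using e by blast
    have "(\<lambda>t. \<omega> a x + t * \<omega> b x) holomorphic_on {t. pt a b t \<in> N}" by (intro holomorphic_intros)
    then show "(\<lambda>t. line_coord (a + cscale t b) b (e (pt a b t)) i) holomorphic_on {t. pt a b t \<in> N}"
      by (rule holomorphic_transform) (use i in \<open>simp add: x val[OF ab] scalar_seq_def \<omega>_simps\<close>)
  next
    fix N a b and j :: nat assume ab: "\<omega> a b \<noteq> 0" and j: "j < 1"
    show "\<exists>e\<in>{\<lambda>\<xi>. \<xi> +>\<^bsub>vector_module cscale\<^esub> v | v. True}.
        \<forall>t. pt a b t \<in> N \<longrightarrow> line_coord (a + cscale t b) b (e (pt a b t)) = unit_seq j"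
      by (intro bexI[of _ "\<lambda>\<xi>. \<xi> +>\<^bsub>vector_module cscale\<^esub> cscale (1 / \<omega> a b) b"])
         (use ab j in \<open>auto simp: val[OF ab] \<omega>_simps scalar_seq_def unit_seq_def fun_eq_iff\<close>)
  qed
qed

subsection \<open>Powers of a line bundle\<close>

lemma holomorphic_on_prod_list:
  "(\<And>s. s \<in> set ss \<Longrightarrow> f s holomorphic_on A) \<Longrightarrow> (\<lambda>t. \<Prod>s\<leftarrow>ss. f s t) holomorphic_on A"
  by (induction ss) (auto intro!: holomorphic_intros)

lemma homogeneous_tensor_power:
  assumes E: "homogeneous E 1 e (\<lambda>_ _. 1) C"
  shows "homogeneous (tensor_power_bundle X E n) 1 (int n * e) (\<lambda>_ _. 1) (\<lambda>v u. tensor_power_coord (C v u))"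
proof (rule homogeneousI)
  fix v u assume vu: "\<omega> v u \<noteq> 0"
  note C = hom_coords[OF E vu]
  show "coords (fibre (tensor_power_bundle X E n) (ln v)) 1 (tensor_power_coord (C v u))"
    using tensor_power_coords[OF C] by (simp add: tensor_power_bundle_def)
  fix g x assume g: "g \<in> SL cscale" and x: "x \<in> carrier (fibre (tensor_power_bundle X E n) (ln v))"
  have 1: "act (tensor_power_bundle X E n) g (ln v) x = tensor_power_map (act E g (ln v)) (fibre E (ln (g v))) n x"
    by (simp add: tensor_power_bundle_def move_X proj_act_ln[OF g])
  note tm = tensor_power_map_coord[OF C hom_coords[OF E SL_frame[OF g vu]], of "act E g (ln v)" x n,
      OF hom_act(1)[OF E g vu] hom_act(2)[OF E g vu]]
  show "act (tensor_power_bundle X E n) g (ln v) x \<in> carrier (fibre (tensor_power_bundle X E n) (ln (g v)))"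
    unfolding 1 using tm(1) x by (simp add: tensor_power_bundle_def)
  show "tensor_power_coord (C (g v) (g u)) (act (tensor_power_bundle X E n) g (ln v) x) = tensor_power_coord (C v u) x"
    unfolding 1 using tm(2) x by (simp add: tensor_power_bundle_def)
next
  fix v u x and l \<mu> \<nu> :: complex and i :: nat
  assume a: "\<omega> v u \<noteq> 0" "l \<noteq> 0" "\<nu> \<noteq> 0" "i < 1" "x \<in> carrier (fibre (tensor_power_bundle X E n) (ln v))"
  let ?u = "cscale \<nu> u + cscale \<mu> v" and ?v = "cscale l v"
  have C': "coords (fibre E (ln v)) 1 (C ?v ?u)"
    using hom_coords[OF E frame_law[OF a(1-3), of \<mu>]] ln_scale[OF a(2), of v] by simp
  have "tensor_power_coord (C ?v ?u) x 0 = (\<Sum>j\<in>{0}. l powi (int n * e) * tensor_power_coord (C v u) x j)"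
    unfolding tensor_power_coord_def
  proof (rule free_coord_linear[OF tensor_power_free_coords[OF hom_coords[OF E a(1)]] tensor_power_free_coords[OF C']])
    show "x \<in> carrier (quotient_module (free_module (tuples (fibre E (ln v)) n))
        (free.span (multilinear_relations (fibre E (ln v)) n)))"
      using a(5) by (simp add: tensor_power_bundle_def tensor_power_def tensor_power_kernel_def)
    fix xs assume "xs \<in> tuples (fibre E (ln v)) n"
    then have xs: "set xs \<subseteq> carrier (fibre E (ln v))" "length xs = n" by (auto simp: tuples_def)
    have "(\<Prod>x\<leftarrow>xs. C ?v ?u x 0) = (l powi e) ^ length xs * (\<Prod>x\<leftarrow>xs. C v u x 0)"
      using xs(1) by (induction xs) (auto simp: line_law[OF a(1-3) E] mult_ac)
    then have "(\<Prod>x\<leftarrow>xs. C ?v ?u x 0) = l powi (int n * e) * (\<Prod>x\<leftarrow>xs. C v u x 0)"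
      by (simp add: xs(2) power_int_mult mult.commute[of "int n"])
    then show "scalar_seq (\<Prod>x\<leftarrow>xs. C ?v ?u x 0) 0 = (\<Sum>j\<in>{0}. l powi (int n * e) * scalar_seq (\<Prod>x\<leftarrow>xs. C v u x 0) j)"
      by (simp add: scalar_seq_def)
  qed
  then show "tensor_power_coord (C ?v ?u) x i =
      (\<Sum>j\<le>i. 1 * \<nu> ^ j * \<mu> ^ (i - j) * l powi (int n * e - int i) * tensor_power_coord (C v u) x j)"
    using a(4) by simp
next
  fix U assume U: "openin (topo X) U"
  have C: "coords (fibre (tensor_power_bundle X E n) (ln v)) 1 (tensor_power_coord (C v u))" if "\<omega> v u \<noteq> 0" for v u
    using tensor_power_coords[OF hom_coords[OF E that]] by (simp add: tensor_power_bundle_def)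
  let ?gen = "\<lambda>N. {\<lambda>q. tensor_of_list (fibre E q) n (map (\<lambda>s. s q) ss) | ss. length ss = n \<and> set ss \<subseteq> sects E N}"
  have sects: "sects (tensor_power_bundle X E n) U = local_span X (fibre (tensor_power_bundle X E n)) ?gen U"
    by (simp add: tensor_power_bundle_def)
  have fib: "fibre (tensor_power_bundle X E n) q = tensor_power (fibre E q) n" for q
    by (simp add: tensor_power_bundle_def)
  have car: "set (map (\<lambda>s. s q) ss) \<subseteq> carrier (fibre E q)" if "openin (topo X) N" "q \<in> N" "set ss \<subseteq> sects E N" for N q ss
  proof -
    have "s q \<in> carrier (fibre E q)" if "s \<in> set ss" for s
      using that \<open>set ss \<subseteq> sects E N\<close> holomorphic_sectionsD(2)[OF _ \<open>q \<in> N\<close>]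
      unfolding hom_sects[OF E \<open>openin (topo X) N\<close>] by blast
    then show ?thesis by auto
  qed
  show "sects (tensor_power_bundle X E n) U =
      holomorphic_sections (fibre (tensor_power_bundle X E n)) 1 (\<lambda>v u. tensor_power_coord (C v u)) U"
    unfolding sects
  proof (rule local_span_eq_holomorphic_sections[OF U])
    show "coords (fibre (tensor_power_bundle X E n) (ln v)) 1 (tensor_power_coord (C v u))" if "\<omega> v u \<noteq> 0" for v u
      by (rule C[OF that])
  next
    fix N e q assume N: "openin (topo X) N" "e \<in> ?gen N" "q \<in> N"
    then obtain ss where ss: "e = (\<lambda>q. tensor_of_list (fibre E q) n (map (\<lambda>s. s q) ss))" "length ss = n" "set ss \<subseteq> sects E N"
      by blast
    obtain w where w: "w \<noteq> 0" "q = ln w" using openin_X_sub[OF N(1)] N(3) by (auto simp: lines_eq)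
    obtain u where u: "\<omega> w u \<noteq> 0" using ex_frame[OF w(1)] by blast
    have "tensor_of_list (fibre E q) n (map (\<lambda>s. s q) ss) \<in> carrier (tensor_power (fibre E q) n)"
      by (rule tensor_of_list_coord(1)[OF hom_coords[OF E u, folded w(2)] car[OF N(1,3) ss(3)]]) (simp add: ss)
    then show "e q \<in> carrier (fibre (tensor_power_bundle X E n) q)" by (simp add: ss(1) fib)
  next
    fix N e a b and i :: nat
    assume N: "openin (topo X) N" and e: "e \<in> ?gen N" and ab: "\<omega> a b \<noteq> 0" and i: "i < 1"
    obtain ss where ss: "e = (\<lambda>q. tensor_of_list (fibre E q) n (map (\<lambda>s. s q) ss))" "length ss = n" "set ss \<subseteq> sects E N"
      using e by blast
    have "(\<lambda>t. \<Prod>s\<leftarrow>ss. C (a + cscale t b) b (s (pt a b t)) 0) holomorphic_on {t. pt a b t \<in> N}"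
    proof (rule holomorphic_on_prod_list)
      fix s assume "s \<in> set ss"
      then have "s \<in> holomorphic_sections (fibre E) 1 C N" using ss hom_sects[OF E N] by blast
      then show "(\<lambda>t. C (a + cscale t b) b (s (pt a b t)) 0) holomorphic_on {t. pt a b t \<in> N}"
        by (rule holomorphic_sectionsD(3)[OF _ ab]) simp
    qed
    then show "(\<lambda>t. tensor_power_coord (C (a + cscale t b) b) (e (pt a b t)) i) holomorphic_on {t. pt a b t \<in> N}"
    proof (rule holomorphic_transform)
      fix t assume t: "t \<in> {t. pt a b t \<in> N}"
      have "tensor_power_coord (C (a + cscale t b) b) (e (pt a b t)) =
          scalar_seq (\<Prod>x\<leftarrow>map (\<lambda>s. s (pt a b t)) ss. C (a + cscale t b) b x 0)"
        unfolding ss(1)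
        by (rule tensor_of_list_coord(2)[OF hom_coords_pt[OF E ab] car[OF N _ ss(3)]]) (use t ss in auto)
      then show "(\<Prod>s\<leftarrow>ss. C (a + cscale t b) b (s (pt a b t)) 0) = tensor_power_coord (C (a + cscale t b) b) (e (pt a b t)) i"
        using i by (simp add: scalar_seq_def o_def)
    qed
  next
    fix N a b and j :: nat assume N: "openin (topo X) N" and ab: "\<omega> a b \<noteq> 0" "N \<subseteq> dom b" and j: "j < 1"
    obtain s where s: "s \<in> sects E N" "\<And>t. pt a b t \<in> N \<Longrightarrow> C (a + cscale t b) b (s (pt a b t)) = unit_seq 0"
      using hom_section_of_coords[OF E ab(1) N ab(2), of "\<lambda>t. unit_seq 0"] unit_seq_in_seqs[of 0 1]
      by (auto simp: unit_seq_def)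
    show "\<exists>e\<in>?gen N. \<forall>t. pt a b t \<in> N \<longrightarrow> tensor_power_coord (C (a + cscale t b) b) (e (pt a b t)) = unit_seq j"
    proof (intro bexI allI impI)
      show "(\<lambda>q. tensor_of_list (fibre E q) n (map (\<lambda>s. s q) (replicate n s))) \<in> ?gen N"
        using s(1) by (intro CollectI exI[of _ "replicate n s"]) auto
      fix t assume t: "pt a b t \<in> N"
      have "tensor_power_coord (C (a + cscale t b) b) (tensor_of_list (fibre E (pt a b t)) n (map (\<lambda>s. s (pt a b t)) (replicate n s)))
         = scalar_seq (\<Prod>x\<leftarrow>map (\<lambda>s. s (pt a b t)) (replicate n s). C (a + cscale t b) b x 0)"
        by (rule tensor_of_list_coord(2)[OF hom_coords_pt[OF E ab(1)] car[OF N t]]) (use s in auto)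
      then show "tensor_power_coord (C (a + cscale t b) b) (tensor_of_list (fibre E (pt a b t)) n (map (\<lambda>s. s (pt a b t)) (replicate n s))) = unit_seq j"
        using s(2)[OF t] j by (auto simp: unit_seq_def scalar_seq_def fun_eq_iff)
    qed
  qed
qed

lemma homogeneous_structure_bundle:
  "homogeneous (structure_bundle X) 1 0 (\<lambda>_ _. 1) (\<lambda>v u. scalar_seq)"
proof (rule homogeneousI)
  have fib: "fibre (structure_bundle X) q = scalar_module" for q
    by (simp add: structure_bundle_def trivial_bundle_def)
  have car: "carrier scalar_module = UNIV" by (simp add: scalar_module_def vector_module_def)
  show "coords (fibre (structure_bundle X) (ln v)) 1 scalar_seq" for v
    unfolding fib by (rule scalar_module_coords)
  fix U assume U: "openin (topo X) U"
  have "sects (structure_bundle X) U = local_span X (fibre (structure_bundle X)) (\<lambda>N. {\<lambda>q. w | w. w \<in> UNIV}) U"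
    by (simp add: structure_bundle_def trivial_bundle_def car)
  also have "\<dots> = holomorphic_sections (fibre (structure_bundle X)) 1 (\<lambda>v u. scalar_seq) U"
  proof (rule local_span_eq_holomorphic_sections[OF U])
    show "\<exists>e\<in>{\<lambda>q. w |w. w \<in> UNIV}. \<forall>t. pt a b t \<in> N \<longrightarrow> scalar_seq (e (pt a b t)) = unit_seq j"
      if "j < 1" for j N a b
      by (intro bexI[of _ "\<lambda>q. 1"]) (use that in \<open>auto simp: scalar_seq_def unit_seq_def fun_eq_iff\<close>)
  qed (auto simp: fib car scalar_module_coords[unfolded One_nat_def])
  finally show "sects (structure_bundle X) U = \<dots>" .
qed (auto simp: structure_bundle_def trivial_bundle_def scalar_module_def vector_module_def)

text \<open>
  The coordinate of a functional is its value on the basis vector dual to the coordinate of the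
  fibre, so it has the opposite degree.
\<close>

lemma homogeneous_dual:
  assumes E: "homogeneous E 1 e (\<lambda>_ _. 1) C"
  shows "homogeneous (dual_bundle X E) 1 (- e) (\<lambda>_ _. 1) (\<lambda>v u. dual_coord (fibre E (ln v)) (C v u))"
proof (rule homogeneousI)
  have fib: "fibre (dual_bundle X E) q = dual_module (fibre E q)" for q by (simp add: dual_bundle_def)
  fix v u assume vu: "\<omega> v u \<noteq> 0"
  note C = hom_coords[OF E vu]
  show "coords (fibre (dual_bundle X E) (ln v)) 1 (dual_coord (fibre E (ln v)) (C v u))"
    unfolding fib by (rule dual_coords[OF C])
  fix g \<phi> assume g: "g \<in> SL cscale" and \<phi>: "\<phi> \<in> carrier (fibre (dual_bundle X E) (ln v))"
  let ?F = "fibre E (ln v)" and ?G = "fibre E (ln (g v))" and ?C = "C (g v) (g u)"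
  define a where "a = act E g (ln v)"
  define \<psi> where "\<psi> = act (dual_bundle X E) g (ln v) \<phi>"
  note C' = hom_coords[OF E SL_frame[OF g vu]]
  have \<psi>: "\<psi> = (\<lambda>y\<in>carrier ?G. \<phi> (inv_into (carrier ?F) a y))"
    by (simp add: \<psi>_def a_def dual_bundle_def move_X proj_act_ln[OF g])
  have "\<psi> y = ?C y 0 * dual_coord ?F (C v u) \<phi> 0" if y: "y \<in> carrier ?G" for y
  proof -
    define x where "x = from_coords ?F (C v u) (?C y)"
    have x: "x \<in> carrier ?F" "C v u x = ?C y"
      using from_coords[OF C coords_seqs[OF C' y]] by (simp_all add: x_def)
    have "a x = y"
      by (rule coords_eqI[OF C']) (use hom_act[OF E g vu x(1)] x y in \<open>auto simp: a_def\<close>)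
    then have "y \<in> a ` carrier ?F" using x by blast
    then have i: "inv_into (carrier ?F) a y \<in> carrier ?F" "a (inv_into (carrier ?F) a y) = y"
      by (auto intro: inv_into_into f_inv_into_f)
    have "C v u (inv_into (carrier ?F) a y) = ?C y"
      using hom_act(2)[OF E g vu i(1)] i(2) by (simp add: a_def)
    then show ?thesis using dual_pairing[OF C _ i(1), of \<phi>] \<phi> y by (simp add: \<psi> fib)
  qed
  then have \<psi>': "\<psi> = (\<lambda>y\<in>carrier ?G. ?C y 0 * dual_coord ?F (C v u) \<phi> 0)"
    unfolding \<psi> by (auto simp: restrict_def fun_eq_iff)
  show "act (dual_bundle X E) g (ln v) \<phi> \<in> carrier (fibre (dual_bundle X E) (ln (g v)))"
    unfolding fib \<psi>_def[symmetric] unfolding \<psi>'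
    by (auto simp: dual_module_def coords_add[OF C'] coords_smult[OF C'] distrib_right)
  have "dual_coord ?G ?C \<psi> = scalar_seq (?C (from_coords ?G ?C (unit_seq 0)) 0 * dual_coord ?F (C v u) \<phi> 0)"
    using from_coords(1)[OF C' unit_seq_in_seqs[of 0]] unfolding \<psi>' by (simp add: dual_coord_def)
  also have "\<dots> = scalar_seq (dual_coord ?F (C v u) \<phi> 0)"
    using from_coords(2)[OF C' unit_seq_in_seqs[of 0]] by (simp add: unit_seq_def)
  also have "\<dots> = dual_coord ?F (C v u) \<phi>" by (simp add: dual_coord_def scalar_seq_def)
  finally show "dual_coord ?G ?C (act (dual_bundle X E) g (ln v) \<phi>) = dual_coord ?F (C v u) \<phi>"
    by (simp add: \<psi>_def)
next
  fix v u \<phi> and l \<mu> \<nu> :: complex and i :: nat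
  assume a: "\<omega> v u \<noteq> 0" "l \<noteq> 0" "\<nu> \<noteq> 0" "i < 1" "\<phi> \<in> carrier (fibre (dual_bundle X E) (ln v))"
  let ?u = "cscale \<nu> u + cscale \<mu> v" and ?v = "cscale l v" and ?F = "fibre E (ln v)"
  have ln: "ln ?v = ln v" by (rule ln_scale[OF a(2)])
  note C = hom_coords[OF E a(1)]
  have C': "coords ?F 1 (C ?v ?u)" using hom_coords[OF E frame_law[OF a(1-3), of \<mu>]] ln by simp
  define x where "x = from_coords ?F (C v u) (unit_seq 0)"
  have x: "x \<in> carrier ?F" "C v u x 0 = 1"
    using from_coords[OF C unit_seq_in_seqs[of 0]] by (auto simp: x_def unit_seq_def)
  have \<phi>: "\<phi> \<in> carrier (dual_module ?F)" using a(5) by (simp add: dual_bundle_def)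
  have "dual_coord ?F (C v u) \<phi> 0 = \<phi> x" using dual_pairing[OF C \<phi> x(1)] x by simp
  also have "\<dots> = l powi e * dual_coord ?F (C ?v ?u) \<phi> 0"
    using dual_pairing[OF C' \<phi> x(1)] line_law[OF a(1-3) E x(1)] x by simp
  finally show "dual_coord (fibre E (ln ?v)) (C ?v ?u) \<phi> i =
      (\<Sum>j\<le>i. 1 * \<nu> ^ j * \<mu> ^ (i - j) * l powi (- e - int i) * dual_coord ?F (C v u) \<phi> j)"
    using a(2,4) by (simp add: ln power_int_minus field_simps)
next
  have fib: "fibre (dual_bundle X E) q = dual_module (fibre E q)" for q by (simp add: dual_bundle_def)
  have lnpt: "fibre E (ln (a + cscale t b)) = fibre E (pt a b t)" for a b t by (simp add: pt_def)
  fix U assume U: "openin (topo X) U"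
  show "sects (dual_bundle X E) U =
      holomorphic_sections (fibre (dual_bundle X E)) 1 (\<lambda>v u. dual_coord (fibre E (ln v)) (C v u)) U"
  proof (intro equalityI subsetI)
    fix \<phi> assume "\<phi> \<in> sects (dual_bundle X E) U"
    then have \<phi>: "\<phi> \<in> extensional U" "\<And>p. p \<in> U \<Longrightarrow> \<phi> p \<in> carrier (dual_module (fibre E p))"
      "\<And>N s. openin (topo X) N \<Longrightarrow> N \<subseteq> U \<Longrightarrow> s \<in> sects E N \<Longrightarrow> (\<lambda>q\<in>N. \<phi> q (s q)) \<in> hol X N"
      by (auto simp: dual_bundle_def)
    show "\<phi> \<in> holomorphic_sections (fibre (dual_bundle X E)) 1 (\<lambda>v u. dual_coord (fibre E (ln v)) (C v u)) U"
    proof (rule holomorphic_sectionsI)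
      fix a b and i :: nat assume ab: "\<omega> a b \<noteq> 0" and i: "i < 1"
      let ?N = "U \<inter> dom b"
      have N: "openin (topo X) ?N" using U openin_dom frame_nz(2)[OF ab] by blast
      obtain s where s: "s \<in> sects E ?N" "\<And>t. pt a b t \<in> ?N \<Longrightarrow> C (a + cscale t b) b (s (pt a b t)) = unit_seq 0"
        using hom_section_of_coords[OF E ab N _ , of "\<lambda>t. unit_seq 0"] unit_seq_in_seqs[of 0 1]
        by (auto simp: unit_seq_def)
      have "(\<lambda>t. (\<lambda>q\<in>?N. \<phi> q (s q)) (pt a b t)) holomorphic_on {t. pt a b t \<in> ?N}"
        by (rule hol_XD[OF \<phi>(3)[OF N _ s(1)] ab]) simp
      moreover have eq: "{t. pt a b t \<in> ?N} = {t. pt a b t \<in> U}" using pt_in_dom[OF ab] by auto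
      ultimately have "(\<lambda>t. (\<lambda>q\<in>?N. \<phi> q (s q)) (pt a b t)) holomorphic_on {t. pt a b t \<in> U}" by simp
      then show "(\<lambda>t. dual_coord (fibre E (ln (a + cscale t b))) (C (a + cscale t b) b) (\<phi> (pt a b t)) i) holomorphic_on {t. pt a b t \<in> U}"
      proof (rule holomorphic_transform)
        fix t assume t: "t \<in> {t. pt a b t \<in> U}"
        then have tN: "pt a b t \<in> ?N" using eq by blast
        have "s (pt a b t) \<in> carrier (fibre E (pt a b t))"
          using s(1) tN unfolding hom_sects[OF E N] by (rule holomorphic_sectionsD(2))
        from dual_pairing[OF hom_coords_pt[OF E ab] \<phi>(2) this] s(2)[OF tN] t i
        show "(\<lambda>q\<in>?N. \<phi> q (s q)) (pt a b t) =
          dual_coord (fibre E (ln (a + cscale t b))) (C (a + cscale t b) b) (\<phi> (pt a b t)) i"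
          using tN by (simp add: lnpt unit_seq_def)
      qed
    qed (use \<phi> in \<open>auto simp: fib\<close>)
  next
    fix \<phi> assume \<phi>: "\<phi> \<in> holomorphic_sections (fibre (dual_bundle X E)) 1 (\<lambda>v u. dual_coord (fibre E (ln v)) (C v u)) U"
    note \<phi>D = holomorphic_sectionsD[OF \<phi>]
    have "(\<lambda>q\<in>N. \<phi> q (s q)) \<in> hol X N" if N: "openin (topo X) N" "N \<subseteq> U" and s: "s \<in> sects E N" for N s
    proof (rule restrict_in_hol_X)
      fix a b assume ab: "\<omega> a b \<noteq> 0"
      note sD = holomorphic_sectionsD[OF s[unfolded hom_sects[OF E N(1)]]]
      have "(\<lambda>t. C (a + cscale t b) b (s (pt a b t)) 0 *
          dual_coord (fibre E (ln (a + cscale t b))) (C (a + cscale t b) b) (\<phi> (pt a b t)) 0) holomorphic_on {t. pt a b t \<in> N}"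
        by (intro holomorphic_intros sD(3)[OF ab] holomorphic_on_subset[OF \<phi>D(3)[OF ab]]) (use N in auto)
      then show "(\<lambda>t. \<phi> (pt a b t) (s (pt a b t))) holomorphic_on {t. pt a b t \<in> N}"
      proof (rule holomorphic_transform)
        fix t assume t: "t \<in> {t. pt a b t \<in> N}"
        then show "C (a + cscale t b) b (s (pt a b t)) 0 * dual_coord (fibre E (ln (a + cscale t b))) (C (a + cscale t b) b) (\<phi> (pt a b t)) 0
          = \<phi> (pt a b t) (s (pt a b t))"
          using dual_pairing[OF hom_coords_pt[OF E ab] \<phi>D(2)[unfolded fib] sD(2), of t] N(2) by (auto simp: lnpt)
      qed
    qed
    then show "\<phi> \<in> sects (dual_bundle X E) U" using \<phi>D(1,2) by (auto simp: dual_bundle_def)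
  qed
qed

lemma homogeneous_relabel:
  assumes E: "homogeneous E r e \<kappa> C" and inj: "inj \<iota>"
  shows "homogeneous (relabel_bundle \<iota> E) r e \<kappa> (\<lambda>v u x. C v u (inv_into UNIV \<iota> x))"
proof (rule homogeneousI)
  have car: "carrier (fibre (relabel_bundle \<iota> E) q) = \<iota> ` carrier (fibre E q)" for q
    by (simp add: relabel_bundle_def relabel_module_def)
  have inv: "inv_into UNIV \<iota> (\<iota> x) = x" for x by (rule inv_into_f_f[OF inj]) simp
  fix v u assume vu: "\<omega> v u \<noteq> 0"
  show "coords (fibre (relabel_bundle \<iota> E) (ln v)) r (\<lambda>x. C v u (inv_into UNIV \<iota> x))"
    using relabel_coords[OF inj hom_coords[OF E vu]] by (simp add: relabel_bundle_def)
  fix g x assume g: "g \<in> SL cscale" and x: "x \<in> carrier (fibre (relabel_bundle \<iota> E) (ln v))"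
  show "act (relabel_bundle \<iota> E) g (ln v) x \<in> carrier (fibre (relabel_bundle \<iota> E) (ln (g v)))"
    using x hom_act(1)[OF E g vu] unfolding car by (auto simp: relabel_bundle_def inv)
  show "C (g v) (g u) (inv_into UNIV \<iota> (act (relabel_bundle \<iota> E) g (ln v) x)) = C v u (inv_into UNIV \<iota> x)"
    using x hom_act(2)[OF E g vu] unfolding car by (auto simp: relabel_bundle_def inv)
next
  have car: "carrier (fibre (relabel_bundle \<iota> E) q) = \<iota> ` carrier (fibre E q)" for q
    by (simp add: relabel_bundle_def relabel_module_def)
  have inv: "inv_into UNIV \<iota> (\<iota> x) = x" for x by (rule inv_into_f_f[OF inj]) simp
  show "C (cscale l v) (cscale \<nu> u + cscale \<mu> v) (inv_into UNIV \<iota> x) i =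
      (\<Sum>j\<le>i. \<kappa> i j * \<nu> ^ j * \<mu> ^ (i - j) * l powi (e - int i) * C v u (inv_into UNIV \<iota> x) j)"
    if "\<omega> v u \<noteq> 0" "l \<noteq> 0" "\<nu> \<noteq> 0" "i < r" "x \<in> carrier (fibre (relabel_bundle \<iota> E) (ln v))" for v u l \<mu> \<nu> x i
    using hom_law[OF E that(1-4)] that(5) unfolding car by (auto simp: inv)
  fix U assume U: "openin (topo X) U"
  let ?H = "holomorphic_sections (fibre (relabel_bundle \<iota> E)) r (\<lambda>v u x. C v u (inv_into UNIV \<iota> x)) U"
  have sects: "sects (relabel_bundle \<iota> E) U = (\<lambda>s. \<lambda>q\<in>U. \<iota> (s q)) ` holomorphic_sections (fibre E) r C U"
    by (simp add: relabel_bundle_def hom_sects[OF E U])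
  show "sects (relabel_bundle \<iota> E) U = ?H"
    unfolding sects
  proof (intro equalityI subsetI)
    fix s' assume "s' \<in> (\<lambda>s. \<lambda>q\<in>U. \<iota> (s q)) ` holomorphic_sections (fibre E) r C U"
    then obtain s where s: "s \<in> holomorphic_sections (fibre E) r C U" "s' = (\<lambda>q\<in>U. \<iota> (s q))" by blast
    show "s' \<in> ?H"
    proof (rule holomorphic_sectionsI)
      fix a b i assume ab: "\<omega> a b \<noteq> 0" "i < r"
      show "(\<lambda>t. C (a + cscale t b) b (inv_into UNIV \<iota> (s' (pt a b t))) i) holomorphic_on {t. pt a b t \<in> U}"
        by (rule holomorphic_transform[OF holomorphic_sectionsD(3)[OF s(1) ab]]) (simp add: s(2) inv)
    qed (use holomorphic_sectionsD(2)[OF s(1)] in \<open>auto simp: s(2) car\<close>)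
  next
    fix s' assume s': "s' \<in> ?H"
    define s where "s = (\<lambda>q\<in>U. inv_into UNIV \<iota> (s' q))"
    have s'_car: "s' q \<in> \<iota> ` carrier (fibre E q)" if "q \<in> U" for q
      using holomorphic_sectionsD(2)[OF s' that] by (simp add: car)
    have "s \<in> holomorphic_sections (fibre E) r C U"
    proof (rule holomorphic_sectionsI)
      show "s p \<in> carrier (fibre E p)" if "p \<in> U" for p using s'_car[OF that] that by (auto simp: s_def inv)
      fix a b i assume ab: "\<omega> a b \<noteq> 0" "i < r"
      show "(\<lambda>t. C (a + cscale t b) b (s (pt a b t)) i) holomorphic_on {t. pt a b t \<in> U}"
        by (rule holomorphic_transform[OF holomorphic_sectionsD(3)[OF s' ab]]) (simp add: s_def)
    qed (simp add: s_def)
    moreover have "s' = (\<lambda>q\<in>U. \<iota> (s q))"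
    proof (rule extensionalityI[of _ U])
      show "s' q = (\<lambda>q\<in>U. \<iota> (s q)) q" if "q \<in> U" for q using s'_car[OF that] that by (auto simp: s_def inv)
    qed (use holomorphic_sectionsD(1)[OF s'] in auto)
    ultimately show "s' \<in> (\<lambda>s. \<lambda>q\<in>U. \<iota> (s q)) ` holomorphic_sections (fibre E) r C U" by blast
  qed
qed

lemma homogeneous_line_bundle_power:
  "\<exists>C. homogeneous (line_bundle_power cscale n) 1 n (\<lambda>_ _. 1) C"
proof -
  have inj: "inj Pos_Power" "inj Zero_Power" "inj Neg_Power" by (auto simp: inj_def)
  consider "n > 0" | "n = 0" | "n < 0" by linarith
  then show ?thesis
  proof cases
    case 1
    then show ?thesis
      using homogeneous_relabel[OF homogeneous_tensor_power[OF homogeneous_line_bundle, of "nat n"] inj(1)]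
      by (auto simp: line_bundle_power_def line_power_def)
  next
    case 2
    then show ?thesis using homogeneous_relabel[OF homogeneous_structure_bundle inj(2)]
      by (auto simp: line_bundle_power_def line_power_def)
  next
    case 3
    then show ?thesis
      using homogeneous_relabel[OF homogeneous_dual[OF homogeneous_tensor_power[OF homogeneous_line_bundle, of "nat (- n)"]] inj(3)]
      by (auto simp: line_bundle_power_def line_power_def)
  qed
qed

end

subsection \<open>Symmetric powers\<close>

lemma coeff_linear_power:
  fixes a b :: complex
  shows "coeff ([:a, b:] ^ n) i = of_nat (n choose i) * b ^ i * a ^ (n - i)"
proof (cases "i \<le> n")
  case False
  have "degree ([:a, b:] ^ n) \<le> n"
    by (rule order_trans[OF degree_power_le]) (simp add: mult_le_cancel2)
  then show ?thesis using False by (simp add: coeff_eq_0)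
qed (rule coeff_linear_poly_power)

text \<open>
  Both sides are homogeneous of degree \<open>length xs\<close> in \<open>P\<close> and \<open>Q\<close>, and the coefficients are those
  of the polynomial obtained for \<open>P = 1\<close> and \<open>Q\<close> the variable.
\<close>

lemma prod_list_linear_substitution:
  fixes P Q :: "complex poly"
  shows "(\<Prod>x\<leftarrow>xs. Polynomial.smult (A x) P + Polynomial.smult (B x) Q) =
    (\<Sum>j\<le>length xs. Polynomial.smult (coeff (\<Prod>x\<leftarrow>xs. [:A x, B x:]) j) (P ^ (length xs - j) * Q ^ j))"
proof (induction xs)
  case (Cons x xs)
  let ?n = "length xs"
  define p where "p = (\<Prod>x\<leftarrow>xs. [:A x, B x:])"
  have "degree p \<le> ?n" unfolding p_def
  proof (induction xs)
    case (Cons y ys)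
    have "degree ([:A y, B y:] * (\<Prod>x\<leftarrow>ys. [:A x, B x:])) \<le> 1 + length ys"
      by (rule order_trans[OF degree_mult_le add_mono]) (use Cons in auto)
    then show ?case by simp
  qed simp
  then have top: "coeff p (Suc ?n) = 0" by (simp add: coeff_eq_0)
  have "(\<Prod>x\<leftarrow>x # xs. Polynomial.smult (A x) P + Polynomial.smult (B x) Q) =
      (Polynomial.smult (A x) P + Polynomial.smult (B x) Q) * (\<Sum>j\<le>?n. Polynomial.smult (coeff p j) (P ^ (?n - j) * Q ^ j))"
    using Cons.IH by (simp add: p_def)
  also have "\<dots> = (\<Sum>j\<le>?n. Polynomial.smult (A x * coeff p j) (P ^ (Suc ?n - j) * Q ^ j)) +
      (\<Sum>j\<le>?n. Polynomial.smult (B x * coeff p j) (P ^ (Suc ?n - Suc j) * Q ^ Suc j))"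
    unfolding sum_distrib_left sum.distrib[symmetric]
    by (rule sum.cong) (auto simp: Suc_diff_le algebra_simps smult_add_right)
  also have "(\<Sum>j\<le>?n. Polynomial.smult (A x * coeff p j) (P ^ (Suc ?n - j) * Q ^ j)) =
      (\<Sum>j\<le>Suc ?n. Polynomial.smult (A x * coeff p j) (P ^ (Suc ?n - j) * Q ^ j))"
    by (simp add: top)
  also have "(\<Sum>j\<le>?n. Polynomial.smult (B x * coeff p j) (P ^ (Suc ?n - Suc j) * Q ^ Suc j)) =
      (\<Sum>j\<le>Suc ?n. Polynomial.smult (coeff (pCons 0 (Polynomial.smult (B x) p)) j) (P ^ (Suc ?n - j) * Q ^ j))"
    unfolding sum.atMost_Suc_shift by simp
  finally show ?case
    by (simp add: p_def[symmetric] sum.distrib[symmetric] smult_add_left[symmetric] del: sum.atMost_Suc)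
qed simp

context plane
begin

text \<open>
  The polynomial attached to a product of vectors \<open>x\<close> is the product of \<open>\<omega> x v + \<omega> x u T\<close>; it is
  the restriction to the affine line \<open>v + T u\<close> of the homogeneous polynomial with factors \<open>\<omega> x\<close>.
\<close>

definition sym_eval :: "'v \<Rightarrow> 'v \<Rightarrow> nat \<Rightarrow> 'v list \<Rightarrow> complex" where
  "sym_eval v u i xs = coeff (\<Prod>x\<leftarrow>xs. [:\<omega> x v, \<omega> x u:]) i"

definition sym_coord :: "'v \<Rightarrow> 'v \<Rightarrow> ('v list \<Rightarrow>\<^sub>0 complex) set \<Rightarrow> nat \<Rightarrow> complex" where
  "sym_coord v u = free_coord (sym_eval v u)"

lemma sym_eval_substitution:
  assumes "length xs = d"
    and "\<And>x. [:\<omega> x v', \<omega> x u':] = Polynomial.smult (\<omega> x v) P + Polynomial.smult (\<omega> x u) Q"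
  shows "sym_eval v' u' i xs = (\<Sum>j\<le>d. coeff (P ^ (d - j) * Q ^ j) i * sym_eval v u j xs)"
  unfolding sym_eval_def assms(2) prod_list_linear_substitution assms(1)
  by (simp add: coeff_sum mult.commute)

lemma tuples_V: "tuples (vector_module cscale) d = {xs. length xs = d}"
  by (auto simp: tuples_def vector_module_def)

text \<open>
  The products of \<open>i\<close> factors \<open>v\<close> and \<open>d - i\<close> factors \<open>u\<close> span the symmetric power, and their
  polynomials are nonzero multiples of the powers of the variable.
\<close>

lemma sym_free_coords:
  assumes vu: "\<omega> v u \<noteq> 0"
  shows "free_coords (tuples (vector_module cscale) d)
    (multilinear_relations (vector_module cscale) d \<union> symmetric_relations (vector_module cscale) d) (Suc d) (sym_eval v u)"
proof -
  let ?V = "vector_module cscale" and ?S = "tuples (vector_module cscale) d"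
  let ?R = "multilinear_relations ?V d \<union> symmetric_relations ?V d"
  let ?w = "\<omega> v u"
  define m where "m = (\<lambda>i. replicate i v @ replicate (d - i) u)"
  define c where "c = (\<lambda>i. ?w ^ i * (- ?w) ^ (d - i))"
  have c: "c i \<noteq> 0" for i using vu by (simp add: c_def)
  have m: "m i \<in> ?S" if "i \<le> d" for i using that by (simp add: m_def tuples_V)
  have m_eval: "sym_eval v u i (m j) = c j * unit_seq j i" if "j \<le> d" for i j
  proof -
    have "(\<Prod>x\<leftarrow>m j. [:\<omega> x v, \<omega> x u:]) = [:0, ?w:] ^ j * [:- ?w:] ^ (d - j)"
      using \<omega>_swap[of u v] by (simp add: m_def \<omega>_self)
    also have "\<dots> = monom (c j) j"
    proof -
      have "[:0, ?w:] = monom ?w 1" "[:- ?w:] = monom (- ?w) 0" by (simp_all add: monom_altdef)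
      then show ?thesis by (simp only: c_def monom_power mult_monom) simp
    qed
    finally show ?thesis by (simp add: sym_eval_def unit_seq_def)
  qed
  have closed: "x \<oplus>\<^bsub>?V\<^esub> y \<in> carrier ?V" "a \<odot>\<^bsub>?V\<^esub> x \<in> carrier ?V" for x y a
    by (auto simp: vector_module_def)
  show ?thesis
  proof (rule free_coordsI[where b = "\<lambda>i. free_scale (1 / c i) (free_gen (m i))"])
    show "?R \<subseteq> carrier (free_module ?S)"
      using multilinear_relations_sub[OF closed]
      by (auto simp: symmetric_relations_def intro!: free.subspace_diff[OF subspace_free_carrier] gen_in_free_carrier)
    show "free_eval (sym_eval v u i) x = 0" if xR: "x \<in> ?R" for x i
    proof (cases "x \<in> multilinear_relations ?V d")
      case True
      then show ?thesis
      proof (rule multilinear_relations_eval[rotated 2])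
        fix xs l y z and a :: complex assume xs: "xs \<in> ?S" "l < d"
        have len: "l < length xs" using xs by (simp add: tuples_V)
        have f: "[:\<omega> (y + z) v, \<omega> (y + z) u:] = [:\<omega> y v, \<omega> y u:] + [:\<omega> z v, \<omega> z u:]"
          "[:\<omega> (cscale a y) v, \<omega> (cscale a y) u:] = Polynomial.smult a [:\<omega> y v, \<omega> y u:]"
          by (simp_all add: \<omega>_simps)
        show "sym_eval v u i (xs[l := y \<oplus>\<^bsub>?V\<^esub> z]) = sym_eval v u i (xs[l := y]) + sym_eval v u i (xs[l := z])"
          unfolding sym_eval_def prod_list_update[OF len] by (simp add: vector_module_def f distrib_left del: mult_pCons_left mult_pCons_right add_pCons)
        show "sym_eval v u i (xs[l := a \<odot>\<^bsub>?V\<^esub> y]) = a * sym_eval v u i (xs[l := y])"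
          unfolding sym_eval_def prod_list_update[OF len] by (simp add: vector_module_def f del: mult_pCons_left mult_pCons_right smult_pCons)
      qed
    next
      case False
      then obtain xs ys where x: "x = free_gen xs - free_gen ys" "mset xs = mset ys"
        using xR unfolding symmetric_relations_def by blast
      have "(\<Prod>x\<leftarrow>xs. [:\<omega> x v, \<omega> x u:]) = (\<Prod>x\<leftarrow>ys. [:\<omega> x v, \<omega> x u:])"
        unfolding prod_mset_prod_list[symmetric] mset_map x(2) ..
      then show ?thesis by (simp add: x(1) free_eval_diff free_eval_single sym_eval_def)
    qed
    show "sym_eval v u i xs = 0" if "xs \<in> ?S" "i \<ge> Suc d" for xs i
    proof -
      have "degree (\<Prod>x\<leftarrow>xs. [:\<omega> x v, \<omega> x u:]) \<le> length xs"
      proof (induction xs)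
        case (Cons y ys)
        have "degree ([:\<omega> y v, \<omega> y u:] * (\<Prod>x\<leftarrow>ys. [:\<omega> x v, \<omega> x u:])) \<le> 1 + length ys"
          by (rule order_trans[OF degree_mult_le add_mono]) (use Cons in auto)
        then show ?case by simp
      qed simp
      then show ?thesis using that by (simp add: sym_eval_def tuples_V coeff_eq_0)
    qed
    show "free_scale (1 / c j) (free_gen (m j)) \<in> carrier (free_module ?S)" if "j < Suc d" for j
      using that by (intro free.subspace_scale[OF subspace_free_carrier] gen_in_free_carrier m) simp
    show "free_eval (sym_eval v u i) (free_scale (1 / c j) (free_gen (m j))) = unit_seq j i" if "j < Suc d" for i j
      using that c[of j] by (simp add: free_eval_scale free_eval_single m_eval)
    let ?Q = "free_span (?R \<union> (\<lambda>i. free_scale (1 / c i) (free_gen (m i))) ` {..<Suc d})"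
    have Q: "free.subspace ?Q" "?R \<subseteq> ?Q" by (auto intro: free.span_base)
    have mQ: "free_gen (m i) \<in> ?Q" if "i \<le> d" for i
    proof -
      have "free_scale (c i) (free_scale (1 / c i) (free_gen (m i))) \<in> ?Q"
        by (intro free.span_scale free.span_base) (use that in auto)
      then show ?thesis using c by simp
    qed
    show "free_gen s \<in> ?Q" if s: "s \<in> ?S" for s
    proof (rule multilinear_span[OF closed _ _ Q(1) _ _ s, where B = "{v, u}"])
      fix x
      have "x = cscale (\<omega> x u / ?w) v + cscale (\<omega> v x / ?w) u" by (rule frame_expansion[OF vu])
      then show "\<exists>a\<in>{v, u}. \<exists>b\<in>{v, u}. \<exists>\<alpha> \<beta>. x = \<alpha> \<odot>\<^bsub>?V\<^esub> a \<oplus>\<^bsub>?V\<^esub> \<beta> \<odot>\<^bsub>?V\<^esub> b"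
        by (auto simp: vector_module_def)
    next
      fix xs assume xs: "xs \<in> ?S" "set xs \<subseteq> {v, u}"
      \<comment> \<open>Modulo the symmetric relations only the number of factors equal to \<open>v\<close> matters.\<close>
      define i where "i = count (mset xs) v"
      have len: "length xs = d" using xs(1) by (simp add: tuples_V)
      have "v \<noteq> u" using vu \<omega>_self by auto
      have "mset xs = filter_mset (\<lambda>x. x = v) (mset xs) + filter_mset (\<lambda>x. x \<noteq> v) (mset xs)"
        by (rule multiset_partition)
      moreover have "filter_mset (\<lambda>x. x = v) (mset xs) = replicate_mset i v"
        by (simp add: filter_eq_replicate_mset i_def)
      moreover have "filter_mset (\<lambda>x. x \<noteq> v) (mset xs) = filter_mset (\<lambda>x. x = u) (mset xs)"
        by (rule filter_mset_cong) (use xs(2) \<open>v \<noteq> u\<close> in auto)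
      moreover have "\<dots> = replicate_mset (count (mset xs) u) u" by (simp add: filter_eq_replicate_mset)
      ultimately have e: "mset xs = replicate_mset i v + replicate_mset (count (mset xs) u) u" by simp
      have "size (mset xs) = i + count (mset xs) u" by (subst e) simp
      then have i: "i \<le> d" "count (mset xs) u = d - i" using len by simp_all
      have "mset xs = replicate_mset i v + replicate_mset (d - i) u" using e i(2) by simp
      then have "mset xs = mset (m i)" by (simp add: m_def)
      then have "free_gen xs - free_gen (m i) \<in> ?R"
        using xs(1) m[OF i(1)] unfolding symmetric_relations_def by blast
      then show "free_gen xs \<in> ?Q" by (rule free_span_diff_mem[OF _ Q(2,1) mQ[OF i(1)]])
    qed (use Q in \<open>auto simp: vector_module_def\<close>)
  qed
qed

abbreviation SymV :: "nat \<Rightarrow> (complex, ('v list \<Rightarrow>\<^sub>0 complex) set) module" where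
  "SymV d \<equiv> sym_power (vector_module cscale) d"

lemma SymV_eq: "SymV d = quotient_module (free_module (tuples (vector_module cscale) d))
    (free_span (multilinear_relations (vector_module cscale) d \<union> symmetric_relations (vector_module cscale) d))"
  by (simp add: sym_power_def sym_power_kernel_def)

lemma sym_coords: "\<omega> v u \<noteq> 0 \<Longrightarrow> coords (SymV d) (Suc d) (sym_coord v u)"
  unfolding SymV_eq sym_coord_def by (rule free_coords_coords[OF sym_free_coords])

lemma sym_coord_substitution:
  assumes fr: "\<omega> v u \<noteq> 0" "\<omega> v' u' \<noteq> 0" and w: "w \<in> carrier (SymV d)"
    and eq: "\<And>x. [:\<omega> x v', \<omega> x u':] = Polynomial.smult (\<omega> x v) P + Polynomial.smult (\<omega> x u) Q"
  shows "sym_coord v' u' w i = (\<Sum>j\<le>d. coeff (P ^ (d - j) * Q ^ j) i * sym_coord v u w j)"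
  unfolding sym_coord_def
  by (rule free_coord_linear[OF sym_free_coords[OF fr(1)] sym_free_coords[OF fr(2)] w[unfolded SymV_eq]])
     (use sym_eval_substitution[OF _ eq] in \<open>auto simp: tuples_V\<close>)

text \<open>
  The change of frame replaces the monomials \<open>1\<close> and \<open>T\<close> by \<open>l + \<mu> T\<close> and \<open>\<nu> T\<close>.
\<close>

lemma sym_coord_law:
  assumes fr: "\<omega> v u \<noteq> 0" "l \<noteq> 0" "\<nu> \<noteq> 0" and i: "i < Suc d" and w: "w \<in> carrier (SymV d)"
  shows "sym_coord (cscale l v) (cscale \<nu> u + cscale \<mu> v) w i =
    (\<Sum>j\<le>i. of_nat ((d - j) choose (i - j)) * \<nu> ^ j * \<mu> ^ (i - j) * l powi (int d - int i) * sym_coord v u w j)"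
proof -
  have pw: "[:0, \<nu>:] ^ j = monom (\<nu> ^ j) j" for j
  proof -
    have "[:0, \<nu>:] = monom \<nu> 1" by (simp add: monom_altdef)
    then show ?thesis by (simp add: monom_power)
  qed
  have "sym_coord (cscale l v) (cscale \<nu> u + cscale \<mu> v) w i =
      (\<Sum>j\<le>d. coeff ([:l, \<mu>:] ^ (d - j) * [:0, \<nu>:] ^ j) i * sym_coord v u w j)"
    by (rule sym_coord_substitution[OF fr(1) frame_law[OF fr] w]) (simp add: \<omega>_simps mult_ac)
  also have "\<dots> = (\<Sum>j\<le>i. coeff ([:l, \<mu>:] ^ (d - j) * [:0, \<nu>:] ^ j) i * sym_coord v u w j)"
    by (rule sum.mono_neutral_right) (use i in \<open>auto simp: pw mult.commute[of _ "monom _ _"] coeff_monom_mult\<close>)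
  also have "\<dots> = (\<Sum>j\<le>i. of_nat ((d - j) choose (i - j)) * \<nu> ^ j * \<mu> ^ (i - j) * l powi (int d - int i) * sym_coord v u w j)"
  proof (rule sum.cong[OF refl])
    fix j assume j: "j \<in> {..i}"
    have "l powi (int d - int i) = l ^ (d - j - (i - j))"
      using i j by (simp add: of_nat_diff[symmetric] del: of_nat_diff)
    then show "coeff ([:l, \<mu>:] ^ (d - j) * [:0, \<nu>:] ^ j) i * sym_coord v u w j =
      of_nat ((d - j) choose (i - j)) * \<nu> ^ j * \<mu> ^ (i - j) * l powi (int d - int i) * sym_coord v u w j"
      using j by (simp add: pw mult.commute[of _ "monom _ _"] coeff_monom_mult coeff_linear_power mult_ac)
  qed
  finally show ?thesis .
qed

text \<open>
  The sections of the trivial bundle are generated by the constant ones, which have constant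
  coordinates in the fixed frame \<open>(a, b)\<close>. Those in the frames \<open>(a + t b, b)\<close> of a chart are
  polynomial in them, and conversely.
\<close>

lemma sym_coord_move:
  assumes ab: "\<omega> a b \<noteq> 0" and w: "w \<in> carrier (SymV d)"
  shows "sym_coord (a + cscale t b) b w i = (\<Sum>j\<le>d. of_nat (j choose i) * t ^ (j - i) * sym_coord a b w j)"
proof -
  have "sym_coord (a + cscale t b) b w i = (\<Sum>j\<le>d. coeff ([:1:] ^ (d - j) * [:t, 1:] ^ j) i * sym_coord a b w j)"
    by (rule sym_coord_substitution[OF ab _ w]) (use ab in \<open>simp_all add: \<omega>_simps mult_ac\<close>)
  moreover have "[:1 :: complex:] ^ n = 1" for n by (simp add: one_pCons[symmetric])
  ultimately show ?thesis by (simp only: coeff_linear_power mult_1) simp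
qed

lemma sym_coord_move_back:
  assumes ab: "\<omega> a b \<noteq> 0" and w: "w \<in> carrier (SymV d)"
  shows "sym_coord a b w i = (\<Sum>j\<le>d. of_nat (j choose i) * (- t) ^ (j - i) * sym_coord (a + cscale t b) b w j)"
  using sym_coord_move[of "a + cscale t b" b w d "- t" i] ab w by (simp add: \<omega>_pt scale_minus_left)

lemma homogeneous_sym_bundle:
  "homogeneous (sym_bundle cscale d) (Suc d) (int d) (\<lambda>i j. of_nat ((d - j) choose (i - j))) sym_coord"
proof (rule homogeneousI)
  have fib: "fibre (sym_bundle cscale d) q = SymV d" for q by (simp add: sym_bundle_def trivial_bundle_def)
  fix v u assume vu: "\<omega> v u \<noteq> 0"
  show "coords (fibre (sym_bundle cscale d) (ln v)) (Suc d) (sym_coord v u)"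
    unfolding fib by (rule sym_coords[OF vu])
  fix g w assume g: "g \<in> SL cscale" and w: "w \<in> carrier (fibre (sym_bundle cscale d) (ln v))"
  have act: "act (sym_bundle cscale d) g (ln v) w = sym_power_map g (vector_module cscale) d w"
    by (simp add: sym_bundle_def trivial_bundle_def)
  have S: "map g s \<in> tuples (vector_module cscale) d" if "s \<in> tuples (vector_module cscale) d" for s
    using that by (simp add: tuples_V)
  have ev: "sym_eval (g v) (g u) i (map g s) = sym_eval v u i s" for s i
    by (simp add: sym_eval_def o_def SL_\<omega>[OF g])
  note q = free_coord_quotient_map[OF sym_free_coords[OF vu, of d] sym_free_coords[OF SL_frame[OF g vu], of d],
      OF S ev w[unfolded fib SymV_eq]]
  show "act (sym_bundle cscale d) g (ln v) w \<in> carrier (fibre (sym_bundle cscale d) (ln (g v)))"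
    unfolding act fib using q(1) by (simp add: sym_power_map_def SymV_eq sym_power_kernel_def)
  show "sym_coord (g v) (g u) (act (sym_bundle cscale d) g (ln v) w) = sym_coord v u w"
    unfolding act using q(2) by (simp add: sym_power_map_def sym_power_kernel_def sym_coord_def)
next
  have fib: "fibre (sym_bundle cscale d) q = SymV d" for q by (simp add: sym_bundle_def trivial_bundle_def)
  show "sym_coord (cscale l v) (cscale \<nu> u + cscale \<mu> v) w i =
    (\<Sum>j\<le>i. of_nat ((d - j) choose (i - j)) * \<nu> ^ j * \<mu> ^ (i - j) * l powi (int d - int i) * sym_coord v u w j)"
    if "\<omega> v u \<noteq> 0" "l \<noteq> 0" "\<nu> \<noteq> 0" "i < Suc d" "w \<in> carrier (fibre (sym_bundle cscale d) (ln v))" for v u l \<mu> \<nu> w i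
    using sym_coord_law[OF that(1-4)] that(5) by (simp add: fib)
  fix U assume U: "openin (topo X) U"
  let ?gen = "\<lambda>N :: 'v set set. {\<lambda>q :: 'v set. w | w. w \<in> carrier (SymV d)}"
  let ?P = "\<lambda>s p. \<exists>N. openin (topo X) N \<and> p \<in> N \<and> N \<subseteq> U \<and>
         (\<exists>(m::nat) f e. (\<forall>i<m. f i \<in> hol X N \<and> e i \<in> ?gen N) \<and>
           (\<forall>q\<in>N. s q = finsum (SymV d) (\<lambda>i. f i q \<odot>\<^bsub>SymV d\<^esub> e i q) {..<m}))"
  have sects: "sects (sym_bundle cscale d) U = {s \<in> extensional U. (\<forall>p\<in>U. s p \<in> carrier (SymV d)) \<and> (\<forall>p\<in>U. ?P s p)}"
    by (simp add: sym_bundle_def trivial_bundle_def local_span_def)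
  have key: "?P s p \<longleftrightarrow> (\<exists>N. openin (topo X) N \<and> p \<in> N \<and> N \<subseteq> U \<inter> dom b \<and>
      (\<forall>i<Suc d. (\<lambda>q\<in>N. sym_coord a b (s q) i) \<in> hol X N))"
    if p: "p \<in> U" and ab: "\<omega> a b \<noteq> 0" "p \<in> dom b" and s: "\<And>q. q \<in> U \<Longrightarrow> s q \<in> carrier (SymV d)" for p a b s
  proof (rule local_span_coords[OF function_algebra_X U p])
    note C = sym_coords[OF ab(1)]
    show "openin (topo X) (dom b)" "p \<in> dom b" using openin_dom frame_nz(2)[OF ab(1)] ab(2) by auto
    show "coords (SymV d) (Suc d) (sym_coord a b)" by (rule C)
    show "s q \<in> carrier (SymV d)" if "q \<in> U" for q by (rule s[OF that])
    show "e q \<in> carrier (SymV d)" if "e \<in> ?gen N" for N e and q :: "'v set" using that by blast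
    show "(\<lambda>q\<in>N \<inter> dom b. sym_coord a b (e q) i) \<in> hol X (N \<inter> dom b)" if "e \<in> ?gen N" for N e i
      using that by (auto intro!: restrict_in_hol_X)
    show "\<exists>e\<in>?gen N. \<forall>q\<in>N. sym_coord a b (e q) = unit_seq j" if "j < Suc d" for N j
      by (intro bexI[of _ "\<lambda>q. from_coords (SymV d) (sym_coord a b) (unit_seq j)"])
         (use from_coords[OF C unit_seq_in_seqs[OF that]] in auto)
  qed
  show "sects (sym_bundle cscale d) U = holomorphic_sections (fibre (sym_bundle cscale d)) (Suc d) sym_coord U"
  proof (intro equalityI subsetI)
    fix s assume s: "s \<in> sects (sym_bundle cscale d) U"
    show "s \<in> holomorphic_sections (fibre (sym_bundle cscale d)) (Suc d) sym_coord U"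
    proof (rule holomorphic_sectionsI)
      fix a b i assume ab: "\<omega> a b \<noteq> 0"
      let ?f = "\<lambda>t. sym_coord (a + cscale t b) b (s (pt a b t)) i"
      show "?f holomorphic_on {t. pt a b t \<in> U}"
      proof (subst holomorphic_on_open[OF openin_X_open[OF U ab]], intro ballI)
        fix t assume "t \<in> {t. pt a b t \<in> U}"
        then have t: "pt a b t \<in> U" by simp
        obtain N where N: "openin (topo X) N" "pt a b t \<in> N" "N \<subseteq> U \<inter> dom b"
          "\<And>i. i < Suc d \<Longrightarrow> (\<lambda>q\<in>N. sym_coord a b (s q) i) \<in> hol X N"
          using iffD1[OF key[OF t ab pt_in_dom[OF ab]], of s] s t unfolding sects by blast
        have "(\<lambda>t. \<Sum>j\<le>d. of_nat (j choose i) * t ^ (j - i) * (\<lambda>q\<in>N. sym_coord a b (s q) j) (pt a b t)) holomorphic_on {t. pt a b t \<in> N}"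
          by (intro holomorphic_intros hol_XD[OF N(4) ab]) auto
        then have "?f holomorphic_on {t. pt a b t \<in> N}"
        proof (rule holomorphic_transform)
          fix z assume z: "z \<in> {t. pt a b t \<in> N}"
          then have "s (pt a b z) \<in> carrier (SymV d)" using s N(3) unfolding sects by blast
          then show "(\<Sum>j\<le>d. of_nat (j choose i) * z ^ (j - i) * (\<lambda>q\<in>N. sym_coord a b (s q) j) (pt a b z)) =
            sym_coord (a + cscale z b) b (s (pt a b z)) i"
            using z by (simp add: sym_coord_move[OF ab])
        qed
        then show "\<exists>f'. (?f has_field_derivative f') (at t)"
          using holomorphic_on_open[OF openin_X_open[OF N(1) ab]] N(2) by blast
      qed
    qed (use s in \<open>auto simp: sects fib\<close>)
  next
    fix s assume s: "s \<in> holomorphic_sections (fibre (sym_bundle cscale d)) (Suc d) sym_coord U"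
    note sD = holomorphic_sectionsD[OF s, unfolded fib]
    have "?P s p" if p: "p \<in> U" for p
    proof -
      obtain a where a: "a \<noteq> 0" "p = ln a" using openin_X_sub[OF U] p by (auto simp: lines_eq)
      obtain b where ab: "\<omega> a b \<noteq> 0" using ex_frame[OF a(1)] by blast
      have pd: "p \<in> dom b" using a ab ln_in_dom by simp
      have "(\<lambda>q\<in>U \<inter> dom b. sym_coord a b (s q) i) \<in> hol X (U \<inter> dom b)" if i: "i < Suc d" for i
      proof (subst hol_X_chart[OF ab])
        show "openin (topo X) (U \<inter> dom b)" using U openin_dom frame_nz(2)[OF ab] by blast
        have "(\<lambda>t. \<Sum>j\<le>d. of_nat (j choose i) * (- t) ^ (j - i) * sym_coord (a + cscale t b) b (s (pt a b t)) j)
            holomorphic_on {t. pt a b t \<in> U \<inter> dom b}"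
          by (intro holomorphic_intros holomorphic_on_subset[OF sD(3)[OF ab]]) auto
        then show "(\<lambda>q\<in>U \<inter> dom b. sym_coord a b (s q) i) \<in> extensional (U \<inter> dom b) \<and>
          (\<lambda>t. (\<lambda>q\<in>U \<inter> dom b. sym_coord a b (s q) i) (pt a b t)) holomorphic_on {t. pt a b t \<in> U \<inter> dom b}"
        proof (intro conjI, simp, elim holomorphic_transform)
          fix t assume "t \<in> {t. pt a b t \<in> U \<inter> dom b}"
          then show "(\<Sum>j\<le>d. of_nat (j choose i) * (- t) ^ (j - i) * sym_coord (a + cscale t b) b (s (pt a b t)) j) =
              (\<lambda>q\<in>U \<inter> dom b. sym_coord a b (s q) i) (pt a b t)"
            using sym_coord_move_back[OF ab sD(2), of "pt a b t" i t] by simp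
        qed
      qed simp
      moreover have "openin (topo X) (U \<inter> dom b)" using U openin_dom frame_nz(2)[OF ab] by blast
      ultimately show ?thesis
        by (intro iffD2[OF key[OF p ab pd]] sD(2) exI[of _ "U \<inter> dom b"] conjI allI impI) (use p pd in auto)
    qed
    then show "s \<in> sects (sym_bundle cscale d) U" unfolding sects using sD(1,2) by blast
  qed
qed

subsection \<open>Tensor products and sums of homogeneous bundles\<close>

lemma homogeneous_tensor:
  assumes L: "homogeneous L 1 m (\<lambda>_ _. 1) A" and E: "homogeneous E r e \<kappa> C"
  shows "homogeneous (tensor_bundle X L E) r (m + e) \<kappa> (\<lambda>v u. tensor_coord (A v u) (C v u))"
proof (rule homogeneousI)
  have fib: "fibre (tensor_bundle X L E) q = tensor_module (fibre L q) (fibre E q)" for q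
    by (simp add: tensor_bundle_def)
  fix v u assume vu: "\<omega> v u \<noteq> 0"
  show "coords (fibre (tensor_bundle X L E) (ln v)) r (tensor_coord (A v u) (C v u))"
    unfolding fib by (rule tensor_coords[OF hom_coords[OF L vu] hom_coords[OF E vu]])
  fix g x assume g: "g \<in> SL cscale" and x: "x \<in> carrier (fibre (tensor_bundle X L E) (ln v))"
  note gvu = SL_frame[OF g vu]
  have act: "act (tensor_bundle X L E) g (ln v) x =
      tensor_map (act L g (ln v)) (act E g (ln v)) (fibre L (ln (g v))) (fibre E (ln (g v))) x"
    by (simp add: tensor_bundle_def move_X proj_act_ln[OF g])
  note tm = tensor_map_coord[OF hom_coords[OF L vu] hom_coords[OF L gvu] hom_coords[OF E vu] hom_coords[OF E gvu]
      hom_act[OF L g vu] hom_act[OF E g vu] x[unfolded fib]]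
  show "act (tensor_bundle X L E) g (ln v) x \<in> carrier (fibre (tensor_bundle X L E) (ln (g v)))"
    unfolding act fib by (rule tm(1))
  show "tensor_coord (A (g v) (g u)) (C (g v) (g u)) (act (tensor_bundle X L E) g (ln v) x) =
      tensor_coord (A v u) (C v u) x"
    unfolding act by (rule tm(2))
next
  have fib: "fibre (tensor_bundle X L E) q = tensor_module (fibre L q) (fibre E q)" for q
    by (simp add: tensor_bundle_def)
  fix v u x and l \<mu> \<nu> :: complex and i :: nat
  assume a: "\<omega> v u \<noteq> 0" "l \<noteq> 0" "\<nu> \<noteq> 0" "i < r" "x \<in> carrier (fibre (tensor_bundle X L E) (ln v))"
  let ?u = "cscale \<nu> u + cscale \<mu> v" and ?v = "cscale l v"
  have A': "coords (fibre L (ln v)) 1 (A ?v ?u)" and C': "coords (fibre E (ln v)) r (C ?v ?u)"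
    using hom_coords[OF L frame_law[OF a(1-3), of \<mu>]] hom_coords[OF E frame_law[OF a(1-3), of \<mu>]]
      ln_scale[OF a(2), of v] by simp_all
  show "tensor_coord (A ?v ?u) (C ?v ?u) x i =
      (\<Sum>j\<le>i. \<kappa> i j * \<nu> ^ j * \<mu> ^ (i - j) * l powi (m + e - int i) * tensor_coord (A v u) (C v u) x j)"
    unfolding tensor_coord_def
  proof (rule free_coord_linear[OF tensor_free_coords[OF hom_coords[OF L a(1)] hom_coords[OF E a(1)]]
        tensor_free_coords[OF A' C']])
    show "x \<in> carrier (quotient_module (free_module (carrier (fibre L (ln v)) \<times> carrier (fibre E (ln v))))
        (free.span (bilinear_relations (fibre L (ln v)) (fibre E (ln v)))))"
      using a(5) by (simp add: fib tensor_module_def tensor_kernel_def)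
    fix p assume p: "p \<in> carrier (fibre L (ln v)) \<times> carrier (fibre E (ln v))"
    then obtain y z where yz: "p = (y, z)" "y \<in> carrier (fibre L (ln v))" "z \<in> carrier (fibre E (ln v))" by blast
    have "A ?v ?u y 0 * C ?v ?u z i = (l powi m * A v u y 0) *
        (\<Sum>j\<le>i. \<kappa> i j * \<nu> ^ j * \<mu> ^ (i - j) * l powi (e - int i) * C v u z j)"
      using line_law[OF a(1-3) L yz(2)] hom_law[OF E a(1-4) yz(3)] by simp
    also have "\<dots> = (\<Sum>j\<le>i. \<kappa> i j * \<nu> ^ j * \<mu> ^ (i - j) * l powi (m + e - int i) * (A v u y 0 * C v u z j))"
      using a(2) by (simp add: sum_distrib_left power_int_add power_int_diff field_simps)
    finally show "(case p of (x, y) \<Rightarrow> A ?v ?u x 0 * C ?v ?u y i) =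
      (\<Sum>j\<le>i. \<kappa> i j * \<nu> ^ j * \<mu> ^ (i - j) * l powi (m + e - int i) * (case p of (x, y) \<Rightarrow> A v u x 0 * C v u y j))"
      by (simp add: yz(1))
  qed
next
  have fib: "fibre (tensor_bundle X L E) q = tensor_module (fibre L q) (fibre E q)" for q
    by (simp add: tensor_bundle_def)
  fix U assume U: "openin (topo X) U"
  let ?gen = "\<lambda>N. {\<lambda>q. pure_tensor (fibre L q) (fibre E q) (s q) (t q) | s t. s \<in> sects L N \<and> t \<in> sects E N}"
  have sects: "sects (tensor_bundle X L E) U = local_span X (fibre (tensor_bundle X L E)) ?gen U"
    by (simp add: tensor_bundle_def)
  have coord: "tensor_coord (A (a + cscale t b) b) (C (a + cscale t b) b)
        (pure_tensor (fibre L (pt a b t)) (fibre E (pt a b t)) x y) =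
      (\<lambda>i. A (a + cscale t b) b x 0 * C (a + cscale t b) b y i)"
    if "\<omega> a b \<noteq> 0" "x \<in> carrier (fibre L (pt a b t))" "y \<in> carrier (fibre E (pt a b t))" for a b t x y
    by (rule pure_tensor_coord(2)[OF hom_coords_pt[OF L that(1)] hom_coords_pt[OF E that(1)] that(2,3)])
  show "sects (tensor_bundle X L E) U =
      holomorphic_sections (fibre (tensor_bundle X L E)) r (\<lambda>v u. tensor_coord (A v u) (C v u)) U"
    unfolding sects
  proof (rule local_span_eq_holomorphic_sections[OF U])
    show "coords (fibre (tensor_bundle X L E) (ln v)) r (tensor_coord (A v u) (C v u))" if "\<omega> v u \<noteq> 0" for v u
      unfolding fib by (rule tensor_coords[OF hom_coords[OF L that] hom_coords[OF E that]])
  next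
    fix N e q assume N: "openin (topo X) N" "e \<in> ?gen N" "q \<in> N"
    then obtain s t where st: "e = (\<lambda>q. pure_tensor (fibre L q) (fibre E q) (s q) (t q))"
      "s \<in> holomorphic_sections (fibre L) 1 A N" "t \<in> holomorphic_sections (fibre E) r C N"
      using hom_sects[OF L N(1)] hom_sects[OF E N(1)] by blast
    obtain w where w: "w \<noteq> 0" "q = ln w" using openin_X_sub[OF N(1)] N(3) by (auto simp: lines_eq)
    obtain u where u: "\<omega> w u \<noteq> 0" using ex_frame[OF w(1)] by blast
    show "e q \<in> carrier (fibre (tensor_bundle X L E) q)"
      unfolding fib st(1)
      by (rule pure_tensor_coord(1)[OF hom_coords[OF L u, folded w(2)] hom_coords[OF E u, folded w(2)]
            holomorphic_sectionsD(2)[OF st(2) N(3)] holomorphic_sectionsD(2)[OF st(3) N(3)]])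
  next
    fix N e a b i
    assume N: "openin (topo X) N" and e: "e \<in> ?gen N" and ab: "\<omega> a b \<noteq> 0" and i: "i < r"
    obtain s t where st: "e = (\<lambda>q. pure_tensor (fibre L q) (fibre E q) (s q) (t q))"
      "s \<in> holomorphic_sections (fibre L) 1 A N" "t \<in> holomorphic_sections (fibre E) r C N"
      using e hom_sects[OF L N] hom_sects[OF E N] by blast
    have "(\<lambda>z. A (a + cscale z b) b (s (pt a b z)) 0 * C (a + cscale z b) b (t (pt a b z)) i) holomorphic_on {z. pt a b z \<in> N}"
      by (intro holomorphic_intros holomorphic_sectionsD(3)[OF st(2) ab] holomorphic_sectionsD(3)[OF st(3) ab i]) simp
    then show "(\<lambda>z. tensor_coord (A (a + cscale z b) b) (C (a + cscale z b) b) (e (pt a b z)) i) holomorphic_on {z. pt a b z \<in> N}"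
      by (rule holomorphic_transform)
         (simp add: st(1) coord[OF ab] holomorphic_sectionsD(2)[OF st(2)] holomorphic_sectionsD(2)[OF st(3)])
  next
    fix N a b j assume N: "openin (topo X) N" and ab: "\<omega> a b \<noteq> 0" "N \<subseteq> dom b" and j: "j < r"
    obtain s where s: "s \<in> sects L N" "\<And>t. pt a b t \<in> N \<Longrightarrow> A (a + cscale t b) b (s (pt a b t)) = unit_seq 0"
      using hom_section_of_coords[OF L ab(1) N ab(2), of "\<lambda>t. unit_seq 0"] unit_seq_in_seqs[of 0 1]
      by (auto simp: unit_seq_def)
    obtain t where t: "t \<in> sects E N" "\<And>z. pt a b z \<in> N \<Longrightarrow> C (a + cscale z b) b (t (pt a b z)) = unit_seq j"
      using hom_section_of_coords[OF E ab(1) N ab(2), of "\<lambda>t. unit_seq j"] unit_seq_in_seqs[OF j]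
      by auto
    show "\<exists>e\<in>?gen N. \<forall>z. pt a b z \<in> N \<longrightarrow>
        tensor_coord (A (a + cscale z b) b) (C (a + cscale z b) b) (e (pt a b z)) = unit_seq j"
    proof (intro bexI[of _ "\<lambda>q. pure_tensor (fibre L q) (fibre E q) (s q) (t q)"] allI impI)
      fix z assume z: "pt a b z \<in> N"
      have "s (pt a b z) \<in> carrier (fibre L (pt a b z))" "t (pt a b z) \<in> carrier (fibre E (pt a b z))"
        using s(1) t(1) z holomorphic_sectionsD(2) unfolding hom_sects[OF L N] hom_sects[OF E N] by blast+
      from coord[OF ab(1) this] show "tensor_coord (A (a + cscale z b) b) (C (a + cscale z b) b)
          (pure_tensor (fibre L (pt a b z)) (fibre E (pt a b z)) (s (pt a b z)) (t (pt a b z))) = unit_seq j"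
        using s(2)[OF z] t(2)[OF z] by (simp add: unit_seq_def)
    qed (use s t in blast)
  qed
qed

text \<open>
  The second block has its coordinates shifted by \<open>r\<close>. The factor \<open>\<omega> v u ^ r\<close> multiplies its law by
  \<open>l^r \<nu>^r\<close>, which restores the exponents \<open>\<nu>^j\<close> and \<open>l^(e - i)\<close> of the shifted indices, and it is
  invariant under the special linear group.
\<close>

lemma homogeneous_sum:
  assumes E: "homogeneous E r e \<kappa> C" and F: "homogeneous F s (e - 2 * int r) \<theta> D"
  shows "homogeneous (sum_bundle X E F) (r + s) e
    (\<lambda>i j. if i < r then \<kappa> i j else if j < r then 0 else \<theta> (i - r) (j - r))
    (\<lambda>v u (x, y) i. if i < r then C v u x i else \<omega> v u ^ r * D v u y (i - r))"
proof (rule homogeneousI)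
  have fib: "fibre (sum_bundle X E F) q = sum_module (fibre E q) (fibre F q)" for q by (simp add: sum_bundle_def)
  have car: "carrier (fibre (sum_bundle X E F) q) = carrier (fibre E q) \<times> carrier (fibre F q)" for q
    by (simp add: fib sum_module_def)
  fix v u assume vu: "\<omega> v u \<noteq> 0"
  show "coords (fibre (sum_bundle X E F) (ln v)) (r + s)
     (\<lambda>(x, y) i. if i < r then C v u x i else \<omega> v u ^ r * D v u y (i - r))"
    unfolding fib by (rule sum_coords[OF hom_coords[OF E vu] hom_coords[OF F vu]]) (simp add: vu)
  fix g p assume g: "g \<in> SL cscale" and p: "p \<in> carrier (fibre (sum_bundle X E F) (ln v))"
  show "act (sum_bundle X E F) g (ln v) p \<in> carrier (fibre (sum_bundle X E F) (ln (g v)))"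
    using p hom_act(1)[OF E g vu] hom_act(1)[OF F g vu] unfolding car by (auto simp: sum_bundle_def)
  show "(case act (sum_bundle X E F) g (ln v) p of (x, y) \<Rightarrow>
      \<lambda>i. if i < r then C (g v) (g u) x i else \<omega> (g v) (g u) ^ r * D (g v) (g u) y (i - r)) =
    (case p of (x, y) \<Rightarrow> \<lambda>i. if i < r then C v u x i else \<omega> v u ^ r * D v u y (i - r))"
    using p hom_act(2)[OF E g vu] hom_act(2)[OF F g vu] unfolding car by (auto simp: sum_bundle_def SL_\<omega>[OF g])
next
  have car: "carrier (fibre (sum_bundle X E F) q) = carrier (fibre E q) \<times> carrier (fibre F q)" for q
    by (simp add: sum_bundle_def sum_module_def)
  fix v u p and l \<mu> \<nu> :: complex and i :: nat
  assume a: "\<omega> v u \<noteq> 0" "l \<noteq> 0" "\<nu> \<noteq> 0" "i < r + s" "p \<in> carrier (fibre (sum_bundle X E F) (ln v))"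
  let ?u = "cscale \<nu> u + cscale \<mu> v" and ?v = "cscale l v"
  obtain x y where p: "p = (x, y)" "x \<in> carrier (fibre E (ln v))" "y \<in> carrier (fibre F (ln v))"
    using a(5) unfolding car by blast
  let ?k = "\<lambda>i j. if i < r then \<kappa> i j else if j < r then 0 else \<theta> (i - r) (j - r)"
  let ?c = "\<lambda>i. if i < r then C v u x i else \<omega> v u ^ r * D v u y (i - r)"
  let ?t = "\<lambda>j. ?k i j * \<nu> ^ j * \<mu> ^ (i - j) * l powi (e - int i) * ?c j"
  have "(if i < r then C ?v ?u x i else \<omega> ?v ?u ^ r * D ?v ?u y (i - r)) = (\<Sum>j\<le>i. ?t j)"
  proof (cases "i < r")
    case True
    then show ?thesis using hom_law[OF E a(1-3) True p(2), of \<mu>] by auto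
  next
    case False
    define i' where "i' = i - r"
    have i: "i = i' + r" "i' < s" using False a(4) by (auto simp: i'_def)
    have w: "\<omega> ?v ?u = l * \<nu> * \<omega> v u" by (simp add: \<omega>_simps)
    have "\<omega> ?v ?u ^ r * D ?v ?u y i' = (\<Sum>j\<le>i'. (l * \<nu> * \<omega> v u) ^ r *
        (\<theta> i' j * \<nu> ^ j * \<mu> ^ (i' - j) * l powi (e - 2 * int r - int i') * D v u y j))"
      unfolding hom_law[OF F a(1-3) i(2) p(3)] w by (simp add: sum_distrib_left)
    also have "\<dots> = (\<Sum>j\<le>i'. ?t (j + r))"
    proof (rule sum.cong[OF refl])
      fix j
      have ei: "e - int i = int r + (e - 2 * int r - int i')" by (simp add: i(1))
      have "l powi (e - int i) = l ^ r * l powi (e - 2 * int r - int i')"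
        by (simp only: ei power_int_add[OF disjI1[OF a(2)]] power_int_of_nat)
      then show "(l * \<nu> * \<omega> v u) ^ r * (\<theta> i' j * \<nu> ^ j * \<mu> ^ (i' - j) * l powi (e - 2 * int r - int i') * D v u y j) = ?t (j + r)"
        by (simp add: i(1) power_mult_distrib power_add mult_ac)
    qed
    also have "\<dots> = (\<Sum>j\<in>{r..i}. ?t j)"
      unfolding i(1) by (rule sum.reindex_bij_witness[of _ "\<lambda>j. j - r" "\<lambda>j. j + r"]) auto
    also have "\<dots> = (\<Sum>j\<le>i. ?t j)"
      by (rule sum.mono_neutral_left) (use False in auto)
    finally show ?thesis using False by (simp only: i'_def if_False)
  qed
  then show "(case p of (x, y) \<Rightarrow> \<lambda>i. if i < r then C ?v ?u x i else \<omega> ?v ?u ^ r * D ?v ?u y (i - r)) i =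
    (\<Sum>j\<le>i. ?k i j * \<nu> ^ j * \<mu> ^ (i - j) * l powi (e - int i) *
       (case p of (x, y) \<Rightarrow> \<lambda>i. if i < r then C v u x i else \<omega> v u ^ r * D v u y (i - r)) j)"
    unfolding p(1) prod.case .
next
  have car: "carrier (fibre (sum_bundle X E F) q) = carrier (fibre E q) \<times> carrier (fibre F q)" for q
    by (simp add: sum_bundle_def sum_module_def)
  let ?B = "\<lambda>v u (x, y) i. if i < r then C v u x i else \<omega> v u ^ r * D v u y (i - r)"
  fix U assume U: "openin (topo X) U"
  show "sects (sum_bundle X E F) U = holomorphic_sections (fibre (sum_bundle X E F)) (r + s) ?B U"
  proof (intro equalityI subsetI)
    fix q assume "q \<in> sects (sum_bundle X E F) U"
    then obtain f h where q: "q = (\<lambda>p\<in>U. (f p, h p))"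
      and f: "f \<in> holomorphic_sections (fibre E) r C U" and h: "h \<in> holomorphic_sections (fibre F) s D U"
      using hom_sects[OF E U] hom_sects[OF F U] by (auto simp: sum_bundle_def)
    show "q \<in> holomorphic_sections (fibre (sum_bundle X E F)) (r + s) ?B U"
    proof (rule holomorphic_sectionsI)
      show "q p \<in> carrier (fibre (sum_bundle X E F) p)" if "p \<in> U" for p
        using that holomorphic_sectionsD(2)[OF f] holomorphic_sectionsD(2)[OF h] by (simp add: q car)
      fix a b i assume ab: "\<omega> a b \<noteq> 0" and i: "i < r + s"
      show "(\<lambda>t. ?B (a + cscale t b) b (q (pt a b t)) i) holomorphic_on {t. pt a b t \<in> U}"
      proof (cases "i < r")
        case True
        show ?thesis
          by (rule holomorphic_transform[OF holomorphic_sectionsD(3)[OF f ab True]]) (use True in \<open>simp add: q\<close>)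
      next
        case False
        then have "(\<lambda>t. \<omega> a b ^ r * D (a + cscale t b) b (h (pt a b t)) (i - r)) holomorphic_on {t. pt a b t \<in> U}"
          using i by (intro holomorphic_intros holomorphic_sectionsD(3)[OF h ab]) auto
        then show ?thesis
          by (rule holomorphic_transform) (use False in \<open>simp add: q \<omega>_pt\<close>)
      qed
    qed (simp add: q)
  next
    fix q assume q: "q \<in> holomorphic_sections (fibre (sum_bundle X E F)) (r + s) ?B U"
    note qD = holomorphic_sectionsD[OF q]
    have "(\<lambda>p\<in>U. fst (q p)) \<in> holomorphic_sections (fibre E) r C U"
    proof (rule holomorphic_sectionsI)
      fix a b i assume ab: "\<omega> a b \<noteq> 0" and i: "i < r"
      show "(\<lambda>t. C (a + cscale t b) b ((\<lambda>p\<in>U. fst (q p)) (pt a b t)) i) holomorphic_on {t. pt a b t \<in> U}"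
        by (rule holomorphic_transform[OF qD(3)[OF ab, of i]]) (use i in \<open>auto simp: case_prod_unfold\<close>)
    qed (use qD(2) car in force)+
    moreover have "(\<lambda>p\<in>U. snd (q p)) \<in> holomorphic_sections (fibre F) s D U"
    proof (rule holomorphic_sectionsI)
      fix a b i assume ab: "\<omega> a b \<noteq> 0" and i: "i < s"
      have "(\<lambda>t. (1 / \<omega> a b ^ r) * ?B (a + cscale t b) b (q (pt a b t)) (i + r)) holomorphic_on {t. pt a b t \<in> U}"
        by (intro holomorphic_intros qD(3)[OF ab]) (use i in auto)
      then show "(\<lambda>t. D (a + cscale t b) b ((\<lambda>p\<in>U. snd (q p)) (pt a b t)) i) holomorphic_on {t. pt a b t \<in> U}"
        by (rule holomorphic_transform) (use ab in \<open>auto simp: case_prod_unfold \<omega>_pt\<close>)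
    qed (use qD(2) car in force)+
    moreover have "q = (\<lambda>p\<in>U. ((\<lambda>p\<in>U. fst (q p)) p, (\<lambda>p\<in>U. snd (q p)) p))"
      by (rule extensionalityI[of _ U]) (use qD(1) in auto)
    ultimately show "q \<in> sects (sum_bundle X E F) U"
      unfolding sum_bundle_def vbundle.simps hom_sects[OF E U] hom_sects[OF F U] by blast
  qed
qed

text \<open>
  Multiplying the coordinates by constants conjugates the matrix \<open>\<kappa>\<close> by a diagonal matrix.
\<close>

lemma homogeneous_rescale:
  assumes E: "homogeneous E r e \<kappa> C" and q: "\<And>i. i < r \<Longrightarrow> q i \<noteq> 0"
    and \<kappa>': "\<And>i j. j \<le> i \<Longrightarrow> i < r \<Longrightarrow> \<kappa>' i j * q i = \<kappa> i j * q j"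
  shows "homogeneous E r e \<kappa>' (\<lambda>v u x i. C v u x i / q i)"
proof (rule homogeneousI)
  fix v u assume vu: "\<omega> v u \<noteq> 0"
  show "coords (fibre E (ln v)) r (\<lambda>x i. C v u x i / q i)" by (rule rescale_coords[OF hom_coords[OF E vu] q])
  fix g x assume g: "g \<in> SL cscale" and x: "x \<in> carrier (fibre E (ln v))"
  show "act E g (ln v) x \<in> carrier (fibre E (ln (g v)))" by (rule hom_act(1)[OF E g vu x])
  show "(\<lambda>i. C (g v) (g u) (act E g (ln v) x) i / q i) = (\<lambda>i. C v u x i / q i)"
    by (simp add: hom_act(2)[OF E g vu x])
next
  fix v u x and l \<mu> \<nu> :: complex and i :: nat
  assume a: "\<omega> v u \<noteq> 0" "l \<noteq> 0" "\<nu> \<noteq> 0" "i < r" "x \<in> carrier (fibre E (ln v))"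
  have ratio: "\<kappa> i j / q i = \<kappa>' i j / q j" if "j \<le> i" for j
    using \<kappa>'[OF that a(4)] q[OF a(4)] q[of j] that a(4) by (simp add: field_simps)
  have terms: "\<kappa> i j * \<nu> ^ j * \<mu> ^ (i - j) * l powi (e - int i) * C v u x j / q i =
      \<kappa>' i j * \<nu> ^ j * \<mu> ^ (i - j) * l powi (e - int i) * (C v u x j / q j)" if "j \<le> i" for j
  proof -
    have "\<kappa> i j * \<nu> ^ j * \<mu> ^ (i - j) * l powi (e - int i) * C v u x j / q i =
        (\<kappa> i j / q i) * (\<nu> ^ j * \<mu> ^ (i - j) * l powi (e - int i) * C v u x j)" by simp
    also have "\<dots> = (\<kappa>' i j / q j) * (\<nu> ^ j * \<mu> ^ (i - j) * l powi (e - int i) * C v u x j)"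
      by (simp only: ratio[OF that])
    finally show ?thesis by simp
  qed
  show "C (cscale l v) (cscale \<nu> u + cscale \<mu> v) x i / q i =
      (\<Sum>j\<le>i. \<kappa>' i j * \<nu> ^ j * \<mu> ^ (i - j) * l powi (e - int i) * (C v u x j / q j))"
    unfolding hom_law[OF E a] sum_divide_distrib by (rule sum.cong[OF refl], rule terms) simp
next
  fix U assume U: "openin (topo X) U"
  have "(\<lambda>t. C (a + cscale t b) b (s (pt a b t)) i / q i) holomorphic_on {t. pt a b t \<in> U} \<longleftrightarrow>
      (\<lambda>t. C (a + cscale t b) b (s (pt a b t)) i) holomorphic_on {t. pt a b t \<in> U}" if "i < r" for a b s i
  proof
    assume "(\<lambda>t. C (a + cscale t b) b (s (pt a b t)) i / q i) holomorphic_on {t. pt a b t \<in> U}"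
    then have "(\<lambda>t. q i * (C (a + cscale t b) b (s (pt a b t)) i / q i)) holomorphic_on {t. pt a b t \<in> U}"
      by (rule holomorphic_on_mult[OF holomorphic_on_const])
    then show "(\<lambda>t. C (a + cscale t b) b (s (pt a b t)) i) holomorphic_on {t. pt a b t \<in> U}"
      using q[OF that] by simp
  qed (intro holomorphic_intros, use q[OF that] in auto)
  then show "sects E U = holomorphic_sections (fibre E) r (\<lambda>v u x i. C v u x i / q i) U"
    unfolding hom_sects[OF E U] holomorphic_sections_def by auto
qed

subsection \<open>The two bundles of the theorem\<close>

text \<open>
  The constants in the transformation law of the Taylor coefficients of sections of \<open>L^n\<close>.
\<close>

definition jet_law :: "int \<Rightarrow> nat \<Rightarrow> nat \<Rightarrow> complex" where
  "jet_law n i j = (of_int n - of_nat j) gchoose (i - j)"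

text \<open>
  The factors of the numerator are the integers from \<open>n - k + 1\<close> to \<open>n - i\<close>; under the assumption
  they all have the same sign.
\<close>

lemma gchoose_nonzero:
  assumes "n < 0 \<or> n \<ge> int k" "i \<le> k"
  shows "((of_int n - of_nat i :: complex) gchoose (k - i)) \<noteq> 0"
proof -
  have "(of_int n - of_nat i :: complex) - of_nat l \<noteq> 0" if "l < k - i" for l
  proof
    assume "(of_int n - of_nat i :: complex) - of_nat l = 0"
    then have "(of_int (n - int i - int l) :: complex) = 0" by simp
    then have "n = int i + int l" by (simp only: of_int_eq_0_iff)
    then show False using that assms by auto
  qed
  then show ?thesis by (simp add: gbinomial_prod_rev)
qed

lemma tensor_sym_homogeneous:
  "\<exists>C. homogeneous (tensor_bundle X (line_bundle_power cscale m) (sym_bundle cscale d)) (Suc d) (m + int d)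
     (\<lambda>i j. of_nat ((d - j) choose (i - j))) C"
  using homogeneous_line_bundle_power[of m] homogeneous_tensor[OF _ homogeneous_sym_bundle[of d]] by blast

text \<open>
  Trinomial revision, applied to \<open>n - j\<close> over \<open>k - j\<close> over \<open>i - j\<close>, says that the binomial
  coefficients of \<open>n - i\<close> over \<open>k - i\<close> conjugate the law of \<open>Sym^k\<close> to that of the jets.
\<close>

theorem high_degree_homogeneous:
  assumes "n < 0 \<or> n \<ge> int k"
  shows "\<exists>C. homogeneous (tensor_bundle X (line_bundle_power cscale (n - int k)) (sym_bundle cscale k))
    (Suc k) n (jet_law n) C"
proof -
  obtain C where C: "homogeneous (tensor_bundle X (line_bundle_power cscale (n - int k)) (sym_bundle cscale k))
    (Suc k) n (\<lambda>i j. of_nat ((k - j) choose (i - j))) C"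
    using tensor_sym_homogeneous[of "n - int k" k] by auto
  define q where "q = (\<lambda>i. (of_int n - of_nat i :: complex) gchoose (k - i))"
  have "jet_law n i j * q i = of_nat ((k - j) choose (i - j)) * q j" if "j \<le> i" "i < Suc k" for i j
  proof -
    have "q j * (of_nat (k - j) gchoose (i - j)) = jet_law n i j * ((of_int n - of_nat j - of_nat (i - j)) gchoose (k - j - (i - j)))"
      unfolding q_def jet_law_def by (rule gbinomial_trinomial_revision) (use that in auto)
    also have "k - j - (i - j) = k - i" using that by auto
    also have "(of_int n - of_nat j - of_nat (i - j) :: complex) = of_int n - of_nat i"
      using that by (simp add: of_nat_diff)
    finally show ?thesis by (simp add: q_def binomial_gbinomial mult.commute)
  qed
  from homogeneous_rescale[OF C _ this] gchoose_nonzero[OF assms] show ?thesis by (auto simp: q_def)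
qed

text \<open>
  The derivative of order \<open>n + 1\<close> maps sections of \<open>L^n\<close> to sections of \<open>L^(-n - 2)\<close> (Bol's lemma).
  On Taylor coefficients it is the multiplication by binomial coefficients over \<open>n + 1\<close>, up to a
  factorial, and the identity expresses that it commutes with fractional linear changes of the
  coordinate.
\<close>

lemma gchoose_bol:
  assumes "Suc n \<le> j" "j \<le> i"
  shows "of_nat (j choose Suc n) * ((- 1 - of_nat j) gchoose (i - j)) =
    ((of_nat n - of_nat j) gchoose (i - j)) * (of_nat (i choose Suc n) :: complex)"
proof -
  let ?l = "i - j"
  have 1: "((- 1 - of_nat j) gchoose ?l) = (- 1) ^ ?l * (of_nat (i choose ?l) :: complex)"
  proof -
    have "((- (of_nat (Suc j)) :: complex) gchoose ?l) = (- 1) ^ ?l * ((of_nat (Suc j) + of_nat ?l - 1) gchoose ?l)"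
      by (rule gbinomial_minus)
    moreover have "(of_nat (Suc j) + of_nat ?l - 1 :: complex) = of_nat i" using assms by (simp add: of_nat_diff)
    moreover have "- (of_nat (Suc j)) = (- 1 - of_nat j :: complex)" by simp
    ultimately show ?thesis by (simp add: binomial_gbinomial)
  qed
  have 2: "((of_nat n - of_nat j) gchoose ?l) = (- 1) ^ ?l * (of_nat ((i - Suc n) choose ?l) :: complex)"
  proof -
    have "((- (of_nat (j - n)) :: complex) gchoose ?l) = (- 1) ^ ?l * ((of_nat (j - n) + of_nat ?l - 1) gchoose ?l)"
      by (rule gbinomial_minus)
    moreover have "(of_nat (j - n) + of_nat ?l - 1 :: complex) = of_nat (i - Suc n)" using assms by (simp add: of_nat_diff)
    moreover have "- (of_nat (j - n)) = (of_nat n - of_nat j :: complex)" using assms by (simp add: of_nat_diff)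
    ultimately show ?thesis by (simp add: binomial_gbinomial)
  qed
  have "(i choose j) * (j choose Suc n) = (i choose Suc n) * ((i - Suc n) choose (j - Suc n))"
    by (rule choose_mult) (use assms in auto)
  moreover have "i choose j = i choose ?l" by (rule binomial_symmetric) (use assms in auto)
  moreover have "(i - Suc n) choose (j - Suc n) = (i - Suc n) choose ?l"
    using binomial_symmetric[of "j - Suc n" "i - Suc n"] assms by simp
  ultimately have "(j choose Suc n) * (i choose ?l) = ((i - Suc n) choose ?l) * (i choose Suc n)"
    by (simp add: mult.commute)
  then have "(of_nat (j choose Suc n) * of_nat (i choose ?l) :: complex) = of_nat ((i - Suc n) choose ?l) * of_nat (i choose Suc n)"
    by (metis of_nat_mult)
  then show ?thesis unfolding 1 2 by (simp add: mult_ac)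
qed

text \<open>
  For \<open>j \<le> n < i\<close> both laws vanish, and for \<open>i \<le> n\<close> they are equal. The block of indices larger than
  \<open>n\<close> is, by Bol's lemma, the law of the jets of order \<open>k - n - 1\<close> of \<open>L^(-n - 2)\<close>, which has
  negative degree.
\<close>

theorem low_degree_homogeneous:
  assumes "n < k"
  shows "\<exists>C. homogeneous (sum_bundle X (sym_bundle cscale n)
      (tensor_bundle X (line_bundle_power cscale (- (int k + 1))) (sym_bundle cscale (k - n - 1))))
    (Suc k) (int n) (jet_law (int n)) C"
proof -
  let ?d = "k - n - 1"
  have e: "- (int k + 1) + int ?d = int n - 2 * int (Suc n)" using assms by simp
  obtain D where D: "homogeneous (tensor_bundle X (line_bundle_power cscale (- (int k + 1))) (sym_bundle cscale ?d))
    (Suc ?d) (int n - 2 * int (Suc n)) (\<lambda>i j. of_nat ((?d - j) choose (i - j))) D"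
    using tensor_sym_homogeneous[of "- (int k + 1)" ?d] unfolding e by blast
  define \<kappa> where "\<kappa> = (\<lambda>i j. if i < Suc n then of_nat ((n - j) choose (i - j)) else
      if j < Suc n then 0 else of_nat ((?d - (j - Suc n)) choose (i - Suc n - (j - Suc n))) :: complex)"
  obtain C where C: "homogeneous (sum_bundle X (sym_bundle cscale n)
      (tensor_bundle X (line_bundle_power cscale (- (int k + 1))) (sym_bundle cscale ?d)))
    (Suc k) (int n) \<kappa> C"
    using homogeneous_sum[OF homogeneous_sym_bundle D] assms unfolding \<kappa>_def by auto
  \<comment> \<open>The first factor is Bol's operator, the second one the constant of \<open>high_degree_homogeneous\<close> for \<open>L^(-n - 2)\<close>.\<close>
  define q where "q = (\<lambda>i. if i \<le> n then 1 else of_nat (i choose Suc n) * ((- 1 - of_nat i :: complex) gchoose (k - i)))"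
  have q: "q i \<noteq> 0" if "i < Suc k" for i
    using gchoose_nonzero[of "- 1" k i] that by (auto simp: q_def)
  have "jet_law (int n) i j * q i = \<kappa> i j * q j" if ij: "j \<le> i" "i < Suc k" for i j
  proof -
    consider "i \<le> n" | "j \<le> n" "n < i" | "n < j" by linarith
    then show ?thesis
    proof cases
      case 1
      then show ?thesis using ij by (simp add: \<kappa>_def q_def jet_law_def binomial_gbinomial of_nat_diff)
    next
      case 2
      then have "(of_nat n - of_nat j :: complex) = of_nat (n - j)" by (simp add: of_nat_diff)
      then have "jet_law (int n) i j = of_nat ((n - j) choose (i - j))"
        by (simp add: jet_law_def binomial_gbinomial)
      moreover have "(n - j) choose (i - j) = 0" using 2 by simp
      ultimately show ?thesis using 2 by (simp add: \<kappa>_def)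
    next
      case 3
      then have \<kappa>: "\<kappa> i j = of_nat ((k - j) choose (i - j))"
        using ij by (simp add: \<kappa>_def)
      have "((- 1 - of_nat j) gchoose (k - j)) * (of_nat (k - j) gchoose (i - j)) =
          ((- 1 - of_nat j) gchoose (i - j)) * ((- 1 - of_nat j - of_nat (i - j) :: complex) gchoose (k - j - (i - j)))"
        by (rule gbinomial_trinomial_revision) (use ij in auto)
      also have "k - j - (i - j) = k - i" using ij by auto
      also have "(- 1 - of_nat j - of_nat (i - j) :: complex) = - 1 - of_nat i" using ij by (simp add: of_nat_diff)
      finally have tr: "((- 1 - of_nat j :: complex) gchoose (k - j)) * of_nat ((k - j) choose (i - j)) =
          ((- 1 - of_nat j) gchoose (i - j)) * ((- 1 - of_nat i) gchoose (k - i))"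
        by (simp add: binomial_gbinomial)
      have "\<kappa> i j * q j = of_nat (j choose Suc n) * (((- 1 - of_nat j :: complex) gchoose (k - j)) * of_nat ((k - j) choose (i - j)))"
        using 3 by (simp add: \<kappa> q_def mult_ac)
      also have "\<dots> = (of_nat (j choose Suc n) * ((- 1 - of_nat j) gchoose (i - j))) * ((- 1 - of_nat i) gchoose (k - i))"
        unfolding tr by (simp only: mult.assoc)
      also have "\<dots> = jet_law (int n) i j * q i"
        using gchoose_bol[of n j i] 3 ij by (simp add: jet_law_def q_def mult_ac)
      finally show ?thesis by simp
    qed
  qed
  from homogeneous_rescale[OF C q this] show ?thesis by blast
qed

end

section \<open>Jets of a power of the line bundle\<close>

text \<open>
  The bundle \<open>W\<close> stands for \<open>L^n\<close>; it enters through its transformation law.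
\<close>

locale line_jets = plane cscale \<omega>
  for cscale :: "complex \<Rightarrow> 'v \<Rightarrow> 'v::ab_group_add" and \<omega> +
  fixes W :: "('v set, 'a, 'v \<Rightarrow> 'v) vbundle" and n :: int and A
  assumes W: "homogeneous W 1 n (\<lambda>_ _. 1) A"
begin

text \<open>
  In rank one the law does not involve \<open>u\<close>, so the coordinate depends on the first vector of the
  frame only.
\<close>

definition lc :: "'v \<Rightarrow> 'a \<Rightarrow> complex" where
  "lc v x = A v (SOME u. \<omega> v u \<noteq> 0) x 0"

lemma lc_eq:
  assumes "\<omega> v u \<noteq> 0" "x \<in> carrier (fibre W (ln v))"
  shows "lc v x = A v u x 0"
proof -
  define u' where "u' = (SOME u. \<omega> v u \<noteq> 0)"
  have u': "\<omega> v u' \<noteq> 0" unfolding u'_def using assms(1) by (rule someI)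
  have "u' = cscale (\<omega> v u' / \<omega> v u) u + cscale (\<omega> u' u / \<omega> v u) v"
    unfolding add.commute[of "cscale _ u"] by (rule frame_expansion[OF assms(1)])
  then have "A v u' x 0 = A (cscale 1 v) (cscale (\<omega> v u' / \<omega> v u) u + cscale (\<omega> u' u / \<omega> v u) v) x 0" by simp
  also have "\<dots> = A v u x 0" by (subst line_law[OF assms(1) _ _ W assms(2)]) (use assms(1) u' in auto)
  finally show ?thesis by (simp add: lc_def u'_def)
qed

lemma lc_scale:
  assumes "v \<noteq> 0" "l \<noteq> 0" "x \<in> carrier (fibre W (ln v))"
  shows "lc (cscale l v) x = l powi n * lc v x"
proof -
  obtain u where u: "\<omega> v u \<noteq> 0" using ex_frame[OF assms(1)] by blast
  have "\<omega> (cscale l v) (cscale 1 u + cscale 0 v) \<noteq> 0" by (rule frame_law[OF u assms(2)]) simp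
  then have "lc (cscale l v) x = A (cscale l v) (cscale 1 u + cscale 0 v) x 0"
    by (rule lc_eq) (use assms ln_scale in simp)
  also have "\<dots> = l powi n * A v u x 0" by (rule line_law[OF u assms(2) _ W assms(3)]) simp
  finally show ?thesis using lc_eq[OF u assms(3)] by simp
qed

lemma lc_act:
  assumes "g \<in> SL cscale" "v \<noteq> 0" "x \<in> carrier (fibre W (ln v))"
  shows "lc (g v) (act W g (ln v) x) = lc v x"
proof -
  obtain u where u: "\<omega> v u \<noteq> 0" using ex_frame[OF assms(2)] by blast
  show ?thesis
    using lc_eq[OF SL_frame[OF assms(1) u] hom_act(1)[OF W assms(1) u assms(3)]]
      hom_act(2)[OF W assms(1) u assms(3)] lc_eq[OF u assms(3)] by simp
qed

lemma W_coords: "v \<noteq> 0 \<Longrightarrow> coords (fibre W (ln v)) 1 (\<lambda>x. scalar_seq (lc v x))"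
proof -
  assume "v \<noteq> 0"
  then obtain u where u: "\<omega> v u \<noteq> 0" using ex_frame by blast
  note C = hom_coords[OF W u]
  have eq: "scalar_seq (lc v x) = A v u x" if "x \<in> carrier (fibre W (ln v))" for x
    using coords_ge[OF C that] lc_eq[OF u that] by (auto simp: scalar_seq_def fun_eq_iff)
  have "bij_betw (\<lambda>x. scalar_seq (lc v x)) (carrier (fibre W (ln v))) (seqs 1)"
    using coords_bij[OF C] by (subst bij_betw_cong[OF eq]) auto
  then show ?thesis using C unfolding coords_def by (simp add: eq)
qed

lemma W_coords_pt: "\<omega> a b \<noteq> 0 \<Longrightarrow> coords (fibre W (pt a b t)) 1 (\<lambda>x. scalar_seq (lc (a + cscale t b) x))"
  unfolding pt_def by (rule W_coords) (rule pt_nz)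

context
  fixes v :: 'v assumes v: "v \<noteq> 0"
begin

lemma lc_add: "x \<in> carrier (fibre W (ln v)) \<Longrightarrow> y \<in> carrier (fibre W (ln v)) \<Longrightarrow>
    lc v (x \<oplus>\<^bsub>fibre W (ln v)\<^esub> y) = lc v x + lc v y"
  using fun_cong[OF coords_add(2)[OF W_coords[OF v]], of x y 0] by (simp add: scalar_seq_def)

lemma lc_smult: "x \<in> carrier (fibre W (ln v)) \<Longrightarrow> lc v (c \<odot>\<^bsub>fibre W (ln v)\<^esub> x) = c * lc v x"
  using fun_cong[OF coords_smult(2)[OF W_coords[OF v]], of x c 0] by (simp add: scalar_seq_def)

lemma lc_minus: "x \<in> carrier (fibre W (ln v)) \<Longrightarrow> y \<in> carrier (fibre W (ln v)) \<Longrightarrow>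
    lc v (x \<ominus>\<^bsub>fibre W (ln v)\<^esub> y) = lc v x - lc v y"
  using fun_cong[OF coords_minus(2)[OF W_coords[OF v]], of x y 0] by (simp add: scalar_seq_def)

lemma lc_zero: "lc v \<zero>\<^bsub>fibre W (ln v)\<^esub> = 0"
  using fun_cong[where x = "0 :: nat", OF coords_zero(2)[OF W_coords[OF v]]] by (simp add: scalar_seq_def)

lemma lc_finsum:
  assumes "finite I" "\<And>i. i \<in> I \<Longrightarrow> f i \<in> carrier (fibre W (ln v))"
  shows "lc v (finsum (fibre W (ln v)) f I) = (\<Sum>i\<in>I. lc v (f i))"
  using fun_cong[where x = "0 :: nat", OF conjunct2[OF coords_finsum[OF W_coords[OF v] assms]]]
  by (simp add: scalar_seq_def)

lemma lc_eqI: "x \<in> carrier (fibre W (ln v)) \<Longrightarrow> y \<in> carrier (fibre W (ln v)) \<Longrightarrow> lc v x = lc v y \<Longrightarrow> x = y"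
  using coords_eqI[OF W_coords[OF v]] by (auto simp: scalar_seq_def)

end

lemma ex_lc:
  assumes "v \<noteq> 0"
  obtains x where "x \<in> carrier (fibre W (ln v))" "lc v x = z"
proof -
  have "lc v (from_coords (fibre W (ln v)) (\<lambda>x. scalar_seq (lc v x)) (scalar_seq z)) = z"
    using fun_cong[OF from_coords(2)[OF W_coords[OF assms] scalar_seq_in_seqs[of z]], of 0]
    by (simp add: scalar_seq_def)
  then show ?thesis using that from_coords(1)[OF W_coords[OF assms] scalar_seq_in_seqs[of z]] by blast
qed

subsection \<open>Sections of the pullback\<close>

definition pb :: "('v set \<times> 'v set, 'a, 'v \<Rightarrow> 'v) vbundle" where
  "pb = pullback_snd (proj_atlas cscale) proj_act W"

lemma pb_fibre: "fibre pb q = fibre W (snd q)" and pb_act: "act pb g q = act W g (snd q)"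
  by (simp_all add: pb_def pullback_snd_def)

text \<open>
  The coordinates on the fibres of the pullback are those of \<open>W\<close> in the frames of a chart of the
  second factor, so they are defined over the product of the line with that chart.
\<close>

lemma pb_key:
  assumes N: "openin (topo X2) N" "p \<in> N" and s: "\<And>q. q \<in> N \<Longrightarrow> s q \<in> carrier (fibre W (snd q))"
    and cd: "\<omega> c d \<noteq> 0" "snd p \<in> dom d"
  shows "(\<exists>N'. openin (topo X2) N' \<and> p \<in> N' \<and> N' \<subseteq> N \<and>
         (\<exists>(m::nat) f e. (\<forall>i<m. f i \<in> hol X2 N' \<and>
            e i \<in> {\<lambda>q. s (snd q) | s U. openin (topo X) U \<and> snd ` N' \<subseteq> U \<and> s \<in> sects W U}) \<and>
           (\<forall>q\<in>N'. s q = finsum (fibre W (snd q)) (\<lambda>i. f i q \<odot>\<^bsub>fibre W (snd q)\<^esub> e i q) {..<m}))) \<longleftrightarrow>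
     (\<exists>N'. openin (topo X2) N' \<and> p \<in> N' \<and> N' \<subseteq> N \<inter> (lines cscale \<times> dom d) \<and>
       (\<forall>i<1. (\<lambda>q\<in>N'. scalar_seq (lc (c + cscale (chart c d (snd q)) d) (s q)) i) \<in> hol X2 N'))"
proof (rule local_span_coords[OF function_algebra_X2 N])
  let ?gen = "\<lambda>N'. {\<lambda>q. s (snd q) | s U. openin (topo X) U \<and> snd ` N' \<subseteq> U \<and> s \<in> sects W U}"
  have opd: "openin (topo X) (dom d)" using openin_dom frame_nz(2)[OF cd(1)] by blast
  show "openin (topo X2) (lines cscale \<times> dom d)"
    by (rule openin_X2_Times[OF _ opd]) (simp add: topspace_X[symmetric])
  show "p \<in> lines cscale \<times> dom d" using openin_X2_sub[OF N(1)] N(2) cd(2) by (auto simp: mem_Times_iff)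
  show "coords (fibre W (snd q)) 1 (\<lambda>x. scalar_seq (lc (c + cscale (chart c d (snd q)) d) x))"
    if "q \<in> lines cscale \<times> dom d" for q
    using W_coords_pt[OF cd(1), of "chart c d (snd q)"] pt_chart[OF cd(1), of "snd q"] that by auto
  show "s q \<in> carrier (fibre W (snd q))" if "q \<in> N" for q by (rule s[OF that])
  show "e q \<in> carrier (fibre W (snd q))" if "e \<in> ?gen N'" "q \<in> N'" for N' e q
    using that hom_sects[OF W] holomorphic_sectionsD(2) by fastforce
  show "(\<lambda>q\<in>N' \<inter> lines cscale \<times> dom d. scalar_seq (lc (c + cscale (chart c d (snd q)) d) (e q)) i)
      \<in> hol X2 (N' \<inter> lines cscale \<times> dom d)"
    if N': "openin (topo X2) N'" and e: "e \<in> ?gen N'" and i: "i < 1" for N' e i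
  proof -
    obtain t U where tU: "e = (\<lambda>q. t (snd q))" "openin (topo X) U" "snd ` N' \<subseteq> U" "t \<in> sects W U"
      using e by blast
    note tD = holomorphic_sectionsD[OF tU(4)[unfolded hom_sects[OF W tU(2)]]]
    let ?U = "U \<inter> dom d"
    have opU: "openin (topo X) ?U" using tU(2) opd by blast
    define \<psi> where "\<psi> = (\<lambda>p\<in>?U. lc (c + cscale (chart c d p) d) (t p))"
    have "\<psi> \<in> hol X ?U"
    proof (rule iffD2[OF hol_X_chart[OF cd(1) _ opU]], simp, intro conjI)
      have "(\<lambda>z. A (c + cscale z d) d (t (pt c d z)) 0) holomorphic_on {z. pt c d z \<in> ?U}"
        by (rule holomorphic_on_subset[OF tD(3)[OF cd(1)]]) auto
      then show "(\<lambda>z. \<psi> (pt c d z)) holomorphic_on {z. pt c d z \<in> ?U}"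
      proof (rule holomorphic_transform)
        fix z assume z: "z \<in> {z. pt c d z \<in> ?U}"
        have "\<omega> (c + cscale z d) d \<noteq> 0" using cd(1) by (simp add: \<omega>_pt)
        moreover have "t (pt c d z) \<in> carrier (fibre W (ln (c + cscale z d)))"
          using tD(2) z by (simp add: pt_def)
        ultimately have "lc (c + cscale z d) (t (pt c d z)) = A (c + cscale z d) d (t (pt c d z)) 0"
          by (rule lc_eq)
        then show "A (c + cscale z d) d (t (pt c d z)) 0 = \<psi> (pt c d z)"
          using z by (simp add: \<psi>_def chart_pt[OF cd(1)])
      qed
    qed (simp add: \<psi>_def)
    then have \<psi>: "(\<lambda>z. \<psi> (pt a b z)) holomorphic_on {z. pt a b z \<in> ?U}" if "\<omega> a b \<noteq> 0" for a b
      using hol_XD that by blast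
    have opN: "openin (topo X2) (N' \<inter> lines cscale \<times> dom d)"
      using N' openin_X2_Times[OF _ opd, of "lines cscale"] openin_topspace[of "topo X"] unfolding topspace_X by blast
    show ?thesis
    proof (rule restrict_in_hol_X2[OF opN])
      fix a b a' b' assume fr: "\<omega> a b \<noteq> 0" "\<omega> a' b' \<noteq> 0"
      let ?S = "{(z, w). (pt a b z, pt a' b' w) \<in> N' \<inter> lines cscale \<times> dom d}"
      have S: "w \<in> {z. pt a' b' z \<in> ?U}" if "(z, w) \<in> ?S" for z w using that tU(3) by force
      have 1: "holomorphic2_on (\<lambda>(z, w). \<psi> (pt a' b' w)) ?S"
        by (rule holomorphic2_on_compose_snd[OF \<psi>[OF fr(2)] openin_X_open[OF opU fr(2)]]) (use S in auto)
      have 2: "(case p of (z, w) \<Rightarrow> \<psi> (pt a' b' w)) =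
          (case p of (z, w) \<Rightarrow> scalar_seq (lc (c + cscale (chart c d (snd (pt a b z, pt a' b' w))) d) (e (pt a b z, pt a' b' w))) i)"
        if p: "p \<in> ?S" for p
      proof -
        obtain z w where zw: "p = (z, w)" by fastforce
        have "pt a' b' w \<in> ?U" using S[of z w] p unfolding zw by blast
        then show ?thesis using i by (simp only: zw prod.case \<psi>_def tU(1) scalar_seq_def restrict_apply if_True snd_conv less_one simp_thms)
      qed
      show "holomorphic2_on (\<lambda>(z, w). scalar_seq (lc (c + cscale (chart c d (snd (pt a b z, pt a' b' w))) d) (e (pt a b z, pt a' b' w))) i) ?S"
        by (rule iffD1[OF holomorphic2_on_cong[OF openin_X2_open[OF opN fr] 2] 1])
    qed
  qed
  show "\<exists>e\<in>?gen N'. \<forall>q\<in>N'. scalar_seq (lc (c + cscale (chart c d (snd q)) d) (e q)) = unit_seq j"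
    if N': "openin (topo X2) N'" "N' \<subseteq> lines cscale \<times> dom d" and j: "j < 1" for N' j
  proof -
    obtain t where t: "t \<in> sects W (dom d)" "\<And>z. pt c d z \<in> dom d \<Longrightarrow> A (c + cscale z d) d (t (pt c d z)) = unit_seq 0"
      using hom_section_of_coords[OF W cd(1) opd, of "\<lambda>_. unit_seq 0"] unit_seq_in_seqs[of 0 1]
      by (auto simp: unit_seq_def)
    have "lc (c + cscale (chart c d p) d) (t p) = 1" if p: "p \<in> dom d" for p
    proof -
      let ?z = "chart c d p"
      have e: "pt c d ?z = p" by (rule pt_chart[OF cd(1) p])
      have "t p \<in> carrier (fibre W (ln (c + cscale ?z d)))"
        using holomorphic_sectionsD(2)[OF t(1)[unfolded hom_sects[OF W opd]] p] e by (simp add: pt_def)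
      then have "lc (c + cscale ?z d) (t p) = A (c + cscale ?z d) d (t p) 0"
        by (rule lc_eq[rotated]) (simp add: \<omega>_pt cd(1))
      then show ?thesis using t(2)[of ?z] p e by (simp add: unit_seq_def)
    qed
    then have "\<forall>q\<in>N'. scalar_seq (lc (c + cscale (chart c d (snd q)) d) (t (snd q))) = unit_seq j"
      using N'(2) j by (auto simp: scalar_seq_def unit_seq_def fun_eq_iff)
    moreover have "snd ` N' \<subseteq> dom d" using N'(2) by auto
    then have "(\<lambda>q. t (snd q)) \<in> ?gen N'"
      by (intro CollectI exI[of _ t] exI[of _ "dom d"] conjI refl opd t(1))
    ultimately show ?thesis by (intro bexI[of _ "\<lambda>q. t (snd q)"])
  qed
qed

definition local_fun :: "('v set \<times> 'v set \<Rightarrow> 'a) \<Rightarrow> 'v \<Rightarrow> 'v \<Rightarrow> 'v \<Rightarrow> 'v \<Rightarrow> complex \<times> complex \<Rightarrow> complex" where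
  "local_fun s a b c d = (\<lambda>(z, w). lc (c + cscale w d) (s (pt a b z, pt c d w)))"

definition in_charts :: "('v set \<times> 'v set) set \<Rightarrow> 'v \<Rightarrow> 'v \<Rightarrow> 'v \<Rightarrow> 'v \<Rightarrow> (complex \<times> complex) set" where
  "in_charts N a b c d = {(z, w). (pt a b z, pt c d w) \<in> N}"

lemma in_charts_iff: "(z, w) \<in> in_charts N a b c d \<longleftrightarrow> (pt a b z, pt c d w) \<in> N"
  by (simp add: in_charts_def)

lemma open_in_charts: "openin (topo X2) N \<Longrightarrow> \<omega> a b \<noteq> 0 \<Longrightarrow> \<omega> c d \<noteq> 0 \<Longrightarrow> open (in_charts N a b c d)"
  unfolding in_charts_def by (rule openin_X2_open)

lemma pb_hol_iff:
  assumes "\<omega> a b \<noteq> 0" "\<omega> c d \<noteq> 0" "openin (topo X2) N" "N \<subseteq> dom b \<times> dom d"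
  shows "(\<lambda>q\<in>N. scalar_seq (lc (c + cscale (chart c d (snd q)) d) (s q)) 0) \<in> hol X2 N \<longleftrightarrow>
    holomorphic2_on (local_fun s a b c d) (in_charts N a b c d)"
proof -
  have "holomorphic2_on (\<lambda>(z, w). (\<lambda>q\<in>N. scalar_seq (lc (c + cscale (chart c d (snd q)) d) (s q)) 0) (pt a b z, pt c d w))
      (in_charts N a b c d) \<longleftrightarrow> holomorphic2_on (local_fun s a b c d) (in_charts N a b c d)"
    by (rule holomorphic2_on_cong[OF open_in_charts[OF assms(3,1,2)]])
       (auto simp: in_charts_def local_fun_def chart_pt[OF assms(2)] scalar_seq_def)
  then show ?thesis using hol_X2_chart[OF assms(1,2,4,3)] by (simp add: in_charts_def)
qed

lemma frame_at:
  assumes "\<xi> \<in> lines cscale"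
  obtains a b where "\<omega> a b \<noteq> 0" "\<xi> = ln a" "\<xi> \<in> dom b"
proof -
  obtain a where a: "a \<noteq> 0" "\<xi> = ln a" using assms by (auto simp: lines_eq)
  obtain b where b: "\<omega> a b \<noteq> 0" using ex_frame[OF a(1)] by blast
  show ?thesis using that[OF b a(2)] a b ln_in_dom by simp
qed

lemma pb_sects_iff:
  assumes N: "openin (topo X2) N"
  shows "s \<in> sects pb N \<longleftrightarrow> s \<in> extensional N \<and> (\<forall>q\<in>N. s q \<in> carrier (fibre W (snd q))) \<and>
    (\<forall>p\<in>N. \<exists>N'. openin (topo X2) N' \<and> p \<in> N' \<and> N' \<subseteq> N \<and>
         (\<exists>(m::nat) f e. (\<forall>i<m. f i \<in> hol X2 N' \<and>
            e i \<in> {\<lambda>q. s (snd q) | s U. openin (topo X) U \<and> snd ` N' \<subseteq> U \<and> s \<in> sects W U}) \<and>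
           (\<forall>q\<in>N'. s q = finsum (fibre W (snd q)) (\<lambda>i. f i q \<odot>\<^bsub>fibre W (snd q)\<^esub> e i q) {..<m})))"
  unfolding pb_def pullback_snd_def vbundle.simps local_span_def proj_def[symmetric] by simp

lemma pb_sectsD:
  assumes N: "openin (topo X2) N" and s: "s \<in> sects pb N"
  shows "s \<in> extensional N" "q \<in> N \<Longrightarrow> s q \<in> carrier (fibre W (snd q))"
    and "\<omega> a b \<noteq> 0 \<Longrightarrow> \<omega> c d \<noteq> 0 \<Longrightarrow> holomorphic2_on (local_fun s a b c d) (in_charts N a b c d)"
proof -
  note sD = s[unfolded pb_sects_iff[OF N]]
  show "s \<in> extensional N" using sD by blast
  show car: "s q \<in> carrier (fibre W (snd q))" if "q \<in> N" for q using sD that by blast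
  assume fr: "\<omega> a b \<noteq> 0" "\<omega> c d \<noteq> 0"
  show "holomorphic2_on (local_fun s a b c d) (in_charts N a b c d)"
  proof (rule holomorphic2_on_local)
    fix zw assume "zw \<in> in_charts N a b c d"
    then obtain z w where zw: "zw = (z, w)" "(pt a b z, pt c d w) \<in> N" by (auto simp: in_charts_def)
    have "snd (pt a b z, pt c d w) \<in> dom d" using pt_in_dom[OF fr(2)] by simp
    from iffD1[OF pb_key[OF N zw(2) car fr(2) this] bspec[OF conjunct2[OF conjunct2[OF sD]] zw(2)]]
    obtain N' where N': "openin (topo X2) N'" "(pt a b z, pt c d w) \<in> N'" "N' \<subseteq> N \<inter> (lines cscale \<times> dom d)"
      "(\<lambda>q\<in>N'. scalar_seq (lc (c + cscale (chart c d (snd q)) d) (s q)) 0) \<in> hol X2 N'" by auto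
    have "holomorphic2_on (local_fun s a b c d) (in_charts N' a b c d)"
      by (rule iffD1[OF holomorphic2_on_cong[OF open_in_charts[OF N'(1) fr]] hol_X2D[OF N'(4) fr, folded in_charts_def]])
         (auto simp: in_charts_def local_fun_def chart_pt[OF fr(2)] scalar_seq_def)
    then show "\<exists>T. zw \<in> T \<and> holomorphic2_on (local_fun s a b c d) T"
      using N'(2) zw(1) by (intro exI[of _ "in_charts N' a b c d"]) (auto simp: in_charts_def)
  qed
qed

lemma pb_sectsI:
  assumes N: "openin (topo X2) N" and ext: "s \<in> extensional N"
    and car: "\<And>q. q \<in> N \<Longrightarrow> s q \<in> carrier (fibre W (snd q))"
    and hol: "\<And>p. p \<in> N \<Longrightarrow> \<exists>a b c d. \<omega> a b \<noteq> 0 \<and> \<omega> c d \<noteq> 0 \<and> p \<in> dom b \<times> dom d \<and>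
      holomorphic2_on (local_fun s a b c d) (in_charts (N \<inter> dom b \<times> dom d) a b c d)"
  shows "s \<in> sects pb N"
  unfolding pb_sects_iff[OF N]
proof (intro conjI ballI ext car, assumption)
  fix p assume p: "p \<in> N"
  from hol[OF p] obtain a b c d where fr: "\<omega> a b \<noteq> 0" "\<omega> c d \<noteq> 0" and pd: "p \<in> dom b \<times> dom d"
    and h: "holomorphic2_on (local_fun s a b c d) (in_charts (N \<inter> dom b \<times> dom d) a b c d)" by blast
  have op: "openin (topo X2) (N \<inter> dom b \<times> dom d)"
    using N openin_X2_Times[OF openin_dom[OF frame_nz(2)[OF fr(1)]] openin_dom[OF frame_nz(2)[OF fr(2)]]] by blast
  have h': "(\<lambda>q\<in>N \<inter> dom b \<times> dom d. scalar_seq (lc (c + cscale (chart c d (snd q)) d) (s q)) 0) \<in> hol X2 (N \<inter> dom b \<times> dom d)"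
    by (rule iffD2[OF pb_hol_iff[OF fr op] h]) blast
  have sd: "snd p \<in> dom d" using pd by auto
  show "\<exists>N'. openin (topo X2) N' \<and> p \<in> N' \<and> N' \<subseteq> N \<and>
         (\<exists>(m::nat) f e. (\<forall>i<m. f i \<in> hol X2 N' \<and>
            e i \<in> {\<lambda>q. s (snd q) | s U. openin (topo X) U \<and> snd ` N' \<subseteq> U \<and> s \<in> sects W U}) \<and>
           (\<forall>q\<in>N'. s q = finsum (fibre W (snd q)) (\<lambda>i. f i q \<odot>\<^bsub>fibre W (snd q)\<^esub> e i q) {..<m}))"
    by (rule iffD2[OF pb_key[OF N p car fr(2) sd]], assumption, intro exI[of _ "N \<inter> dom b \<times> dom d"] conjI allI impI)
       (use op p pd h' in \<open>auto simp: dom_def[of b]\<close>)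
qed

lemma pb_sectsI_all:
  assumes N: "openin (topo X2) N" and ext: "s \<in> extensional N"
    and car: "\<And>q. q \<in> N \<Longrightarrow> s q \<in> carrier (fibre W (snd q))"
    and hol: "\<And>a b c d. \<omega> a b \<noteq> 0 \<Longrightarrow> \<omega> c d \<noteq> 0 \<Longrightarrow> holomorphic2_on (local_fun s a b c d) (in_charts N a b c d)"
  shows "s \<in> sects pb N"
proof (rule pb_sectsI[OF N ext car], assumption)
  fix p assume p: "p \<in> N"
  have "fst p \<in> lines cscale" "snd p \<in> lines cscale" using openin_X2_sub[OF N] p by auto
  then obtain a b c d where fr: "\<omega> a b \<noteq> 0" "fst p \<in> dom b" "\<omega> c d \<noteq> 0" "snd p \<in> dom d"
    using frame_at by metis
  have "holomorphic2_on (local_fun s a b c d) (in_charts (N \<inter> dom b \<times> dom d) a b c d)"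
    by (rule holomorphic2_on_subset[OF hol[OF fr(1,3)]]) (auto simp: in_charts_def)
  then show "\<exists>a b c d. \<omega> a b \<noteq> 0 \<and> \<omega> c d \<noteq> 0 \<and> p \<in> dom b \<times> dom d \<and>
      holomorphic2_on (local_fun s a b c d) (in_charts (N \<inter> dom b \<times> dom d) a b c d)"
    using fr by (metis mem_Times_iff)
qed

lemma in_charts_square: "in_charts (V \<times> V) a b a b = {z. pt a b z \<in> V} \<times> {z. pt a b z \<in> V}"
  by (auto simp: in_charts_def)

lemma section_of_local_fun:
  assumes ab: "\<omega> a b \<noteq> 0" and V: "openin (topo X) V" "V \<subseteq> dom b"
    and F: "holomorphic2_on F ({z. pt a b z \<in> V} \<times> {z. pt a b z \<in> V})"
  obtains t where "t \<in> sects pb (V \<times> V)"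
    "\<And>z w. pt a b z \<in> V \<Longrightarrow> pt a b w \<in> V \<Longrightarrow> local_fun t a b a b (z, w) = F (z, w)"
proof -
  let ?T = "{z. pt a b z \<in> V}"
  have N: "openin (topo X2) (V \<times> V)" by (rule openin_X2_Times[OF V(1) V(1)])
  have T: "open ?T" by (rule openin_X_open[OF V(1) ab])
  have ex: "\<exists>x. x \<in> carrier (fibre W (pt a b w)) \<and> lc (a + cscale w b) x = F (z, w)" for z w
    using ex_lc[OF pt_nz[OF ab]] unfolding pt_def by metis
  define t where "t = (\<lambda>q\<in>V \<times> V. SOME x. x \<in> carrier (fibre W (snd q)) \<and>
      lc (a + cscale (chart a b (snd q)) b) x = F (chart a b (fst q), chart a b (snd q)))"
  have t: "t (pt a b z, pt a b w) \<in> carrier (fibre W (pt a b w)) \<and> lc (a + cscale w b) (t (pt a b z, pt a b w)) = F (z, w)"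
    if "z \<in> ?T" "w \<in> ?T" for z w
    using someI_ex[OF ex[of w z]] that by (simp add: t_def chart_pt[OF ab])
  show ?thesis
  proof (rule that)
    show local: "local_fun t a b a b (z, w) = F (z, w)" if "pt a b z \<in> V" "pt a b w \<in> V" for z w
      using t that by (simp add: local_fun_def)
    show "t \<in> sects pb (V \<times> V)"
    proof (rule pb_sectsI[OF N])
      show "t q \<in> carrier (fibre W (snd q))" if "q \<in> V \<times> V" for q
      proof -
        have q: "pt a b (chart a b (fst q)) = fst q" "pt a b (chart a b (snd q)) = snd q"
          using pt_chart[OF ab] that V(2) by auto
        show ?thesis using t[of "chart a b (fst q)" "chart a b (snd q)"] that unfolding mem_Collect_eq q by auto
      qed
      have 2: "F p = local_fun t a b a b p" if "p \<in> ?T \<times> ?T" for p using that local by auto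
      have "holomorphic2_on (local_fun t a b a b) (?T \<times> ?T)"
        by (rule iffD1[OF holomorphic2_on_cong[OF open_Times[OF T T] 2] F])
      moreover have "V \<times> V \<inter> dom b \<times> dom b = V \<times> V" using V(2) by blast
      ultimately have hol: "holomorphic2_on (local_fun t a b a b) (in_charts (V \<times> V \<inter> dom b \<times> dom b) a b a b)"
        by (simp only: in_charts_square)
      show "\<exists>a b c d. \<omega> a b \<noteq> 0 \<and> \<omega> c d \<noteq> 0 \<and> q \<in> dom b \<times> dom d \<and>
          holomorphic2_on (local_fun t a b c d) (in_charts (V \<times> V \<inter> dom b \<times> dom d) a b c d)" if "q \<in> V \<times> V" for q
        by (rule exI[of _ a], rule exI[of _ b], rule exI[of _ a], rule exI[of _ b]) (use ab that hol V(2) in auto)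
    qed (simp add: t_def)
  qed
qed

lemma local_fun_restrict:
  "(z, w) \<in> in_charts N a b c d \<Longrightarrow> local_fun (restrict s N) a b c d (z, w) = local_fun s a b c d (z, w)"
  by (simp add: local_fun_def in_charts_def)

lemma pb_restrict:
  assumes N: "openin (topo X2) N" "s \<in> sects pb N" and N': "openin (topo X2) N'" "N' \<subseteq> N"
  shows "restrict s N' \<in> sects pb N'"
proof (rule pb_sectsI_all[OF N'(1)])
  show "restrict s N' q \<in> carrier (fibre W (snd q))" if "q \<in> N'" for q
    using pb_sectsD(2)[OF N subsetD[OF N'(2) that]] that by simp
  fix a b c d assume fr: "\<omega> a b \<noteq> 0" "\<omega> c d \<noteq> 0"
  have "holomorphic2_on (local_fun s a b c d) (in_charts N' a b c d)"
    by (rule holomorphic2_on_subset[OF pb_sectsD(3)[OF N fr]]) (use N'(2) in \<open>auto simp: in_charts_def\<close>)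
  then show "holomorphic2_on (local_fun (restrict s N') a b c d) (in_charts N' a b c d)"
    by (rule iffD1[OF holomorphic2_on_cong[OF open_in_charts[OF N'(1) fr]], rotated])
       (auto simp: local_fun_restrict)
qed simp

end

lemma taylor_sum:
  assumes "\<And>i. i \<in> I \<Longrightarrow> f i holomorphic_on A" "open A" "0 \<in> A"
  shows "taylor (\<lambda>x. \<Sum>i\<in>I. f i x) l = (\<Sum>i\<in>I. taylor (f i) l)"
  using assms(1)
proof (induction I rule: infinite_finite_induct)
  case (insert j I)
  then show ?case using taylor_add[of "f j" A "\<lambda>x. \<Sum>i\<in>I. f i x" l] assms(2,3)
    by (auto intro!: holomorphic_intros)
qed (simp_all add: taylor_0)

lemma bidisc_in_open:
  fixes S :: "(complex \<times> complex) set"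
  assumes "open S" "(z, z) \<in> S"
  obtains r where "r > 0" "ball z r \<times> ball z r \<subseteq> S"
proof -
  obtain A B where AB: "open A" "open B" "z \<in> A" "z \<in> B" "A \<times> B \<subseteq> S"
    using open_prod_elim[OF assms] by (metis mem_Sigma_iff)
  have "open (A \<inter> B)" "z \<in> A \<inter> B" using AB by auto
  then obtain r where "r > 0" "ball z r \<subseteq> A \<inter> B" using open_contains_ball by blast
  then show ?thesis using AB by (intro that[of r]) auto
qed

context line_jets
begin

subsection \<open>Taylor coefficients along the diagonal\<close>

text \<open>
  The Taylor coefficient at the diagonal point of the line of \<open>v\<close>, in the direction of the second
  factor, with respect to the affine coordinate defined by the frame.
\<close>

definition jet_coeff :: "('v set \<times> 'v set \<Rightarrow> 'a) \<Rightarrow> 'v \<Rightarrow> 'v \<Rightarrow> nat \<Rightarrow> complex" where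
  "jet_coeff s v u i = taylor (\<lambda>\<tau>. lc (v + cscale \<tau> u) (s (ln v, pt v u \<tau>))) i"

lemma open_fibre_dir:
  assumes "openin (topo X2) N" "\<omega> v u \<noteq> 0"
  shows "open {\<tau>. (ln v, pt v u \<tau>) \<in> N}"
proof -
  have "open ((\<lambda>\<tau>. (0, \<tau>)) -` in_charts N v u v u)"
    by (rule open_vimage[OF open_in_charts[OF assms assms(2)]]) (intro continuous_intros)
  moreover have "(\<lambda>\<tau>. (0, \<tau>)) -` in_charts N v u v u = {\<tau>. (ln v, pt v u \<tau>) \<in> N}"
    by (auto simp: in_charts_def pt_0)
  ultimately show ?thesis by simp
qed

lemma hol_X2_fibre_dir:
  assumes "openin (topo X2) N" "\<omega> v u \<noteq> 0" "f \<in> hol X2 N"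
  shows "(\<lambda>\<tau>. f (ln v, pt v u \<tau>)) holomorphic_on {\<tau>. (ln v, pt v u \<tau>) \<in> N}"
proof -
  have "(\<lambda>\<tau>. (\<lambda>(s, t). f (pt v u s, pt v u t)) (0, \<tau>)) holomorphic_on {\<tau>. (ln v, pt v u \<tau>) \<in> N}"
    by (rule holomorphic2_on_along[OF hol_X2D[OF assms(3,2,2)] _ _ open_fibre_dir[OF assms(1,2)]])
       (auto simp: pt_0)
  then show ?thesis by (simp add: pt_0)
qed

lemma jet_fun_holomorphic:
  assumes "openin (topo X2) N" "\<omega> v u \<noteq> 0" "s \<in> sects pb N"
  shows "(\<lambda>\<tau>. lc (v + cscale \<tau> u) (s (ln v, pt v u \<tau>))) holomorphic_on {\<tau>. (ln v, pt v u \<tau>) \<in> N}"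
proof -
  have "(\<lambda>\<tau>. local_fun s v u v u (0, \<tau>)) holomorphic_on {\<tau>. (ln v, pt v u \<tau>) \<in> N}"
    by (rule holomorphic2_on_along[OF pb_sectsD(3)[OF assms(1,3,2,2)] _ _ open_fibre_dir[OF assms(1,2)]])
       (auto simp: pt_0 in_charts_def)
  then show ?thesis by (simp add: local_fun_def pt_0)
qed

text \<open>
  The new frame describes the line of \<open>v + \<tau>' u\<close> by the vector \<open>(l + \<tau> \<mu>) (v + \<tau>' u)\<close> with
  \<open>\<tau>' = \<tau> \<nu> / (l + \<tau> \<mu>)\<close>, and the coordinate of the fibre has degree \<open>n\<close>; so \<open>taylor_moebius\<close>
  applies.
\<close>

lemma jet_coeff_law:
  assumes N: "openin (topo X2) N" and s: "s \<in> sects pb N" and fr: "\<omega> v u \<noteq> 0" "l \<noteq> 0" "\<nu> \<noteq> 0"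
    and vN: "(ln v, ln v) \<in> N"
  shows "jet_coeff s (cscale l v) (cscale \<nu> u + cscale \<mu> v) i =
    (\<Sum>j\<le>i. jet_law n i j * \<nu> ^ j * \<mu> ^ (i - j) * l powi (n - int i) * jet_coeff s v u j)"
  unfolding jet_law_def jet_coeff_def
proof (rule taylor_moebius[OF fr(2) jet_fun_holomorphic[OF N fr(1) s] open_fibre_dir[OF N fr(1)]])
  show "0 \<in> {\<tau>. (ln v, pt v u \<tau>) \<in> N}" using vN by (simp add: pt_0)
  define h where "h = (\<lambda>x. x * \<nu> / (l + x * \<mu>))"
  have "h holomorphic_on {x. l + x * \<mu> \<noteq> 0}" unfolding h_def by (intro holomorphic_intros) auto
  moreover have op: "open {x. l + x * \<mu> \<noteq> 0}" by (auto intro!: open_Collect_neq continuous_intros)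
  ultimately have op': "open ({x. l + x * \<mu> \<noteq> 0} \<inter> h -` {\<tau>. (ln v, pt v u \<tau>) \<in> N})"
    by (intro continuous_open_preimage open_fibre_dir[OF N fr(1)] holomorphic_on_imp_continuous_on)
  have "\<forall>\<^sub>F x in nhds 0. x \<in> {x. l + x * \<mu> \<noteq> 0} \<inter> h -` {\<tau>. (ln v, pt v u \<tau>) \<in> N}"
    by (rule eventually_nhds_in_open[OF op']) (use fr vN in \<open>auto simp: h_def pt_0\<close>)
  then show "\<forall>\<^sub>F x in nhds 0. lc (cscale l v + cscale x (cscale \<nu> u + cscale \<mu> v))
      (s (ln (cscale l v), pt (cscale l v) (cscale \<nu> u + cscale \<mu> v) x)) =
    (l + x * \<mu>) powi n * lc (v + cscale (x * \<nu> / (l + x * \<mu>)) u) (s (ln v, pt v u (x * \<nu> / (l + x * \<mu>))))"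
  proof eventually_elim
    case (elim x)
    then have nz: "l + x * \<mu> \<noteq> 0" and hN: "(ln v, pt v u (h x)) \<in> N" by auto
    let ?y = "v + cscale (h x) u"
    have "cscale (l + x * \<mu>) ?y = cscale (l + x * \<mu>) v + cscale ((l + x * \<mu>) * h x) u"
      by (simp add: scale_right_distrib)
    also have "(l + x * \<mu>) * h x = x * \<nu>" using nz by (simp add: h_def)
    finally have y: "cscale l v + cscale x (cscale \<nu> u + cscale \<mu> v) = cscale (l + x * \<mu>) ?y"
      by (simp add: scale_right_distrib scale_left_distrib algebra_simps)
    have pt: "pt (cscale l v) (cscale \<nu> u + cscale \<mu> v) x = pt v u (h x)"
      unfolding pt_def y by (rule ln_scale[OF nz])
    have c: "s (ln v, pt v u (h x)) \<in> carrier (fibre W (ln ?y))"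
      using pb_sectsD(2)[OF N s hN] by (simp add: pt_def)
    have hx: "x * \<nu> / (l + x * \<mu>) = h x" by (simp add: h_def)
    show ?case
      unfolding pt y ln_scale[OF fr(2)] hx by (rule lc_scale[OF pt_nz[OF fr(1)] nz c])
  qed
qed

lemma jet_coeff_chart: "jet_coeff s (a + cscale z b) b i = taylor (\<lambda>x. local_fun s a b a b (z, z + x)) i"
  by (simp add: jet_coeff_def local_fun_def pt_def scale_left_distrib add.assoc)

lemma jet_coeff_holomorphic:
  assumes N: "openin (topo X2) N" and s: "s \<in> sects pb N" and ab: "\<omega> a b \<noteq> 0"
  shows "(\<lambda>z. jet_coeff s (a + cscale z b) b i) holomorphic_on {z. (pt a b z, pt a b z) \<in> N}"
  unfolding holomorphic_on_def
proof
  fix z assume "z \<in> {z. (pt a b z, pt a b z) \<in> N}"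
  then have "(z, z) \<in> in_charts N a b a b" by (simp add: in_charts_def)
  then obtain r where r: "r > 0" "ball z r \<times> ball z r \<subseteq> in_charts N a b a b"
    using bidisc_in_open[OF open_in_charts[OF N ab ab]] by blast
  have "(\<lambda>z. taylor (\<lambda>x. local_fun s a b a b (z, z + x)) i) holomorphic_on ball z r"
    by (rule holomorphic2_taylor[OF open_ball holomorphic2_on_subset[OF pb_sectsD(3)[OF N s ab ab] r(2)], of "Suc i"])
      simp
  then have "(\<lambda>z. jet_coeff s (a + cscale z b) b i) field_differentiable (at z)"
    unfolding jet_coeff_chart using r(1) holomorphic_on_imp_differentiable_at[OF _ open_ball] by auto
  then show "(\<lambda>z. jet_coeff s (a + cscale z b) b i) field_differentiable (at z within {z. (pt a b z, pt a b z) \<in> N})"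
    by (rule field_differentiable_at_within)
qed

text \<open>
  The coefficients depend on the first factor only, so they are constant in the direction in which
  jets are taken. The lemma covers differences (in germs) and the module operations of the direct
  image.
\<close>

lemma pb_combination:
  assumes N: "openin (topo X2) N" "openin (topo X2) N1" "openin (topo X2) N2" "N \<subseteq> N1 \<inter> N2"
    and s: "s1 \<in> sects pb N1" "s2 \<in> sects pb N2"
    and U: "openin (topo X) U" "fst ` N \<subseteq> U"
    and f: "\<And>a b. \<omega> a b \<noteq> 0 \<Longrightarrow> (\<lambda>z. f1 (pt a b z)) holomorphic_on {z. pt a b z \<in> U}"
      "\<And>a b. \<omega> a b \<noteq> 0 \<Longrightarrow> (\<lambda>z. f2 (pt a b z)) holomorphic_on {z. pt a b z \<in> U}"
    and D: "D \<in> extensional N" "\<And>q. q \<in> N \<Longrightarrow> D q \<in> carrier (fibre W (snd q))"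
      "\<And>\<xi> w. w \<noteq> 0 \<Longrightarrow> (\<xi>, ln w) \<in> N \<Longrightarrow>
        lc w (D (\<xi>, ln w)) = f1 \<xi> * lc w (s1 (\<xi>, ln w)) + f2 \<xi> * lc w (s2 (\<xi>, ln w))"
  shows "D \<in> sects pb N"
    and "\<omega> v u \<noteq> 0 \<Longrightarrow> (ln v, ln v) \<in> N \<Longrightarrow>
      jet_coeff D v u i = f1 (ln v) * jet_coeff s1 v u i + f2 (ln v) * jet_coeff s2 v u i"
proof -
  show Ds: "D \<in> sects pb N"
  proof (rule pb_sectsI_all[OF N(1) D(1,2)], assumption)
    fix a b c d assume fr: "\<omega> a b \<noteq> 0" "\<omega> c d \<noteq> 0"
    let ?S = "in_charts N a b c d"
    have sub: "?S \<subseteq> in_charts N1 a b c d" "?S \<subseteq> in_charts N2 a b c d" using N(4) by (auto simp: in_charts_def)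
    have fS: "fst ` ?S \<subseteq> {z. pt a b z \<in> U}" using U(2) by (force simp: in_charts_def)
    have 1: "holomorphic2_on (\<lambda>p. (case p of (z, w) \<Rightarrow> f1 (pt a b z)) * local_fun s1 a b c d p +
        (case p of (z, w) \<Rightarrow> f2 (pt a b z)) * local_fun s2 a b c d p) ?S"
      by (intro holomorphic2_on_add holomorphic2_on_mult
          holomorphic2_on_compose_fst[OF f(1)[OF fr(1)] openin_X_open[OF U(1) fr(1)] fS]
          holomorphic2_on_compose_fst[OF f(2)[OF fr(1)] openin_X_open[OF U(1) fr(1)] fS]
          holomorphic2_on_subset[OF pb_sectsD(3)[OF N(2) s(1) fr] sub(1)]
          holomorphic2_on_subset[OF pb_sectsD(3)[OF N(3) s(2) fr] sub(2)])
    have 2: "(case p of (z, w) \<Rightarrow> f1 (pt a b z)) * local_fun s1 a b c d p +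
        (case p of (z, w) \<Rightarrow> f2 (pt a b z)) * local_fun s2 a b c d p = local_fun D a b c d p"
      if p: "p \<in> ?S" for p
    proof -
      obtain z w where zw: "p = (z, w)" by fastforce
      have "(pt a b z, ln (c + cscale w d)) \<in> N" using p unfolding zw in_charts_iff pt_def .
      from D(3)[OF pt_nz[OF fr(2)] this] show ?thesis unfolding zw local_fun_def pt_def[of c d] by simp
    qed
    show "holomorphic2_on (local_fun D a b c d) ?S"
      by (rule iffD1[OF holomorphic2_on_cong[OF open_in_charts[OF N(1) fr] 2] 1])
  qed
  assume vu: "\<omega> v u \<noteq> 0" and vN: "(ln v, ln v) \<in> N"
  let ?T = "{\<tau>. (ln v, pt v u \<tau>) \<in> N}"
  let ?g = "\<lambda>s \<tau>. lc (v + cscale \<tau> u) (s (ln v, pt v u \<tau>))"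
  have T: "open ?T" "0 \<in> ?T" using open_fibre_dir[OF N(1) vu] vN by (auto simp: pt_0)
  have sub: "?T \<subseteq> {\<tau>. (ln v, pt v u \<tau>) \<in> N1}" "?T \<subseteq> {\<tau>. (ln v, pt v u \<tau>) \<in> N2}"
    using N(4) by auto
  have g: "?g s1 holomorphic_on ?T" "?g s2 holomorphic_on ?T"
    by (rule holomorphic_on_subset[OF jet_fun_holomorphic[OF N(2) vu s(1)] sub(1)],
        rule holomorphic_on_subset[OF jet_fun_holomorphic[OF N(3) vu s(2)] sub(2)])
  have "\<forall>\<^sub>F \<tau> in nhds 0. \<tau> \<in> ?T" by (rule eventually_nhds_in_open[OF T])
  then have "\<forall>\<^sub>F \<tau> in nhds 0. ?g D \<tau> = f1 (ln v) * ?g s1 \<tau> + f2 (ln v) * ?g s2 \<tau>"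
    by eventually_elim (use D(3)[OF pt_nz[OF vu]] in \<open>simp add: pt_def\<close>)
  then have "jet_coeff D v u i = taylor (\<lambda>\<tau>. f1 (ln v) * ?g s1 \<tau> + f2 (ln v) * ?g s2 \<tau>) i"
    unfolding jet_coeff_def by (rule taylor_cong)
  also have "\<dots> = taylor (\<lambda>\<tau>. f1 (ln v) * ?g s1 \<tau>) i + taylor (\<lambda>\<tau>. f2 (ln v) * ?g s2 \<tau>) i"
    by (rule taylor_add[OF _ _ T]) (intro holomorphic_intros g)+
  also have "\<dots> = f1 (ln v) * jet_coeff s1 v u i + f2 (ln v) * jet_coeff s2 v u i"
    unfolding jet_coeff_def using taylor_cmult[OF g(1) T] taylor_cmult[OF g(2) T] by simp
  finally show "jet_coeff D v u i = f1 (ln v) * jet_coeff s1 v u i + f2 (ln v) * jet_coeff s2 v u i" .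
qed

subsection \<open>The powers of the ideal of the diagonal\<close>

text \<open>
  Off the diagonal a point has the form of the lines of \<open>v\<close> and \<open>w\<close> for a frame \<open>(v, w)\<close>. The lines
  of \<open>v + s w\<close> and \<open>w + t v\<close> agree only if \<open>s t = 1\<close>, which does not happen in the unit discs.
\<close>

lemma separate_points:
  assumes N: "openin (topo X2) N" "p \<in> N" "fst p \<noteq> snd p"
  obtains N' where "openin (topo X2) N'" "p \<in> N'" "N' \<subseteq> N" "\<And>q. q \<in> N' \<Longrightarrow> fst q \<noteq> snd q"
proof -
  obtain v w where vw: "v \<noteq> 0" "w \<noteq> 0" "p = (ln v, ln w)"
    using openin_X2_sub[OF N(1)] N(2) by (auto simp: lines_eq)
  have o: "\<omega> v w \<noteq> 0" using N(3) ln_eq_iff[OF vw(1,2)] vw(3) by auto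
  have o': "\<omega> w v \<noteq> 0" using o \<omega>_swap[of w v] by simp
  let ?B = "(pt v w ` ball 0 1) \<times> (pt w v ` ball 0 1)"
  have opB: "openin (topo X2) ?B"
    by (intro openin_X2_Times openin_chart_image o o' open_ball)
  have pB: "p \<in> ?B" using vw(3) pt_0[of v w] pt_0[of w v] by (auto simp: image_iff)
  have "pt v w s \<noteq> pt w v t" if st: "s \<in> ball 0 1" "t \<in> ball 0 1" for s t
  proof
    assume "pt v w s = pt w v t"
    then have "\<omega> (v + cscale s w) (w + cscale t v) = 0"
      using ln_eq_iff[OF pt_nz[OF o] pt_nz[OF o']] by (simp add: pt_def)
    then have "(1 - s * t) * \<omega> v w = 0" using \<omega>_swap[of w v] by (simp add: \<omega>_simps algebra_simps)
    then have "s * t = 1" using o by simp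
    then have "norm s * norm t = 1" by (metis norm_mult norm_one)
    moreover have "norm s * norm t < 1 * 1"
      by (rule mult_strict_mono') (use st in auto)
    ultimately show False by simp
  qed
  then have "fst q \<noteq> snd q" if "q \<in> N \<inter> ?B" for q using that by auto
  then show ?thesis using that[of "N \<inter> ?B"] N opB pB by blast
qed

abbreviation twist :: "nat \<Rightarrow> ('v set \<times> 'v set) set \<Rightarrow> ('v set \<times> 'v set \<Rightarrow> 'a) set" where
  "twist j \<equiv> diagonal_twist (proj_atlas cscale) proj_act pb j"

text \<open>
  Along the second factor the generators are products of \<open>k\<close> functions vanishing at the point of
  the diagonal with a holomorphic function.
\<close>

lemma twistD:
  assumes N: "openin (topo X2) N" and D: "D \<in> twist k N"
  shows "D \<in> sects pb N" and "\<omega> v u \<noteq> 0 \<Longrightarrow> (ln v, ln v) \<in> N \<Longrightarrow> i < k \<Longrightarrow> jet_coeff D v u i = 0"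
proof -
  have ext: "D \<in> extensional N" and car: "\<And>q. q \<in> N \<Longrightarrow> D q \<in> carrier (fibre W (snd q))"
    using D unfolding diagonal_twist_def local_span_def by (auto simp: pb_fibre)
  have loc: "\<exists>N' (m::nat) f h t. openin (topo X2) N' \<and> p \<in> N' \<and> N' \<subseteq> N \<and>
      (\<forall>l<m. f l \<in> hol X2 N' \<and> t l \<in> sects pb N' \<and>
        (\<forall>i<k. h l i \<in> hol X2 N' \<and> (\<forall>x. (x, x) \<in> N' \<longrightarrow> h l i (x, x) = 0))) \<and>
      (\<forall>\<xi> w. w \<noteq> 0 \<longrightarrow> (\<xi>, ln w) \<in> N' \<longrightarrow> lc w (D (\<xi>, ln w)) =
        (\<Sum>l<m. (\<Prod>i<k. h l i (\<xi>, ln w)) * (f l (\<xi>, ln w) * lc w (t l (\<xi>, ln w)))))"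
    if p: "p \<in> N" for p
  proof -
    obtain N' and m :: nat and f e where N': "openin (topo X2) N'" "p \<in> N'" "N' \<subseteq> N"
      and fe: "\<And>l. l < m \<Longrightarrow> f l \<in> hol X2 N'" "\<And>l. l < m \<Longrightarrow> e l \<in> {\<lambda>q. (\<Prod>i<k. h i q) \<odot>\<^bsub>fibre pb q\<^esub> t q | h t.
              (\<forall>i<k. h i \<in> hol X2 N' \<and> (\<forall>x. (x, x) \<in> N' \<longrightarrow> h i (x, x) = 0)) \<and> t \<in> sects pb N'}"
      and sum: "\<And>q. q \<in> N' \<Longrightarrow> D q = finsum (fibre pb q) (\<lambda>i. f i q \<odot>\<^bsub>fibre pb q\<^esub> e i q) {..<m}"
      using bspec[OF conjunct2[OF conjunct2[OF CollectD[OF D[unfolded diagonal_twist_def local_span_def]]]] p]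
      by (elim exE conjE) (rule that, assumption+, simp_all)
    have "\<forall>l. \<exists>h t. l < m \<longrightarrow> e l = (\<lambda>q. (\<Prod>i<k. h i q) \<odot>\<^bsub>fibre pb q\<^esub> t q) \<and>
        (\<forall>i<k. h i \<in> hol X2 N' \<and> (\<forall>x. (x, x) \<in> N' \<longrightarrow> h i (x, x) = 0)) \<and> t \<in> sects pb N'"
      using fe(2) by blast
    from choice[OF this] obtain h where "\<forall>l. \<exists>t. l < m \<longrightarrow> e l = (\<lambda>q. (\<Prod>i<k. h l i q) \<odot>\<^bsub>fibre pb q\<^esub> t q) \<and>
        (\<forall>i<k. h l i \<in> hol X2 N' \<and> (\<forall>x. (x, x) \<in> N' \<longrightarrow> h l i (x, x) = 0)) \<and> t \<in> sects pb N'" ..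
    from choice[OF this] obtain t where t: "\<forall>l. l < m \<longrightarrow> e l = (\<lambda>q. (\<Prod>i<k. h l i q) \<odot>\<^bsub>fibre pb q\<^esub> t l q) \<and>
        (\<forall>i<k. h l i \<in> hol X2 N' \<and> (\<forall>x. (x, x) \<in> N' \<longrightarrow> h l i (x, x) = 0)) \<and> t l \<in> sects pb N'" ..
    have ht: "\<And>l. l < m \<Longrightarrow> e l = (\<lambda>q. (\<Prod>i<k. h l i q) \<odot>\<^bsub>fibre pb q\<^esub> t l q)"
      "\<And>l i. l < m \<Longrightarrow> i < k \<Longrightarrow> h l i \<in> hol X2 N' \<and> (\<forall>x. (x, x) \<in> N' \<longrightarrow> h l i (x, x) = 0)"
      "\<And>l. l < m \<Longrightarrow> t l \<in> sects pb N'"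
      using t by simp_all
    have "lc w (D (\<xi>, ln w)) = (\<Sum>l<m. (\<Prod>i<k. h l i (\<xi>, ln w)) * (f l (\<xi>, ln w) * lc w (t l (\<xi>, ln w))))"
      if w: "w \<noteq> 0" "(\<xi>, ln w) \<in> N'" for \<xi> w
    proof -
      let ?q = "(\<xi>, ln w)" and ?F = "fibre W (ln w)"
      have tc: "t l ?q \<in> carrier ?F" if "l < m" for l using pb_sectsD(2)[OF N'(1) ht(3)[OF that] w(2)] by simp
      have ec: "e l ?q \<in> carrier ?F" if "l < m" for l
        using coords_smult(1)[OF W_coords[OF w(1)] tc[OF that]] by (simp add: ht(1)[OF that] pb_fibre)
      have "lc w (D ?q) = (\<Sum>l<m. lc w (f l ?q \<odot>\<^bsub>?F\<^esub> e l ?q))"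
        using sum[OF w(2)] lc_finsum[OF w(1), of "{..<m}" "\<lambda>l. f l ?q \<odot>\<^bsub>?F\<^esub> e l ?q"]
          coords_smult(1)[OF W_coords[OF w(1)] ec] by (simp add: pb_fibre)
      also have "\<dots> = (\<Sum>l<m. (\<Prod>i<k. h l i ?q) * (f l ?q * lc w (t l ?q)))"
      proof (rule sum.cong[OF refl])
        fix l assume "l \<in> {..<m}"
        then have l: "l < m" by simp
        have "e l ?q = (\<Prod>i<k. h l i ?q) \<odot>\<^bsub>?F\<^esub> t l ?q" by (simp add: ht(1)[OF l] pb_fibre)
        then show "lc w (f l ?q \<odot>\<^bsub>?F\<^esub> e l ?q) = (\<Prod>i<k. h l i ?q) * (f l ?q * lc w (t l ?q))"
          using lc_smult[OF w(1) ec[OF l], of "f l ?q"] lc_smult[OF w(1) tc[OF l]] by simp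
      qed
      finally show ?thesis .
    qed
    then show ?thesis
      by (intro exI[of _ N'] exI[of _ m] exI[of _ f] exI[of _ h] exI[of _ t] conjI N' allI impI) (use fe(1) ht(2,3) in blast)+
  qed
  show "D \<in> sects pb N"
  proof (rule pb_sectsI_all[OF N ext car], assumption)
    fix a b c d assume fr: "\<omega> a b \<noteq> 0" "\<omega> c d \<noteq> 0"
    show "holomorphic2_on (local_fun D a b c d) (in_charts N a b c d)"
    proof (rule holomorphic2_on_local)
      fix p assume "p \<in> in_charts N a b c d"
      then have "(pt a b (fst p), pt c d (snd p)) \<in> N" by (auto simp: in_charts_def)
      from loc[OF this] obtain N' m f h t where N': "openin (topo X2) N'" "(pt a b (fst p), pt c d (snd p)) \<in> N'"
        and *: "\<forall>l<m. f l \<in> hol X2 N' \<and> t l \<in> sects pb N' \<and> (\<forall>i<k. h l i \<in> hol X2 N' \<and> (\<forall>x. (x, x) \<in> N' \<longrightarrow> h l i (x, x) = 0))"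
          "\<forall>\<xi> w. w \<noteq> 0 \<longrightarrow> (\<xi>, ln w) \<in> N' \<longrightarrow> lc w (D (\<xi>, ln w)) =
            (\<Sum>l<(m::nat). (\<Prod>i<k. h l i (\<xi>, ln w)) * (f l (\<xi>, ln w) * lc w (t l (\<xi>, ln w))))"
        by (elim exE conjE) (rule that; assumption)
      let ?S = "in_charts N' a b c d"
      let ?G = "\<lambda>g (z, w). g (pt a b z, pt c d w) :: complex"
      have hol: "holomorphic2_on (?G g) ?S" if "g \<in> hol X2 N'" for g
        using hol_X2D[OF that fr] by (simp add: in_charts_def case_prod_unfold)
      have 1: "holomorphic2_on (\<lambda>p. \<Sum>l<m. (\<Prod>i<k. ?G (h l i) p) * (?G (f l) p * local_fun (t l) a b c d p)) ?S"
        by (intro holomorphic2_on_sum holomorphic2_on_mult holomorphic2_on_prod hol pb_sectsD(3)[OF N'(1) _ fr])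
           (use *(1) in auto)
      have 2: "(\<Sum>l<m. (\<Prod>i<k. ?G (h l i) p) * (?G (f l) p * local_fun (t l) a b c d p)) = local_fun D a b c d p"
        if p: "p \<in> ?S" for p
      proof -
        obtain z w where zw: "p = (z, w)" by fastforce
        have "(pt a b z, ln (c + cscale w d)) \<in> N'" using p unfolding zw in_charts_iff pt_def .
        with *(2) pt_nz[OF fr(2)] show ?thesis unfolding zw local_fun_def pt_def[of c d] by simp
      qed
      have "holomorphic2_on (local_fun D a b c d) ?S"
        by (rule iffD1[OF holomorphic2_on_cong[OF open_in_charts[OF N'(1) fr] 2] 1])
      moreover have "p \<in> ?S" using N'(2) by (simp add: in_charts_def case_prod_unfold)
      ultimately show "\<exists>T. p \<in> T \<and> holomorphic2_on (local_fun D a b c d) T" by blast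
    qed
  qed
  assume vu: "\<omega> v u \<noteq> 0" and vN: "(ln v, ln v) \<in> N" and i: "i < k"
  from loc[OF vN] obtain N' m f h t where N': "openin (topo X2) N'" "(ln v, ln v) \<in> N'"
    and *: "\<And>l. l < m \<Longrightarrow> f l \<in> hol X2 N'" "\<And>l. l < m \<Longrightarrow> t l \<in> sects pb N'"
      "\<And>l i. l < m \<Longrightarrow> i < k \<Longrightarrow> h l i \<in> hol X2 N'" "\<And>l i x. l < m \<Longrightarrow> i < k \<Longrightarrow> (x, x) \<in> N' \<Longrightarrow> h l i (x, x) = 0"
      "\<And>\<xi> w. w \<noteq> 0 \<Longrightarrow> (\<xi>, ln w) \<in> N' \<Longrightarrow> lc w (D (\<xi>, ln w)) =
        (\<Sum>l<(m::nat). (\<Prod>i<k. h l i (\<xi>, ln w)) * (f l (\<xi>, ln w) * lc w (t l (\<xi>, ln w))))"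
    by (elim exE conjE) (rule that, assumption, assumption, simp_all)
  let ?T = "{\<tau>. (ln v, pt v u \<tau>) \<in> N'}"
  let ?R = "\<lambda>l \<tau>. f l (ln v, pt v u \<tau>) * lc (v + cscale \<tau> u) (t l (ln v, pt v u \<tau>))"
  let ?P = "\<lambda>l \<tau>. (\<Prod>i<k. h l i (ln v, pt v u \<tau>)) * ?R l \<tau>"
  have T: "open ?T" "0 \<in> ?T" using open_fibre_dir[OF N'(1) vu] N'(2) by (auto simp: pt_0)
  have R: "?R l holomorphic_on ?T" if "l < m" for l
    by (intro holomorphic_intros hol_X2_fibre_dir[OF N'(1) vu] jet_fun_holomorphic[OF N'(1) vu] *(1,2) that)
  have H: "(\<lambda>\<tau>. h l i (ln v, pt v u \<tau>)) holomorphic_on ?T" if "l < m" "i < k" for l i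
    by (intro hol_X2_fibre_dir[OF N'(1) vu] *(3) that)
  have "\<forall>\<^sub>F \<tau> in nhds 0. \<tau> \<in> ?T" by (rule eventually_nhds_in_open[OF T])
  then have "\<forall>\<^sub>F \<tau> in nhds 0. lc (v + cscale \<tau> u) (D (ln v, pt v u \<tau>)) = (\<Sum>l<m. ?P l \<tau>)"
    by eventually_elim (use *(5)[OF pt_nz[OF vu]] in \<open>simp add: pt_def\<close>)
  then have "jet_coeff D v u i = taylor (\<lambda>\<tau>. \<Sum>l<m. ?P l \<tau>) i"
    unfolding jet_coeff_def by (rule taylor_cong)
  also have "\<dots> = (\<Sum>l<m. taylor (?P l) i)"
    by (rule taylor_sum[OF _ T]) (intro holomorphic_intros R H; simp)
  also have "\<dots> = 0"
  proof (rule sum.neutral, rule ballI)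
    fix l assume "l \<in> {..<m}"
    then have l: "l < m" by simp
    show "taylor (?P l) i = 0"
      by (rule taylor_prod_eq_0[OF H[OF l] _ R[OF l] T i]) (use *(4)[OF l] N'(2) in \<open>simp_all add: pt_0\<close>)
  qed
  finally show "jet_coeff D v u i = 0" .
qed

text \<open>
  Near the diagonal, Taylor's formula with vanishing coefficients exhibits the section as the
  \<open>k\<close>-th power of the function \<open>w - z\<close>, which generates the ideal, times a section. Away from it the
  functions in the product can be taken to be 1.
\<close>

lemma twistI:
  assumes N: "openin (topo X2) N" and D: "D \<in> sects pb N"
    and van: "\<And>v u i. \<omega> v u \<noteq> 0 \<Longrightarrow> (ln v, ln v) \<in> N \<Longrightarrow> i < k \<Longrightarrow> jet_coeff D v u i = 0"
  shows "D \<in> twist k N"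
  unfolding diagonal_twist_def local_span_def
proof (intro CollectI conjI ballI)
  show "D \<in> extensional N" by (rule pb_sectsD(1)[OF N D])
  show "D q \<in> carrier (fibre pb q)" if "q \<in> N" for q using pb_sectsD(2)[OF N D that] by (simp add: pb_fibre)
  fix p assume p: "p \<in> N"
  have "\<exists>N' h t. openin (topo X2) N' \<and> p \<in> N' \<and> N' \<subseteq> N \<and>
      (\<forall>i<k. h i \<in> hol X2 N' \<and> (\<forall>x. (x, x) \<in> N' \<longrightarrow> h i (x, x) = 0)) \<and> t \<in> sects pb N' \<and>
      (\<forall>\<xi> w. w \<noteq> 0 \<longrightarrow> (\<xi>, ln w) \<in> N' \<longrightarrow> lc w (D (\<xi>, ln w)) = (\<Prod>i<k. h i (\<xi>, ln w)) * lc w (t (\<xi>, ln w)))"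
  proof (cases "fst p = snd p")
    case False
    obtain N' where N': "openin (topo X2) N'" "p \<in> N'" "N' \<subseteq> N" "\<And>q. q \<in> N' \<Longrightarrow> fst q \<noteq> snd q"
      using separate_points[OF N p False] by blast
    have one: "(\<lambda>q\<in>N'. 1) \<in> hol X2 N'" using function_algebra_X2 N'(1) unfolding function_algebra_def by blast
    have t: "restrict D N' \<in> sects pb N'" by (rule pb_restrict[OF N D N'(1,3)])
    show ?thesis
      by (rule exI[of _ N'], rule exI[of _ "\<lambda>i. \<lambda>q\<in>N'. 1"], rule exI[of _ "restrict D N'"])
         (use N' one t in fastforce)
  next
    case True
    then obtain \<xi> where \<xi>: "p = (\<xi>, \<xi>)" by (metis prod.collapse)
    have "\<xi> \<in> lines cscale" using openin_X2_sub[OF N] p \<xi> by auto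
    then obtain a b where ab: "\<omega> a b \<noteq> 0" "\<xi> = ln a" using frame_at by metis
    have "(0, 0) \<in> in_charts N a b a b" using p \<xi> ab by (simp add: in_charts_def pt_0)
    then obtain r where r: "r > 0" "ball 0 r \<times> ball 0 r \<subseteq> in_charts N a b a b"
      using bidisc_in_open[OF open_in_charts[OF N ab(1) ab(1)]] by blast
    let ?B = "ball (0 :: complex) r"
    have hol: "holomorphic2_on (local_fun D a b a b) (?B \<times> ?B)"
      by (rule holomorphic2_on_subset[OF pb_sectsD(3)[OF N D ab(1) ab(1)] r(2)])
    obtain F where F: "holomorphic2_on F (?B \<times> ?B)"
      "\<And>z w. z \<in> ?B \<Longrightarrow> w \<in> ?B \<Longrightarrow> local_fun D a b a b (z, w) =
        (\<Sum>i<k. taylor (\<lambda>x. local_fun D a b a b (z, z + x)) i * (w - z) ^ i) + (w - z) ^ k * F (z, w)"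
      by (rule holomorphic2_taylor[OF open_ball hol, where m = k]) (rule that, assumption, blast)
    have DF: "local_fun D a b a b (z, w) = (w - z) ^ k * F (z, w)" if zw: "z \<in> ?B" "w \<in> ?B" for z w
    proof -
      have "taylor (\<lambda>x. local_fun D a b a b (z, z + x)) i = 0" if "i < k" for i
      proof -
        have "(z, z) \<in> in_charts N a b a b" using r(2) zw(1) by auto
        then have "(ln (a + cscale z b), ln (a + cscale z b)) \<in> N" by (simp add: in_charts_def pt_def)
        from van[OF _ this that] ab(1) show ?thesis unfolding jet_coeff_chart[symmetric] by (simp add: \<omega>_pt)
      qed
      then show ?thesis using F(2)[OF zw] by simp
    qed
    define V where "V = pt a b ` ?B"
    have V: "openin (topo X) V" unfolding V_def by (rule openin_chart_image[OF ab(1) open_ball])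
    have Vd: "V \<subseteq> dom b" unfolding V_def using pt_in_dom[OF ab(1)] by blast
    let ?N = "V \<times> V"
    have opN: "openin (topo X2) ?N" by (rule openin_X2_Times[OF V V])
    have V_iff: "pt a b z \<in> V \<longleftrightarrow> z \<in> ?B" for z unfolding V_def by (auto simp: image_iff pt_eq_iff[OF ab(1)])
    have pN: "p \<in> ?N" using V_iff[of 0] r(1) by (simp add: \<xi> ab(2) pt_0)
    have NN: "?N \<subseteq> N"
    proof
      fix q assume "q \<in> ?N"
      then obtain z w where q: "q = (pt a b z, pt a b w)" "z \<in> ?B" "w \<in> ?B" unfolding V_def by blast
      then have "(z, w) \<in> in_charts N a b a b" using r(2) by blast
      then show "q \<in> N" using q by (simp add: in_charts_def)
    qed
    have VB: "{z. pt a b z \<in> V} = ?B" using V_iff by blast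
    have charts: "in_charts ?N a b a b = ?B \<times> ?B" unfolding in_charts_square VB ..
    \<comment> \<open>The equation of the diagonal in the chart.\<close>
    define h where "h = (\<lambda>q\<in>?N. chart a b (snd q) - chart a b (fst q))"
    have h: "h \<in> hol X2 ?N"
    proof (rule iffD2[OF hol_X2_chart[OF ab(1) ab(1) _ opN]])
      show "?N \<subseteq> dom b \<times> dom b" using Vd by blast
      have "holomorphic2_on (\<lambda>(s, t). h (pt a b s, pt a b t)) (?B \<times> ?B)"
        by (rule iffD1[OF holomorphic2_on_cong[OF open_Times[OF open_ball open_ball]]
              holomorphic2_on_diff[OF holomorphic2_on_snd holomorphic2_on_fst]])
           (use V_iff in \<open>auto simp: h_def chart_pt[OF ab(1)]\<close>)
      then show "h \<in> extensional ?N \<and> holomorphic2_on (\<lambda>(s, t). h (pt a b s, pt a b t)) {(s, t). (pt a b s, pt a b t) \<in> ?N}"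
        unfolding in_charts_def[symmetric] charts by (simp add: h_def)
    qed
    obtain t where ts: "t \<in> sects pb ?N"
      and t: "\<And>z w. pt a b z \<in> V \<Longrightarrow> pt a b w \<in> V \<Longrightarrow> local_fun t a b a b (z, w) = F (z, w)"
      by (rule section_of_local_fun[OF ab(1) V Vd, unfolded VB, OF F(1)]) (rule that, assumption, blast)
    have "lc w (D (\<eta>, ln w)) = (\<Prod>i<k. h (\<eta>, ln w)) * lc w (t (\<eta>, ln w))" if w: "w \<noteq> 0" "(\<eta>, ln w) \<in> ?N" for \<eta> w
    proof -
      obtain z y where zy: "\<eta> = pt a b z" "ln w = pt a b y" "z \<in> ?B" "y \<in> ?B" using w(2) unfolding V_def by blast
      have "\<omega> (a + cscale y b) w = 0"
        by (rule iffD1[OF ln_eq_iff[OF pt_nz[OF ab(1)] w(1)] zy(2)[unfolded pt_def, symmetric]])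
      then have "w \<in> ln (a + cscale y b)" using in_ln_iff[OF pt_nz[OF ab(1)]] by blast
      then obtain l where l: "w = cscale l (a + cscale y b)" by (auto simp: ln_def)
      have lnz: "l \<noteq> 0" using l w(1) by auto
      have sc: "lc w x = l powi n * lc (a + cscale y b) x" if "x \<in> carrier (fibre W (pt a b y))" for x
        unfolding l by (rule lc_scale[OF pt_nz[OF ab(1)] lnz]) (use that in \<open>simp add: pt_def\<close>)
      have "D (pt a b z, pt a b y) \<in> carrier (fibre W (pt a b y))" "t (pt a b z, pt a b y) \<in> carrier (fibre W (pt a b y))"
        using pb_sectsD(2)[OF N D, of "(pt a b z, pt a b y)"] pb_sectsD(2)[OF opN ts, of "(pt a b z, pt a b y)"] NN w(2) zy
        by auto
      then show ?thesis
        using sc t[of z y] DF[OF zy(3,4)] V_iff zy by (simp add: local_fun_def h_def chart_pt[OF ab(1)])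
    qed
    then show ?thesis using opN pN NN h ts
      by (intro exI[of _ ?N] exI[of _ "\<lambda>i. h"] exI[of _ t]) (auto simp: h_def)
  qed
  then obtain N' h t where N': "openin (topo X2) N'" "p \<in> N'" "N' \<subseteq> N"
    and h: "\<forall>i<k. h i \<in> hol X2 N' \<and> (\<forall>x. (x, x) \<in> N' \<longrightarrow> h i (x, x) = 0)" and t: "t \<in> sects pb N'"
    and eq: "\<And>\<xi> w. w \<noteq> 0 \<Longrightarrow> (\<xi>, ln w) \<in> N' \<Longrightarrow> lc w (D (\<xi>, ln w)) = (\<Prod>i<k. h i (\<xi>, ln w)) * lc w (t (\<xi>, ln w))"
    by blast
  define e where "e = (\<lambda>q. (\<Prod>i<k. h i q) \<odot>\<^bsub>fibre pb q\<^esub> t q)"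
  have one: "(\<lambda>q\<in>N'. 1) \<in> hol X2 N'" using function_algebra_X2 N'(1) unfolding function_algebra_def by blast
  have sum: "D q = finsum (fibre pb q) (\<lambda>i. (\<lambda>q\<in>N'. 1) q \<odot>\<^bsub>fibre pb q\<^esub> e q) {..<1::nat}" if q: "q \<in> N'" for q
  proof -
    obtain \<xi> w where w: "q = (\<xi>, ln w)" "w \<noteq> 0" using openin_X2_sub[OF N'(1)] q by (auto simp: lines_eq)
    let ?F = "fibre W (ln w)"
    note C = W_coords[OF w(2)]
    have tc: "t q \<in> carrier ?F" using pb_sectsD(2)[OF N'(1) t q] w by simp
    have Dc: "D q \<in> carrier ?F" using pb_sectsD(2)[OF N D] N'(3) q w by auto
    have ec: "e q \<in> carrier ?F" using coords_smult(1)[OF C tc] w by (simp add: e_def pb_fibre)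
    have oc: "1 \<odot>\<^bsub>?F\<^esub> e q \<in> carrier ?F" by (rule coords_smult(1)[OF C ec])
    have fs: "finsum ?F (\<lambda>i. 1 \<odot>\<^bsub>?F\<^esub> e q) {..<1::nat} \<in> carrier ?F"
      using coords_finsum[OF C, of "{..<1::nat}" "\<lambda>i. 1 \<odot>\<^bsub>?F\<^esub> e q"] oc by simp
    have "lc w (finsum ?F (\<lambda>i. 1 \<odot>\<^bsub>?F\<^esub> e q) {..<1::nat}) = lc w (e q)"
      using lc_finsum[OF w(2), of "{..<1::nat}" "\<lambda>i. 1 \<odot>\<^bsub>?F\<^esub> e q"] oc lc_smult[OF w(2) ec, of 1] by simp
    also have "\<dots> = lc w (D q)" using eq[OF w(2)] q w lc_smult[OF w(2) tc] by (simp add: e_def pb_fibre)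
    finally have "finsum ?F (\<lambda>i. 1 \<odot>\<^bsub>?F\<^esub> e q) {..<1::nat} = D q" by (intro lc_eqI[OF w(2) fs Dc])
    then show ?thesis using q w by (simp add: pb_fibre)
  qed
  have "e \<in> {\<lambda>q. (\<Prod>i<k. h i q) \<odot>\<^bsub>fibre pb q\<^esub> t q | h t.
      (\<forall>i<k. h i \<in> hol X2 N' \<and> (\<forall>x. (x, x) \<in> N' \<longrightarrow> h i (x, x) = 0)) \<and> t \<in> sects pb N'}"
    unfolding e_def using h t by blast
  then show "\<exists>N'. openin (topo X2) N' \<and> p \<in> N' \<and> N' \<subseteq> N \<and>
      (\<exists>(m::nat) f e. (\<forall>i<m. f i \<in> hol X2 N' \<and> e i \<in> {\<lambda>q. (\<Prod>i<k. h i q) \<odot>\<^bsub>fibre pb q\<^esub> t q | h t.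
        (\<forall>i<k. h i \<in> hol X2 N' \<and> (\<forall>x. (x, x) \<in> N' \<longrightarrow> h i (x, x) = 0)) \<and> t \<in> sects pb N'}) \<and>
        (\<forall>q\<in>N'. D q = finsum (fibre pb q) (\<lambda>i. f i q \<odot>\<^bsub>fibre pb q\<^esub> e i q) {..<m}))"
    using N' one sum by (intro exI[of _ N'] conjI exI[of _ 1] exI[of _ "\<lambda>i. \<lambda>q\<in>N'. 1"] exI[of _ "\<lambda>i. e"]) auto
qed

text \<open>
  The group maps the frame, the affine coordinate that it defines and the coordinate of the fibre
  to those of the moved frame.
\<close>

lemma jet_coeff_translate:
  assumes g: "g \<in> SL cscale" and N: "openin (topo X2) N" and s: "s \<in> sects pb N"
    and vu: "\<omega> v u \<noteq> 0" "(ln v, ln v) \<in> N"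
  shows "jet_coeff (translate_section X2 pb g N s) (g v) (g u) i = jet_coeff s v u i"
  unfolding jet_coeff_def
proof (rule taylor_cong)
  have "\<forall>\<^sub>F \<tau> in nhds 0. \<tau> \<in> {\<tau>. (ln v, pt v u \<tau>) \<in> N}"
    by (rule eventually_nhds_in_open[OF open_fibre_dir[OF N vu(1)]]) (use vu(2) in \<open>simp add: pt_0\<close>)
  then show "\<forall>\<^sub>F \<tau> in nhds 0. lc (g v + cscale \<tau> (g u)) (translate_section X2 pb g N s (ln (g v), pt (g v) (g u) \<tau>)) =
      lc (v + cscale \<tau> u) (s (ln v, pt v u \<tau>))"
  proof eventually_elim
    case (elim \<tau>)
    then have q: "(ln v, pt v u \<tau>) \<in> N" by simp
    have m: "(ln (g v), pt (g v) (g u) \<tau>) = move X2 g (ln v, pt v u \<tau>)"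
      by (simp add: move_X2 proj_act_ln[OF g] SL_pt[OF g])
    have "translate_section X2 pb g N s (ln (g v), pt (g v) (g u) \<tau>) = act W g (pt v u \<tau>) (s (ln v, pt v u \<tau>))"
      unfolding m using q inv_into_move_X2[OF g q] by (simp add: translate_section_def pb_act)
    moreover have "s (ln v, pt v u \<tau>) \<in> carrier (fibre W (ln (v + cscale \<tau> u)))"
      using pb_sectsD(2)[OF N s q] by (simp add: pt_def)
    ultimately show ?case
      using lc_act[OF g pt_nz[OF vu(1)], of _ \<tau>] by (simp add: SL_linear[OF g] pt_def)
  qed
qed

subsection \<open>Germs of the quotient\<close>

definition jets_agree :: "nat \<Rightarrow> ('v set \<times> 'v set) set \<Rightarrow> ('v set \<times> 'v set \<Rightarrow> 'a) \<Rightarrow> ('v set \<times> 'v set \<Rightarrow> 'a) \<Rightarrow> bool" where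
  "jets_agree k N s s' \<longleftrightarrow> (\<forall>v u i. \<omega> v u \<noteq> 0 \<longrightarrow> (ln v, ln v) \<in> N \<longrightarrow> i \<le> k \<longrightarrow> jet_coeff s v u i = jet_coeff s' v u i)"

text \<open>
  Two sections are congruent modulo the power of the ideal iff their difference has vanishing
  Taylor coefficients, so a germ of the quotient is the same as a jet along the diagonal near the
  point.
\<close>

lemma germ_iff:
  assumes N: "openin (topo X2) N" and s: "s \<in> sects pb N"
  shows "(N', s') \<in> quotient_germ X2 pb (twist (k + 1)) q N s \<longleftrightarrow>
    openin (topo X2) N' \<and> q \<in> N' \<and> s' \<in> sects pb N' \<and>
    (\<exists>N''. openin (topo X2) N'' \<and> q \<in> N'' \<and> N'' \<subseteq> N \<inter> N' \<and> jets_agree k N'' s s')"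
proof -
  have "(\<lambda>r\<in>N''. s r \<ominus>\<^bsub>fibre pb r\<^esub> s' r) \<in> twist (k + 1) N'' \<longleftrightarrow> jets_agree k N'' s s'"
    if N': "openin (topo X2) N'" "s' \<in> sects pb N'" and N'': "openin (topo X2) N''" "N'' \<subseteq> N \<inter> N'" for N''
  proof -
    let ?D = "\<lambda>r\<in>N''. s r \<ominus>\<^bsub>fibre pb r\<^esub> s' r"
    have car: "s q \<in> carrier (fibre W (snd q))" "s' q \<in> carrier (fibre W (snd q))" if "q \<in> N''" for q
      using pb_sectsD(2)[OF N s, of q] pb_sectsD(2)[OF N', of q] N''(2) that by blast+
    have Dc: "?D q \<in> carrier (fibre W (snd q))" if q: "q \<in> N''" for q
    proof -
      obtain w where "w \<noteq> 0" "snd q = ln w" using openin_X2_sub[OF N''(1)] q by (auto simp: lines_eq)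
      then show ?thesis using coords_minus(1)[OF W_coords, of w "s q" "s' q"] car[OF q] q by (simp add: pb_fibre)
    qed
    have U: "openin (topo X) (lines cscale)" using openin_topspace[of "topo X"] unfolding topspace_X .
    have fst: "fst ` N'' \<subseteq> lines cscale" using openin_X2_sub[OF N''(1)] by auto
    have eq: "lc w (?D (\<xi>, ln w)) = 1 * lc w (s (\<xi>, ln w)) + (- 1) * lc w (s' (\<xi>, ln w))"
      if "w \<noteq> 0" "(\<xi>, ln w) \<in> N''" for \<xi> w
      using lc_minus[OF that(1)] car[OF that(2)] that(2) by (simp add: pb_fibre)
    note comb0 = pb_combination[OF N''(1) N N'(1) N''(2) s N'(2) U fst, of "\<lambda>_. 1" "\<lambda>_. - 1" ?D,
        OF holomorphic_on_const holomorphic_on_const restrict_extensional Dc eq]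
    have comb: "?D \<in> sects pb N''" "\<omega> v u \<noteq> 0 \<Longrightarrow> (ln v, ln v) \<in> N'' \<Longrightarrow>
        jet_coeff ?D v u i = jet_coeff s v u i - jet_coeff s' v u i" for v u i
      using comb0(1) comb0(2)[of v u i] by simp_all
    show ?thesis
    proof
      assume D: "?D \<in> twist (k + 1) N''"
      have "jet_coeff s v u i = jet_coeff s' v u i"
        if "\<omega> v u \<noteq> 0" "(ln v, ln v) \<in> N''" "i \<le> k" for v u i
        using twistD(2)[OF N''(1) D that(1,2), of i] comb(2)[OF that(1,2), of i] that(3) by simp
      then show "jets_agree k N'' s s'" unfolding jets_agree_def by blast
    next
      assume "jets_agree k N'' s s'"
      then show "?D \<in> twist (k + 1) N''"
        by (intro twistI[OF N''(1) comb(1)]) (simp add: comb(2) jets_agree_def less_Suc_eq_le)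
    qed
  qed
  then show ?thesis unfolding quotient_germ_def mem_Collect_eq prod.case by blast
qed

end

section \<open>The jet bundle is determined by the transformation law\<close>

text \<open>
  Comparison of the jet bundle of \<open>W\<close> with a homogeneous bundle \<open>E\<close> having the transformation law of
  jets.
\<close>

locale jet_comparison = line_jets cscale \<omega> W n A
  for cscale :: "complex \<Rightarrow> 'v \<Rightarrow> 'v::ab_group_add" and \<omega>
    and W :: "('v set, 'a, 'v \<Rightarrow> 'v) vbundle" and n :: int and A +
  fixes E :: "('v set, 'b, 'v \<Rightarrow> 'v) vbundle" and C and k :: nat
  assumes E: "homogeneous E (Suc k) n (jet_law n) C"
begin

lemma openin_lines: "openin (topo X) (lines cscale)"
  using openin_topspace[of "topo X"] unfolding topspace_X .

lemma frames_over_line: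
  assumes "\<omega> v u \<noteq> 0" "\<omega> v' u' \<noteq> 0" "ln v' = ln v"
  obtains l \<nu> \<mu> where "l \<noteq> 0" "\<nu> \<noteq> 0" "v' = cscale l v" "u' = cscale \<nu> u + cscale \<mu> v"
proof -
  obtain l where l: "v' = cscale l v" using ln_self[of v'] assms(3) by (auto simp: ln_def)
  have "l \<noteq> 0" using l assms(2) by (auto simp: \<omega>_zero)
  have u: "u' = cscale (\<omega> v u' / \<omega> v u) u + cscale (\<omega> u' u / \<omega> v u) v"
    unfolding add.commute[of "cscale _ u"] by (rule frame_expansion[OF assms(1)])
  have "\<omega> v u' / \<omega> v u \<noteq> 0" using assms(1,2) l by (simp add: \<omega>_simps)
  then show ?thesis using that \<open>l \<noteq> 0\<close> l u by blast
qed

text \<open>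
  Jets and coordinates of \<open>E\<close> obey the same law, so they agree in all frames over a line if they
  agree in one of them.
\<close>

lemma jets_eq_coords_any_frame:
  assumes N: "openin (topo X2) N" and s: "s \<in> sects pb N" "(ln v, ln v) \<in> N"
    and x: "x \<in> carrier (fibre E (ln v))"
    and fr: "\<omega> v u \<noteq> 0" "\<omega> v' u' \<noteq> 0" "ln v' = ln v"
    and eq: "\<And>i. i \<le> k \<Longrightarrow> jet_coeff s v u i = C v u x i" and i: "i \<le> k"
  shows "jet_coeff s v' u' i = C v' u' x i"
proof -
  obtain l \<nu> \<mu> where l: "l \<noteq> 0" "\<nu> \<noteq> 0" "v' = cscale l v" "u' = cscale \<nu> u + cscale \<mu> v"
    by (rule frames_over_line[OF fr])
  have "jet_coeff s v' u' i = (\<Sum>j\<le>i. jet_law n i j * \<nu> ^ j * \<mu> ^ (i - j) * l powi (n - int i) * jet_coeff s v u j)"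
    unfolding l(3,4) by (rule jet_coeff_law[OF N s(1) fr(1) l(1,2) s(2)])
  also have "\<dots> = (\<Sum>j\<le>i. jet_law n i j * \<nu> ^ j * \<mu> ^ (i - j) * l powi (n - int i) * C v u x j)"
    by (rule sum.cong) (use eq i in auto)
  also have "\<dots> = C v' u' x i"
    unfolding l(3,4) by (rule hom_law[OF E fr(1) l(1,2) _ x, symmetric]) (use i in simp)
  finally show ?thesis .
qed

subsection \<open>Jets of sections of the quotient sheaf\<close>

abbreviation germ where "germ \<equiv> quotient_germ X2 pb (twist (k + 1))"

abbreviation Q where "Q \<equiv> quotient_sheaf X2 pb (twist (k + 1))"

lemma jets_agreeD:
  "jets_agree k N s s' \<Longrightarrow> \<omega> v u \<noteq> 0 \<Longrightarrow> (ln v, ln v) \<in> N \<Longrightarrow> i \<le> k \<Longrightarrow> jet_coeff s v u i = jet_coeff s' v u i"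
  unfolding jets_agree_def by blast

lemma jets_agreeI:
  "(\<And>v u i. \<omega> v u \<noteq> 0 \<Longrightarrow> (ln v, ln v) \<in> N \<Longrightarrow> i \<le> k \<Longrightarrow> jet_coeff s v u i = jet_coeff s' v u i) \<Longrightarrow>
    jets_agree k N s s'"
  unfolding jets_agree_def by blast

lemma germ_eqI:
  assumes N: "openin (topo X2) N" "s \<in> sects pb N" "openin (topo X2) N'" "s' \<in> sects pb N'"
    and N'': "openin (topo X2) N''" "q \<in> N''" "N'' \<subseteq> N \<inter> N'" and agree: "jets_agree k N'' s s'"
  shows "germ q N s = germ q N' s'"
proof -
  have "germ q N s \<subseteq> germ q N' s'"
    if N: "openin (topo X2) N" "s \<in> sects pb N" "openin (topo X2) N'" "s' \<in> sects pb N'"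
      and N'': "N'' \<subseteq> N \<inter> N'" and agree: "jets_agree k N'' s s'" for N s N' s'
  proof
    fix p assume p: "p \<in> germ q N s"
    obtain M t where pe: "p = (M, t)" by (cases p)
    from p[unfolded pe germ_iff[OF N(1,2)]] obtain M' where
      M: "openin (topo X2) M" "q \<in> M" "t \<in> sects pb M" and
      M': "openin (topo X2) M'" "q \<in> M'" "M' \<subseteq> N \<inter> M" "jets_agree k M' s t" by blast
    have "jets_agree k (M' \<inter> N'') s' t"
    proof (rule jets_agreeI)
      fix v u i assume *: "\<omega> v u \<noteq> 0" "(ln v, ln v) \<in> M' \<inter> N''" "i \<le> k"
      show "jet_coeff s' v u i = jet_coeff t v u i"
        using jets_agreeD[OF M'(4) *(1) _ *(3)] jets_agreeD[OF agree *(1) _ *(3)] *(2) by simp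
    qed
    moreover have "openin (topo X2) (M' \<inter> N'')" using M'(1) \<open>openin (topo X2) N''\<close> by blast
    ultimately show "p \<in> germ q N' s'"
      unfolding pe germ_iff[OF N(3,4)]
      by (intro conjI M exI[of _ "M' \<inter> N''"]) (use M' N'' \<open>q \<in> N''\<close> in auto)
  qed
  note sub = this
  have agree': "jets_agree k N'' s' s" by (rule jets_agreeI) (simp add: jets_agreeD[OF agree])
  have "N'' \<subseteq> N' \<inter> N" using N''(3) by blast
  then show ?thesis
    by (intro subset_antisym sub[OF N N''(3) agree] sub[OF N(3,4,1,2) _ agree'])
qed

lemma germ_self:
  assumes "openin (topo X2) N" "s \<in> sects pb N" "q \<in> N"
  shows "(N, s) \<in> germ q N s"
  unfolding germ_iff[OF assms(1,2)] using assms by (auto simp: jets_agree_def)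

lemma germ_jet_coeff:
  assumes "openin (topo X2) N" "s \<in> sects pb N" "(N', s') \<in> germ (ln v, ln v) N s" "\<omega> v u \<noteq> 0" "i \<le> k"
  shows "jet_coeff s' v u i = jet_coeff s v u i"
  using assms(3)[unfolded germ_iff[OF assms(1,2)]] assms(4,5) unfolding jets_agree_def by metis

lemma Q_carrier: "carrier (sections Q U) = {\<sigma> \<in> extensional U. \<forall>q\<in>U. \<exists>N s. openin (topo X2) N \<and> q \<in> N \<and> N \<subseteq> U \<and>
            s \<in> sects pb N \<and> (\<forall>r\<in>N. \<sigma> r = germ r N s)}"
  by (simp add: quotient_sheaf_def)

lemma Q_local:
  assumes "\<sigma> \<in> carrier (sections Q U)" "q \<in> U"
  obtains N s where "openin (topo X2) N" "q \<in> N" "N \<subseteq> U" "s \<in> sects pb N" "\<forall>r\<in>N. \<sigma> r = germ r N s"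
  using bspec[OF conjunct2[OF CollectD[OF assms(1)[unfolded Q_carrier]]] assms(2)]
  by (elim exE conjE) (rule that)

text \<open>Any representative of the germ at a point represents the section near that point.\<close>

lemma Q_element:
  assumes \<sigma>: "\<sigma> \<in> carrier (sections Q U)" and q: "q \<in> U" and Ns: "(N, s) \<in> \<sigma> q"
  shows "openin (topo X2) N" "q \<in> N" "s \<in> sects pb N"
    and "\<exists>N'. openin (topo X2) N' \<and> q \<in> N' \<and> N' \<subseteq> N \<inter> U \<and> (\<forall>r\<in>N'. \<sigma> r = germ r N s)"
proof -
  obtain N0 s0 where N0: "openin (topo X2) N0" "q \<in> N0" "N0 \<subseteq> U" "s0 \<in> sects pb N0" and all: "\<forall>r\<in>N0. \<sigma> r = germ r N0 s0"
    by (rule Q_local[OF \<sigma> q])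
  note N0 = N0 bspec[OF all]
  note * = Ns[unfolded N0(5)[OF N0(2)] germ_iff[OF N0(1,4)]]
  show N: "openin (topo X2) N" "q \<in> N" "s \<in> sects pb N" using * by blast+
  obtain N' where N': "openin (topo X2) N'" "q \<in> N'" "N' \<subseteq> N0 \<inter> N" "jets_agree k N' s0 s" using * by blast
  have "\<sigma> r = germ r N s" if "r \<in> N'" for r
    using germ_eqI[OF N0(1,4) N(1,3) N'(1) that N'(3,4)] N0(5)[of r] N'(3) that by auto
  then show "\<exists>N'. openin (topo X2) N' \<and> q \<in> N' \<and> N' \<subseteq> N \<inter> U \<and> (\<forall>r\<in>N'. \<sigma> r = germ r N s)"
    using N' N0(3) by blast
qed

lemma Q_nonempty:
  assumes "\<sigma> \<in> carrier (sections Q U)" "q \<in> U"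
  obtains N s where "(N, s) \<in> \<sigma> q"
proof -
  obtain N s where "openin (topo X2) N" "q \<in> N" "s \<in> sects pb N" "\<forall>r\<in>N. \<sigma> r = germ r N s"
    by (rule Q_local[OF assms])
  then show ?thesis using germ_self that by metis
qed

text \<open>
  The jet of a section of the quotient sheaf, read off an arbitrary representative of its germ. It
  is extended by 0 beyond the order \<open>k\<close> so that it lies in the range of the coordinates of \<open>E\<close>.
\<close>

definition jet :: "('v set \<times> 'v set \<Rightarrow> (('v set \<times> 'v set) set \<times> ('v set \<times> 'v set \<Rightarrow> 'a)) set) \<Rightarrow> 'v \<Rightarrow> 'v \<Rightarrow> nat \<Rightarrow> complex" where
  "jet \<sigma> v u i = (if i \<le> k then jet_coeff (snd (SOME p. p \<in> \<sigma> (ln v, ln v))) v u i else 0)"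

lemma jet_gt: "i > k \<Longrightarrow> jet \<sigma> v u i = 0"
  by (simp add: jet_def)

lemma jetI:
  assumes "p \<in> \<sigma> (ln v, ln v)" "\<And>N s. (N, s) \<in> \<sigma> (ln v, ln v) \<Longrightarrow> jet_coeff s v u i = c" "i \<le> k"
  shows "jet \<sigma> v u i = c"
proof -
  define p where "p = (SOME p. p \<in> \<sigma> (ln v, ln v))"
  have "p \<in> \<sigma> (ln v, ln v)" unfolding p_def using assms(1) by (rule someI)
  then show ?thesis using assms(2)[of "fst p" "snd p"] assms(3) by (simp add: jet_def p_def)
qed

lemma jet_eq:
  assumes \<sigma>: "\<sigma> \<in> carrier (sections Q U)" and q: "(ln v, ln v) \<in> U" and Ns: "(N, s) \<in> \<sigma> (ln v, ln v)"
    and vu: "\<omega> v u \<noteq> 0" "i \<le> k"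
  shows "jet \<sigma> v u i = jet_coeff s v u i"
proof (rule jetI[where \<sigma> = \<sigma> and v = v, OF Ns _ vu(2)])
  note N = Q_element[OF \<sigma> q Ns]
  have eq: "\<sigma> (ln v, ln v) = germ (ln v, ln v) N s" using N(4) by blast
  show "jet_coeff s' v u i = jet_coeff s v u i" if "(N', s') \<in> \<sigma> (ln v, ln v)" for N' s'
    using germ_jet_coeff[OF N(1,3) _ vu] that unfolding eq .
qed

lemma jet_local:
  assumes \<sigma>: "\<sigma> \<in> carrier (sections Q U)" and q: "q \<in> U"
  obtains N s where "openin (topo X2) N" "q \<in> N" "N \<subseteq> U" "s \<in> sects pb N" "\<sigma> q = germ q N s"
    "\<And>v u i. \<omega> v u \<noteq> 0 \<Longrightarrow> (ln v, ln v) \<in> N \<Longrightarrow> i \<le> k \<Longrightarrow> jet \<sigma> v u i = jet_coeff s v u i"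
proof -
  obtain N s where N: "openin (topo X2) N" "q \<in> N" "N \<subseteq> U" "s \<in> sects pb N" and all: "\<forall>r\<in>N. \<sigma> r = germ r N s"
    by (rule Q_local[OF \<sigma> q])
  note N = N bspec[OF all]
  show ?thesis
  proof (rule that[OF N(1-4) N(5)[OF N(2)]])
    fix v u i assume *: "\<omega> v u \<noteq> 0" "(ln v, ln v) \<in> N" "i \<le> k"
    have "(N, s) \<in> \<sigma> (ln v, ln v)" using germ_self[OF N(1,4) *(2)] N(5)[OF *(2)] by simp
    then show "jet \<sigma> v u i = jet_coeff s v u i"
      using jet_eq[OF \<sigma> _ _ *(1,3)] *(2) N(3) by blast
  qed
qed

subsection \<open>The comparison map\<close>

text \<open>
  The section with prescribed coordinates in all frames. Existence at a point is a condition on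
  \<open>J\<close>, to be shown for each use.
\<close>

definition section_of :: "'v set set \<Rightarrow> ('v \<Rightarrow> 'v \<Rightarrow> nat \<Rightarrow> complex) \<Rightarrow> 'v set \<Rightarrow> 'b" where
  "section_of U J = (\<lambda>\<xi>\<in>U. SOME x. x \<in> carrier (fibre E \<xi>) \<and> (\<forall>v u. \<omega> v u \<noteq> 0 \<and> ln v = \<xi> \<longrightarrow> C v u x = J v u))"

lemma section_of_eqI:
  assumes \<xi>: "\<xi> \<in> U" "\<xi> \<in> lines cscale" and x: "x \<in> carrier (fibre E \<xi>)"
    and eq: "\<And>v u. \<omega> v u \<noteq> 0 \<Longrightarrow> ln v = \<xi> \<Longrightarrow> C v u x = J v u"
  shows "section_of U J \<xi> = x"
proof -
  define y where "y = section_of U J \<xi>"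
  have "y = (SOME x. x \<in> carrier (fibre E \<xi>) \<and> (\<forall>v u. \<omega> v u \<noteq> 0 \<and> ln v = \<xi> \<longrightarrow> C v u x = J v u))"
    using \<xi>(1) by (simp add: y_def section_of_def)
  moreover have "\<exists>x. x \<in> carrier (fibre E \<xi>) \<and> (\<forall>v u. \<omega> v u \<noteq> 0 \<and> ln v = \<xi> \<longrightarrow> C v u x = J v u)"
    using x eq by blast
  ultimately have y: "y \<in> carrier (fibre E \<xi>)" "\<And>v u. \<omega> v u \<noteq> 0 \<Longrightarrow> ln v = \<xi> \<Longrightarrow> C v u y = J v u"
    using someI_ex[of "\<lambda>x. x \<in> carrier (fibre E \<xi>) \<and> (\<forall>v u. \<omega> v u \<noteq> 0 \<and> ln v = \<xi> \<longrightarrow> C v u x = J v u)"] by auto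
  obtain v u where vu: "\<omega> v u \<noteq> 0" "\<xi> = ln v" using frame_at[OF \<xi>(2)] by metis
  have "y = x"
    by (rule coords_eqI[OF hom_coords[OF E vu(1), folded vu(2)] y(1) x]) (simp add: y(2) eq vu)
  then show ?thesis by (simp add: y_def)
qed

definition comparison :: "'v set set \<Rightarrow> ('v set \<times> 'v set \<Rightarrow> (('v set \<times> 'v set) set \<times> ('v set \<times> 'v set \<Rightarrow> 'a)) set) \<Rightarrow> 'v set \<Rightarrow> 'b" where
  "comparison U \<sigma> = section_of U (jet \<sigma>)"

lemma comparison_ext: "comparison U \<sigma> \<in> extensional U"
  by (simp add: comparison_def section_of_def)

abbreviation jets_over where "jets_over U \<equiv> carrier (sections Q (U \<times> lines cscale))"

context
  fixes U assumes U: "openin (topo X) U"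
begin

lemma diag_in: "ln v \<in> U \<Longrightarrow> (ln v, ln v) \<in> U \<times> lines cscale"
  using openin_X_sub[OF U] by blast

text \<open>
  A vector with the right coordinates exists in one frame; by the common transformation law it has the
  right coordinates in all frames.
\<close>

lemma comparison_coords:
  assumes \<sigma>: "\<sigma> \<in> jets_over U" and vu: "\<omega> v u \<noteq> 0" "ln v \<in> U"
  shows "comparison U \<sigma> (ln v) \<in> carrier (fibre E (ln v))" "C v u (comparison U \<sigma> (ln v)) = jet \<sigma> v u"
proof -
  obtain N s where N: "openin (topo X2) N" "(ln v, ln v) \<in> N" "s \<in> sects pb N"
    "\<And>v u i. \<omega> v u \<noteq> 0 \<Longrightarrow> (ln v, ln v) \<in> N \<Longrightarrow> i \<le> k \<Longrightarrow> jet \<sigma> v u i = jet_coeff s v u i"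
    by (rule jet_local[OF \<sigma> diag_in[OF vu(2)]]) (rule that; assumption)
  note cs = hom_coords[OF E vu(1)]
  define x where "x = from_coords (fibre E (ln v)) (C v u) (jet \<sigma> v u)"
  have "jet \<sigma> v u \<in> seqs (Suc k)" by (simp add: seqs_def jet_gt Suc_le_eq)
  from from_coords[OF cs this] have x: "x \<in> carrier (fibre E (ln v))" "C v u x = jet \<sigma> v u" by (simp_all add: x_def)
  have "C v' u' x = jet \<sigma> v' u'" if fr: "\<omega> v' u' \<noteq> 0" "ln v' = ln v" for v' u'
  proof
    fix i
    show "C v' u' x i = jet \<sigma> v' u' i"
    proof (cases "i \<le> k")
      case True
      have "jet_coeff s v' u' i = C v' u' x i"
        by (rule jets_eq_coords_any_frame[OF N(1,3,2) x(1) vu(1) fr _ True]) (simp add: x(2) N(4) vu N(2))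
      then show ?thesis using N(4)[OF fr(1) _ True] fr(2) N(2) by simp
    next
      case False
      then show ?thesis using coords_ge[OF hom_coords[OF E fr(1)], of x i] x(1) fr(2) by (simp add: jet_gt)
    qed
  qed
  then have "comparison U \<sigma> (ln v) = x"
    unfolding comparison_def using vu openin_X_sub[OF U] by (intro section_of_eqI x(1)) auto
  then show "comparison U \<sigma> (ln v) \<in> carrier (fibre E (ln v))" "C v u (comparison U \<sigma> (ln v)) = jet \<sigma> v u"
    using x by simp_all
qed

lemma comparison_carrier:
  assumes "\<sigma> \<in> jets_over U" "\<xi> \<in> U"
  shows "comparison U \<sigma> \<xi> \<in> carrier (fibre E \<xi>)"
proof -
  obtain v u where vu: "\<omega> v u \<noteq> 0" "\<xi> = ln v" using frame_at[OF subsetD[OF openin_X_sub[OF U] assms(2)]] by blast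
  show ?thesis using comparison_coords(1)[OF assms(1) vu(1)] assms(2) unfolding vu(2) .
qed

lemma comparison_eqI:
  assumes s: "s \<in> extensional U" "\<And>\<xi>. \<xi> \<in> U \<Longrightarrow> s \<xi> \<in> carrier (fibre E \<xi>)"
    and eq: "\<And>v u i. \<omega> v u \<noteq> 0 \<Longrightarrow> ln v \<in> U \<Longrightarrow> i \<le> k \<Longrightarrow> jet \<sigma> v u i = C v u (s (ln v)) i"
  shows "comparison U \<sigma> = s"
proof (rule extensionalityI[OF comparison_ext s(1)])
  fix \<xi> assume \<xi>: "\<xi> \<in> U"
  show "comparison U \<sigma> \<xi> = s \<xi>"
    unfolding comparison_def
  proof (rule section_of_eqI[OF \<xi> _ s(2)[OF \<xi>]])
    show "\<xi> \<in> lines cscale" using \<xi> openin_X_sub[OF U] by blast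
    fix v u assume vu: "\<omega> v u \<noteq> 0" "ln v = \<xi>"
    show "C v u (s \<xi>) = jet \<sigma> v u"
    proof
      fix i
      have "s \<xi> \<in> carrier (fibre E (ln v))" using s(2)[OF \<xi>] vu(2) by simp
      from coords_ge[OF hom_coords[OF E vu(1)] this, of i]
      show "C v u (s \<xi>) i = jet \<sigma> v u i"
        using eq[OF vu(1), of i] vu(2) \<xi> jet_gt[of i \<sigma> v u] by (cases "i \<le> k") auto
    qed
  qed
qed

lemma comparison_holomorphic:
  assumes \<sigma>: "\<sigma> \<in> jets_over U"
  shows "comparison U \<sigma> \<in> sects E U"
  unfolding hom_sects[OF E U]
proof (rule holomorphic_sectionsI[OF comparison_ext comparison_carrier[OF \<sigma>]], assumption)
  fix a b i assume ab: "\<omega> a b \<noteq> 0" and i: "i < Suc k"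
  have "(\<lambda>z. jet \<sigma> (a + cscale z b) b i) holomorphic_on {z. pt a b z \<in> U}"
    unfolding holomorphic_on_def
  proof
    fix z assume "z \<in> {z. pt a b z \<in> U}"
    then have "ln (a + cscale z b) \<in> U" by (simp add: pt_def)
    from jet_local[OF \<sigma> diag_in[OF this]] obtain N s where
      N: "openin (topo X2) N" "(ln (a + cscale z b), ln (a + cscale z b)) \<in> N" "s \<in> sects pb N"
      "\<And>v u i. \<omega> v u \<noteq> 0 \<Longrightarrow> (ln v, ln v) \<in> N \<Longrightarrow> i \<le> k \<Longrightarrow> jet \<sigma> v u i = jet_coeff s v u i"
      by metis
    let ?T = "{z. (pt a b z, pt a b z) \<in> N}"
    have "open ((\<lambda>z. (z, z)) -` in_charts N a b a b)"
      by (rule open_vimage[OF open_in_charts[OF N(1) ab ab]]) (intro continuous_intros)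
    then have op: "open ?T" by (simp add: in_charts_def vimage_def)
    have zT: "z \<in> ?T" using N(2) by (simp add: pt_def)
    have "(\<lambda>z. jet \<sigma> (a + cscale z b) b i) holomorphic_on ?T"
    proof (rule holomorphic_transform[OF jet_coeff_holomorphic[OF N(1,3) ab, of i]])
      fix y assume "y \<in> ?T"
      then show "jet_coeff s (a + cscale y b) b i = jet \<sigma> (a + cscale y b) b i"
        using N(4)[of "a + cscale y b" b i] ab i by (simp add: pt_def \<omega>_pt)
    qed
    from holomorphic_on_imp_differentiable_at[OF this op zT]
    show "(\<lambda>z. jet \<sigma> (a + cscale z b) b i) field_differentiable (at z within {z. pt a b z \<in> U})"
      by (rule field_differentiable_at_within)
  qed
  then show "(\<lambda>z. C (a + cscale z b) b (comparison U \<sigma> (pt a b z)) i) holomorphic_on {z. pt a b z \<in> U}"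
  proof (rule holomorphic_transform)
    fix z assume "z \<in> {z. pt a b z \<in> U}"
    then have "ln (a + cscale z b) \<in> U" by (simp add: pt_def)
    from comparison_coords(2)[OF \<sigma> _ this, of b]
    show "jet \<sigma> (a + cscale z b) b i = C (a + cscale z b) b (comparison U \<sigma> (pt a b z)) i"
      using ab by (simp add: \<omega>_pt pt_def)
  qed
qed

text \<open>Locally the two sections have representatives with equal jets, hence equal germs.\<close>

lemma comparison_inj: "inj_on (comparison U) (jets_over U)"
proof (rule inj_onI)
  fix \<sigma> \<tau> assume \<sigma>: "\<sigma> \<in> jets_over U" and \<tau>: "\<tau> \<in> jets_over U" and eq: "comparison U \<sigma> = comparison U \<tau>"
  show "\<sigma> = \<tau>"
  proof (rule extensionalityI)
    show "\<sigma> \<in> extensional (U \<times> lines cscale)" "\<tau> \<in> extensional (U \<times> lines cscale)"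
      using \<sigma> \<tau> unfolding Q_carrier by blast+
    fix q assume q: "q \<in> U \<times> lines cscale"
    \<comment> \<open>Points off the diagonal are included: there the condition on jets is empty and all germs agree.\<close>
    obtain N s where N: "openin (topo X2) N" "q \<in> N" "N \<subseteq> U \<times> lines cscale" "s \<in> sects pb N" "\<sigma> q = germ q N s"
      "\<And>v u i. \<omega> v u \<noteq> 0 \<Longrightarrow> (ln v, ln v) \<in> N \<Longrightarrow> i \<le> k \<Longrightarrow> jet \<sigma> v u i = jet_coeff s v u i"
      by (rule jet_local[OF \<sigma> q]) (rule that; assumption)
    obtain M t where M: "openin (topo X2) M" "q \<in> M" "M \<subseteq> U \<times> lines cscale" "t \<in> sects pb M" "\<tau> q = germ q M t"
      "\<And>v u i. \<omega> v u \<noteq> 0 \<Longrightarrow> (ln v, ln v) \<in> M \<Longrightarrow> i \<le> k \<Longrightarrow> jet \<tau> v u i = jet_coeff t v u i"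
      by (rule jet_local[OF \<tau> q]) (rule that; assumption)
    have "jets_agree k (N \<inter> M) s t"
      unfolding jets_agree_def
    proof (intro allI impI)
      fix v u i assume *: "\<omega> v u \<noteq> 0" "(ln v, ln v) \<in> N \<inter> M" "i \<le> k"
      have vU: "ln v \<in> U" using *(2) N(3) by blast
      have "jet \<sigma> v u = jet \<tau> v u"
        using comparison_coords(2)[OF \<sigma> *(1) vU] comparison_coords(2)[OF \<tau> *(1) vU] eq by simp
      then show "jet_coeff s v u i = jet_coeff t v u i"
        using N(6)[OF *(1) _ *(3)] M(6)[OF *(1) _ *(3)] *(2) by simp
    qed
    from germ_eqI[OF N(1,4) M(1,4) _ _ subset_refl this] N(1,2) M(1,2)
    show "\<sigma> q = \<tau> q" unfolding N(5) M(5) by blast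
  qed
qed

end

subsection \<open>Surjectivity of the comparison map\<close>

lemma holomorphic2_on_taylor_polynomial:
  assumes "open T" "\<And>i. i \<le> k \<Longrightarrow> f i holomorphic_on T"
  shows "holomorphic2_on (\<lambda>(z, w). \<Sum>i\<le>k. f i z * (w - z) ^ i) (T \<times> T)"
proof -
  have pw: "holomorphic2_on (\<lambda>p. (snd p - fst p) ^ i) (T \<times> T)" for i
    by (rule holomorphic2_on_compose_left[where g = "\<lambda>x. x ^ i" and T = UNIV])
       (auto intro!: holomorphic_intros holomorphic2_on_diff holomorphic2_on_fst holomorphic2_on_snd)
  have "holomorphic2_on (\<lambda>p. f i (fst p)) (T \<times> T)" if "i \<le> k" for i
    by (rule holomorphic2_on_compose_left[OF assms(2)[OF that] assms(1) holomorphic2_on_fst]) auto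
  then have "holomorphic2_on (\<lambda>p. \<Sum>i\<le>k. f i (fst p) * (snd p - fst p) ^ i) (T \<times> T)"
    using pw by (intro holomorphic2_on_sum holomorphic2_on_mult) auto
  then show ?thesis by (simp add: case_prod_unfold)
qed

definition has_jets :: "('v set \<Rightarrow> 'b) \<Rightarrow> ('v set \<times> 'v set) set \<Rightarrow> ('v set \<times> 'v set \<Rightarrow> 'a) \<Rightarrow> bool" where
  "has_jets s N t \<longleftrightarrow>
    (\<forall>v u i. \<omega> v u \<noteq> 0 \<longrightarrow> (ln v, ln v) \<in> N \<longrightarrow> i \<le> k \<longrightarrow> jet_coeff t v u i = C v u (s (ln v)) i)"

lemma has_jetsD: "has_jets s N t \<Longrightarrow> \<omega> v u \<noteq> 0 \<Longrightarrow> (ln v, ln v) \<in> N \<Longrightarrow> i \<le> k \<Longrightarrow>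
    jet_coeff t v u i = C v u (s (ln v)) i"
  unfolding has_jets_def by blast

lemma has_jetsI: "(\<And>v u i. \<omega> v u \<noteq> 0 \<Longrightarrow> (ln v, ln v) \<in> N \<Longrightarrow> i \<le> k \<Longrightarrow>
    jet_coeff t v u i = C v u (s (ln v)) i) \<Longrightarrow> has_jets s N t"
  unfolding has_jets_def by blast

text \<open>
  Near the diagonal the lift is the polynomial in \<open>w - z\<close> with the coordinates of the section as
  coefficients. Away from the diagonal there is no condition, and the zero section is a lift.
\<close>

lemma local_lift:
  assumes U: "openin (topo X) U" and s: "s \<in> sects E U" and q: "q \<in> U \<times> lines cscale"
  obtains N t where "openin (topo X2) N" "q \<in> N" "N \<subseteq> U \<times> lines cscale" "t \<in> sects pb N" "has_jets s N t"
proof (cases "fst q = snd q")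
  case False
  have "openin (topo X2) (U \<times> lines cscale)" by (rule openin_X2_Times[OF U openin_lines])
  from separate_points[OF this q False] obtain N where N: "openin (topo X2) N" "q \<in> N" "N \<subseteq> U \<times> lines cscale"
    "\<And>p. p \<in> N \<Longrightarrow> fst p \<noteq> snd p" by blast
  let ?t = "\<lambda>p\<in>N. \<zero>\<^bsub>fibre W (snd p)\<^esub>"
  have "?t \<in> sects pb N"
  proof (rule pb_sectsI_all[OF N(1)])
    show "?t p \<in> carrier (fibre W (snd p))" if p: "p \<in> N" for p
    proof -
      obtain w where w: "w \<noteq> 0" "snd p = ln w" using openin_X2_sub[OF N(1)] p by (auto simp: lines_eq)
      show ?thesis using coords_zero(1)[OF W_coords[OF w(1)]] p w(2) by simp
    qed
    fix a b c d assume fr: "\<omega> a b \<noteq> 0" "\<omega> c d \<noteq> 0"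
    have 1: "holomorphic2_on (\<lambda>p. 0) (in_charts N a b c d)" by (rule holomorphic2_on_const)
    have 2: "0 = local_fun ?t a b c d p" if p: "p \<in> in_charts N a b c d" for p
      using p lc_zero[OF pt_nz[OF fr(2)]] by (auto simp: local_fun_def in_charts_def pt_def[of c d])
    show "holomorphic2_on (local_fun ?t a b c d) (in_charts N a b c d)"
      by (rule iffD1[OF holomorphic2_on_cong[OF open_in_charts[OF N(1) fr] 2] 1])
  qed simp
  moreover have "has_jets s N ?t" by (rule has_jetsI) (use N(4) in force)
  ultimately show ?thesis using that N by blast
next
  case True
  have "fst q \<in> lines cscale" using q openin_X_sub[OF U] by auto
  then obtain a b where ab: "\<omega> a b \<noteq> 0" "fst q = ln a" "fst q \<in> dom b" using frame_at by blast
  define V where "V = U \<inter> dom b"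
  have V: "openin (topo X) V" unfolding V_def using U openin_dom[OF frame_nz(2)[OF ab(1)]] by blast
  let ?N = "V \<times> V"
  have N: "openin (topo X2) ?N" by (rule openin_X2_Times[OF V V])
  define T where "T = {z. pt a b z \<in> V}"
  have T: "open T" unfolding T_def by (rule openin_X_open[OF V ab(1)])
  have sD: "s p \<in> carrier (fibre E p)" if "p \<in> U" for p
    using holomorphic_sectionsD(2)[OF s[unfolded hom_sects[OF E U]] that] .
  define f where "f = (\<lambda>i z. C (a + cscale z b) b (s (pt a b z)) i)"
  have f: "f i holomorphic_on T" if "i \<le> k" for i
    unfolding f_def
    by (rule holomorphic_on_subset[OF holomorphic_sectionsD(3)[OF s[unfolded hom_sects[OF E U]] ab(1)]])
       (use that in \<open>auto simp: T_def V_def\<close>)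
  define F where "F = (\<lambda>(z, w). \<Sum>i\<le>k. f i z * (w - z) ^ i)"
  have F: "holomorphic2_on F (T \<times> T)" unfolding F_def by (rule holomorphic2_on_taylor_polynomial[OF T f])
  have Vd: "V \<subseteq> dom b" by (simp add: V_def)
  obtain t where ts: "t \<in> sects pb ?N"
    and t: "\<And>z w. pt a b z \<in> V \<Longrightarrow> pt a b w \<in> V \<Longrightarrow> local_fun t a b a b (z, w) = F (z, w)"
    by (rule section_of_local_fun[OF ab(1) V Vd F[unfolded T_def]]) (rule that, assumption, blast)
  have V_pt: "\<exists>z\<in>T. p = pt a b z" if "p \<in> V" for p
    using that pt_chart[OF ab(1), of p] by (intro bexI[of _ "chart a b p"]) (auto simp: T_def V_def)
  have coeff: "jet_coeff t (a + cscale z b) b i = f i z" if z: "z \<in> T" and i: "i \<le> k" for z i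
    unfolding jet_coeff_chart
  proof (rule taylor_remainder[where r = "\<lambda>x. 0" and m = "Suc k" and A = "(\<lambda>x. z + x) -` T"])
    show "open ((\<lambda>x. z + x) -` T)" by (rule open_vimage[OF T]) (intro continuous_intros)
    show "local_fun t a b a b (z, z + x) = (\<Sum>i<Suc k. f i z * x ^ i) + x ^ Suc k * 0" if "x \<in> (\<lambda>x. z + x) -` T" for x
      using t[of z "z + x"] z that by (simp add: T_def F_def lessThan_Suc_atMost)
  qed (use z i in auto)
  have "has_jets s ?N t"
  proof (rule has_jetsI)
    fix v u i assume vu: "\<omega> v u \<noteq> 0" "(ln v, ln v) \<in> ?N" and i: "i \<le> k"
    then obtain z where z: "z \<in> T" "ln v = pt a b z" using V_pt by blast
    have lnv: "ln v = ln (a + cscale z b)" using z(2) by (simp add: pt_def)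
    have "s (ln (a + cscale z b)) \<in> carrier (fibre E (ln (a + cscale z b)))" using sD vu(2) unfolding lnv V_def by blast
    from jets_eq_coords_any_frame[OF N ts vu(2)[unfolded lnv] this _ vu(1) lnv _ i, of b]
    show "jet_coeff t v u i = C v u (s (ln v)) i"
      using ab(1) coeff[OF z(1)] by (simp add: \<omega>_pt f_def pt_def lnv)
  qed
  moreover have "q \<in> ?N" using q ab(3) True by (auto simp: V_def mem_Times_iff)
  moreover have "?N \<subseteq> U \<times> lines cscale" using openin_X_sub[OF V] by (auto simp: V_def)
  ultimately show ?thesis using that N ts by blast
qed

text \<open>
  The section of the quotient sheaf is defined pointwise as the set of all germs with the prescribed
  jets; by \<open>local_lift\<close> it is locally the germ of a section.
\<close>

lemma comparison_surj:
  assumes U: "openin (topo X) U" and s: "s \<in> sects E U"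
  shows "\<exists>\<sigma>\<in>jets_over U. comparison U \<sigma> = s"
proof -
  let ?W = "U \<times> lines cscale"
  define \<sigma> where "\<sigma> = (\<lambda>q\<in>?W. {(N, t). openin (topo X2) N \<and> q \<in> N \<and> t \<in> sects pb N \<and>
    (\<exists>N'. openin (topo X2) N' \<and> q \<in> N' \<and> N' \<subseteq> N \<inter> ?W \<and> has_jets s N' t)})"
  have germ: "\<sigma> r = germ r N t" if N: "openin (topo X2) N" "N \<subseteq> ?W" "t \<in> sects pb N" "has_jets s N t" and r: "r \<in> N" for N t r
  proof -
    have "(N', t') \<in> \<sigma> r \<longleftrightarrow> (N', t') \<in> germ r N t" for N' t'
    proof
      assume "(N', t') \<in> \<sigma> r"
      then obtain M where N': "openin (topo X2) N'" "r \<in> N'" "t' \<in> sects pb N'"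
        and M: "openin (topo X2) M" "r \<in> M" "M \<subseteq> N' \<inter> ?W" "has_jets s M t'"
        using subsetD[OF N(2) r] unfolding \<sigma>_def by auto
      have "jets_agree k (M \<inter> N) t t'"
        by (rule jets_agreeI) (simp add: has_jetsD[OF M(4)] has_jetsD[OF N(4)])
      then show "(N', t') \<in> germ r N t"
        unfolding germ_iff[OF N(1,3)] using N' M N(1) r by (intro conjI exI[of _ "M \<inter> N"]) auto
    next
      assume "(N', t') \<in> germ r N t"
      then obtain M where N': "openin (topo X2) N'" "r \<in> N'" "t' \<in> sects pb N'"
        and M: "openin (topo X2) M" "r \<in> M" "M \<subseteq> N \<inter> N'" "jets_agree k M t t'"
        unfolding germ_iff[OF N(1,3)] by blast
      have MN: "p \<in> N" if "p \<in> M" for p using M(3) that by blast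
      have "has_jets s M t'"
        by (rule has_jetsI) (simp add: jets_agreeD[OF M(4), symmetric] has_jetsD[OF N(4)] MN)
      then show "(N', t') \<in> \<sigma> r" unfolding \<sigma>_def using N' M N(2) r by auto
    qed
    then show ?thesis by auto
  qed
  have \<sigma>: "\<sigma> \<in> jets_over U"
    unfolding Q_carrier
  proof (intro CollectI conjI ballI)
    fix q assume q: "q \<in> ?W"
    obtain N t where "openin (topo X2) N" "q \<in> N" "N \<subseteq> ?W" "t \<in> sects pb N" "has_jets s N t"
      by (rule local_lift[OF U s q])
    then show "\<exists>N t. openin (topo X2) N \<and> q \<in> N \<and> N \<subseteq> ?W \<and> t \<in> sects pb N \<and> (\<forall>r\<in>N. \<sigma> r = germ r N t)"
      using germ by (intro exI[of _ N] exI[of _ t]) auto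
  qed (simp add: \<sigma>_def)
  note sD = holomorphic_sectionsD[OF s[unfolded hom_sects[OF E U]]]
  have "comparison U \<sigma> = s"
  proof (rule comparison_eqI[OF U sD(1,2)], assumption)
    fix v u i assume vu: "\<omega> v u \<noteq> 0" "ln v \<in> U" and i: "i \<le> k"
    note q = diag_in[OF U vu(2)]
    obtain N t where Nt: "(N, t) \<in> \<sigma> (ln v, ln v)" by (rule Q_nonempty[OF \<sigma> q])
    then obtain M where "(ln v, ln v) \<in> M" "has_jets s M t" using q by (auto simp: \<sigma>_def)
    then show "jet \<sigma> v u i = C v u (s (ln v)) i"
      using jet_eq[OF \<sigma> q Nt vu(1) i] has_jetsD vu(1) i by metis
  qed
  then show ?thesis using \<sigma> by blast
qed

subsection \<open>Compatibility with the module structure, restriction and the group\<close>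

context
  fixes U \<sigma> v u i
  assumes U: "openin (topo X) U" and \<sigma>: "\<sigma> \<in> jets_over U" and vu: "\<omega> v u \<noteq> 0" "ln v \<in> U" and i: "i \<le> k"
begin

text \<open>
  The sum in the quotient sheaf is a union over all pairs of representatives; all its
  members have the sum of the two jets.
\<close>

lemma jet_add:
  assumes \<tau>: "\<tau> \<in> jets_over U"
  shows "jet (\<sigma> \<oplus>\<^bsub>sections Q (U \<times> lines cscale)\<^esub> \<tau>) v u i = jet \<sigma> v u i + jet \<tau> v u i"
proof -
  let ?q = "(ln v, ln v)"
  let ?D = "\<lambda>N N' s s'. \<lambda>r\<in>N \<inter> N'. s r \<oplus>\<^bsub>fibre pb r\<^esub> s' r"
  note q = diag_in[OF U vu(2)]
  have val: "(\<sigma> \<oplus>\<^bsub>sections Q (U \<times> lines cscale)\<^esub> \<tau>) ?q =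
      (\<Union>(N, s)\<in>\<sigma> ?q. \<Union>(N', s')\<in>\<tau> ?q. germ ?q (N \<inter> N') (?D N N' s s'))"
    using q by (simp add: quotient_sheaf_def)
  have comb: "openin (topo X2) (N \<inter> N')" "?q \<in> N \<inter> N'" "?D N N' s s' \<in> sects pb (N \<inter> N')"
      "jet_coeff (?D N N' s s') v u i = jet \<sigma> v u i + jet \<tau> v u i"
    if Ns: "(N, s) \<in> \<sigma> ?q" and Ns': "(N', s') \<in> \<tau> ?q" for N s N' s'
  proof -
    note N = Q_element(1-3)[OF \<sigma> q Ns] and N' = Q_element(1-3)[OF \<tau> q Ns']
    show op: "openin (topo X2) (N \<inter> N')" and qN: "?q \<in> N \<inter> N'" using N N' by blast+
    have car: "s r \<in> carrier (fibre W (snd r))" "s' r \<in> carrier (fibre W (snd r))" if "r \<in> N \<inter> N'" for r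
      using pb_sectsD(2)[OF N(1,3), of r] pb_sectsD(2)[OF N'(1,3), of r] that by blast+
    have Dc: "?D N N' s s' r \<in> carrier (fibre W (snd r))" if r: "r \<in> N \<inter> N'" for r
    proof -
      obtain w where "w \<noteq> 0" "snd r = ln w" using openin_X2_sub[OF op] r by (auto simp: lines_eq)
      then show ?thesis using coords_add(1)[OF W_coords, of w "s r" "s' r"] car[OF r] r by (simp add: pb_fibre)
    qed
    have fst: "fst ` (N \<inter> N') \<subseteq> lines cscale" using openin_X2_sub[OF op] by auto
    have eq: "lc w (?D N N' s s' (\<xi>, ln w)) = 1 * lc w (s (\<xi>, ln w)) + 1 * lc w (s' (\<xi>, ln w))"
      if "w \<noteq> 0" "(\<xi>, ln w) \<in> N \<inter> N'" for \<xi> w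
      using lc_add[OF that(1)] car[OF that(2)] that(2) by (simp add: pb_fibre)
    note comb0 = pb_combination[OF op N(1) N'(1) subset_refl N(3) N'(3) openin_lines fst, of "\<lambda>_. 1" "\<lambda>_. 1" "?D N N' s s'",
        OF holomorphic_on_const holomorphic_on_const restrict_extensional Dc eq]
    show "?D N N' s s' \<in> sects pb (N \<inter> N')" using comb0(1) by simp
    show "jet_coeff (?D N N' s s') v u i = jet \<sigma> v u i + jet \<tau> v u i"
      using comb0(2)[of v u i] vu(1) qN jet_eq[OF \<sigma> q Ns vu(1) i] jet_eq[OF \<tau> q Ns' vu(1) i] by simp
  qed
  obtain N s N' s' where Ns: "(N, s) \<in> \<sigma> ?q" "(N', s') \<in> \<tau> ?q"
    using Q_nonempty[OF \<sigma> q] Q_nonempty[OF \<tau> q] by metis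
  show ?thesis
  proof (rule jetI[where v = v, OF _ _ i])
    show "(N \<inter> N', ?D N N' s s') \<in> (\<sigma> \<oplus>\<^bsub>sections Q (U \<times> lines cscale)\<^esub> \<tau>) ?q"
      unfolding val using germ_self[OF comb(1,3,2)[OF Ns]] Ns by blast
    fix M t assume "(M, t) \<in> (\<sigma> \<oplus>\<^bsub>sections Q (U \<times> lines cscale)\<^esub> \<tau>) ?q"
    then obtain N s N' s' where Ns: "(N, s) \<in> \<sigma> ?q" "(N', s') \<in> \<tau> ?q"
      and "(M, t) \<in> germ ?q (N \<inter> N') (?D N N' s s')" unfolding val by blast
    from germ_jet_coeff[OF comb(1,3)[OF Ns] this(3) vu(1) i] comb(4)[OF Ns]
    show "jet_coeff t v u i = jet \<sigma> v u i + jet \<tau> v u i" by simp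
  qed
qed

lemma jet_smult:
  assumes f: "f \<in> hol X U"
  shows "jet ((\<lambda>q\<in>U \<times> lines cscale. f (fst q)) \<odot>\<^bsub>sections Q (U \<times> lines cscale)\<^esub> \<sigma>) v u i = f (ln v) * jet \<sigma> v u i"
proof -
  let ?q = "(ln v, ln v)" and ?W = "U \<times> lines cscale"
  let ?F = "\<lambda>q\<in>?W. f (fst q)"
  let ?D = "\<lambda>N s. \<lambda>r\<in>N \<inter> ?W. ?F r \<odot>\<^bsub>fibre pb r\<^esub> s r"
  note q = diag_in[OF U vu(2)]
  have val: "(?F \<odot>\<^bsub>sections Q ?W\<^esub> \<sigma>) ?q = (\<Union>(N, s)\<in>\<sigma> ?q. germ ?q (N \<inter> ?W) (?D N s))"
    using q by (simp add: quotient_sheaf_def)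
  have comb: "openin (topo X2) (N \<inter> ?W)" "?q \<in> N \<inter> ?W" "?D N s \<in> sects pb (N \<inter> ?W)"
      "jet_coeff (?D N s) v u i = f (ln v) * jet \<sigma> v u i"
    if Ns: "(N, s) \<in> \<sigma> ?q" for N s
  proof -
    note N = Q_element(1-3)[OF \<sigma> q Ns]
    have opW: "openin (topo X2) ?W" by (rule openin_X2_Times[OF U openin_lines])
    show op: "openin (topo X2) (N \<inter> ?W)" and qN: "?q \<in> N \<inter> ?W" using N opW q by blast+
    have car: "s r \<in> carrier (fibre W (snd r))" if "r \<in> N \<inter> ?W" for r
      using pb_sectsD(2)[OF N(1,3), of r] that by blast
    have Dc: "?D N s r \<in> carrier (fibre W (snd r))" if r: "r \<in> N \<inter> ?W" for r
    proof -
      obtain w where "w \<noteq> 0" "snd r = ln w" using openin_X2_sub[OF op] r by (auto simp: lines_eq)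
      then show ?thesis using coords_smult(1)[OF W_coords, of w "s r"] car[OF r] r by (simp add: pb_fibre)
    qed
    have sub: "N \<inter> ?W \<subseteq> N \<inter> N" by blast
    have fst: "fst ` (N \<inter> ?W) \<subseteq> U" by auto
    have eq: "lc w (?D N s (\<xi>, ln w)) = f \<xi> * lc w (s (\<xi>, ln w)) + 0 * lc w (s (\<xi>, ln w))"
      if "w \<noteq> 0" "(\<xi>, ln w) \<in> N \<inter> ?W" for \<xi> w
      using lc_smult[OF that(1)] car[OF that(2)] that(2) by (simp add: pb_fibre)
    note comb0 = pb_combination[OF op N(1) N(1) sub N(3) N(3) U fst, of f "\<lambda>_. 0" "?D N s",
        OF hol_XD[OF f] holomorphic_on_const restrict_extensional Dc eq]
    show "?D N s \<in> sects pb (N \<inter> ?W)" using comb0(1) by simp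
    show "jet_coeff (?D N s) v u i = f (ln v) * jet \<sigma> v u i"
      using comb0(2)[of v u i] vu(1) qN jet_eq[OF \<sigma> q Ns vu(1) i] by simp
  qed
  obtain N s where Ns: "(N, s) \<in> \<sigma> ?q" by (rule Q_nonempty[OF \<sigma> q])
  show ?thesis
  proof (rule jetI[where v = v, OF _ _ i])
    show "(N \<inter> ?W, ?D N s) \<in> (?F \<odot>\<^bsub>sections Q ?W\<^esub> \<sigma>) ?q"
      unfolding val using germ_self[OF comb(1,3,2)[OF Ns]] Ns by blast
    fix M t assume "(M, t) \<in> (?F \<odot>\<^bsub>sections Q ?W\<^esub> \<sigma>) ?q"
    then obtain N s where Ns: "(N, s) \<in> \<sigma> ?q" and "(M, t) \<in> germ ?q (N \<inter> ?W) (?D N s)" unfolding val by blast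
    from germ_jet_coeff[OF comb(1,3)[OF Ns] this(2) vu(1) i] comb(4)[OF Ns]
    show "jet_coeff t v u i = f (ln v) * jet \<sigma> v u i" by simp
  qed
qed

lemma jet_translate:
  assumes g: "g \<in> SL cscale"
  shows "jet (translate Q g (U \<times> lines cscale) \<sigma>) (g v) (g u) i = jet \<sigma> v u i"
proof -
  let ?q = "(ln v, ln v)" and ?W = "U \<times> lines cscale"
  note q = diag_in[OF U vu(2)]
  have m: "(ln (g v), ln (g v)) = move X2 g ?q" by (simp add: move_X2 proj_act_ln[OF g])
  have val: "translate Q g ?W \<sigma> (ln (g v), ln (g v)) =
      (\<lambda>(N, s). (move X2 g ` N, translate_section X2 pb g N s)) ` \<sigma> ?q"
    unfolding m using q inv_into_move_X2[OF g q] by (simp add: quotient_sheaf_def)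
  obtain N s where Ns: "(N, s) \<in> \<sigma> ?q" by (rule Q_nonempty[OF \<sigma> q])
  show ?thesis
  proof (rule jetI[where v = "g v", OF _ _ i])
    show "(move X2 g ` N, translate_section X2 pb g N s) \<in> translate Q g ?W \<sigma> (ln (g v), ln (g v))"
      unfolding val using Ns by force
    fix M t assume "(M, t) \<in> translate Q g ?W \<sigma> (ln (g v), ln (g v))"
    then obtain N s where Ns: "(N, s) \<in> \<sigma> ?q" and t: "t = translate_section X2 pb g N s" unfolding val by auto
    note N = Q_element(1-3)[OF \<sigma> q Ns]
    show "jet_coeff t (g v) (g u) i = jet \<sigma> v u i"
      unfolding t jet_coeff_translate[OF g N(1,3) vu(1) N(2)] by (rule jet_eq[OF \<sigma> q Ns vu(1) i, symmetric])
  qed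
qed

end

context
  fixes U assumes U: "openin (topo X) U"
begin

lemma comparison_add:
  assumes \<sigma>: "\<sigma> \<in> jets_over U" and \<tau>: "\<tau> \<in> jets_over U"
  shows "comparison U (\<sigma> \<oplus>\<^bsub>sections Q (U \<times> lines cscale)\<^esub> \<tau>) =
    (\<lambda>\<xi>\<in>U. comparison U \<sigma> \<xi> \<oplus>\<^bsub>fibre E \<xi>\<^esub> comparison U \<tau> \<xi>)"
proof (rule comparison_eqI[OF U])
  show "(\<lambda>\<xi>\<in>U. comparison U \<sigma> \<xi> \<oplus>\<^bsub>fibre E \<xi>\<^esub> comparison U \<tau> \<xi>) \<xi> \<in> carrier (fibre E \<xi>)" if \<xi>: "\<xi> \<in> U" for \<xi>
  proof -
    obtain v u where vu: "\<omega> v u \<noteq> 0" "\<xi> = ln v" using frame_at[OF subsetD[OF openin_X_sub[OF U] \<xi>]] by blast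
    show ?thesis
      using coords_add(1)[OF hom_coords[OF E vu(1)]] comparison_carrier[OF U \<sigma> \<xi>] comparison_carrier[OF U \<tau> \<xi>] \<xi>
      unfolding vu(2) by simp
  qed
  fix v u i assume vu: "\<omega> v u \<noteq> 0" "ln v \<in> U" and i: "i \<le> k"
  show "jet (\<sigma> \<oplus>\<^bsub>sections Q (U \<times> lines cscale)\<^esub> \<tau>) v u i =
      C v u ((\<lambda>\<xi>\<in>U. comparison U \<sigma> \<xi> \<oplus>\<^bsub>fibre E \<xi>\<^esub> comparison U \<tau> \<xi>) (ln v)) i"
    unfolding jet_add[OF U \<sigma> vu i \<tau>]
    using coords_add(2)[OF hom_coords[OF E vu(1)] comparison_coords(1)[OF U \<sigma> vu] comparison_coords(1)[OF U \<tau> vu]]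
      comparison_coords(2)[OF U \<sigma> vu] comparison_coords(2)[OF U \<tau> vu] vu(2) by simp
qed simp

lemma comparison_smult:
  assumes \<sigma>: "\<sigma> \<in> jets_over U" and f: "f \<in> hol X U"
  shows "comparison U ((\<lambda>q\<in>U \<times> lines cscale. f (fst q)) \<odot>\<^bsub>sections Q (U \<times> lines cscale)\<^esub> \<sigma>) =
    (\<lambda>\<xi>\<in>U. f \<xi> \<odot>\<^bsub>fibre E \<xi>\<^esub> comparison U \<sigma> \<xi>)"
proof (rule comparison_eqI[OF U])
  show "(\<lambda>\<xi>\<in>U. f \<xi> \<odot>\<^bsub>fibre E \<xi>\<^esub> comparison U \<sigma> \<xi>) \<xi> \<in> carrier (fibre E \<xi>)" if \<xi>: "\<xi> \<in> U" for \<xi>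
  proof -
    obtain v u where vu: "\<omega> v u \<noteq> 0" "\<xi> = ln v" using frame_at[OF subsetD[OF openin_X_sub[OF U] \<xi>]] by blast
    show ?thesis
      using coords_smult(1)[OF hom_coords[OF E vu(1)]] comparison_carrier[OF U \<sigma> \<xi>] \<xi> unfolding vu(2) by simp
  qed
  fix v u i assume vu: "\<omega> v u \<noteq> 0" "ln v \<in> U" and i: "i \<le> k"
  show "jet ((\<lambda>q\<in>U \<times> lines cscale. f (fst q)) \<odot>\<^bsub>sections Q (U \<times> lines cscale)\<^esub> \<sigma>) v u i =
      C v u ((\<lambda>\<xi>\<in>U. f \<xi> \<odot>\<^bsub>fibre E \<xi>\<^esub> comparison U \<sigma> \<xi>) (ln v)) i"
    unfolding jet_smult[OF U \<sigma> vu i f]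
    using coords_smult(2)[OF hom_coords[OF E vu(1)] comparison_coords(1)[OF U \<sigma> vu]]
      comparison_coords(2)[OF U \<sigma> vu] vu(2) by simp
qed simp

lemma comparison_restrict:
  assumes \<sigma>: "\<sigma> \<in> jets_over U" and V: "openin (topo X) V" "V \<subseteq> U"
  shows "comparison V (restrict \<sigma> (V \<times> lines cscale)) = restrict (comparison U \<sigma>) V"
proof (rule comparison_eqI[OF V(1)])
  show "restrict (comparison U \<sigma>) V \<xi> \<in> carrier (fibre E \<xi>)" if "\<xi> \<in> V" for \<xi>
    using comparison_carrier[OF U \<sigma>] that V(2) by auto
  fix v u i assume vu: "\<omega> v u \<noteq> 0" "ln v \<in> V" and i: "i \<le> k"
  have vU: "ln v \<in> U" using vu(2) V(2) by blast
  have "jet (restrict \<sigma> (V \<times> lines cscale)) v u i = jet \<sigma> v u i"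
    using diag_in[OF V(1) vu(2)] by (simp add: jet_def)
  then show "jet (restrict \<sigma> (V \<times> lines cscale)) v u i = C v u (restrict (comparison U \<sigma>) V (ln v)) i"
    using comparison_coords(2)[OF U \<sigma> vu(1) vU] vu(2) by simp
qed simp

text \<open>
  Every frame over a line in the translate of \<open>U\<close> is the image of a frame over a line in \<open>U\<close>, and
  both the jets and the coordinates of \<open>E\<close> are preserved by the group.
\<close>

lemma comparison_translate:
  assumes \<sigma>: "\<sigma> \<in> jets_over U" and g: "g \<in> SL cscale"
  shows "comparison (move X g ` U) (translate Q g (U \<times> lines cscale) \<sigma>) = translate_section X E g U (comparison U \<sigma>)"
proof (rule comparison_eqI)
  show "openin (topo X) (move X g ` U)" unfolding move_X by (rule openin_translate[OF g U])
  show "translate_section X E g U (comparison U \<sigma>) \<in> extensional (move X g ` U)"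
    by (simp add: translate_section_def)
  show "translate_section X E g U (comparison U \<sigma>) \<eta> \<in> carrier (fibre E \<eta>)" if \<eta>: "\<eta> \<in> move X g ` U" for \<eta>
  proof -
    obtain \<xi> where \<xi>: "\<xi> \<in> U" "\<eta> = proj_act g \<xi>" using \<eta> by (auto simp: move_X)
    obtain v u where vu: "\<omega> v u \<noteq> 0" "\<xi> = ln v" using frame_at[OF subsetD[OF openin_X_sub[OF U] \<xi>(1)]] by blast
    have vU: "ln v \<in> U" using \<xi>(1) vu(2) by simp
    show ?thesis
      unfolding \<xi>(2) vu(2) proj_act_ln[OF g] translate_section_X[OF g vU]
      by (rule hom_act(1)[OF E g vu(1) comparison_coords(1)[OF U \<sigma> vu(1) vU]])
  qed
  fix v' u' i assume vu': "\<omega> v' u' \<noteq> 0" "ln v' \<in> move X g ` U" and i: "i \<le> k"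
  obtain v u where g': "v' = g v" "u' = g u" using SL_surj[OF g] by metis
  have vu: "\<omega> v u \<noteq> 0" using vu'(1) SL_\<omega>[OF g, of v u] g' by simp
  obtain \<xi> where "\<xi> \<in> U" "proj_act g (ln v) = proj_act g \<xi>"
    using vu'(2) by (auto simp: move_X g' proj_act_ln[OF g])
  then have vU: "ln v \<in> U" using inj_proj_act[OF g] by simp
  have "jet \<sigma> v u i = C v u (comparison U \<sigma> (ln v)) i" using comparison_coords(2)[OF U \<sigma> vu vU] by simp
  also have "\<dots> = C (g v) (g u) (act E g (ln v) (comparison U \<sigma> (ln v))) i"
    using hom_act(2)[OF E g vu comparison_coords(1)[OF U \<sigma> vu vU]] by simp
  finally show "jet (translate Q g (U \<times> lines cscale) \<sigma>) v' u' i =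
      C v' u' (translate_section X E g U (comparison U \<sigma>) (ln v')) i"
    unfolding g' translate_section_X[OF g vU] jet_translate[OF U \<sigma> vu vU i g] .
qed

end

theorem jet_bundle_iso:
  "equivariant_iso X (SL cscale) (jet_bundle (proj_atlas cscale) proj_act k W) (sheaf_of_sections X E)"
proof -
  let ?A = "jet_bundle (proj_atlas cscale) proj_act k W" and ?B = "sheaf_of_sections X E"
  have A: "?A = direct_image_fst X Q"
    by (simp add: jet_bundle_def pb_def proj_def)
  have secA: "carrier (sections ?A U) = jets_over U"
    "\<sigma> \<oplus>\<^bsub>sections ?A U\<^esub> \<tau> = \<sigma> \<oplus>\<^bsub>sections Q (U \<times> lines cscale)\<^esub> \<tau>"
    "f \<odot>\<^bsub>sections ?A U\<^esub> \<sigma> = (\<lambda>q\<in>U \<times> lines cscale. f (fst q)) \<odot>\<^bsub>sections Q (U \<times> lines cscale)\<^esub> \<sigma>"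
    "restr ?A U \<sigma> = restrict \<sigma> (U \<times> lines cscale)"
    "translate ?A g U \<sigma> = translate Q g (U \<times> lines cscale) \<sigma>" for U \<sigma> \<tau> f g
    unfolding A direct_image_fst_def by (simp_all add: topspace_X Let_def) (simp add: quotient_sheaf_def)
  have secB: "carrier (sections ?B U) = sects E U"
    "s \<oplus>\<^bsub>sections ?B U\<^esub> t = (\<lambda>\<xi>\<in>U. s \<xi> \<oplus>\<^bsub>fibre E \<xi>\<^esub> t \<xi>)"
    "f \<odot>\<^bsub>sections ?B U\<^esub> s = (\<lambda>\<xi>\<in>U. f \<xi> \<odot>\<^bsub>fibre E \<xi>\<^esub> s \<xi>)"
    "restr ?B U s = restrict s U" "translate ?B g U s = translate_section X E g U s" for U s t f g
    by (simp_all add: sheaf_of_sections_def)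
  have bij: "bij_betw (comparison U) (jets_over U) (sects E U)" if U: "openin (topo X) U" for U
    unfolding bij_betw_def
    using comparison_inj[OF U] comparison_holomorphic[OF U] comparison_surj[OF U] by (auto simp: image_iff)
  show ?thesis
    unfolding equivariant_iso_def secA secB
    by (intro exI[of _ comparison] allI impI conjI ballI bij comparison_add comparison_smult comparison_restrict
        comparison_translate; (elim conjE)?; assumption)
qed

end

text \<open>The form is the determinant of the coordinates in a basis.\<close>

lemma plane_of_dim_2:
  fixes cscale :: "complex \<Rightarrow> 'v \<Rightarrow> 'v::ab_group_add"
  assumes "vector_space cscale" "vector_space.dim cscale (UNIV :: 'v set) = 2"
  shows "\<exists>\<omega>. plane cscale \<omega>"
proof -
  interpret vector_space cscale by (rule assms(1))
  obtain B where B: "independent B" "span B = UNIV" "card B = 2"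
    using basis_exists[of UNIV] assms(2) by (metis UNIV_I subsetI top.extremum_uniqueI)
  then obtain e1 e2 where e: "B = {e1, e2}" "e1 \<noteq> e2" by (auto simp: card_2_iff)
  define c where "c = (\<lambda>e v. representation B v e)"
  have add: "c e (v + w) = c e v + c e w" and scale: "c e (cscale l v) = l * c e v" for e v w l
    unfolding c_def using B by (simp_all add: representation_add representation_scale)
  have expand: "cscale (c e1 v) e1 + cscale (c e2 v) e2 = v" for v
    using sum_representation_eq[OF B(1), of v B] B(2) e by (simp add: c_def)
  have basis: "c e1 e1 = 1" "c e2 e1 = 0" "c e1 e2 = 0" "c e2 e2 = 1"
    unfolding c_def using representation_basis[OF B(1)] e by auto
  define \<omega> where "\<omega> = (\<lambda>v u. c e1 v * c e2 u - c e2 v * c e1 u)"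
  have "plane cscale \<omega>"
  proof unfold_locales
    show "\<omega> v (x + y) = \<omega> v x + \<omega> v y" "\<omega> v (cscale l x) = l * \<omega> v x" "\<omega> v x = - \<omega> x v" for v x y l
      by (simp_all add: \<omega>_def add scale algebra_simps)
    show "\<exists>v u. \<omega> v u \<noteq> 0" by (rule exI[of _ e1], rule exI[of _ e2]) (simp add: \<omega>_def basis)
    show "cscale (\<omega> v u) x = cscale (\<omega> x u) v + cscale (\<omega> v x) u" for v u x
    proof -
      have eqI: "y = z" if "c e1 y = c e1 z" "c e2 y = c e2 z" for y z
        by (subst (1 2) expand[symmetric]) (simp only: that)
      show ?thesis by (rule eqI; simp only: add scale \<omega>_def; simp add: algebra_simps)
    qed
  qed
  then show ?thesis by blast
qed

theorem theorem1p1: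
  fixes cscale :: "complex \<Rightarrow> 'v \<Rightarrow> 'v::ab_group_add" and k :: nat and n :: int
  assumes "vector_space cscale" and "vector_space.dim cscale (UNIV :: 'v set) = 2"
  shows
    "(n < 0 \<or> n \<ge> int k \<longrightarrow>
        equivariant_iso (proj cscale) (SL cscale)
          (jet_bundle (proj_atlas cscale) proj_act k (line_bundle_power cscale n))
          (sheaf_of_sections (proj cscale)
            (tensor_bundle (proj cscale)
              (line_bundle_power cscale (n - int k)) (sym_bundle cscale k)))) \<and>
     (int k > n \<and> n \<ge> 0 \<longrightarrow>
        equivariant_iso (proj cscale) (SL cscale)
          (jet_bundle (proj_atlas cscale) proj_act k (line_bundle_power cscale n))
          (sheaf_of_sections (proj cscale)
            (sum_bundle (proj cscale)
              (sym_bundle cscale (nat n))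
              (tensor_bundle (proj cscale)
                (line_bundle_power cscale (- (int k + 1)))
                (sym_bundle cscale (nat (int k - n - 1)))))))"
proof -
  obtain \<omega> where "plane cscale \<omega>" using plane_of_dim_2[OF assms] by blast
  then interpret plane cscale \<omega> .
  obtain A where "homogeneous (line_bundle_power cscale n) 1 n (\<lambda>_ _. 1) A"
    using homogeneous_line_bundle_power by blast
  then have "line_jets cscale \<omega> (line_bundle_power cscale n) n A" by unfold_locales
  then interpret line_jets cscale \<omega> "line_bundle_power cscale n" n A .
  have iso: "equivariant_iso X (SL cscale)
      (jet_bundle (proj_atlas cscale) proj_act k (line_bundle_power cscale n)) (sheaf_of_sections X E)"
    if E: "homogeneous E (Suc k) n (jet_law n) C" for E :: "('v set, 'b, 'v \<Rightarrow> 'v) vbundle" and C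
    by (rule jet_comparison.jet_bundle_iso[OF jet_comparison.intro[OF line_jets_axioms jet_comparison_axioms.intro[OF E]]])
  show ?thesis
  proof (intro conjI impI)
    assume "n < 0 \<or> n \<ge> int k"
    from high_degree_homogeneous[OF this] iso show "equivariant_iso X (SL cscale)
          (jet_bundle (proj_atlas cscale) proj_act k (line_bundle_power cscale n))
          (sheaf_of_sections X (tensor_bundle X (line_bundle_power cscale (n - int k)) (sym_bundle cscale k)))"
      by blast
  next
    assume n: "int k > n \<and> n \<ge> 0"
    have eqs: "int (nat n) = n" "nat (int k - n - 1) = k - nat n - 1" using n by auto
    have "nat n < k" using n by linarith
    from low_degree_homogeneous[OF this] show "equivariant_iso X (SL cscale)
          (jet_bundle (proj_atlas cscale) proj_act k (line_bundle_power cscale n))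
          (sheaf_of_sections X (sum_bundle X (sym_bundle cscale (nat n))
            (tensor_bundle X (line_bundle_power cscale (- (int k + 1))) (sym_bundle cscale (nat (int k - n - 1))))))"
      unfolding eqs using iso by blast
  qed
qed

end
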